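(* Let $\Omega$ be a variety in the tetrablock $\mathbb E$. Then $$\Omega=\{(x_1,x_2,x_3)\in\mathbb E:(x_1,x_2)\in\sigma_T(A_1^*+x_3A_2,\;A_2^*+x_3A_1)\}$$ for two commuting complex square matrices $A_1,A_2$ (of the same order) satisfying $[A_1^*,A_1]=[A_2^*,A_2]$ and $\|A_1^*+A_2z\|_{\infty,\mathbb T}<1$ if and only if $\Omega$ is a distinguished variety in $\mathbb E$ such that $\partial\Omega\cap bD_{\mathbb E}=\emptyset$, where $$bD_{\mathbb E}=\{(x_1,x_2,x_1x_2):|x_1|=|x_2|=1\}.$$
   Context: The tetrablock is $\mathbb E=\{(x_1,x_2,x_3)\in\mathbb C^3: 1-zx_1-wx_2+zwx_3\ne0 \text{ whenever } |z|\le1,|w|\le1\}$; $\partial\mathbb E$ is its topological boundary, and its distinguished boundary is $b\mathbb E=\{(x_1,x_2,x_3)\in\overline{\mathbb E}:|x_3|=1\}$. A variety in $\mathbb E$ is a set $V_S\cap\mathbb E$, where $V_S\subseteq\mathbb C^3$ is the common zero set of a set $S$ of polynomials in three complex variables. A distinguished variety in $\mathbb E$ is a variety $\Omega$ in $\mathbb E$, of complex dimension one or two, such that $\overline\Omega\cap\partial\mathbb E=\overline\Omega\cap b\mathbb E$; for such $\Omega$, $\partial\Omega$ denotes the set $\overline\Omega\cap\partial\mathbb E=\overline\Omega\cap b\mathbb E$. $\mathbb T$ is the unit circle, $\|A_1^*+A_2z\|_{\infty,\mathbb T}=\sup_{z\in\mathbb T}\|A_1^*+A_2z\|$ (operator norm),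 $[S_1,S_2]=S_1S_2-S_2S_1$. $\sigma_T$ is the Taylor joint spectrum, which for a pair of commuting matrices is the set of joint eigenvalues.
   Formalization: "Complex dimension one or two" is taken to mean the same local dimension at every point; otherwise {(0,0,z): |z|<1} together with the isolated point (1/2,0,0) would be a distinguished variety missing bD_E that has no such matrix representation. *)

theory Defs
  imports
    "HOL-Analysis.Analysis"
    "HOL-Computational_Algebra.Polynomial"
    "Jordan_Normal_Form.Schur_Decomposition"
begin

no_notation Matrix.vec_index (infixl \<open>$\<close> 100)

section \<open>The tetrablock\<close>

definition tetrablock :: "(complex ^ 3) set" where
  "tetrablock = {x. \<forall>z w :: complex. norm z \<le> 1 \<longrightarrow> norm w \<le> 1 \<longrightarrow>
     1 - z * x $ 1 - w * x $ 2 + z * w * x $ 3 \<noteq> 0}"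

definition dist_boundary :: "(complex ^ 3) set" where
  "dist_boundary = {x \<in> closure tetrablock. norm (x $ 3) = 1}"

definition bD_tetrablock :: "(complex ^ 3) set" where
  "bD_tetrablock = {x. norm (x $ 1) = 1 \<and> norm (x $ 2) = 1 \<and> x $ 3 = x $ 1 * x $ 2}"

section \<open>Varieties\<close>

text \<open>A polynomial in three variables is an element of \<open>\<complex>[X\<^sub>1][X\<^sub>2][X\<^sub>3]\<close>; the outermost
  variable is \<open>X\<^sub>3\<close>.\<close>

definition poly3 :: "complex poly poly poly \<Rightarrow> complex ^ 3 \<Rightarrow> complex" where
  "poly3 p x = poly (poly (poly p [:[:x $ 3:]:]) [:x $ 2:]) (x $ 1)"

definition zero_locus :: "complex poly poly poly set \<Rightarrow> (complex ^ 3) set" where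
  "zero_locus S = {x. \<forall>p \<in> S. poly3 p x = 0}"

definition variety_in_tetrablock :: "(complex ^ 3) set \<Rightarrow> bool" where
  "variety_in_tetrablock \<Omega> \<longleftrightarrow> (\<exists>S. \<Omega> = zero_locus S \<inter> tetrablock)"

section \<open>Complex dimension\<close>

text \<open>Holomorphy of a map of several variables: complex Frechet differentiability, the
  derivative being given by a complex Jacobian matrix.\<close>

definition holomorphic_map_on :: "(complex ^ 'n \<Rightarrow> complex ^ 'm) \<Rightarrow> (complex ^ 'n) set \<Rightarrow> bool" where
  "holomorphic_map_on f U \<longleftrightarrow>
     (\<forall>x \<in> U. \<exists>A :: complex ^ 'n ^ 'm. (f has_derivative (\<lambda>h. A *v h)) (at x))"

text \<open>Near \<open>a \<in> Z\<close>, the set \<open>Z\<close> is a complex submanifold of dimension \<open>k\<close>: a biholomorphic map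
  of a neighbourhood of \<open>a\<close> straightens \<open>Z\<close> to a piece of a \<open>k\<close>-dimensional coordinate subspace.\<close>

definition submanifold_at :: "nat \<Rightarrow> (complex ^ 'n) set \<Rightarrow> complex ^ 'n \<Rightarrow> bool" where
  "submanifold_at k Z a \<longleftrightarrow> a \<in> Z \<and>
     (\<exists>U V F G (J :: 'n set). open U \<and> a \<in> U \<and> open V \<and> homeomorphism U V F G \<and>
        holomorphic_map_on F U \<and> holomorphic_map_on G V \<and>
        card J = k \<and> F ` (Z \<inter> U) = {y \<in> V. \<forall>i. i \<notin> J \<longrightarrow> y $ i = 0})"

text \<open>The dimension of an analytic set \<open>Z\<close> at a point \<open>a \<in> Z\<close> is the largest dimension of
  manifold points of \<open>Z\<close> arbitrarily close to \<open>a\<close>. The maximum is over a nonempty set, since the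
  manifold points of an analytic set are dense in it.\<close>

definition local_dim :: "(complex ^ 'n) set \<Rightarrow> complex ^ 'n \<Rightarrow> nat" where
  "local_dim Z a = Max {k. a \<in> closure {z. submanifold_at k Z z}}"

text \<open>``Of dimension \<open>d\<close>'' is understood as having dimension \<open>d\<close> at each point, so that a curve
  together with an isolated point is not a set of dimension one.\<close>

definition of_dimension :: "(complex ^ 'n) set \<Rightarrow> nat \<Rightarrow> bool" where
  "of_dimension Z d \<longleftrightarrow> Z \<noteq> {} \<and> (\<forall>a \<in> Z. local_dim Z a = d)"

definition distinguished_variety :: "(complex ^ 3) set \<Rightarrow> bool" where
  "distinguished_variety \<Omega> \<longleftrightarrow> variety_in_tetrablock \<Omega> \<and>
     (of_dimension \<Omega> 1 \<or> of_dimension \<Omega> 2) \<and>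
     closure \<Omega> \<inter> frontier tetrablock = closure \<Omega> \<inter> dist_boundary"

definition variety_boundary :: "(complex ^ 3) set \<Rightarrow> (complex ^ 3) set" where
  "variety_boundary \<Omega> = closure \<Omega> \<inter> frontier tetrablock"

section \<open>Matrices\<close>

definition commutator :: "complex mat \<Rightarrow> complex mat \<Rightarrow> complex mat" where
  "commutator A B = A * B - B * A"

definition vec_norm2 :: "complex Matrix.vec \<Rightarrow> real" where
  "vec_norm2 v = L2_set (\<lambda>i. norm (vec_index v i)) {..<dim_vec v}"

definition mat_opnorm :: "complex mat \<Rightarrow> real" where
  "mat_opnorm A = (SUP v \<in> {v \<in> carrier_vec (dim_col A). vec_norm2 v = 1}. vec_norm2 (A *\<^sub>v v))"

text \<open>Exactness of the Koszul complex \<open>0 \<rightarrow> X \<rightarrow> X \<oplus> X \<rightarrow> X \<rightarrow> 0\<close> of a commuting pair \<open>(T\<^sub>1, T\<^sub>2)\<close> on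
  \<open>X = \<complex>\<^sup>n\<close>, with maps \<open>v \<mapsto> (T\<^sub>1 v, T\<^sub>2 v)\<close> and \<open>(u, w) \<mapsto> T\<^sub>1 w - T\<^sub>2 u\<close>.\<close>

definition koszul_exact :: "nat \<Rightarrow> complex mat \<Rightarrow> complex mat \<Rightarrow> bool" where
  "koszul_exact n T\<^sub>1 T\<^sub>2 \<longleftrightarrow>
     (\<forall>v \<in> carrier_vec n. T\<^sub>1 *\<^sub>v v = 0\<^sub>v n \<and> T\<^sub>2 *\<^sub>v v = 0\<^sub>v n \<longrightarrow> v = 0\<^sub>v n) \<and>
     (\<forall>u \<in> carrier_vec n. \<forall>w \<in> carrier_vec n. T\<^sub>1 *\<^sub>v w - T\<^sub>2 *\<^sub>v u = 0\<^sub>v n \<longrightarrow>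
        (\<exists>v \<in> carrier_vec n. u = T\<^sub>1 *\<^sub>v v \<and> w = T\<^sub>2 *\<^sub>v v)) \<and>
     (\<forall>y \<in> carrier_vec n. \<exists>u \<in> carrier_vec n. \<exists>w \<in> carrier_vec n. y = T\<^sub>1 *\<^sub>v w - T\<^sub>2 *\<^sub>v u)"

text \<open>The Taylor joint spectrum of a commuting pair of \<open>n \<times> n\<close> matrices.\<close>

definition taylor_spectrum :: "nat \<Rightarrow> complex mat \<Rightarrow> complex mat \<Rightarrow> (complex \<times> complex) set" where
  "taylor_spectrum n T\<^sub>1 T\<^sub>2 =
     {(a, b). \<not> koszul_exact n (T\<^sub>1 - a \<cdot>\<^sub>m 1\<^sub>m n) (T\<^sub>2 - b \<cdot>\<^sub>m 1\<^sub>m n)}"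

end

(* If the variety comes from a pencil, compressing A1^* and A2^* to a joint eigenvector of the pencil
   at x3 yields b1, b2 with |b1| + |b2| < 1, x1 = b1 + cnj b2 * x3 and x2 = b2 + cnj b1 * x3; hence
   the points lie in the tetrablock, tend to its distinguished boundary only as |x3| tends to 1, and
   stay away from bD. Continuity of the roots of det (P1 + c P2 - s), with c separating joint
   eigenvalues, excludes isolated points, and the characteristic polynomials make the variety a
   finite union of graphs over x3 off finitely many fibres.

   Conversely, elimination shows that a distinguished variety avoiding bD is such a finite branched
   cover of the disc. Averaging p * cnj q over its fibres above circles of radius tending to 1 gives
   an inner product on polynomials for which multiplication by x3 is an isometry T, while on the
   distinguished boundary x1 = cnj x2 * x3 and x2 = cnj x1 * x3. After completion, the wandering
   space of T is finite-dimensional because x1 and x2 are integral over C[x3] off finitely many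
   fibres, and compressing the multiplications X and Y by x1 and x2 to it produces A1 and A2: one has
   X = A1^* + T A2 and Y = A2^* + T A1, from which commutativity, the equality of self-commutators
   and the norm bound are read off. Left eigenvectors of the pencil correspond to evaluations at
   points of the variety, which are bounded functionals. *)
theory Submission
  imports Defs "HOL-Complex_Analysis.Complex_Analysis" "HOL-Library.Function_Algebras"
begin

text \<open>Two facts shape the proof: the averaged form on polynomials is only semidefinite, and
  the number of sheets is controlled only off a finite set \<open>B\<close>. No quotient is formed:
  vectors are ring elements, later Cauchy sequences in the ring \<open>nat \<Rightarrow> 'a\<close>,
  equality becomes \<open>nrm (u - v) = 0\<close>, and the coordinates act by ring multiplication,
  so that they commute for free. Results over the complement of \<open>B\<close> reach the whole
  variety because it has no isolated points, its fibres are finite and the joint spectrum is closed.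
  The strict bound comes from compactness: on the distinguished boundary |x1| = 1 would force
  membership in \<open>bD_tetrablock\<close>, so |x1| stays below some \<open>\<rho>\<close> < 1
  there, and \<open>\<rho>\<close> bounds multiplication by \<open>X3\<close> and then the pencil. A
  left eigenvector at t yields a functional on polynomials on which all three coordinates act as
  scalars, hence a multiple of a point evaluation; polynomials vanishing on the variety have norm
  zero, so the point satisfies every equation.\<close>

no_notation fps_nth (infixl \<open>$\<close> 75)

section \<open>Shift-invariant inner product spaces\<close>

text \<open>Vectors live in a commutative ring so that they can be multiplied by the coordinates;
  \<open>\<kappa>\<close> embeds the scalars into it. The form is merely positive semidefinite, so
  null vectors need not be zero.\<close>

locale sip =
  fixes C :: "'b::comm_ring_1 set" and \<kappa> :: "complex \<Rightarrow> 'b" and ip :: "'b \<Rightarrow> 'b \<Rightarrow> complex"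
  assumes k_add: "\<kappa> (a + b) = \<kappa> a + \<kappa> b" and k_mult: "\<kappa> (a * b) = \<kappa> a * \<kappa> b" and k_1: "\<kappa> 1 = 1"
    and C_add: "u \<in> C \<Longrightarrow> v \<in> C \<Longrightarrow> u + v \<in> C"
    and C_scale: "u \<in> C \<Longrightarrow> \<kappa> c * u \<in> C"
    and C_0: "0 \<in> C"
    and ip_add: "u \<in> C \<Longrightarrow> v \<in> C \<Longrightarrow> w \<in> C \<Longrightarrow> ip (u + v) w = ip u w + ip v w"
    and ip_scale: "u \<in> C \<Longrightarrow> v \<in> C \<Longrightarrow> ip (\<kappa> c * u) v = c * ip u v"
    and ip_cnj: "u \<in> C \<Longrightarrow> v \<in> C \<Longrightarrow> ip v u = cnj (ip u v)"
    and ip_pos: "u \<in> C \<Longrightarrow> 0 \<le> Re (ip u u)"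
begin

definition "nrm u = sqrt (Re (ip u u))"

lemma k_0: "\<kappa> 0 = 0" using k_add[of 0 0] by simp
lemma k_uminus: "\<kappa> (- c) = - \<kappa> c" using k_add[of c "-c"] k_0 by (simp add: eq_neg_iff_add_eq_0 add.commute)
lemma k_sum: "\<kappa> (sum f A) = (\<Sum>i\<in>A. \<kappa> (f i))"
  by (induction A rule: infinite_finite_induct) (auto simp: k_0 k_add)

lemma C_uminus: "u \<in> C \<Longrightarrow> - u \<in> C" using C_scale[of u "-1"] by (simp add: k_uminus k_1)
lemma C_diff: "u \<in> C \<Longrightarrow> v \<in> C \<Longrightarrow> u - v \<in> C" using C_add[of u "-v"] C_uminus[of v] by simp
lemma C_sum: "(\<And>i. i \<in> A \<Longrightarrow> f i \<in> C) \<Longrightarrow> sum f A \<in> C"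
  by (induction A rule: infinite_finite_induct) (auto intro: C_add C_0)

lemma ip_add2: "u \<in> C \<Longrightarrow> v \<in> C \<Longrightarrow> w \<in> C \<Longrightarrow> ip w (u + v) = ip w u + ip w v"
  by (metis C_add complex_cnj_add ip_add ip_cnj)
lemma ip_scale2: "u \<in> C \<Longrightarrow> v \<in> C \<Longrightarrow> ip u (\<kappa> c * v) = cnj c * ip u v"
  by (metis C_scale complex_cnj_mult ip_scale ip_cnj)
lemma ip_0: "u \<in> C \<Longrightarrow> ip 0 u = 0" using ip_scale[of u u 0] by (simp add: k_0)
lemma ip_0': "u \<in> C \<Longrightarrow> ip u 0 = 0" using ip_scale2[of u u 0] by (simp add: k_0)
lemma ip_uminus: "u \<in> C \<Longrightarrow> v \<in> C \<Longrightarrow> ip (- u) v = - ip u v"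
  using ip_scale[of u v "-1"] by (simp add: k_uminus k_1)
lemma ip_uminus2: "u \<in> C \<Longrightarrow> v \<in> C \<Longrightarrow> ip u (- v) = - ip u v"
  using ip_scale2[of u v "-1"] by (simp add: k_uminus k_1)
lemma ip_diff: "u \<in> C \<Longrightarrow> v \<in> C \<Longrightarrow> w \<in> C \<Longrightarrow> ip (u - v) w = ip u w - ip v w"
  using ip_add[of u "-v" w] by (simp add: C_uminus ip_uminus)
lemma ip_diff2: "u \<in> C \<Longrightarrow> v \<in> C \<Longrightarrow> w \<in> C \<Longrightarrow> ip w (u - v) = ip w u - ip w v"
  using ip_add2[of u "-v" w] by (simp add: C_uminus ip_uminus2)
lemma ip_sum: "(\<And>i. i \<in> A \<Longrightarrow> f i \<in> C) \<Longrightarrow> v \<in> C \<Longrightarrow> ip (sum f A) v = (\<Sum>i\<in>A. ip (f i) v)"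
  by (induction A rule: infinite_finite_induct) (auto simp: ip_0 ip_add C_sum)
lemma ip_sum2: "(\<And>i. i \<in> A \<Longrightarrow> f i \<in> C) \<Longrightarrow> v \<in> C \<Longrightarrow> ip v (sum f A) = (\<Sum>i\<in>A. ip v (f i))"
  by (induction A rule: infinite_finite_induct) (auto simp: ip_0' ip_add2 C_sum)

lemma nrm_ge0: "u \<in> C \<Longrightarrow> 0 \<le> nrm u" by (simp add: nrm_def ip_pos)
lemma nrm_sq: "u \<in> C \<Longrightarrow> (nrm u)\<^sup>2 = Re (ip u u)" by (simp add: nrm_def ip_pos)
lemma ip_self: "u \<in> C \<Longrightarrow> ip u u = of_real ((nrm u)\<^sup>2)"
  using ip_cnj[of u u] by (simp add: nrm_sq complex_eq_iff)

lemma CS: assumes "u \<in> C" "v \<in> C" shows "norm (ip u v) \<le> nrm u * nrm v"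
proof -
  define z where "z = ip u v"
  define N where "N = (norm z)\<^sup>2"
  have zz: "Re z * Re z + Im z * Im z = N" by (simp only: N_def cmod_power2) (simp add: power2_eq_square)
  \<comment> \<open>Positivity of the form at \<open>u - \<kappa> c * v\<close>; the phase of
    \<open>c\<close> is that of \<open>z\<close>, which makes the cross term real.\<close>
  have *: "0 \<le> (nrm u)\<^sup>2 - 2 * s * N + s\<^sup>2 * N * (nrm v)\<^sup>2" for s :: real
  proof -
    define c where "c = of_real s * z"
    have vu: "ip v u = cnj z" using ip_cnj[of u v] assms by (simp add: z_def)
    have cv: "\<kappa> c * v \<in> C" using C_scale assms by blast
    have "0 \<le> Re (ip (u - \<kappa> c * v) (u - \<kappa> c * v))" using ip_pos C_diff cv assms by blast
    also have "ip (u - \<kappa> c * v) (u - \<kappa> c * v) = ip u u - cnj c * z - c * cnj z + c * cnj c * ip v v"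
      using assms cv by (simp add: ip_diff ip_diff2 C_diff ip_scale ip_scale2 C_scale vu z_def[symmetric]) (simp add: algebra_simps)
    also have "Re \<dots> = (nrm u)\<^sup>2 - 2 * s * N + s\<^sup>2 * N * (nrm v)\<^sup>2"
      unfolding ip_self[OF assms(1)] ip_self[OF assms(2)] c_def zz[symmetric]
      by (simp add: algebra_simps power2_eq_square)
    finally show ?thesis .
  qed
  have "N \<le> (nrm u)\<^sup>2 * (nrm v)\<^sup>2"
  proof (cases "nrm v = 0")
    case True
    have "N = 0"
    proof (rule ccontr)
      assume "N \<noteq> 0"
      then have "N > 0" by (simp add: N_def)
      \<comment> \<open>For this \<open>s\<close> the quadratic of \<open>*\<close> takes the value
        -1.\<close>
      then show False using *[of "((nrm u)\<^sup>2 + 1) / (2 * N)"] True by (simp add: field_simps)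
    qed
    then show ?thesis by simp
  next
    case False
    then have p: "(nrm v)\<^sup>2 > 0" by simp
    have "0 \<le> (nrm u)\<^sup>2 - N / (nrm v)\<^sup>2"
    proof -
      have "(1 / (nrm v)\<^sup>2)\<^sup>2 * N * (nrm v)\<^sup>2 = N / (nrm v)\<^sup>2" using p by (simp add: power2_eq_square False)
      then show ?thesis using *[of "1 / (nrm v)\<^sup>2"] by simp
    qed
    then show ?thesis using p by (simp add: field_simps)
  qed
  then have "(norm z)\<^sup>2 \<le> (nrm u * nrm v)\<^sup>2" by (simp add: N_def power_mult_distrib)
  then show ?thesis unfolding z_def[symmetric] using nrm_ge0 assms
    by (metis abs_le_square_iff abs_norm_cancel abs_of_nonneg mult_nonneg_nonneg)
qed

lemma null_ip: "u \<in> C \<Longrightarrow> v \<in> C \<Longrightarrow> nrm u = 0 \<Longrightarrow> ip u v = 0"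
  using CS[of u v] by simp
lemma null_ip2: "u \<in> C \<Longrightarrow> v \<in> C \<Longrightarrow> nrm u = 0 \<Longrightarrow> ip v u = 0"
  using CS[of v u] by simp
lemma null_I: "u \<in> C \<Longrightarrow> ip u u = 0 \<Longrightarrow> nrm u = 0"
  by (simp add: nrm_def)
lemma eq_ip: "u \<in> C \<Longrightarrow> u' \<in> C \<Longrightarrow> v \<in> C \<Longrightarrow> nrm (u - u') = 0 \<Longrightarrow> ip u v = ip u' v"
  using null_ip[of "u - u'" v] by (simp add: C_diff ip_diff)
lemma eq_ip2: "u \<in> C \<Longrightarrow> u' \<in> C \<Longrightarrow> v \<in> C \<Longrightarrow> nrm (u - u') = 0 \<Longrightarrow> ip v u = ip v u'"
  using null_ip2[of "u - u'" v] by (simp add: C_diff ip_diff2)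

lemma nrm_0: "nrm 0 = 0" by (simp add: nrm_def ip_0 C_0)

lemma nrm_scale: assumes "u \<in> C" shows "nrm (\<kappa> c * u) = norm c * nrm u"
proof -
  have "ip (\<kappa> c * u) (\<kappa> c * u) = (c * cnj c) * ip u u"
    using assms by (simp add: ip_scale ip_scale2 C_scale)
  then have "Re (ip (\<kappa> c * u) (\<kappa> c * u)) = (norm c)\<^sup>2 * Re (ip u u)"
    by (simp only: complex_norm_square[symmetric]) simp
  then show ?thesis by (simp add: nrm_def real_sqrt_mult)
qed

lemma nrm_add_sq: "u \<in> C \<Longrightarrow> v \<in> C \<Longrightarrow> (nrm (u + v))\<^sup>2 = (nrm u)\<^sup>2 + (nrm v)\<^sup>2 + 2 * Re (ip u v)"
  using ip_cnj[of u v] by (simp add: nrm_sq C_add ip_add ip_add2)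

lemma nrm_triangle: assumes "u \<in> C" "v \<in> C" shows "nrm (u + v) \<le> nrm u + nrm v"
proof -
  have "Re (ip u v) \<le> nrm u * nrm v" using CS[OF assms] complex_Re_le_cmod[of "ip u v"] by linarith
  then have "(nrm (u + v))\<^sup>2 \<le> (nrm u + nrm v)\<^sup>2"
    using nrm_add_sq[OF assms] by (simp add: power2_eq_square algebra_simps)
  then show ?thesis by (rule power2_le_imp_le) (use nrm_ge0 assms in auto)
qed

lemma nrm_uminus: "u \<in> C \<Longrightarrow> nrm (- u) = nrm u"
  using nrm_scale[of u "-1"] by (simp add: k_uminus k_1)

lemma nrm_diff_commute: "u \<in> C \<Longrightarrow> v \<in> C \<Longrightarrow> nrm (u - v) = nrm (v - u)"
  using nrm_uminus[of "u - v"] C_diff[of u v] by simp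

lemma nrm_diff_ge: assumes "u \<in> C" "v \<in> C" shows "\<bar>nrm u - nrm v\<bar> \<le> nrm (u - v)"
  using nrm_triangle[of "u - v" v] nrm_triangle[of "v - u" u] nrm_diff_commute[OF assms] assms
  by (simp add: C_diff)

end

text \<open>Abstract form of the completed space: \<open>C\<close> is the completion,
  \<open>D\<close> the dense set of polynomials, \<open>T\<close> an isometry. The adjoint laws say
  \<open>X = Y\<^sup>* T\<close> and \<open>Y = X\<^sup>* T\<close>. \<open>proj\<close> projects
  elements of \<open>D\<close> onto the range of \<open>T\<close>, and \<open>fin\<close> says that
  eigenfunctionals of \<open>T\<close> at one point \<open>t0\<close> are determined by
  \<open>M\<close> values; finite dimension will come from it.\<close>

locale hardy = sip C \<kappa> ip for C :: "'b::comm_ring_1 set" and \<kappa> and ip +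
  fixes D :: "'b set" and X Y T :: 'b and \<rho> :: real and t0 :: complex and M :: nat and b :: "nat \<Rightarrow> 'b"
  assumes D_sub: "p \<in> D \<Longrightarrow> p \<in> C"
    and D_add: "p \<in> D \<Longrightarrow> q \<in> D \<Longrightarrow> p + q \<in> D"
    and D_scale: "p \<in> D \<Longrightarrow> \<kappa> c * p \<in> D"
    and D_X: "p \<in> D \<Longrightarrow> X * p \<in> D" and D_Y: "p \<in> D \<Longrightarrow> Y * p \<in> D" and D_T: "p \<in> D \<Longrightarrow> T * p \<in> D"
    and D_1: "1 \<in> D"
    and C_X: "u \<in> C \<Longrightarrow> X * u \<in> C" and C_Y: "u \<in> C \<Longrightarrow> Y * u \<in> C" and C_T: "u \<in> C \<Longrightarrow> T * u \<in> C"
    and T_iso: "u \<in> C \<Longrightarrow> v \<in> C \<Longrightarrow> ip (T * u) (T * v) = ip u v"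
    and X_adj: "u \<in> C \<Longrightarrow> v \<in> C \<Longrightarrow> ip (X * u) v = ip (T * u) (Y * v)"
    and Y_adj: "u \<in> C \<Longrightarrow> v \<in> C \<Longrightarrow> ip (Y * u) v = ip (T * u) (X * v)"
    and X_bound: "u \<in> C \<Longrightarrow> nrm (X * u) \<le> \<rho> * nrm u"
    and dense: "u \<in> C \<Longrightarrow> \<epsilon> > 0 \<Longrightarrow> \<exists>p\<in>D. nrm (u - p) < \<epsilon>"
    and proj: "p \<in> D \<Longrightarrow> \<exists>h\<in>C. \<forall>q\<in>D. ip (p - T * h) (T * q) = 0"
    and t0: "norm t0 < 1"
    and b_D: "b i \<in> D"
    and fin: "(\<And>p q. p \<in> D \<Longrightarrow> q \<in> D \<Longrightarrow> \<phi> (p + q) = \<phi> p + \<phi> q) \<Longrightarrow>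
       (\<And>c p. p \<in> D \<Longrightarrow> \<phi> (\<kappa> c * p) = c * \<phi> p) \<Longrightarrow>
       (\<And>p. p \<in> D \<Longrightarrow> \<phi> (T * p) = t0 * \<phi> p) \<Longrightarrow>
       (\<And>p. p \<in> D \<Longrightarrow> nrm p = 0 \<Longrightarrow> \<phi> p = 0) \<Longrightarrow>
       (\<And>i. i < M \<Longrightarrow> \<phi> (b i) = 0) \<Longrightarrow> p \<in> D \<Longrightarrow> \<phi> p = 0"
begin

section \<open>The wandering space \<open>L\<close> of the isometry \<open>T\<close> and the
  functionals it carries\<close>

definition "L = {w \<in> C. \<forall>u\<in>C. ip w (T * u) = 0}"

lemma L_C: "w \<in> L \<Longrightarrow> w \<in> C" by (simp add: L_def)
lemma L_ip: "w \<in> L \<Longrightarrow> u \<in> C \<Longrightarrow> ip w (T * u) = 0" by (simp add: L_def)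
lemma L_ip2: "w \<in> L \<Longrightarrow> u \<in> C \<Longrightarrow> ip (T * u) w = 0"
  using ip_cnj[of w "T * u"] by (simp add: L_ip L_C C_T)

lemma nrm_T: "u \<in> C \<Longrightarrow> nrm (T * u) = nrm u" by (simp add: nrm_def T_iso)

lemma small_zero: assumes "\<And>\<epsilon>. \<epsilon> > 0 \<Longrightarrow> norm (x::complex) \<le> K * \<epsilon>" "K \<ge> 0" shows "x = 0"
proof (rule ccontr)
  assume "x \<noteq> 0"
  then have "norm x > 0" by simp
  from assms(1)[of "norm x / (2 * (K + 1))"] this assms(2)
  have "norm x \<le> K * (norm x / (2 * (K + 1)))" by simp
  also have "\<dots> \<le> norm x / 2" using assms(2) \<open>norm x > 0\<close> by (simp add: field_simps)
  finally show False using \<open>norm x > 0\<close> by simp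
qed

lemma L_I: assumes w: "w \<in> C" and *: "\<And>q. q \<in> D \<Longrightarrow> ip w (T * q) = 0" shows "w \<in> L"
proof -
  have "ip w (T * u) = 0" if u: "u \<in> C" for u
  proof (rule small_zero)
    fix \<epsilon> :: real assume "\<epsilon> > 0"
    then obtain p where p: "p \<in> D" "nrm (u - p) < \<epsilon>" using dense u by blast
    have "ip w (T * u) = ip w (T * (u - p))"
      using *[OF p(1)] w u D_sub[OF p(1)] by (simp add: right_diff_distrib ip_diff2 C_T)
    also have "norm \<dots> \<le> nrm w * nrm (u - p)"
      using CS[OF w C_T[OF C_diff[OF u D_sub[OF p(1)]]]] nrm_T[OF C_diff[OF u D_sub[OF p(1)]]] by simp
    also have "\<dots> \<le> nrm w * \<epsilon>" using p nrm_ge0[OF w] by (simp add: mult_left_mono)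
    finally show "norm (ip w (T * u)) \<le> nrm w * \<epsilon>" .
  qed (use nrm_ge0[OF w] in simp)
  then show ?thesis using w by (simp add: L_def)
qed

lemma L_add: "u \<in> L \<Longrightarrow> v \<in> L \<Longrightarrow> u + v \<in> L"
  by (auto simp: L_def C_add ip_add C_T)
lemma L_scale: "u \<in> L \<Longrightarrow> \<kappa> c * u \<in> L"
  by (auto simp: L_def C_scale ip_scale C_T)
lemma L_0: "0 \<in> L" by (auto simp: L_def C_0 ip_0 C_T)
lemma L_sum: "(\<And>i. i \<in> A \<Longrightarrow> f i \<in> L) \<Longrightarrow> sum f A \<in> L"
  by (induction A rule: infinite_finite_induct) (auto intro: L_add L_0)
lemma L_diff: "u \<in> L \<Longrightarrow> v \<in> L \<Longrightarrow> u - v \<in> L"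
  using L_add[of u "- v"] L_scale[of v "-1"] by (simp add: k_uminus k_1)

lemma Tpow_C: "u \<in> C \<Longrightarrow> T ^ m * u \<in> C"
  by (induction m) (auto simp: mult.assoc C_T)
lemma Tpow_iso: "u \<in> C \<Longrightarrow> v \<in> C \<Longrightarrow> ip (T ^ m * u) (T ^ m * v) = ip u v"
  by (induction m) (auto simp: mult.assoc T_iso Tpow_C)
lemma nrm_Tpow: "u \<in> C \<Longrightarrow> nrm (T ^ m * u) = nrm u" by (simp add: nrm_def Tpow_iso)

text \<open>If p expands as a series in \<open>T ^ m\<close> with coefficients in \<open>L\<close>,
  and \<open>w\<close> is in \<open>L\<close>, this is the value at \<open>t\<close> of its
  component along \<open>w\<close>, as for point evaluations of a vector-valued Hardy space. It is
  conjugate linear in \<open>w\<close>.\<close>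

definition "phi t w p = (\<Sum>m. t ^ m * ip p (T ^ m * w))"

lemma phi_summable: assumes "norm t < 1" "w \<in> C" "p \<in> C"
  shows "summable (\<lambda>m. norm (t ^ m * ip p (T ^ m * w)))"
    and "norm (phi t w p) \<le> nrm p * nrm w / (1 - norm t)"
proof -
  have b: "norm (t ^ m * ip p (T ^ m * w)) \<le> norm t ^ m * (nrm p * nrm w)" for m
    using CS[OF assms(3) Tpow_C[OF assms(2)], of m] nrm_Tpow[OF assms(2)]
    by (simp add: norm_mult norm_power mult_left_mono)
  have s: "summable (\<lambda>m. norm t ^ m * (nrm p * nrm w))"
    using assms(1) by (intro summable_mult2 summable_geometric) simp
  show 1: "summable (\<lambda>m. norm (t ^ m * ip p (T ^ m * w)))"
    by (rule summable_comparison_test'[OF s, of 0]) (use b in auto)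
  have "norm (phi t w p) \<le> (\<Sum>m. norm (t ^ m * ip p (T ^ m * w)))"
    unfolding phi_def by (rule summable_norm[OF 1])
  also have "\<dots> \<le> (\<Sum>m. norm t ^ m * (nrm p * nrm w))" by (rule suminf_le[OF b 1 s])
  also have "\<dots> = nrm p * nrm w / (1 - norm t)"
    using assms(1) by (subst suminf_mult2[symmetric]) (auto simp: suminf_geometric)
  finally show "norm (phi t w p) \<le> nrm p * nrm w / (1 - norm t)" .
qed

lemma phi_sums: "norm t < 1 \<Longrightarrow> w \<in> C \<Longrightarrow> p \<in> C \<Longrightarrow> (\<lambda>m. t ^ m * ip p (T ^ m * w)) sums phi t w p"
  unfolding phi_def by (rule summable_sums, rule summable_norm_cancel, rule phi_summable)

lemma phi_add: assumes "norm t < 1" "w \<in> C" "p \<in> C" "q \<in> C" shows "phi t w (p + q) = phi t w p + phi t w q"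
proof -
  have "(\<lambda>m. t ^ m * ip (p + q) (T ^ m * w)) sums (phi t w p + phi t w q)"
    using sums_add[OF phi_sums[of t w p] phi_sums[of t w q]] assms by (simp add: ip_add Tpow_C ring_distribs)
  then show ?thesis using sums_unique2[OF phi_sums[of t w "p + q"]] assms C_add by blast
qed

lemma phi_scale: assumes "norm t < 1" "w \<in> C" "p \<in> C" shows "phi t w (\<kappa> c * p) = c * phi t w p"
proof -
  have "(\<lambda>m. t ^ m * ip (\<kappa> c * p) (T ^ m * w)) sums (c * phi t w p)"
    using sums_mult[OF phi_sums[of t w p], of c] assms by (simp add: ip_scale Tpow_C mult.left_commute)
  then show ?thesis using sums_unique2[OF phi_sums[of t w "\<kappa> c * p"]] assms C_scale by blast
qed

lemma phi_add2: assumes "norm t < 1" "w \<in> C" "v \<in> C" "p \<in> C" shows "phi t (v + w) p = phi t v p + phi t w p"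
proof -
  have "(\<lambda>m. t ^ m * ip p (T ^ m * (v + w))) sums (phi t v p + phi t w p)"
    using sums_add[OF phi_sums[of t v p] phi_sums[of t w p]] assms by (simp add: ip_add2 Tpow_C ring_distribs)
  then show ?thesis using sums_unique2[OF phi_sums[of t "v + w" p]] assms C_add by blast
qed

lemma phi_scale2: assumes "norm t < 1" "w \<in> C" "p \<in> C" shows "phi t (\<kappa> c * w) p = cnj c * phi t w p"
proof -
  have e: "T ^ m * (\<kappa> c * w) = \<kappa> c * (T ^ m * w)" for m by (simp add: mult.left_commute)
  have "(\<lambda>m. t ^ m * ip p (T ^ m * (\<kappa> c * w))) sums (cnj c * phi t w p)"
    using sums_mult[OF phi_sums[of t w p], of "cnj c"] assms unfolding e by (simp add: ip_scale2 Tpow_C mult.left_commute)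
  then show ?thesis using sums_unique2[OF phi_sums[of t "\<kappa> c * w" p]] assms C_scale by blast
qed

lemma phi_0: "norm t < 1 \<Longrightarrow> p \<in> C \<Longrightarrow> phi t 0 p = 0"
  using phi_scale2[of t 0 p 0] by (simp add: C_0 k_0)

lemma phi_sum2: "norm t < 1 \<Longrightarrow> p \<in> C \<Longrightarrow> (\<And>i. i \<in> A \<Longrightarrow> f i \<in> C) \<Longrightarrow> phi t (sum f A) p = (\<Sum>i\<in>A. phi t (f i) p)"
  by (induction A rule: infinite_finite_induct) (auto simp: phi_0 phi_add2 C_sum)

lemma phi_null: "norm t < 1 \<Longrightarrow> w \<in> C \<Longrightarrow> p \<in> C \<Longrightarrow> nrm p = 0 \<Longrightarrow> phi t w p = 0"
  using phi_summable(2)[of t w p] by simp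
lemma phi_null2: "norm t < 1 \<Longrightarrow> w \<in> C \<Longrightarrow> p \<in> C \<Longrightarrow> nrm w = 0 \<Longrightarrow> phi t w p = 0"
  using phi_summable(2)[of t w p] by simp

lemma phi_diff: "norm t < 1 \<Longrightarrow> w \<in> C \<Longrightarrow> p \<in> C \<Longrightarrow> q \<in> C \<Longrightarrow> phi t w (p - q) = phi t w p - phi t w q"
  using phi_add[of t w "p - q" q] by (simp add: C_diff)

lemma phi_T: assumes "norm t < 1" "w \<in> L" "p \<in> C" shows "phi t w (T * p) = t * phi t w p"
proof -
  have s: "(\<lambda>m. t ^ m * ip (T * p) (T ^ m * w)) sums phi t w (T * p)"
    by (rule phi_sums) (use assms L_C C_T in auto)
  have "(\<lambda>m. t ^ (Suc m) * ip (T * p) (T ^ (Suc m) * w)) sums (t * phi t w p)"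
    using sums_mult[OF phi_sums[of t w p], of t] assms L_C
    by (auto simp: T_iso Tpow_C mult.assoc)
  \<comment> \<open>The missing term m = 0 is zero, because \<open>w\<close> is orthogonal to the
    range of \<open>T\<close>.\<close>
  then have "(\<lambda>m. t ^ m * ip (T * p) (T ^ m * w)) sums (t * phi t w p)"
    by (subst (asm) sums_Suc_iff) (use assms L_ip2 in auto)
  then show ?thesis using sums_unique2 s by blast
qed

lemma phi_self: assumes "norm t < 1" "w \<in> L" "v \<in> L" shows "phi t w v = ip v w"
proof -
  have "ip v (T ^ m * w) = 0" if "m > 0" for m
    using that assms L_ip[of v "T ^ (m - 1) * w"] L_C Tpow_C by (cases m) (auto simp: mult.assoc)
  then have e: "(\<lambda>m. t ^ m * ip v (T ^ m * w)) = (\<lambda>m. if m = 0 then ip v w else 0)" by (auto simp: fun_eq_iff)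
  have "(\<lambda>m::nat. if m = 0 then ip v w else 0) sums ip v w" using sums_single[of 0 "\<lambda>_. ip v w"] by simp
  then show ?thesis using sums_unique2[OF phi_sums[OF assms(1) L_C[OF assms(2)] L_C[OF assms(3)]]] unfolding e by blast
qed

lemma phi_dense: assumes "norm t < 1" "w \<in> C" "\<And>p. p \<in> D \<Longrightarrow> phi t w p = 0" "u \<in> C" shows "phi t w u = 0"
proof (rule small_zero)
  fix \<epsilon> :: real assume "\<epsilon> > 0"
  then obtain p where p: "p \<in> D" "nrm (u - p) < \<epsilon>" using dense assms by blast
  have "norm (phi t w u) = norm (phi t w (u - p))" using assms p D_sub phi_diff by simp
  also have "\<dots> \<le> nrm (u - p) * nrm w / (1 - norm t)" using phi_summable(2) assms p D_sub C_diff by blast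
  also have "\<dots> \<le> \<epsilon> * nrm w / (1 - norm t)"
    using p assms nrm_ge0[OF assms(2)] by (intro divide_right_mono mult_right_mono) auto
  finally show "norm (phi t w u) \<le> nrm w / (1 - norm t) * \<epsilon>" by (simp add: mult.commute)
qed (use assms nrm_ge0 in auto)

text \<open>By density the functional vanishes on all of \<open>C\<close>, in particular at
  \<open>w\<close> itself, where \<open>phi_self\<close> makes it the squared norm of
  \<open>w\<close>.\<close>

lemma phi_zero_null: assumes "norm t < 1" "w \<in> L" "\<And>p. p \<in> D \<Longrightarrow> phi t w p = 0" shows "nrm w = 0"
  using phi_dense[of t w w] phi_self[of t w w] assms L_C null_I by auto

section \<open>Finite dimension of the wandering space\<close>

definition onf :: "nat \<Rightarrow> (nat \<Rightarrow> 'b) \<Rightarrow> bool" where "onf n e \<longleftrightarrow> (\<forall>i<n. e i \<in> L) \<and> (\<forall>i<n. \<forall>j<n. ip (e i) (e j) = of_bool (i = j))"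

lemma onf_ip_comb: assumes "onf n e"
  shows "j < n \<Longrightarrow> ip (\<Sum>i<n. \<kappa> (c i) * e i) (e j) = c j"
proof -
  assume j: "j < n"
  have "ip (\<Sum>i<n. \<kappa> (c i) * e i) (e j) = (\<Sum>i<n. c i * of_bool (i = j))"
    using assms j by (subst ip_sum) (auto simp: onf_def L_C C_scale ip_scale intro!: sum.cong)
  then show ?thesis using j by (simp add: of_bool_def if_distrib cong: if_cong)
qed

lemma onf_ip_comb2: assumes "onf n e"
  shows "ip (\<Sum>i<n. \<kappa> (c i) * e i) (\<Sum>i<n. \<kappa> (d i) * e i) = (\<Sum>i<n. c i * cnj (d i))"
proof -
  have s: "(\<Sum>i<n. \<kappa> (c i) * e i) \<in> C" using assms by (intro C_sum) (auto simp: onf_def L_C C_scale)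
  have "ip (\<Sum>i<n. \<kappa> (c i) * e i) (\<Sum>i<n. \<kappa> (d i) * e i) = (\<Sum>j<n. cnj (d j) * c j)"
    using assms s by (subst ip_sum2) (auto simp: onf_def L_C C_scale ip_scale2 onf_ip_comb[OF assms] intro!: sum.cong)
  then show ?thesis by (simp add: mult.commute)
qed

text \<open>An orthonormal family gives \<open>n\<close> functionals \<open>phi t0 (e j)\<close>.
  With more than \<open>M\<close> of them, some nontrivial combination kills all the
  \<open>b i\<close>, is zero by \<open>fin\<close>, and hence comes from a null vector, against
  orthonormality.\<close>

lemma onf_bound: assumes "onf n e" shows "n \<le> M"
proof (rule ccontr)
  assume "\<not> n \<le> M"
  then have nM: "M < n" by simp
  \<comment> \<open>The \<open>M\<close> conditions are padded with zero rows to a square system;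
    row \<open>M\<close> is zero, so the determinant vanishes.\<close>
  define A where "A = mat n n (\<lambda>(i, j). if i < M then phi t0 (e j) (b i) else 0)"
  have A: "A \<in> carrier_mat n n" by (simp add: A_def)
  have At: "transpose_mat A \<in> carrier_mat n n" using A by simp
  have "transpose_mat A *\<^sub>v unit_vec n M = 0\<^sub>v n"
  proof (rule eq_vecI)
    fix i assume "i < dim_vec (0\<^sub>v n :: complex Matrix.vec)"
    then have i: "i < n" by simp
    have "vec_index (transpose_mat A *\<^sub>v unit_vec n M) i = row (transpose_mat A) i \<bullet> unit_vec n M"
      using i At by (subst index_mult_mat_vec) auto
    also have "\<dots> = vec_index (row (transpose_mat A) i) M"
      by (rule scalar_prod_right_unit[OF nM])
    also have "\<dots> = 0" using i nM by (simp add: A_def)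
    finally show "vec_index (transpose_mat A *\<^sub>v unit_vec n M) i = vec_index (0\<^sub>v n) i" using i by simp
  qed (use A in simp)
  moreover have "unit_vec n M \<noteq> (0\<^sub>v n :: complex Matrix.vec)"
  proof
    assume "unit_vec n M = (0\<^sub>v n :: complex Matrix.vec)"
    then have "vec_index (unit_vec n M) M = vec_index (0\<^sub>v n :: complex Matrix.vec) M" by simp
    then show False using nM by simp
  qed
  ultimately have "det (transpose_mat A) = 0"
    using det_0_iff_vec_prod_zero[OF At] unit_vec_carrier[of n M] by blast
  then have "det A = 0" using det_transpose[OF A] by simp
  then obtain v where v: "v \<in> carrier_vec n" "v \<noteq> 0\<^sub>v n" "A *\<^sub>v v = 0\<^sub>v n"
    using det_0_iff_vec_prod_zero[OF A] by blast
  have eL: "e i \<in> L" if "i < n" for i using assms that by (simp add: onf_def)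
  \<comment> \<open>Conjugate coefficients, because \<open>phi\<close> is conjugate linear in its
    vector argument.\<close>
  define w where "w = (\<Sum>i<n. \<kappa> (cnj (vec_index v i)) * e i)"
  have wL: "w \<in> L" unfolding w_def using eL by (intro L_sum L_scale) auto
  have 0: "phi t0 w (b i) = 0" if "i < M" for i
  proof -
    have "phi t0 w (b i) = (\<Sum>j<n. vec_index v j * phi t0 (e j) (b i))"
      unfolding w_def using t0 eL b_D D_sub by (subst phi_sum2) (auto simp: C_scale L_C phi_scale2)
    also have "\<dots> = vec_index (A *\<^sub>v v) i"
      using v(1) that nM by (auto simp: A_def scalar_prod_def lessThan_atLeast0 mult.commute intro!: sum.cong)
    also have "\<dots> = 0" using v that nM by simp
    finally show ?thesis .
  qed
  have "phi t0 w p = 0" if p: "p \<in> D" for p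
    by (rule fin[of "phi t0 w"])
       (simp_all add: p t0 wL L_C D_sub phi_add phi_scale phi_T phi_null 0)
  then have "nrm w = 0" using phi_zero_null t0 wL by blast
  then have "ip w w = 0" using ip_self[of w] wL L_C by simp
  then have "(\<Sum>i<n. cnj (vec_index v i) * vec_index v i) = 0"
    using onf_ip_comb2[OF assms, of "\<lambda>i. cnj (vec_index v i)" "\<lambda>i. cnj (vec_index v i)"] by (simp add: w_def)
  then have "of_real (\<Sum>i<n. (norm (vec_index v i))\<^sup>2) = (0::complex)"
    unfolding of_real_sum complex_norm_square by (simp add: mult.commute)
  then have "(\<Sum>i<n. (norm (vec_index v i))\<^sup>2) = 0" by (simp only: of_real_eq_0_iff)
  then have "\<forall>i\<in>{..<n}. (norm (vec_index v i))\<^sup>2 = 0" by (subst (asm) sum_nonneg_eq_0_iff) auto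
  then have "v = 0\<^sub>v n" using v(1) by (intro eq_vecI) auto
  then show False using v(2) by blast
qed

text \<open>The family has maximal length, which exists by \<open>onf_bound\<close>; a vector of
  \<open>L\<close> with non-null remainder would extend it by a Gram-Schmidt step.\<close>

lemma obtain_basis: obtains n e where "onf n e"
  "\<And>w. w \<in> L \<Longrightarrow> nrm (w - (\<Sum>i<n. \<kappa> (ip w (e i)) * e i)) = 0"
proof -
  define S where "S = {n. \<exists>e. onf n e}"
  have S0: "0 \<in> S" by (simp add: S_def onf_def)
  have "S \<subseteq> {..M}" using onf_bound by (auto simp: S_def)
  then have S: "finite S" by (rule finite_subset) simp
  define n where "n = Max S"
  have n: "\<exists>e. onf n e" using Max_in[OF S] S0 unfolding n_def S_def by blast
  have mx: "m \<le> n" if "onf m e" for m e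
    unfolding n_def by (rule Max_ge[OF S]) (use that in \<open>auto simp: S_def\<close>)
  from n obtain e where e: "onf n e" by blast
  have eL: "e i \<in> L" if "i < n" for i using e that by (simp add: onf_def)
  have "nrm (w - (\<Sum>i<n. \<kappa> (ip w (e i)) * e i)) = 0" if w: "w \<in> L" for w
  proof (rule ccontr)
    define s where "s = (\<Sum>i<n. \<kappa> (ip w (e i)) * e i)"
    have sL: "s \<in> L" unfolding s_def using eL by (intro L_sum L_scale) auto
    define r where "r = w - s"
    assume "nrm (w - (\<Sum>i<n. \<kappa> (ip w (e i)) * e i)) \<noteq> 0"
    then have nr: "nrm r \<noteq> 0" by (simp add: r_def s_def)
    have rL: "r \<in> L" unfolding r_def using w sL L_diff by blast
    have re: "ip r (e j) = 0" if "j < n" for j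
      unfolding r_def using that w sL eL onf_ip_comb[OF e that, of "\<lambda>i. ip w (e i)"]
      by (simp add: ip_diff L_C s_def)
    have er: "ip (e j) r = 0" if "j < n" for j
      using ip_cnj[of r "e j"] re[OF that] rL eL[OF that] L_C by simp
    define e' where "e' = e(n := \<kappa> (of_real (1 / nrm r)) * r)"
    have "ip (e' n) (e' n) = 1"
      using nr rL ip_self[of r] by (simp add: e'_def ip_scale ip_scale2 C_scale L_C power2_eq_square)
    then have "onf (Suc n) e'"
      using e rL re er eL unfolding onf_def e'_def
      by (auto simp: less_Suc_eq L_scale ip_scale ip_scale2 L_C C_scale)
    then show False using mx[of "Suc n" e'] by simp
  qed
  then show ?thesis using that e by blast
qed

end

section \<open>Compression of the coordinates to the wandering space\<close>

locale hardy_basis = hardy C \<kappa> ip D X Y T \<rho> t0 M b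
  for C :: "'b::comm_ring_1 set" and \<kappa> ip D X Y T \<rho> t0 M b +
  fixes n :: nat and e :: "nat \<Rightarrow> 'b"
  assumes onf: "onf n e"
    and basis: "w \<in> L \<Longrightarrow> nrm (w - (\<Sum>i<n. \<kappa> (ip w (e i)) * e i)) = 0"
begin

lemma eL: "i < n \<Longrightarrow> e i \<in> L" using onf by (simp add: onf_def)
lemma eC: "i < n \<Longrightarrow> e i \<in> C" using eL L_C by blast

definition "comb c = (\<Sum>i<n. \<kappa> (c i) * e i)"

lemma comb_L: "comb c \<in> L" unfolding comb_def by (intro L_sum L_scale eL) auto
lemma comb_C: "comb c \<in> C" using comb_L L_C by blast
lemma ip_comb: "v \<in> C \<Longrightarrow> ip (comb c) v = (\<Sum>i<n. c i * ip (e i) v)"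
  unfolding comb_def by (subst ip_sum) (auto simp: eC C_scale ip_scale)
lemma ip_comb2: "v \<in> C \<Longrightarrow> ip v (comb c) = (\<Sum>i<n. cnj (c i) * ip v (e i))"
  unfolding comb_def by (subst ip_sum2) (auto simp: eC C_scale ip_scale2)
lemma ip_comb_comb: "ip (comb c) (comb d) = (\<Sum>i<n. c i * cnj (d i))"
  unfolding comb_def by (rule onf_ip_comb2[OF onf])
lemma mult_comb: "U * comb c = (\<Sum>i<n. \<kappa> (c i) * (U * e i))"
  by (simp add: comb_def sum_distrib_left mult.left_commute)
lemma scale_comb: "\<kappa> c * comb d = comb (\<lambda>i. c * d i)"
  by (simp add: comb_def sum_distrib_left k_mult mult.assoc)
lemma comb_add: "comb c + comb d = comb (\<lambda>i. c i + d i)"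
  by (simp add: comb_def k_add ring_distribs sum.distrib)
lemma comb_cong: "(\<And>i. i < n \<Longrightarrow> c i = d i) \<Longrightarrow> comb c = comb d"
  by (auto simp: comb_def)
lemma nrm_comb: "(nrm (comb c))\<^sup>2 = (\<Sum>i<n. (norm (c i))\<^sup>2)"
proof -
  have "ip (comb c) (comb c) = of_real (\<Sum>i<n. (norm (c i))\<^sup>2)"
    unfolding ip_comb_comb of_real_sum complex_norm_square ..
  then show ?thesis using ip_self[OF comb_C] by (metis of_real_eq_iff)
qed

text \<open>One step of the Wold decomposition: \<open>proj\<close> splits off the part in the range
  of \<open>T\<close>, and the rest lies in \<open>L\<close> and is expanded in the basis. The bound
  on \<open>h\<close> is Pythagoras; it allows estimates to be iterated.\<close>

lemma decomp: assumes p: "p \<in> D"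
  obtains h where "h \<in> C" "nrm (p - (comb (\<lambda>i. ip p (e i)) + T * h)) = 0"
    "nrm h \<le> nrm p"
proof -
  obtain h where h: "h \<in> C" "\<And>q. q \<in> D \<Longrightarrow> ip (p - T * h) (T * q) = 0" using proj[OF p] by blast
  have pC: "p \<in> C" using p D_sub by blast
  define w where "w = p - T * h"
  have wL: "w \<in> L" unfolding w_def by (rule L_I) (use h pC C_diff C_T in auto)
  have "ip w (e i) = ip p (e i)" if "i < n" for i
    unfolding w_def using that eL[OF that] h pC by (simp add: ip_diff eC C_T L_ip2)
  then have c: "comb (\<lambda>i. ip p (e i)) = comb (\<lambda>i. ip w (e i))" by (intro comb_cong) auto
  have 1: "nrm (p - (comb (\<lambda>i. ip p (e i)) + T * h)) = 0"
    using basis[OF wL] unfolding c unfolding comb_def w_def by (simp add: algebra_simps)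
  have "(nrm p)\<^sup>2 = (nrm (w + T * h))\<^sup>2" by (simp add: w_def)
  also have "\<dots> = (nrm w)\<^sup>2 + (nrm h)\<^sup>2"
    using nrm_add_sq[of w "T * h"] wL h L_ip[OF wL h(1)] by (simp add: L_C C_T nrm_T)
  finally have "(nrm h)\<^sup>2 \<le> (nrm p)\<^sup>2" by simp
  then have "nrm h \<le> nrm p" using nrm_ge0[OF pC] by (rule power2_le_imp_le)
  then show ?thesis using that h 1 by blast
qed

text \<open>The relation \<open>U = V\<^sup>* T\<close> and preservation of null vectors, abstracted
  so that each computation serves both (X, Y) and (Y, X).\<close>

definition "pair U V \<longleftrightarrow> (\<forall>u\<in>C. U * u \<in> C \<and> V * u \<in> C \<and> (nrm u = 0 \<longrightarrow> nrm (U * u) = 0))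
  \<and> (\<forall>u\<in>C. \<forall>v\<in>C. ip (U * u) v = ip (T * u) (V * v))"

text \<open>Both sides equal \<open>ip (T * u) (X * (Y * v))\<close> by the two adjoint
  laws.\<close>

lemma ip_Y_Y: assumes "u \<in> C" "v \<in> C" shows "ip (Y * u) (Y * v) = ip (X * u) (X * v)"
  using X_adj[OF assms(1) C_X[OF assms(2)]] Y_adj[OF assms(1) C_Y[OF assms(2)]]
  by (simp add: mult.left_commute)

lemma nrm_Y: "u \<in> C \<Longrightarrow> nrm (Y * u) = nrm (X * u)"
  by (simp add: nrm_def ip_Y_Y)

lemma X_null: "u \<in> C \<Longrightarrow> nrm u = 0 \<Longrightarrow> nrm (X * u) = 0"
  using X_bound[of u] nrm_ge0[OF C_X, of u] by simp

lemma pair_XY: "pair X Y" unfolding pair_def using C_X C_Y X_null X_adj by auto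
lemma pair_YX: "pair Y X" unfolding pair_def using C_X C_Y X_null nrm_Y Y_adj by auto

text \<open>Matrix of the adjoint of the compression of \<open>U\<close> to \<open>L\<close>; the
  compression itself has the entry \<open>cnj (a U i j)\<close> in position (j, i). With this
  convention the pencil reads \<open>X = A\<^sub>1\<^sup>* + T A\<^sub>2\<close>.\<close>

definition "a U i j = ip (e j) (U * e i)"

lemma cnj_a: assumes "pair U V" "i < n" "j < n" shows "cnj (a U i j) = ip (U * e i) (e j)"
  unfolding a_def using ip_cnj[of "e j" "U * e i"] assms eC by (auto simp: pair_def)

lemma pair_T: assumes "pair U V" "u \<in> C" "v \<in> C" shows "ip (U * u) (T * v) = ip u (V * v)"
proof -
  have "ip (U * u) (T * v) = ip (T * u) (V * (T * v))" using assms C_T by (auto simp: pair_def)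
  also have "\<dots> = ip (T * u) (T * (V * v))" by (simp add: mult.left_commute)
  finally show ?thesis using assms T_iso by (auto simp: pair_def)
qed

lemma pair_C: "pair U V \<Longrightarrow> u \<in> C \<Longrightarrow> U * u \<in> C" "pair U V \<Longrightarrow> u \<in> C \<Longrightarrow> V * u \<in> C"
  by (auto simp: pair_def)

text \<open>Moving \<open>V\<close> across the form as in \<open>pair_T\<close> shows that
  \<open>ip (U * e j) (T * q)\<close> depends only on the component of \<open>q\<close> in
  \<open>L\<close>, as \<open>e j\<close> is orthogonal to the range of \<open>T\<close>. So after
  subtraction of the \<open>T\<close> part the remainder lies in \<open>L\<close>, and its
  coordinates are those of the compression of \<open>U\<close>.\<close>

lemma pencil: assumes UV: "pair U V" and j: "j < n"
  shows "nrm (U * e j - (comb (\<lambda>k. cnj (a U j k)) + T * comb (\<lambda>k. a V k j))) = 0"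
proof -
  define z where "z = U * e j - T * comb (\<lambda>k. a V k j)"
  have UC: "U * e j \<in> C" using pair_C[OF UV] eC j by blast
  have zC: "z \<in> C" unfolding z_def using UC C_T comb_C C_diff by blast
  have zL: "z \<in> L"
  proof (rule L_I[OF zC])
    fix q assume q: "q \<in> D"
    obtain h where h: "h \<in> C" "nrm (q - (comb (\<lambda>i. ip q (e i)) + T * h)) = 0" using decomp[OF q] by blast
    let ?c = "comb (\<lambda>i. ip q (e i))"
    have qC: "q \<in> C" using q D_sub by blast
    have cC: "?c + T * h \<in> C" using comb_C h C_T C_add by blast
    have "nrm (T * (q - (?c + T * h))) = 0" using h qC cC by (simp add: nrm_T C_diff)
    then have "ip (U * e j) (T * q) = ip (U * e j) (T * (?c + T * h))"
      using eq_ip2[OF C_T[OF qC] C_T[OF cC] UC] by (simp add: right_diff_distrib)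
    also have "\<dots> = ip (U * e j) (T * ?c) + ip (U * e j) (T * (T * h))"
      using h UC by (simp add: ring_distribs ip_add2 C_T comb_C)
    also have "ip (U * e j) (T * (T * h)) = ip (e j) (T * (V * h))"
      using pair_T[OF UV eC[OF j] C_T[OF h(1)]] by (simp add: mult.left_commute)
    also have "\<dots> = 0" using eL[OF j] h pair_C[OF UV] L_ip by blast
    also have "ip (U * e j) (T * ?c) = ip (e j) (V * ?c)" using pair_T[OF UV eC[OF j] comb_C] .
    also have "\<dots> = (\<Sum>i<n. cnj (ip q (e i)) * ip (e j) (V * e i))"
      unfolding mult_comb using j pair_C[OF UV] by (subst ip_sum2) (auto simp: eC C_scale ip_scale2)
    also have "\<dots> = ip (T * comb (\<lambda>k. a V k j)) (T * q)"
    proof -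
      have "ip (T * comb (\<lambda>k. a V k j)) (T * q) = (\<Sum>i<n. a V i j * ip (e i) q)"
        by (simp add: T_iso comb_C qC ip_comb)
      also have "\<dots> = (\<Sum>i<n. cnj (ip q (e i)) * ip (e j) (V * e i))"
        by (rule sum.cong[OF refl]) (use ip_cnj[OF qC eC] in \<open>simp add: a_def\<close>)
      finally show ?thesis by simp
    qed
    finally have "ip (U * e j) (T * q) = ip (T * comb (\<lambda>k. a V k j)) (T * q)" by simp
    then show "ip z (T * q) = 0" unfolding z_def using UC qC by (simp add: ip_diff C_T comb_C)
  qed
  have "ip z (e k) = cnj (a U j k)" if "k < n" for k
    unfolding z_def using cnj_a[OF UV j that] that UC L_ip2[OF eL[OF that] comb_C] by (simp add: ip_diff eC C_T comb_C)
  then have "comb (\<lambda>k. ip z (e k)) = comb (\<lambda>k. cnj (a U j k))" by (intro comb_cong) auto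
  then have "nrm (z - comb (\<lambda>k. cnj (a U j k))) = 0" using basis[OF zL] by (simp add: comb_def)
  then show ?thesis by (simp add: z_def algebra_simps)
qed

lemma pencil_C: "comb c + T * comb d \<in> C" using comb_C C_T C_add by blast

text \<open>Compression to \<open>L\<close> is multiplicative here, because the range of
  \<open>T\<close> is invariant under \<open>W\<close>: the \<open>T\<close> part of
  \<open>U * e i\<close> contributes nothing after multiplication by \<open>W\<close>.\<close>

lemma product_coeff: assumes UV: "pair U V" and W: "pair W W'" and "i < n" "j < n"
  shows "ip (W * (U * e i)) (e j) = (\<Sum>k<n. cnj (a U i k) * cnj (a W k j))"
proof -
  let ?c = "comb (\<lambda>k. cnj (a U i k))" and ?d = "comb (\<lambda>k. a V k i)"
  have UC: "U * e i \<in> C" using pair_C[OF UV] eC assms by blast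
  have "nrm (W * (U * e i - (?c + T * ?d))) = 0"
    using pencil[OF UV assms(3)] W UC pencil_C C_diff unfolding pair_def by blast
  then have "ip (W * (U * e i)) (e j) = ip (W * (?c + T * ?d)) (e j)"
    using eq_ip pair_C(1)[OF W UC] pair_C(1)[OF W pencil_C] eC assms(4) by (simp add: right_diff_distrib)
  also have "\<dots> = ip (W * ?c) (e j) + ip (T * (W * ?d)) (e j)"
    using pair_C(1)[OF W] comb_C C_T eC assms by (simp add: ring_distribs ip_add mult.left_commute)
  also have "ip (T * (W * ?d)) (e j) = 0"
    using L_ip2[OF eL[OF assms(4)]] pair_C(1)[OF W comb_C] by blast
  also have "ip (W * ?c) (e j) = (\<Sum>k<n. cnj (a U i k) * cnj (a W k j))"
    unfolding mult_comb using assms pair_C(1)[OF W]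
    by (subst ip_sum) (auto simp: eC C_scale ip_scale cnj_a[OF W])
  finally show ?thesis by simp
qed

lemma a_commute: assumes "i < n" "j < n"
  shows "(\<Sum>k<n. a X i k * a Y k j) = (\<Sum>k<n. a Y i k * a X k j)"
proof -
  have "cnj (\<Sum>k<n. a X i k * a Y k j) = cnj (\<Sum>k<n. a Y i k * a X k j)"
    using product_coeff[OF pair_XY pair_YX assms] product_coeff[OF pair_YX pair_XY assms]
    by (simp add: mult.left_commute[of X Y])
  then show ?thesis by (simp only: complex_cnj_cancel_iff)
qed

text \<open>The two terms of the decomposition in \<open>pencil\<close> are orthogonal, so the Gram
  matrix splits.\<close>

lemma gram_coeff: assumes UV: "pair U V" and "i < n" "j < n"
  shows "ip (U * e j) (U * e i) = (\<Sum>k<n. cnj (a U j k) * a U i k) + (\<Sum>k<n. a V k j * cnj (a V k i))"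
proof -
  let ?f = "\<lambda>j. comb (\<lambda>k. cnj (a U j k)) + T * comb (\<lambda>k. a V k j)"
  have UC: "U * e i \<in> C" "U * e j \<in> C" using pair_C[OF UV] eC assms by blast+
  have "ip (U * e j) (U * e i) = ip (?f j) (?f i)"
    using eq_ip[OF UC(2) pencil_C UC(1) pencil[OF UV assms(3)]] eq_ip2[OF UC(1) pencil_C pencil_C pencil[OF UV assms(2)]] by simp
  also have "\<dots> = ip (comb (\<lambda>k. cnj (a U j k))) (comb (\<lambda>k. cnj (a U i k))) + ip (comb (\<lambda>k. a V k j)) (comb (\<lambda>k. a V k i))"
    by (simp add: ip_add ip_add2 comb_C C_T C_add T_iso L_ip[OF comb_L] L_ip2[OF comb_L])
  finally show ?thesis by (simp add: ip_comb_comb)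
qed

text \<open>\<open>X\<close> and \<open>Y\<close> have the same Gram matrix by
  \<open>ip_Y_Y\<close>; it remains to equate the two expressions from \<open>gram_coeff\<close> and
  to regroup.\<close>

lemma a_selfcommutator: assumes "i < n" "j < n"
  shows "(\<Sum>k<n. cnj (a X k i) * a X k j) - (\<Sum>k<n. a X i k * cnj (a X j k))
       = (\<Sum>k<n. cnj (a Y k i) * a Y k j) - (\<Sum>k<n. a Y i k * cnj (a Y j k))"
  using gram_coeff[OF pair_XY assms] gram_coeff[OF pair_YX assms] ip_Y_Y[OF eC eC, OF assms(2,1)]
  by (simp add: mult.commute algebra_simps)

text \<open>Along the powers of \<open>T\<close> the operator \<open>X\<close> is block Toeplitz
  with just two nonzero diagonals: powers below \<open>l\<close> drop out because \<open>L\<close>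
  is orthogonal to the range of \<open>T\<close>, powers above \<open>Suc l\<close> because moving
  \<open>X\<close> to the other side uses up only one factor \<open>T\<close>.\<close>

lemma X_Tpow: assumes "v \<in> L" "u \<in> L"
  shows "ip (X * (T ^ l * v)) (T ^ m * u) =
     (if m = l then ip (X * v) u else 0) + (if m = Suc l then ip (X * v) (T * u) else 0)"
proof -
  have vC: "v \<in> C" "u \<in> C" "X * v \<in> C" "Y * u \<in> C" using assms L_C C_X C_Y by blast+
  consider "m < l" | "m = l" | "m = Suc l" | "Suc l < m" by linarith
  then show ?thesis
  proof cases
    case 1
    then obtain k where l: "l = m + Suc k" by (metis add_Suc_right less_imp_Suc_add)
    have "X * (T ^ l * v) = T ^ m * (T * (T ^ k * (X * v)))" by (simp add: l power_add mult_ac)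
    then have "ip (X * (T ^ l * v)) (T ^ m * u) = ip (T * (T ^ k * (X * v))) u"
      by (simp add: Tpow_iso C_T Tpow_C vC)
    also have "\<dots> = 0" using L_ip2[OF assms(2)] Tpow_C vC by blast
    finally show ?thesis using 1 by simp
  next
    case 2
    then show ?thesis using Tpow_iso[of "X * v" u m] vC by (simp add: mult.left_commute)
  next
    case 3
    have "ip (T ^ l * (X * v)) (T ^ l * (T * u)) = ip (X * v) (T * u)" using Tpow_iso vC C_T by blast
    then show ?thesis using 3 by (simp add: mult_ac)
  next
    case 4
    then obtain k where k: "m = l + Suc (Suc k)" using less_imp_Suc_add[OF 4] by auto
    have "ip (X * (T ^ l * v)) (T ^ m * u) = ip (T ^ l * (X * v)) (T ^ l * (T * (T * (T ^ k * u))))"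
      by (simp add: k power_add mult_ac)
    also have "\<dots> = ip (X * v) (T * (T * (T ^ k * u)))" using vC C_T Tpow_C by (intro Tpow_iso) auto
    also have "\<dots> = ip v (Y * (T * (T ^ k * u)))" using pair_T[OF pair_XY] vC C_T Tpow_C by blast
    also have "\<dots> = ip v (T * (Y * (T ^ k * u)))" by (simp add: mult.left_commute)
    also have "\<dots> = 0" using L_ip[OF assms(1)] C_Y Tpow_C vC by blast
    finally show ?thesis using 4 by simp
  qed
qed

lemma Tpow_orth: assumes "v \<in> L" "u \<in> L"
  shows "ip (T ^ l * v) (T ^ m * u) = (if m = l then ip v u else 0)"
proof -
  have vC: "v \<in> C" "u \<in> C" using assms L_C by blast+
  consider "m < l" | "m = l" | "l < m" by linarith
  then show ?thesis
  proof cases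
    case 1
    then obtain k where l: "l = m + Suc k" by (metis add_Suc_right less_imp_Suc_add)
    have "ip (T ^ l * v) (T ^ m * u) = ip (T ^ m * (T * (T ^ k * v))) (T ^ m * u)" by (simp add: l power_add mult_ac)
    also have "\<dots> = ip (T * (T ^ k * v)) u" using vC C_T Tpow_C by (intro Tpow_iso) auto
    also have "\<dots> = 0" using L_ip2[OF assms(2)] Tpow_C vC by blast
    finally show ?thesis using 1 by simp
  next
    case 2
    then show ?thesis using Tpow_iso vC by simp
  next
    case 3
    then obtain k where l: "m = l + Suc k" by (metis add_Suc_right less_imp_Suc_add)
    have "ip (T ^ l * v) (T ^ m * u) = ip (T ^ l * v) (T ^ l * (T * (T ^ k * u)))" by (simp add: l power_add mult_ac)
    also have "\<dots> = ip v (T * (T ^ k * u))" using vC C_T Tpow_C by (intro Tpow_iso) auto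
    also have "\<dots> = 0" using L_ip[OF assms(1)] Tpow_C vC by blast
    finally show ?thesis using 3 by simp
  qed
qed

text \<open>The symbol of a Toeplitz operator is bounded by its norm. \<open>X\<close> is tested on
  the truncated geometric sums \<open>F\<close>, for which the form equals N + 1 copies of
  \<open>P\<close> and N copies of \<open>z * Q\<close>, against norms that grow like sqrt (N + 1);
  division by N + 1 and a limit remove the missing copy.\<close>

lemma toeplitz_bound: assumes v: "v \<in> L" and u: "u \<in> L" and z: "norm z = 1"
  shows "norm (ip (X * v) u + z * ip (X * v) (T * u)) \<le> \<rho> * nrm v * nrm u"
proof -
  define P Q where "P = ip (X * v) u" and "Q = ip (X * v) (T * u)"
  have zz: "cnj z * z = 1" using z by (metis complex_norm_square mult.commute of_real_1 power_one)
  have zp: "cnj z ^ l * z ^ l = 1" for l by (metis power_mult_distrib power_one zz)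
  define F where "F w N = (\<Sum>l<N. \<kappa> (cnj z ^ l) * (T ^ l * w))" for w and N :: nat
  have FC: "F w N \<in> C" if "w \<in> L" for w N unfolding F_def using that L_C Tpow_C C_scale by (intro C_sum) auto
  have FF: "(nrm (F w N))\<^sup>2 = real N * (nrm w)\<^sup>2" if w: "w \<in> L" for w N
  proof -
    have wC: "w \<in> C" using w L_C by blast
    have "ip (F w N) (F w N) = (\<Sum>m<N. \<Sum>l<N. z ^ m * cnj z ^ l * (if m = l then ip w w else 0))"
      unfolding F_def using wC
      by (simp only: ip_sum ip_sum2 C_sum C_scale Tpow_C ip_scale ip_scale2 Tpow_orth[OF w w] mult.assoc
           sum_distrib_left complex_cnj_power complex_cnj_cnj)
    also have "\<dots> = (\<Sum>m<N. ip w w)"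
    proof (rule sum.cong[OF refl])
      fix m assume m: "m \<in> {..<N}"
      have "(\<Sum>l<N. z ^ m * cnj z ^ l * (if m = l then ip w w else 0)) = (\<Sum>l<N. if m = l then cnj z ^ m * z ^ m * ip w w else 0)"
        by (intro sum.cong refl) auto
      then show "(\<Sum>l<N. z ^ m * cnj z ^ l * (if m = l then ip w w else 0)) = ip w w" using m by (simp add: zp)
    qed
    finally have "ip (F w N) (F w N) = of_nat N * ip w w" by simp
    then show ?thesis unfolding ip_self[OF FC[OF w]] ip_self[OF wC] by (metis of_real_eq_iff of_real_mult of_real_of_nat_eq)
  qed
  have nF: "nrm (F w N) = sqrt (real N) * nrm w" if "w \<in> L" for w N
    using FF[OF that, of N] nrm_ge0[OF FC[OF that]] nrm_ge0[OF L_C[OF that]]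
    by (metis real_sqrt_abs real_sqrt_mult abs_of_nonneg)
  have main: "norm (of_nat (Suc N) * P + of_nat N * (z * Q)) \<le> \<rho> * real (Suc N) * (nrm v * nrm u)" for N
  proof -
    let ?f = "F v (Suc N)" and ?g = "F u (Suc N)"
    have XF: "X * ?f = (\<Sum>l<Suc N. \<kappa> (cnj z ^ l) * (X * (T ^ l * v)))"
      unfolding F_def sum_distrib_left by (simp only: mult.left_commute)
    have "ip (X * ?f) ?g = (\<Sum>m<Suc N. \<Sum>l<Suc N. z ^ m * cnj z ^ l * ip (X * (T ^ l * v)) (T ^ m * u))"
    proof -
      have c: "X * (T ^ l * v) \<in> C" "T ^ l * u \<in> C" for l using L_C v u Tpow_C C_X by blast+
      show ?thesis unfolding XF unfolding F_def
        by (simp only: ip_sum ip_sum2 C_sum C_scale c ip_scale ip_scale2 sum_distrib_left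
             complex_cnj_power complex_cnj_cnj mult.assoc)
    qed
    also have "\<dots> = (\<Sum>l<Suc N. \<Sum>m<Suc N. cnj z ^ l * z ^ m * ip (X * (T ^ l * v)) (T ^ m * u))"
      by (subst sum.swap) (intro sum.cong refl, simp only: mult_ac)
    also have "\<dots> = (\<Sum>l<Suc N. P + (if l < N then z * Q else 0))"
    proof (rule sum.cong[OF refl])
      fix l assume l: "l \<in> {..<Suc N}"
      have "(\<Sum>m<Suc N. cnj z ^ l * z ^ m * ip (X * (T ^ l * v)) (T ^ m * u)) =
        (\<Sum>m<Suc N. (if m = l then P else 0) + (if m = Suc l then z * Q else 0))"
        unfolding X_Tpow[OF v u] P_def[symmetric] Q_def[symmetric]
        proof (rule sum.cong[OF refl])
          fix m
          have "cnj z ^ l * z ^ Suc l * Q = z * Q" using zp[of l] by (simp add: mult.left_commute)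
          then show "cnj z ^ l * z ^ m * ((if m = l then P else 0) + (if m = Suc l then Q else 0)) =
            (if m = l then P else 0) + (if m = Suc l then z * Q else 0)"
            using zp[of l] by (cases "m = l"; cases "m = Suc l") simp_all
        qed
      also have "\<dots> = P + (if l < N then z * Q else 0)"
        using l by (subst sum.distrib) (simp add: sum.delta)
      finally show "(\<Sum>m<Suc N. cnj z ^ l * z ^ m * ip (X * (T ^ l * v)) (T ^ m * u)) = P + (if l < N then z * Q else 0)" .
    qed
    also have "\<dots> = of_nat (Suc N) * P + of_nat N * (z * Q)"
      by (simp add: sum.distrib)
    finally have "norm (of_nat (Suc N) * P + of_nat N * (z * Q)) = norm (ip (X * ?f) ?g)" by simp
    also have "\<dots> \<le> nrm (X * ?f) * nrm ?g" using FC v u C_X by (intro CS) auto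
    also have "\<dots> \<le> (\<rho> * nrm ?f) * nrm ?g"
      using X_bound FC v u nrm_ge0 by (intro mult_right_mono) auto
    also have "\<dots> = \<rho> * (sqrt (real (Suc N)) * sqrt (real (Suc N))) * (nrm v * nrm u)"
      by (simp only: nF[OF v] nF[OF u] mult_ac)
    finally show ?thesis by simp
  qed
  have "norm (P + z * Q) \<le> \<rho> * nrm v * nrm u + norm Q / real (Suc N)" for N
  proof -
    have "of_nat (Suc N) * (P + z * Q) = (of_nat (Suc N) * P + of_nat N * (z * Q)) + z * Q"
      by (simp add: algebra_simps)
    then have "norm (of_nat (Suc N) * (P + z * Q)) \<le> \<rho> * real (Suc N) * (nrm v * nrm u) + norm (z * Q)"
      using main[of N] norm_triangle_le by (metis add_right_mono)
    then have "real (Suc N) * norm (P + z * Q) \<le> \<rho> * real (Suc N) * (nrm v * nrm u) + norm Q"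
      using z by (simp only: norm_mult norm_of_nat mult_1_left)
    then show ?thesis by (simp add: field_simps del: of_nat_Suc)
  qed
  moreover have "(\<lambda>N. \<rho> * nrm v * nrm u + norm Q / real (Suc N)) \<longlonglongrightarrow> \<rho> * nrm v * nrm u + 0"
    by (intro tendsto_add tendsto_const) (use LIMSEQ_Suc[OF lim_const_over_n[of "norm Q"]] in simp)
  ultimately have "norm (P + z * Q) \<le> \<rho> * nrm v * nrm u + 0"
    by (intro LIMSEQ_le_const) auto
  then show ?thesis by (simp add: P_def Q_def)
qed

text \<open>\<open>toeplitz_bound\<close> for \<open>v\<close> against its own image
  \<open>\<Phi>\<close> makes the left side the squared norm of the image; one factor
  cancels.\<close>

lemma pencil_norm: assumes z: "norm z = 1"
  shows "sqrt (\<Sum>i<n. (norm (\<Sum>j<n. (cnj (a X j i) + z * a Y i j) * v j))\<^sup>2) \<le> \<rho> * sqrt (\<Sum>i<n. (norm (v i))\<^sup>2)"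
proof -
  define \<Phi> where "\<Phi> i = (\<Sum>j<n. (cnj (a X j i) + z * a Y i j) * v j)" for i
  let ?v = "comb v" and ?u = "comb \<Phi>"
  have XvC: "X * ?v \<in> C" using C_X comb_C by blast
  have n2: "nrm (comb c) = sqrt (\<Sum>i<n. (norm (c i))\<^sup>2)" for c
    using nrm_comb[of c] nrm_ge0[OF comb_C[of c]] by (metis real_sqrt_abs abs_of_nonneg)
  have 1: "ip (X * ?v) (e i) = (\<Sum>j<n. cnj (a X j i) * v j)" if "i < n" for i
    unfolding mult_comb using that by (subst ip_sum) (auto simp: C_scale C_X eC ip_scale cnj_a[OF pair_XY] mult.commute)
  have 2: "ip (X * ?v) (T * e i) = (\<Sum>j<n. a Y i j * v j)" if "i < n" for i
    unfolding pair_T[OF pair_XY comb_C eC[OF that]] using that C_Y eC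
    by (simp add: ip_comb a_def mult.commute[of _ "v _"])
  have "ip (X * ?v) ?u + z * ip (X * ?v) (T * ?u) = (\<Sum>i<n. cnj (\<Phi> i) * (ip (X * ?v) (e i) + z * ip (X * ?v) (T * e i)))"
  proof -
    have "ip (X * ?v) (T * ?u) = (\<Sum>i<n. cnj (\<Phi> i) * ip (X * ?v) (T * e i))"
      unfolding mult_comb[of T] using XvC by (subst ip_sum2) (auto simp: C_scale C_T eC ip_scale2)
    then show ?thesis using ip_comb2[OF XvC, of \<Phi>]
      by (simp only: sum_distrib_left ring_distribs sum.distrib mult.left_commute)
  qed
  also have "\<dots> = (\<Sum>i<n. cnj (\<Phi> i) * \<Phi> i)"
    by (intro sum.cong refl) (simp add: 1 2 \<Phi>_def sum_distrib_left ring_distribs sum.distrib mult_ac)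
  also have "\<dots> = of_real (\<Sum>i<n. (norm (\<Phi> i))\<^sup>2)"
    unfolding of_real_sum complex_norm_square by (simp add: mult.commute)
  finally have "norm (ip (X * ?v) ?u + z * ip (X * ?v) (T * ?u)) = (nrm ?u)\<^sup>2"
    using nrm_ge0[OF comb_C] by (simp add: nrm_comb[symmetric] norm_power)
  then have "(nrm ?u)\<^sup>2 \<le> \<rho> * nrm ?v * nrm ?u"
    using toeplitz_bound[OF comb_L comb_L z, of v \<Phi>] by simp
  then have "nrm ?u \<le> \<rho> * nrm ?v"
    using nrm_ge0[OF comb_C, of \<Phi>] nrm_ge0[OF comb_C, of v] X_bound[OF comb_C, of v] nrm_ge0[OF C_X[OF comb_C], of v]
    by (cases "nrm ?u = 0") (auto simp: power2_eq_square)
  then show ?thesis by (simp add: n2 \<Phi>_def)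
qed

text \<open>Applying \<open>\<psi>\<close> to the decomposition in \<open>pencil\<close> turns the
  values \<open>\<psi> (e k)\<close> into a left eigenvector. They cannot all vanish: otherwise
  \<open>decomp\<close> bounds \<psi> at p by |t| times \<psi> at a vector h no longer than p, and
  iteration forces \<open>\<psi> 1 = 0\<close>.\<close>

lemma evaluation_eigenvector:
  assumes add: "\<And>u v. u \<in> C \<Longrightarrow> v \<in> C \<Longrightarrow> \<psi> (u + v) = \<psi> u + \<psi> v"
    and sc: "\<And>c u. u \<in> C \<Longrightarrow> \<psi> (\<kappa> c * u) = c * \<psi> u"
    and mT: "\<And>u. u \<in> C \<Longrightarrow> \<psi> (T * u) = t * \<psi> u"
    and bd: "\<And>u. u \<in> C \<Longrightarrow> norm (\<psi> u) \<le> K * nrm u" and t: "norm t < 1"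
    and one: "\<psi> 1 \<noteq> 0"
  shows "\<exists>k<n. \<psi> (e k) \<noteq> 0"
    and "pair U V \<Longrightarrow> (\<And>u. u \<in> C \<Longrightarrow> \<psi> (U * u) = x * \<psi> u) \<Longrightarrow> j < n \<Longrightarrow>
      (\<Sum>k<n. \<psi> (e k) * (cnj (a U j k) + t * a V k j)) = x * \<psi> (e j)"
proof -
  have diff: "\<psi> (u - v) = \<psi> u - \<psi> v" if "u \<in> C" "v \<in> C" for u v
    using add[of "u - v" v] that C_diff by auto
  have zero: "\<psi> 0 = 0" using sc[OF C_0, of 0] by (simp add: k_0)
  have null: "\<psi> u = \<psi> v" if "u \<in> C" "v \<in> C" "nrm (u - v) = 0" for u v
    using bd[of "u - v"] diff that C_diff by simp
  have sums: "\<psi> (sum f A) = (\<Sum>i\<in>A. \<psi> (f i))" if "\<And>i. i \<in> A \<Longrightarrow> f i \<in> C" for f and A :: "nat set"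
    using that by (induction A rule: infinite_finite_induct) (auto simp: zero add C_sum)
  have comb: "\<psi> (comb c) = (\<Sum>i<n. c i * \<psi> (e i))" for c
    unfolding comb_def by (subst sums) (auto simp: eC C_scale sc)
  show "(\<Sum>k<n. \<psi> (e k) * (cnj (a U j k) + t * a V k j)) = x * \<psi> (e j)"
    if UV: "pair U V" and mU: "\<And>u. u \<in> C \<Longrightarrow> \<psi> (U * u) = x * \<psi> u" and j: "j < n"
  proof -
    have "\<psi> (U * e j) = \<psi> (comb (\<lambda>k. cnj (a U j k)) + T * comb (\<lambda>k. a V k j))"
      by (rule null[OF pair_C(1)[OF UV eC[OF j]] pencil_C pencil[OF UV j]])
    then have "x * \<psi> (e j) = (\<Sum>k<n. cnj (a U j k) * \<psi> (e k)) + t * (\<Sum>k<n. a V k j * \<psi> (e k))"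
      using mU[OF eC[OF j]] by (simp only: add comb_C C_T mT comb)
    then show ?thesis by (simp only: sum_distrib_left sum.distrib distrib_left mult_ac)
  qed
  show "\<exists>k<n. \<psi> (e k) \<noteq> 0"
  proof (rule ccontr)
    assume "\<not> ?thesis"
    then have c0: "\<psi> (comb c) = 0" for c unfolding comb by auto
    have K0: "0 \<le> K * nrm u" if "u \<in> C" for u using bd[OF that] norm_ge_zero order_trans by blast
    \<comment> \<open>The vectors \<open>h\<close> from \<open>decomp\<close> lie in
      \<open>C\<close>, not in \<open>D\<close>, so each stage is proved on \<open>D\<close> and
      carried back to \<open>C\<close> by density.\<close>
    have step: "norm (\<psi> u) \<le> norm t ^ m * (K * nrm u)" if u: "u \<in> C" for u m
      using u
    proof (induction m arbitrary: u)
      case 0 then show ?case using bd by simp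
    next
      case (Suc m)
      have D: "norm (\<psi> p) \<le> norm t ^ Suc m * (K * nrm p)" if p: "p \<in> D" for p
      proof -
        obtain h where h: "h \<in> C" "nrm (p - (comb (\<lambda>i. ip p (e i)) + T * h)) = 0" "nrm h \<le> nrm p"
          using decomp[OF p] by blast
        have "\<psi> p = \<psi> (comb (\<lambda>i. ip p (e i)) + T * h)"
          by (rule null) (use p D_sub h comb_C C_T C_add in auto)
        also have "\<dots> = t * \<psi> h" using h by (simp add: add comb_C C_T mT c0)
        finally have "norm (\<psi> p) \<le> norm t * (norm t ^ m * (K * nrm h))"
          using Suc.IH[OF h(1)] by (simp add: norm_mult mult_left_mono)
        also have "\<dots> \<le> norm t * (norm t ^ m * (K * nrm p))"
        proof (cases "K \<ge> 0")
          case True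
          then show ?thesis using h by (intro mult_left_mono) auto
        next
          case False
          \<comment> \<open>A negative \<open>K\<close> forces these norms to vanish, since
            \<open>K\<close> times a norm bounds a modulus.\<close>
          then have "nrm h = 0 \<and> nrm p = 0"
            using K0[OF h(1)] K0[OF D_sub[OF p]] nrm_ge0[OF h(1)] nrm_ge0[OF D_sub[OF p]]
            by (auto simp: zero_le_mult_iff)
          then show ?thesis by simp
        qed
        finally show ?thesis by (simp add: mult_ac)
      qed
      have "norm (\<psi> u) \<le> norm t ^ Suc m * (K * nrm u) + \<epsilon> * (2 * \<bar>K\<bar>)" if e: "\<epsilon> > 0" for \<epsilon>
      proof -
        obtain p where p: "p \<in> D" "nrm (u - p) < \<epsilon>" using dense[OF Suc.prems e] by blast
        have pC: "p \<in> C" using p D_sub by blast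
        have "norm (\<psi> u) \<le> norm (\<psi> p) + norm (\<psi> (u - p))"
          using diff[OF Suc.prems pC] norm_triangle_ineq[of "\<psi> p" "\<psi> u - \<psi> p"] by simp
        also have "norm (\<psi> (u - p)) \<le> \<bar>K\<bar> * \<epsilon>"
        proof -
          have "norm (\<psi> (u - p)) \<le> K * nrm (u - p)" using bd C_diff Suc.prems pC by blast
          also have "\<dots> \<le> \<bar>K\<bar> * nrm (u - p)" using nrm_ge0 C_diff Suc.prems pC by (intro mult_right_mono) auto
          also have "\<dots> \<le> \<bar>K\<bar> * \<epsilon>" using p by (intro mult_left_mono) auto
          finally show ?thesis .
        qed
        also have "norm (\<psi> p) \<le> norm t ^ Suc m * (K * nrm u) + \<bar>K\<bar> * \<epsilon>"
        proof -
          have "K * nrm p \<le> K * nrm u + \<bar>K\<bar> * \<bar>nrm p - nrm u\<bar>"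
            by (metis abs_ge_self abs_mult add.commute diff_le_eq right_diff_distrib)
          also have "\<bar>K\<bar> * \<bar>nrm p - nrm u\<bar> \<le> \<bar>K\<bar> * \<epsilon>"
            using nrm_diff_ge[OF pC Suc.prems] nrm_diff_commute[OF pC Suc.prems] p by (intro mult_left_mono) auto
          finally have "norm t ^ Suc m * (K * nrm p) \<le> norm t ^ Suc m * (K * nrm u + \<bar>K\<bar> * \<epsilon>)"
            by (intro mult_left_mono) auto
          also have "\<dots> \<le> norm t ^ Suc m * (K * nrm u) + 1 * (\<bar>K\<bar> * \<epsilon>)"
            unfolding distrib_left using e t power_le_one[of "norm t" "Suc m"] by (intro add_left_mono mult_right_mono) auto
          finally show ?thesis using D[OF p(1)] by linarith
        qed
        finally show ?thesis by (simp add: algebra_simps)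
      qed
      note A = this
      show ?case
      proof (rule field_le_epsilon)
        fix d :: real assume d: "d > 0"
        have "norm (\<psi> u) \<le> norm t ^ Suc m * (K * nrm u) + d / (2 * \<bar>K\<bar> + 1) * (2 * \<bar>K\<bar>)"
          using d by (intro A) auto
        also have "d / (2 * \<bar>K\<bar> + 1) * (2 * \<bar>K\<bar>) \<le> d" using d by (simp add: field_simps)
        finally show "norm (\<psi> u) \<le> norm t ^ Suc m * (K * nrm u) + d" by simp
      qed
    qed
    have oneC: "1 \<in> C" using D_1 D_sub by blast
    have "(\<lambda>m. norm t ^ m * (K * nrm 1)) \<longlonglongrightarrow> 0 * (K * nrm 1)"
      using t by (intro tendsto_mult LIMSEQ_power_zero tendsto_const) auto
    then have "norm (\<psi> 1) \<le> 0 * (K * nrm 1)" using step[OF oneC] by (intro LIMSEQ_le_const) auto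
    then show False using one by simp
  qed
qed

lemma phi_T2: assumes "norm t < 1" "v \<in> C" "p \<in> C" shows "t * phi t (T * v) p = phi t v p - ip p v"
proof -
  have "(\<lambda>m. t ^ Suc m * ip p (T ^ Suc m * v)) sums (t * phi t (T * v) p)"
    using sums_mult[OF phi_sums[of t "T * v" p], of t] assms C_T by (simp add: mult_ac)
  moreover have "(\<lambda>m. t ^ Suc m * ip p (T ^ Suc m * v)) sums (phi t v p - ip p v)"
    by (subst sums_Suc_iff) (use phi_sums[of t v p] assms in simp)
  ultimately show ?thesis using sums_unique2 by blast
qed

text \<open>Converse passage, from a left eigenvector to a functional. Splitting off the term m = 0
  gives \<open>phi t w (U * p) = ip (U * p) w + t * phi t (V * w) p\<close>. The first summand is
  \<open>ip p (comb \<beta>)\<close>, and it cancels the boundary term that appears when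
  \<open>T\<close> is removed from \<open>phi t (T * comb \<beta>) p\<close>; the eigenvector
  equation identifies what remains.\<close>

lemma eigenvector_functional:
  assumes t: "norm t < 1" and UV: "pair U V" and VU: "pair V U"
    and eig: "\<And>j. j < n \<Longrightarrow> (\<Sum>k<n. c k * (cnj (a U j k) + t * a V k j)) = x * c j"
    and p: "p \<in> D"
  shows "phi t (comb (\<lambda>k. cnj (c k))) (U * p) = x * phi t (comb (\<lambda>k. cnj (c k))) p"
proof -
  define w where "w = comb (\<lambda>k. cnj (c k))"
  define \<alpha> \<beta> where "\<alpha> l = (\<Sum>k<n. cnj (c k) * cnj (a V k l))" and "\<beta> l = (\<Sum>k<n. cnj (c k) * a U l k)" for l
  have pC: "p \<in> C" using p D_sub by blast
  have wC: "w \<in> C" "w \<in> L" unfolding w_def using comb_C comb_L by auto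
  have UpC: "U * p \<in> C" "V * w \<in> C" using pair_C[OF UV] pC wC by blast+
  have s1: "(\<lambda>m. t ^ m * ip (U * p) (T ^ m * w)) sums phi t w (U * p)" using phi_sums t wC UpC by blast
  have "(\<lambda>m. t ^ Suc m * ip (U * p) (T ^ Suc m * w)) sums (t * phi t (V * w) p)"
  proof -
    have "ip (U * p) (T ^ Suc m * w) = ip p (T ^ m * (V * w))" for m
      using pair_T[OF UV pC Tpow_C[OF wC(1)], of m] by (simp add: mult_ac)
    then show ?thesis using sums_mult[OF phi_sums[OF t UpC(2) pC], of t] by (simp add: mult_ac)
  qed
  moreover have "(\<lambda>m. t ^ Suc m * ip (U * p) (T ^ Suc m * w)) sums (phi t w (U * p) - ip (U * p) w)"
    by (subst sums_Suc_iff) (use s1 in simp)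
  ultimately have 1: "phi t w (U * p) = ip (U * p) w + t * phi t (V * w) p"
    using sums_unique2 by fastforce
  \<comment> \<open>Only the component of \<open>p\<close> in \<open>L\<close> matters, since
    \<open>w\<close> is orthogonal to the range of \<open>T\<close>.\<close>
  have 2: "ip (U * p) w = ip p (comb \<beta>)"
  proof -
    obtain h where h: "h \<in> C" "nrm (p - (comb (\<lambda>i. ip p (e i)) + T * h)) = 0" using decomp[OF p] by blast
    let ?c = "comb (\<lambda>i. ip p (e i))"
    have cC: "?c + T * h \<in> C" using comb_C h C_T C_add by blast
    have "nrm (U * (p - (?c + T * h))) = 0" using UV h cC pC C_diff unfolding pair_def by blast
    then have "ip (U * p) w = ip (U * (?c + T * h)) w"
      using eq_ip[OF UpC(1) pair_C(1)[OF UV cC] wC(1)] by (simp add: right_diff_distrib)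
    also have "\<dots> = ip (U * ?c) w + ip (T * (U * h)) w"
      using pair_C(1)[OF UV] comb_C C_T h wC by (simp add: ring_distribs ip_add mult.left_commute)
    also have "ip (T * (U * h)) w = 0" using L_ip2[OF wC(2)] pair_C(1)[OF UV h(1)] by blast
    also have "ip (U * ?c) w = (\<Sum>l<n. ip p (e l) * ip (U * e l) w)"
      unfolding mult_comb using wC pair_C(1)[OF UV] by (subst ip_sum) (auto simp: eC C_scale ip_scale)
    also have "\<dots> = (\<Sum>l<n. cnj (\<beta> l) * ip p (e l))"
    proof (rule sum.cong[OF refl])
      fix l assume "l \<in> {..<n}"
      then have l: "l < n" by simp
      have "ip (U * e l) w = (\<Sum>k<n. c k * ip (U * e l) (e k))"
        unfolding w_def using ip_comb2[OF pair_C(1)[OF UV eC[OF l]]] by simp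
      also have "\<dots> = cnj (\<beta> l)" unfolding \<beta>_def using l cnj_a[OF UV l] by simp
      finally show "ip p (e l) * ip (U * e l) w = cnj (\<beta> l) * ip p (e l)" by simp
    qed
    also have "\<dots> = ip p (comb \<beta>)" using ip_comb2[OF pC] by simp
    finally show ?thesis by simp
  qed
  \<comment> \<open>This is \<open>pencil\<close> for the pair (V, U), applied to each term of
    \<open>w\<close>.\<close>
  have 3: "phi t (V * w) p = phi t (comb \<alpha>) p + phi t (T * comb \<beta>) p"
  proof -
    let ?g = "\<lambda>k. comb (\<lambda>l. cnj (a V k l)) + T * comb (\<lambda>l. a U l k)"
    have Vw: "V * w = (\<Sum>k<n. \<kappa> (cnj (c k)) * (V * e k))" unfolding w_def mult_comb ..
    have ek: "phi t (V * e k) p = phi t (?g k) p" if k: "k < n" for k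
    proof -
      have VC: "V * e k \<in> C" using pair_C(2)[OF UV eC[OF k]] .
      have "phi t (V * e k - ?g k) p = 0"
        by (rule phi_null2[OF t C_diff[OF VC pencil_C] pC pencil[OF VU k]])
      then show ?thesis using phi_add2[OF t pencil_C[of "\<lambda>l. cnj (a V k l)" "\<lambda>l. a U l k"]
        C_diff[OF VC pencil_C[of "\<lambda>l. cnj (a V k l)" "\<lambda>l. a U l k"]] pC] by simp
    qed
    have "phi t (V * w) p = (\<Sum>k<n. c k * phi t (?g k) p)"
      unfolding Vw using pair_C(2)[OF UV] t pC
      by (subst phi_sum2) (auto simp: eC C_scale phi_scale2 ek)
    also have "\<dots> = phi t (\<Sum>k<n. \<kappa> (cnj (c k)) * ?g k) p"
      using t pC pencil_C by (subst phi_sum2) (auto simp: C_scale phi_scale2)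
    also have "(\<Sum>k<n. \<kappa> (cnj (c k)) * ?g k) = comb \<alpha> + T * comb \<beta>"
    proof -
      have "(\<Sum>k<n. \<kappa> (cnj (c k)) * comb (\<lambda>l. f k l)) = comb (\<lambda>l. \<Sum>k<n. cnj (c k) * f k l)" for f
      proof -
        have "(\<Sum>k<n. \<kappa> (cnj (c k)) * comb (\<lambda>l. f k l)) = (\<Sum>l<n. \<Sum>k<n. \<kappa> (cnj (c k) * f k l) * e l)"
          unfolding scale_comb unfolding comb_def by (rule sum.swap)
        then show ?thesis by (simp only: comb_def k_sum sum_distrib_right)
      qed
      moreover have "(\<Sum>k<n. \<kappa> (cnj (c k)) * ?g k) = (\<Sum>k<n. \<kappa> (cnj (c k)) * comb (\<lambda>l. cnj (a V k l)))
          + T * (\<Sum>k<n. \<kappa> (cnj (c k)) * comb (\<lambda>l. a U l k))"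
        by (simp add: ring_distribs sum.distrib sum_distrib_left mult.left_commute)
      ultimately show ?thesis by (simp add: \<alpha>_def[abs_def] \<beta>_def[abs_def])
    qed
    finally show ?thesis using phi_add2[OF t C_T[OF comb_C] comb_C pC] by simp
  qed
  have "phi t w (U * p) = t * phi t (comb \<alpha>) p + phi t (comb \<beta>) p"
    unfolding 1 2 3 distrib_left phi_T2[OF t comb_C pC] by simp
  also have "\<dots> = phi t (\<kappa> (cnj t) * comb \<alpha> + comb \<beta>) p"
    using phi_add2[OF t comb_C C_scale[OF comb_C] pC] phi_scale2[OF t comb_C pC] by simp
  also have "\<kappa> (cnj t) * comb \<alpha> + comb \<beta> = \<kappa> (cnj x) * w"
    unfolding w_def scale_comb comb_add
  proof (rule comb_cong)
    fix l assume l: "l < n"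
    have "cnj t * \<alpha> l + \<beta> l = cnj (\<Sum>k<n. c k * (cnj (a U l k) + t * a V k l))"
      by (simp only: \<alpha>_def \<beta>_def sum_distrib_left sum.distrib distrib_left cnj_sum complex_cnj_mult
          complex_cnj_add complex_cnj_cnj mult_ac add.commute)
    then show "cnj t * \<alpha> l + \<beta> l = cnj x * cnj (c l)" using eig[OF l] by simp
  qed
  also have "phi t (\<kappa> (cnj x) * w) p = x * phi t w p" using phi_scale2[OF t wC(1) pC] by simp
  finally show ?thesis by (simp add: w_def)
qed

lemma eigenvector_functional_nonzero:
  assumes t: "norm t < 1" and "k < n" "c k \<noteq> 0"
  shows "\<exists>p\<in>D. phi t (comb (\<lambda>k. cnj (c k))) p \<noteq> 0"
proof (rule ccontr)
  assume "\<not> ?thesis"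
  then have "nrm (comb (\<lambda>k. cnj (c k))) = 0" using phi_zero_null[OF t comb_L] by blast
  then have "(\<Sum>i<n. (norm (c i))\<^sup>2) = 0" using nrm_comb[of "\<lambda>k. cnj (c k)"] by simp
  then have "\<forall>i\<in>{..<n}. (norm (c i))\<^sup>2 = 0" by (subst (asm) sum_nonneg_eq_0_iff) auto
  then show False using assms by simp
qed

end

section \<open>Completion\<close>

locale pre_hardy = sip UNIV \<kappa> ip for \<kappa> :: "complex \<Rightarrow> 'a::comm_ring_1" and ip +
  fixes X Y T :: 'a and \<rho> :: real
  assumes T_iso: "ip (T * u) (T * v) = ip u v"
    and X_adj: "ip (X * u) v = ip (T * u) (Y * v)"
    and Y_adj: "ip (Y * u) v = ip (T * u) (X * v)"
    and X_bound: "nrm (X * u) \<le> \<rho> * nrm u"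
begin

text \<open>The completion is realised by Cauchy sequences inside the function ring
  \<open>nat \<Rightarrow> 'a\<close>. Sequences tending to zero remain as null vectors, and an
  element of \<open>'a\<close> becomes a constant sequence.\<close>

definition cau :: "(nat \<Rightarrow> 'a) set" where
  "cau = {u. \<forall>\<epsilon>>0. \<exists>N. \<forall>m\<ge>N. \<forall>k\<ge>N. nrm (u m - u k) < \<epsilon>}"

definition lip :: "(nat \<Rightarrow> 'a) \<Rightarrow> (nat \<Rightarrow> 'a) \<Rightarrow> complex" where
  "lip u v = lim (\<lambda>k. ip (u k) (v k))"

lemma nonneg: "0 \<le> nrm u" by (rule nrm_ge0) simp

lemma cauD: "u \<in> cau \<Longrightarrow> \<epsilon> > 0 \<Longrightarrow> \<exists>N. \<forall>m\<ge>N. \<forall>k\<ge>N. nrm (u m - u k) < \<epsilon>"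
  by (simp add: cau_def)

lemma cau_bounded: assumes "u \<in> cau" shows "\<exists>B>0. \<forall>k. nrm (u k) \<le> B"
proof -
  obtain N where N: "\<And>m k. m \<ge> N \<Longrightarrow> k \<ge> N \<Longrightarrow> nrm (u m - u k) < 1"
    using cauD[OF assms, of 1] by auto
  define B where "B = Max ((\<lambda>k. nrm (u k)) ` {..N}) + 1"
  have mx: "nrm (u k) \<le> B - 1" if "k \<le> N" for k unfolding B_def using that by auto
  have "nrm (u k) \<le> B" for k
  proof (cases "k \<le> N")
    case True then show ?thesis using mx[of k] by simp
  next
    case False
    have "nrm (u k) \<le> nrm (u k - u N) + nrm (u N)" using nrm_triangle[of "u k - u N" "u N"] by simp
    then show ?thesis using N[of k N] False mx[of N] by simp
  qed
  moreover have "B > 0" using mx[of 0] nonneg[of "u 0"] by simp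
  ultimately show ?thesis by blast
qed

lemma Cauchy_ip: assumes "u \<in> cau" "v \<in> cau" shows "Cauchy (\<lambda>k. ip (u k) (v k))"
proof -
  obtain A where A: "A > 0" "\<And>k. nrm (u k) \<le> A" using cau_bounded[OF assms(1)] by blast
  obtain B where B: "B > 0" "\<And>k. nrm (v k) \<le> B" using cau_bounded[OF assms(2)] by blast
  show ?thesis
  proof (rule metric_CauchyI)
    fix \<epsilon> :: real assume e: "\<epsilon> > 0"
    obtain N1 where N1: "\<And>m k. m \<ge> N1 \<Longrightarrow> k \<ge> N1 \<Longrightarrow> nrm (u m - u k) < \<epsilon> / (2 * B)"
      using cauD[OF assms(1), of "\<epsilon> / (2 * B)"] e B by auto
    obtain N2 where N2: "\<And>m k. m \<ge> N2 \<Longrightarrow> k \<ge> N2 \<Longrightarrow> nrm (v m - v k) < \<epsilon> / (2 * A)"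
      using cauD[OF assms(2), of "\<epsilon> / (2 * A)"] e A by auto
    have "dist (ip (u m) (v m)) (ip (u k) (v k)) < \<epsilon>" if mk: "m \<ge> max N1 N2" "k \<ge> max N1 N2" for m k
    proof -
      have "ip (u m) (v m) - ip (u k) (v k) = ip (u m - u k) (v m) + ip (u k) (v m - v k)"
        by (simp add: ip_diff ip_diff2)
      then have "dist (ip (u m) (v m)) (ip (u k) (v k)) \<le> norm (ip (u m - u k) (v m)) + norm (ip (u k) (v m - v k))"
        by (simp add: dist_norm norm_triangle_ineq)
      also have "\<dots> \<le> nrm (u m - u k) * nrm (v m) + nrm (u k) * nrm (v m - v k)"
        by (intro add_mono CS) auto
      also have "\<dots> \<le> nrm (u m - u k) * B + A * nrm (v m - v k)"
        by (intro add_mono mult_left_mono mult_right_mono A B nonneg)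
      also have "\<dots> < \<epsilon> / (2 * B) * B + A * (\<epsilon> / (2 * A))"
        using N1[of m k] N2[of m k] mk A B by (intro add_strict_mono mult_strict_right_mono mult_strict_left_mono) auto
      also have "\<dots> = \<epsilon>" using A B by simp
      finally show ?thesis .
    qed
    then show "\<exists>M. \<forall>m\<ge>M. \<forall>n\<ge>M. dist (ip (u m) (v m)) (ip (u n) (v n)) < \<epsilon>" by blast
  qed
qed

lemma lip_tendsto: "u \<in> cau \<Longrightarrow> v \<in> cau \<Longrightarrow> (\<lambda>k. ip (u k) (v k)) \<longlonglongrightarrow> lip u v"
  unfolding lip_def using Cauchy_ip Cauchy_convergent_iff convergent_LIMSEQ_iff by blast

lemma lip_eqI: "u \<in> cau \<Longrightarrow> v \<in> cau \<Longrightarrow> (\<lambda>k. ip (u k) (v k)) \<longlonglongrightarrow> c \<Longrightarrow> lip u v = c"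
  using lip_tendsto LIMSEQ_unique by blast

lemma cau_const: "(\<lambda>_. p) \<in> cau" by (simp add: cau_def nrm_0)

lemma cau_mult: assumes u: "u \<in> cau" and K: "\<And>w. nrm (c * w) \<le> K * nrm w"
  shows "(\<lambda>_. c) * u \<in> cau"
  unfolding cau_def
proof (intro CollectI allI impI)
  fix \<epsilon> :: real assume e: "\<epsilon> > 0"
  \<comment> \<open>A strictly positive bound, so that \<epsilon> can be divided by it.\<close>
  define K' where "K' = \<bar>K\<bar> + 1"
  have K': "nrm (c * w) \<le> K' * nrm w" "K' > 0" for w
    using order_trans[OF K mult_right_mono[OF _ nonneg]] by (auto simp: K'_def)
  obtain N where N: "\<And>m k. m \<ge> N \<Longrightarrow> k \<ge> N \<Longrightarrow> nrm (u m - u k) < \<epsilon> / K'"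
    using cauD[OF u, of "\<epsilon> / K'"] e K' by auto
  have "nrm (((\<lambda>_. c) * u) m - ((\<lambda>_. c) * u) k) < \<epsilon>" if "m \<ge> N" "k \<ge> N" for m k
  proof -
    have "nrm (((\<lambda>_. c) * u) m - ((\<lambda>_. c) * u) k) \<le> K' * nrm (u m - u k)"
      using K'(1)[of "u m - u k"] by (simp add: right_diff_distrib)
    also have "\<dots> < K' * (\<epsilon> / K')" using N[OF that] K' by (intro mult_strict_left_mono) auto
    also have "\<dots> = \<epsilon>" using K'(2) by simp
    finally show ?thesis .
  qed
  then show "\<exists>N. \<forall>m\<ge>N. \<forall>k\<ge>N. nrm (((\<lambda>_. c) * u) m - ((\<lambda>_. c) * u) k) < \<epsilon>" by blast
qed

lemma ip_YY: "ip (Y * u) (Y * v) = ip (X * u) (X * v)"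
  using X_adj[of u "X * v"] Y_adj[of u "Y * v"] by (simp add: mult.left_commute)

lemma nT: "nrm (T * w) \<le> 1 * nrm w" by (simp add: nrm_def T_iso)
lemma nY: "nrm (Y * w) \<le> \<rho> * nrm w" using X_bound[of w] by (simp add: nrm_def ip_YY)
lemma nk: "nrm (\<kappa> c * w) \<le> norm c * nrm w" by (simp add: nrm_scale)

lemma cau_add: assumes "u \<in> cau" "v \<in> cau" shows "u + v \<in> cau"
  unfolding cau_def
proof (intro CollectI allI impI)
  fix \<epsilon> :: real assume e: "\<epsilon> > 0"
  obtain N1 where N1: "\<And>m k. m \<ge> N1 \<Longrightarrow> k \<ge> N1 \<Longrightarrow> nrm (u m - u k) < \<epsilon> / 2"
    using cauD[OF assms(1), of "\<epsilon> / 2"] e by auto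
  obtain N2 where N2: "\<And>m k. m \<ge> N2 \<Longrightarrow> k \<ge> N2 \<Longrightarrow> nrm (v m - v k) < \<epsilon> / 2"
    using cauD[OF assms(2), of "\<epsilon> / 2"] e by auto
  have "nrm ((u + v) m - (u + v) k) < \<epsilon>" if "m \<ge> max N1 N2" "k \<ge> max N1 N2" for m k
    using nrm_triangle[of "u m - u k" "v m - v k"] N1[of m k] N2[of m k] that
    by (simp add: algebra_simps)
  then show "\<exists>N. \<forall>m\<ge>N. \<forall>k\<ge>N. nrm ((u + v) m - (u + v) k) < \<epsilon>" by blast
qed

sublocale lim: sip cau "\<lambda>c _. \<kappa> c" lip
proof
  show "(\<lambda>_. \<kappa> (a + b)) = (\<lambda>_::nat. \<kappa> a) + (\<lambda>_. \<kappa> b)" for a b by (simp add: fun_eq_iff k_add)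
  show "(\<lambda>_. \<kappa> (a * b)) = (\<lambda>_::nat. \<kappa> a) * (\<lambda>_. \<kappa> b)" for a b by (simp add: fun_eq_iff k_mult)
  show "(\<lambda>_::nat. \<kappa> 1) = 1" by (simp add: fun_eq_iff k_1)
  show "u + v \<in> cau" if "u \<in> cau" "v \<in> cau" for u v using that cau_add by blast
  show S: "(\<lambda>_. \<kappa> c) * u \<in> cau" if "u \<in> cau" for u c using that cau_mult nk by blast
  show "0 \<in> cau" using cau_const[of 0] by (simp add: zero_fun_def)
  show "lip (u + v) w = lip u w + lip v w" if "u \<in> cau" "v \<in> cau" "w \<in> cau" for u v w
    using tendsto_add[OF lip_tendsto[OF that(1,3)] lip_tendsto[OF that(2,3)]] that
    by (intro lip_eqI cau_add) (auto simp: ip_add)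
  show "lip ((\<lambda>_. \<kappa> c) * u) v = c * lip u v" if "u \<in> cau" "v \<in> cau" for u v c
    using tendsto_mult[OF tendsto_const lip_tendsto[OF that], of c] that
    by (intro lip_eqI S) (auto simp: ip_scale)
  show "lip v u = cnj (lip u v)" if "u \<in> cau" "v \<in> cau" for u v
    using tendsto_cnj[OF lip_tendsto[OF that]] that
    by (intro lip_eqI) (auto simp: ip_cnj[symmetric])
  show "0 \<le> Re (lip u u)" if "u \<in> cau" for u
    using tendsto_Re[OF lip_tendsto[OF that that]] by (rule LIMSEQ_le_const) (auto simp: ip_pos)
qed

lemma lnrm_tendsto: assumes "u \<in> cau" shows "(\<lambda>k. nrm (u k)) \<longlonglongrightarrow> lim.nrm u"
  unfolding nrm_def lim.nrm_def by (intro tendsto_intros tendsto_Re lip_tendsto assms)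

lemma lip_const: "lip (\<lambda>_. p) (\<lambda>_. q) = ip p q" by (intro lip_eqI cau_const) simp
lemma lnrm_const: "lim.nrm (\<lambda>_. p) = nrm p" by (simp add: nrm_def lim.nrm_def lip_const)

text \<open>A minimising sequence for the distance from \<open>p\<close> to \<open>T \<cdot> H\<close> is Cauchy by the parallelogram law;
  its limit, in the completion, is the orthogonal projection.\<close>

lemma projection: "\<exists>h\<in>cau. \<forall>q. lip ((\<lambda>_. p) - (\<lambda>_. T) * h) ((\<lambda>_. T) * (\<lambda>_. q)) = 0"
proof -
  define d where "d = Inf (range (\<lambda>h. (nrm (p - T * h))\<^sup>2))"
  have bdd: "bdd_below (range (\<lambda>h. (nrm (p - T * h))\<^sup>2))" by (rule bdd_belowI[of _ 0]) auto
  have d_le: "d \<le> (nrm (p - T * h))\<^sup>2" for h unfolding d_def by (rule cINF_lower[OF bdd]) simp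
  have "\<exists>h. (nrm (p - T * h))\<^sup>2 < d + 1 / real (Suc k)" for k
  proof -
    have "d < d + 1 / real (Suc k)" by simp
    then show ?thesis unfolding d_def using cInf_lessD[of "range (\<lambda>h. (nrm (p - T * h))\<^sup>2)"] by blast
  qed
  then obtain h where h: "\<And>k. (nrm (p - T * h k))\<^sup>2 < d + 1 / real (Suc k)" by metis
  have par: "(nrm (u - v))\<^sup>2 = 2 * (nrm u)\<^sup>2 + 2 * (nrm v)\<^sup>2 - (nrm (u + v))\<^sup>2" for u v
    using nrm_add_sq[of u v] nrm_add_sq[of u "- v"] by (simp add: ip_uminus2 nrm_uminus)
  have est: "(nrm (h m - h k))\<^sup>2 \<le> 2 / real (Suc m) + 2 / real (Suc k)" for m k
  proof -
    let ?u = "p - T * h m" and ?v = "p - T * h k"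
    have "?u - ?v = T * (h k - h m)" by (simp add: algebra_simps)
    then have 1: "(nrm (h m - h k))\<^sup>2 = (nrm (?u - ?v))\<^sup>2"
      using nrm_diff_commute[of "h m" "h k"] by (simp add: nrm_def T_iso)
    have k2: "\<kappa> 2 = 2" using k_add[of 1 1] k_1 by simp
    \<comment> \<open>The midpoint of \<open>h m\<close> and \<open>h k\<close> is an admissible
      competitor, which bounds \<open>?u + ?v\<close> from below by minimality.\<close>
    have "?u + ?v = \<kappa> 2 * (p - T * (\<kappa> (1/2) * (h m + h k)))"
    proof -
      have "\<kappa> 2 * \<kappa> (1/2) = 1" using k_mult[of 2 "1/2"] k_1 by simp
      then have "\<kappa> 2 * (T * (\<kappa> (1/2) * (h m + h k))) = T * (h m + h k)"
        by (metis mult.assoc mult.left_commute mult_1)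
      then show ?thesis by (simp add: right_diff_distrib k2 algebra_simps)
    qed
    then have "(nrm (?u + ?v))\<^sup>2 = 4 * (nrm (p - T * (\<kappa> (1/2) * (h m + h k))))\<^sup>2"
      by (simp only: nrm_scale UNIV_I power_mult_distrib) simp
    then have d4: "4 * d \<le> (nrm (?u + ?v))\<^sup>2" using d_le by simp
    have "(nrm (h m - h k))\<^sup>2 \<le> 2 * (d + 1 / real (Suc m)) + 2 * (d + 1 / real (Suc k)) - 4 * d"
    proof -
      have "A \<le> 2 * (d + e1) + 2 * (d + e2) - 4 * d"
        if "4 * d \<le> S" "A = B" "B = 2 * P + 2 * Q - S" "P < d + e1" "Q < d + e2" for A B P Q S e1 e2 :: real
      proof -
        have "2 * P \<le> 2 * d + 2 * e1" "2 * Q \<le> 2 * d + 2 * e2" using that(4,5) by (simp_all add: algebra_simps)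
        then show ?thesis unfolding that(2,3) using that(1) by (simp add: algebra_simps)
      qed
      from this[OF d4 1 par h h] show ?thesis .
    qed
    then show ?thesis by (simp add: algebra_simps)
  qed
  have hc: "h \<in> cau"
    unfolding cau_def
  proof (intro CollectI allI impI)
    fix \<epsilon> :: real assume e: "\<epsilon> > 0"
    obtain N where N: "4 / \<epsilon>\<^sup>2 < real N" using reals_Archimedean2 by blast
    have N0: "real N > 0" by (rule le_less_trans[OF _ N]) (use e in simp)
    have "nrm (h m - h k) < \<epsilon>" if "m \<ge> N" "k \<ge> N" for m k
    proof -
      have "2 / real (Suc m) \<le> 2 / real N" "2 / real (Suc k) \<le> 2 / real N"
        using that N0 by (intro divide_left_mono; simp)+
      then have "(nrm (h m - h k))\<^sup>2 \<le> 4 / real N" using est[of m k] by simp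
      also have "\<dots> < \<epsilon>\<^sup>2" using N N0 e by (simp add: field_simps)
      finally show ?thesis using e by (simp add: power2_less_imp_less)
    qed
    then show "\<exists>N. \<forall>m\<ge>N. \<forall>k\<ge>N. nrm (h m - h k) < \<epsilon>" by blast
  qed
  have Thc: "(\<lambda>_. T) * h \<in> cau" by (rule cau_mult[OF hc nT])
  define w where "w = (\<lambda>_. p) - (\<lambda>_. T) * h"
  have wc: "w \<in> cau" unfolding w_def by (rule lim.C_diff[OF cau_const Thc])
  have wd: "(\<lambda>k. (nrm (w k))\<^sup>2) \<longlonglongrightarrow> d"
  proof (rule tendsto_sandwich[of "\<lambda>_. d" _ _ "\<lambda>k. d + 1 / real (Suc k)"])
    show "(\<lambda>k. d + 1 / real (Suc k)) \<longlonglongrightarrow> d"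
      using tendsto_add[OF tendsto_const[of d] LIMSEQ_Suc[OF lim_const_over_n[of "1::real"]]] by simp
  qed (use d_le h less_imp_le in \<open>auto simp: w_def intro!: always_eventually\<close>)
  have "lip w (\<lambda>_. T * q) = 0" for q
  proof (cases "nrm q = 0")
    case True
    then have "nrm (T * q) = 0" by (simp add: nrm_def T_iso)
    then show ?thesis by (intro lip_eqI wc cau_const) (simp add: null_ip2)
  next
    case False
    define z where "z = lip w (\<lambda>_. T * q)"
    \<comment> \<open>The optimal coefficient: moving \<open>h\<close> by
      \<open>\<kappa> s * q\<close> would lower the squared distance by
      \<open>(norm s)\<^sup>2 * (nrm q)\<^sup>2\<close> in the limit, so minimality forces
      \<open>s\<close> to be zero.\<close>
    define s where "s = z / of_real ((nrm q)\<^sup>2)"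
    have lz: "(\<lambda>k. ip (w k) (T * q)) \<longlonglongrightarrow> z" unfolding z_def using lip_tendsto[OF wc cau_const] by simp
    have "d \<le> (nrm (w k))\<^sup>2 + (norm s)\<^sup>2 * (nrm q)\<^sup>2 - 2 * Re (cnj s * ip (w k) (T * q))" for k
    proof -
      have "w k + (- (\<kappa> s * (T * q))) = p - T * (h k + \<kappa> s * q)" by (simp add: w_def algebra_simps)
      then have "d \<le> (nrm (w k + (- (\<kappa> s * (T * q)))))\<^sup>2" using d_le by simp
      also have "\<dots> = (nrm (w k))\<^sup>2 + (nrm (\<kappa> s * (T * q)))\<^sup>2 - 2 * Re (cnj s * ip (w k) (T * q))"
        by (subst nrm_add_sq) (auto simp: nrm_uminus ip_uminus2 ip_scale2)
      also have "(nrm (\<kappa> s * (T * q)))\<^sup>2 = (norm s)\<^sup>2 * (nrm q)\<^sup>2"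
        by (simp add: nrm_scale power_mult_distrib) (simp add: nrm_def T_iso)
      finally show ?thesis .
    qed
    moreover have "(\<lambda>k. (nrm (w k))\<^sup>2 + (norm s)\<^sup>2 * (nrm q)\<^sup>2 - 2 * Re (cnj s * ip (w k) (T * q)))
       \<longlonglongrightarrow> d + (norm s)\<^sup>2 * (nrm q)\<^sup>2 - 2 * Re (cnj s * z)"
      by (intro tendsto_intros tendsto_Re wd lz)
    ultimately have "d \<le> d + (norm s)\<^sup>2 * (nrm q)\<^sup>2 - 2 * Re (cnj s * z)" by (intro LIMSEQ_le_const) auto
    moreover have "Re (cnj s * z) = (norm s)\<^sup>2 * (nrm q)\<^sup>2"
    proof -
      have "z = s * of_real ((nrm q)\<^sup>2)" using False by (simp add: s_def)
      then have "cnj s * z = of_real ((norm s)\<^sup>2) * of_real ((nrm q)\<^sup>2)"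
        unfolding complex_norm_square by (simp add: mult_ac)
      then show ?thesis by (metis Re_complex_of_real of_real_mult)
    qed
    ultimately have "(norm s)\<^sup>2 * (nrm q)\<^sup>2 \<le> 0" by linarith
    then have "s = 0" using False by (auto simp: mult_le_0_iff)
    then show ?thesis using False by (simp add: s_def z_def)
  qed
  then show ?thesis using hc by (intro bexI[of _ h]) (auto simp: w_def times_fun_def)
qed

lemma cau_X: "u \<in> cau \<Longrightarrow> (\<lambda>_. X) * u \<in> cau" by (rule cau_mult[OF _ X_bound])
lemma cau_Y: "u \<in> cau \<Longrightarrow> (\<lambda>_. Y) * u \<in> cau" by (rule cau_mult[OF _ nY])
lemma cau_T: "u \<in> cau \<Longrightarrow> (\<lambda>_. T) * u \<in> cau" by (rule cau_mult[OF _ nT])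

lemma completion_hardy:
  fixes b :: "nat \<Rightarrow> 'a"
  assumes t0: "norm t0 < 1"
    and fin: "\<And>\<phi> p. (\<And>p q. \<phi> (p + q) = \<phi> p + \<phi> q) \<Longrightarrow> (\<And>c p. \<phi> (\<kappa> c * p) = c * \<phi> p) \<Longrightarrow>
       (\<And>p. \<phi> (T * p) = t0 * \<phi> p) \<Longrightarrow> (\<And>p. nrm p = 0 \<Longrightarrow> \<phi> p = 0) \<Longrightarrow>
       (\<And>i. i < M \<Longrightarrow> \<phi> (b i) = 0) \<Longrightarrow> \<phi> p = (0::complex)"
  shows "hardy cau (\<lambda>c _. \<kappa> c) lip (range (\<lambda>p _. p)) (\<lambda>_. X) (\<lambda>_. Y) (\<lambda>_. T) \<rho> t0 M (\<lambda>i _. b i)"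
proof
  show "p \<in> cau" if "p \<in> range (\<lambda>p _. p)" for p using that cau_const by auto
  show "p + q \<in> range (\<lambda>p _. p)" if "p \<in> range (\<lambda>p _::nat. p::'a)" "q \<in> range (\<lambda>p _. p)" for p q
    using that by (auto simp: plus_fun_def)
  show "(\<lambda>_. \<kappa> c) * p \<in> range (\<lambda>p _. p)" if "p \<in> range (\<lambda>p _::nat. p)" for p c
    using that by (auto simp: times_fun_def)
  show "(\<lambda>_. X) * p \<in> range (\<lambda>p _. p)" if "p \<in> range (\<lambda>p _::nat. p)" for p
    using that by (auto simp: times_fun_def)
  show "(\<lambda>_. Y) * p \<in> range (\<lambda>p _. p)" if "p \<in> range (\<lambda>p _::nat. p)" for p
    using that by (auto simp: times_fun_def)
  show "(\<lambda>_. T) * p \<in> range (\<lambda>p _. p)" if "p \<in> range (\<lambda>p _::nat. p)" for p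
    using that by (auto simp: times_fun_def)
  show "(1::nat \<Rightarrow> 'a) \<in> range (\<lambda>p _. p)" by (auto simp: one_fun_def)
  show "lip ((\<lambda>_. T) * u) ((\<lambda>_. T) * v) = lip u v" if "u \<in> cau" "v \<in> cau" for u v
    by (rule lip_eqI) (use that cau_T lip_tendsto[OF that] T_iso in auto)
  show "lip ((\<lambda>_. X) * u) v = lip ((\<lambda>_. T) * u) ((\<lambda>_. Y) * v)" if "u \<in> cau" "v \<in> cau" for u v
    by (rule lip_eqI) (use that cau_T cau_X cau_Y lip_tendsto[OF cau_T[OF that(1)] cau_Y[OF that(2)]] X_adj in auto)
  show "lip ((\<lambda>_. Y) * u) v = lip ((\<lambda>_. T) * u) ((\<lambda>_. X) * v)" if "u \<in> cau" "v \<in> cau" for u v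
    by (rule lip_eqI) (use that cau_T cau_X cau_Y lip_tendsto[OF cau_T[OF that(1)] cau_X[OF that(2)]] Y_adj in auto)
  show "lim.nrm ((\<lambda>_. X) * u) \<le> \<rho> * lim.nrm u" if "u \<in> cau" for u
  proof (rule LIMSEQ_le)
    show "(\<lambda>k. nrm (((\<lambda>_. X) * u) k)) \<longlonglongrightarrow> lim.nrm ((\<lambda>_. X) * u)" using lnrm_tendsto cau_X that by blast
    show "(\<lambda>k. \<rho> * nrm (u k)) \<longlonglongrightarrow> \<rho> * lim.nrm u" by (intro tendsto_intros lnrm_tendsto that)
  qed (auto simp: X_bound)
  show "\<exists>p\<in>range (\<lambda>p _. p). lim.nrm (u - p) < \<epsilon>" if u: "u \<in> cau" and e: "\<epsilon> > 0" for u \<epsilon>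
  proof -
    obtain N where N: "\<And>m k. m \<ge> N \<Longrightarrow> k \<ge> N \<Longrightarrow> nrm (u m - u k) < \<epsilon> / 2"
      using cauD[OF u, of "\<epsilon> / 2"] e by auto
    have "lim.nrm (u - (\<lambda>_. u N)) \<le> \<epsilon> / 2"
      using lnrm_tendsto[OF lim.C_diff[OF u cau_const]]
    proof (rule LIMSEQ_le_const2)
      show "\<exists>K. \<forall>k\<ge>K. nrm ((u - (\<lambda>_. u N)) k) \<le> \<epsilon> / 2"
        using N[of _ N] by (intro exI[of _ N]) (auto intro: less_imp_le)
    qed
    then show ?thesis using e by (intro bexI[of _ "\<lambda>_. u N"]) auto
  qed
  show "\<exists>h\<in>cau. \<forall>q\<in>range (\<lambda>p _. p). lip (p - (\<lambda>_. T) * h) ((\<lambda>_. T) * q) = 0"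
    if "p \<in> range (\<lambda>p _. p)" for p
    using that projection by auto
  show "\<phi> p = 0" if
    1: "\<And>p q. p \<in> range (\<lambda>p _. p) \<Longrightarrow> q \<in> range (\<lambda>p _. p) \<Longrightarrow> \<phi> (p + q) = \<phi> p + \<phi> q"
   and 2: "\<And>c p. p \<in> range (\<lambda>p _. p) \<Longrightarrow> \<phi> ((\<lambda>_. \<kappa> c) * p) = c * \<phi> p"
   and 3: "\<And>p. p \<in> range (\<lambda>p _. p) \<Longrightarrow> \<phi> ((\<lambda>_. T) * p) = t0 * \<phi> p"
   and 4: "\<And>p. p \<in> range (\<lambda>p _. p) \<Longrightarrow> lim.nrm p = 0 \<Longrightarrow> \<phi> p = 0"
   and 5: "\<And>i. i < M \<Longrightarrow> \<phi> (\<lambda>_. b i) = 0" and p: "p \<in> range (\<lambda>p _. p)" for \<phi> :: "(nat \<Rightarrow> 'a) \<Rightarrow> complex" and p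
  proof -
    have "\<phi> (\<lambda>_. q) = 0" for q
    proof (rule fin[of "\<lambda>q. \<phi> (\<lambda>_. q)"])
      show "\<phi> (\<lambda>_. p + q) = \<phi> (\<lambda>_. p) + \<phi> (\<lambda>_. q)" for p q using 1[of "\<lambda>_. p" "\<lambda>_. q"] by (simp add: plus_fun_def)
      show "\<phi> (\<lambda>_. \<kappa> c * p) = c * \<phi> (\<lambda>_. p)" for c p using 2[of "\<lambda>_. p" c] by (simp add: times_fun_def)
      show "\<phi> (\<lambda>_. T * p) = t0 * \<phi> (\<lambda>_. p)" for p using 3[of "\<lambda>_. p"] by (simp add: times_fun_def)
      show "nrm p = 0 \<Longrightarrow> \<phi> (\<lambda>_. p) = 0" for p using 4[of "\<lambda>_. p"] by (simp add: lnrm_const)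
    qed (use 5 in auto)
    then show ?thesis using p by auto
  qed
qed (use t0 cau_X cau_Y cau_T in auto)

end

section \<open>The tetrablock\<close>

lemma tetrablock_iff: "x \<in> tetrablock \<longleftrightarrow>
   (\<forall>z w. norm z \<le> 1 \<longrightarrow> norm w \<le> 1 \<longrightarrow> 1 - z * x $ 1 - w * x $ 2 + z * w * x $ 3 \<noteq> 0)"
  by (simp add: tetrablock_def)

definition swap12 :: "complex ^ 3 \<Rightarrow> complex ^ 3" where
  "swap12 x = vector [x $ 2, x $ 1, x $ 3]"

lemma swap12_simps [simp]: "swap12 x $ 1 = x $ 2" "swap12 x $ 2 = x $ 1" "swap12 x $ 3 = x $ 3"
  by (simp_all add: swap12_def vector_3)

lemma vec3_eqI: "x $ 1 = y $ 1 \<Longrightarrow> x $ 2 = y $ 2 \<Longrightarrow> x $ 3 = y $ 3 \<Longrightarrow> x = (y :: 'a ^ 3)"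
  by (simp add: Finite_Cartesian_Product.vec_eq_iff forall_3)

lemma swap12_swap12 [simp]: "swap12 (swap12 x) = x"
  by (rule vec3_eqI) auto

lemma swap12_tetrablock: "x \<in> tetrablock \<Longrightarrow> swap12 x \<in> tetrablock"
  unfolding tetrablock_iff
proof (intro allI impI)
  fix z w assume *: "\<forall>z w. norm z \<le> 1 \<longrightarrow> norm w \<le> 1 \<longrightarrow> 1 - z * x $ 1 - w * x $ 2 + z * w * x $ 3 \<noteq> 0"
    and zw: "norm (z::complex) \<le> 1" "norm (w::complex) \<le> 1"
  have "1 - w * x $ 1 - z * x $ 2 + w * z * x $ 3 \<noteq> 0" using * zw by blast
  then show "1 - z * swap12 x $ 1 - w * swap12 x $ 2 + z * w * swap12 x $ 3 \<noteq> 0"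
    by (simp add: algebra_simps)
qed

lemma tetrablock_nth_less: assumes "x \<in> tetrablock" shows "norm (x $ 1) < 1" "norm (x $ 2) < 1"
proof -
  have *: "norm (x $ 1) < 1" if x: "x \<in> tetrablock" for x
  proof (rule ccontr)
    assume "\<not> norm (x $ 1) < 1"
    then have "norm (1 / x $ 1) \<le> 1" "x $ 1 \<noteq> 0" by (auto simp: norm_divide divide_le_eq_1)
    then show False using x[unfolded tetrablock_iff, rule_format, of "1 / x $ 1" 0] by simp
  qed
  show "norm (x $ 1) < 1" "norm (x $ 2) < 1" using *[of x] *[of "swap12 x"] swap12_tetrablock assms by auto
qed

text \<open>The defining expression is affine in \<open>w\<close>; if the inequality failed, its
  root \<open>w\<close> would lie in the closed disc.\<close>

lemma tetrablock_less: assumes x: "x \<in> tetrablock" and z: "norm z \<le> 1"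
  shows "norm (x $ 2 - z * x $ 3) < norm (1 - z * x $ 1)"
proof (rule ccontr)
  assume a: "\<not> ?thesis"
  have nz: "1 - z * x $ 1 \<noteq> 0" using x[unfolded tetrablock_iff, rule_format, of z 0] z by simp
  then have nz2: "x $ 2 - z * x $ 3 \<noteq> 0" using a by auto
  define w where "w = (1 - z * x $ 1) / (x $ 2 - z * x $ 3)"
  have "norm w \<le> 1" using a nz2 by (simp add: w_def norm_divide divide_le_eq_1)
  moreover have "w * (x $ 2 - z * x $ 3) = 1 - z * x $ 1" using nz2 by (simp add: w_def)
  ultimately show False using x[unfolded tetrablock_iff, rule_format, of z w] z by (simp add: algebra_simps)
qed

lemma norm_expand: "(norm (b - z * c))\<^sup>2 = (norm b)\<^sup>2 + (norm z)\<^sup>2 * (norm c)\<^sup>2 - 2 * Re (z * (cnj b * c))"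
  unfolding cmod_power2 by (simp add: power2_eq_square algebra_simps)

lemma Re_mult_unit: "\<exists>z. norm z = 1 \<and> Re (z * c) = norm (c::complex)"
proof (cases "c = 0")
  case True
  then show ?thesis by (intro exI[of _ 1]) simp
next
  case False
  have "cnj c * c = of_real (norm c * norm c)" by (metis complex_norm_square mult.commute power2_eq_square)
  then have "cnj c / of_real (norm c) * c = of_real (norm c)" using False by (simp add: divide_simps)
  then show ?thesis using False by (intro exI[of _ "cnj c / of_real (norm c)"]) (simp add: norm_divide)
qed

text \<open>Squaring and expanding leaves one term depending on \<open>z\<close>, the real part of a
  multiple of \<open>x $ 1 - cnj (x $ 2) * x $ 3\<close>; the unit \<open>z\<close> is chosen to
  turn it into the modulus.\<close>

lemma tetrablock_ineq1:
  assumes "\<And>z. norm z = 1 \<Longrightarrow> norm (x $ 2 - z * x $ 3) \<le> norm (1 - z * x $ 1)"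
  shows "2 * norm (x $ 1 - cnj (x $ 2) * x $ 3) \<le> 1 + (norm (x $ 1))\<^sup>2 - (norm (x $ 2))\<^sup>2 - (norm (x $ 3))\<^sup>2"
proof -
  obtain z where z: "norm z = 1" "Re (z * (x $ 1 - cnj (x $ 2) * x $ 3)) = norm (x $ 1 - cnj (x $ 2) * x $ 3)"
    using Re_mult_unit by blast
  have "(norm (x $ 2 - z * x $ 3))\<^sup>2 \<le> (norm (1 - z * x $ 1))\<^sup>2" using assms[OF z(1)] by simp
  then show ?thesis unfolding norm_expand z(2)[symmetric] using z(1) by (simp add: right_diff_distrib)
qed

lemma tetrablock_ineq: assumes "x \<in> tetrablock"
  shows "2 * norm (x $ 1 - cnj (x $ 2) * x $ 3) \<le> 1 + (norm (x $ 1))\<^sup>2 - (norm (x $ 2))\<^sup>2 - (norm (x $ 3))\<^sup>2"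
    and "2 * norm (x $ 2 - cnj (x $ 1) * x $ 3) \<le> 1 + (norm (x $ 2))\<^sup>2 - (norm (x $ 1))\<^sup>2 - (norm (x $ 3))\<^sup>2"
  using tetrablock_ineq1[of x] tetrablock_ineq1[of "swap12 x"] tetrablock_less[of x] tetrablock_less[of "swap12 x"]
    swap12_tetrablock[of x] assms by (simp_all add: less_imp_le)

text \<open>The strict form of one of the two quadratic inequalities and the weak form of the other
  add up to 0 < 2 - 2 |x3|^2.\<close>

lemma tetrablock_3_less: assumes x: "x \<in> tetrablock" shows "norm (x $ 3) < 1"
proof -
  obtain z where z: "norm z = 1" "Re (z * (x $ 1 - cnj (x $ 2) * x $ 3)) = norm (x $ 1 - cnj (x $ 2) * x $ 3)"
    using Re_mult_unit by blast
  have "(norm (x $ 2 - z * x $ 3))\<^sup>2 < (norm (1 - z * x $ 1))\<^sup>2"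
    using tetrablock_less[OF x, of z] z by (intro power_strict_mono) auto
  then have "2 * norm (x $ 1 - cnj (x $ 2) * x $ 3) < 1 + (norm (x $ 1))\<^sup>2 - (norm (x $ 2))\<^sup>2 - (norm (x $ 3))\<^sup>2"
    unfolding norm_expand z(2)[symmetric] using z(1) by (simp add: right_diff_distrib)
  then have "0 < 1 + (norm (x $ 1))\<^sup>2 - (norm (x $ 2))\<^sup>2 - (norm (x $ 3))\<^sup>2"
    by (rule le_less_trans[rotated]) simp
  moreover have "0 \<le> 1 + (norm (x $ 2))\<^sup>2 - (norm (x $ 1))\<^sup>2 - (norm (x $ 3))\<^sup>2"
    by (rule order_trans[OF _ tetrablock_ineq(2)[OF x]]) simp
  ultimately have "(norm (x $ 3))\<^sup>2 < 1" by linarith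
  then show ?thesis by (simp add: power_less_one_iff abs_square_less_1)
qed

lemma closure_tetrablock:
  assumes "x \<in> closure tetrablock"
  shows closure_tetrablock_ineq: "2 * norm (x $ 1 - cnj (x $ 2) * x $ 3) \<le> 1 + (norm (x $ 1))\<^sup>2 - (norm (x $ 2))\<^sup>2 - (norm (x $ 3))\<^sup>2"
      "2 * norm (x $ 2 - cnj (x $ 1) * x $ 3) \<le> 1 + (norm (x $ 2))\<^sup>2 - (norm (x $ 1))\<^sup>2 - (norm (x $ 3))\<^sup>2"
    and closure_tetrablock_nth_le: "norm (x $ 1) \<le> 1" "norm (x $ 2) \<le> 1" "norm (x $ 3) \<le> 1"
proof -
  let ?A = "{x::complex^3. 2 * norm (x $ 1 - cnj (x $ 2) * x $ 3) \<le> 1 + (norm (x $ 1))\<^sup>2 - (norm (x $ 2))\<^sup>2 - (norm (x $ 3))\<^sup>2 \<and>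
      2 * norm (x $ 2 - cnj (x $ 1) * x $ 3) \<le> 1 + (norm (x $ 2))\<^sup>2 - (norm (x $ 1))\<^sup>2 - (norm (x $ 3))\<^sup>2 \<and>
      norm (x $ 1) \<le> 1 \<and> norm (x $ 2) \<le> 1 \<and> norm (x $ 3) \<le> 1}"
  have "closed ?A"
    by (intro closed_Collect_conj closed_Collect_le continuous_intros)
  moreover have "tetrablock \<subseteq> ?A"
    using tetrablock_ineq tetrablock_nth_less tetrablock_3_less by (auto simp: less_imp_le)
  ultimately have "x \<in> ?A" using assms closure_minimal by blast
  then show "2 * norm (x $ 1 - cnj (x $ 2) * x $ 3) \<le> 1 + (norm (x $ 1))\<^sup>2 - (norm (x $ 2))\<^sup>2 - (norm (x $ 3))\<^sup>2"
      "2 * norm (x $ 2 - cnj (x $ 1) * x $ 3) \<le> 1 + (norm (x $ 2))\<^sup>2 - (norm (x $ 1))\<^sup>2 - (norm (x $ 3))\<^sup>2"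
      "norm (x $ 1) \<le> 1" "norm (x $ 2) \<le> 1" "norm (x $ 3) \<le> 1" by auto
qed

text \<open>For |x3| = 1 the right-hand sides of the two inequalities are negatives of each other,
  while both left-hand sides are nonnegative; so everything vanishes.\<close>

lemma dist_boundary_eqs: assumes "x \<in> dist_boundary"
  shows "x $ 1 = cnj (x $ 2) * x $ 3" "x $ 2 = cnj (x $ 1) * x $ 3" "norm (x $ 1) \<le> 1"
    "norm (x $ 1) = 1 \<Longrightarrow> x \<in> bD_tetrablock"
proof -
  have x: "x \<in> closure tetrablock" "norm (x $ 3) = 1" using assms by (auto simp: dist_boundary_def)
  have 1: "2 * norm (x $ 1 - cnj (x $ 2) * x $ 3) \<le> (norm (x $ 1))\<^sup>2 - (norm (x $ 2))\<^sup>2"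
    "2 * norm (x $ 2 - cnj (x $ 1) * x $ 3) \<le> (norm (x $ 2))\<^sup>2 - (norm (x $ 1))\<^sup>2"
    using closure_tetrablock_ineq[OF x(1)] x(2) by simp_all
  have n: "norm (x $ 1 - cnj (x $ 2) * x $ 3) \<ge> 0" "norm (x $ 2 - cnj (x $ 1) * x $ 3) \<ge> 0" by simp_all
  have "norm (x $ 1 - cnj (x $ 2) * x $ 3) = 0" "norm (x $ 2 - cnj (x $ 1) * x $ 3) = 0"
    using 1 n by linarith+
  then show e: "x $ 1 = cnj (x $ 2) * x $ 3" "x $ 2 = cnj (x $ 1) * x $ 3" by simp_all
  show "norm (x $ 1) \<le> 1" using closure_tetrablock_nth_le[OF x(1)] by simp
  assume 2: "norm (x $ 1) = 1"
  have "x $ 1 * x $ 2 = (x $ 1 * cnj (x $ 1)) * x $ 3" using e(2) by (metis mult.assoc)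
  also have "x $ 1 * cnj (x $ 1) = 1" using 2 by (metis complex_norm_square of_real_1 power_one)
  finally have "x $ 3 = x $ 1 * x $ 2" by simp
  moreover have "norm (x $ 2) = 1" using e(2) 2 x(2) by (metis complex_mod_cnj mult_1 norm_mult)
  ultimately show "x \<in> bD_tetrablock" using 2 by (simp add: bD_tetrablock_def)
qed

text \<open>The pairs (z, w) witnessing membership in the complement range over the compact closed
  bidisc, so a limit of points of the complement has a limit witness.\<close>

lemma open_tetrablock: "open tetrablock"
proof -
  let ?F = "\<lambda>(x :: complex^3) z w. 1 - z * x $ 1 - w * x $ 2 + z * w * x $ 3"
  have "closed (- tetrablock)"
    unfolding closed_sequential_limits
  proof (intro allI impI)
    fix x l assume x: "(\<forall>n. x n \<in> - tetrablock) \<and> x \<longlonglongrightarrow> l"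
    have "\<exists>p. p \<in> cball 0 1 \<times> cball 0 1 \<and> ?F (x n) (fst p) (snd p) = 0" for n
    proof -
      obtain z w where "norm z \<le> 1" "norm w \<le> 1" "?F (x n) z w = 0"
        using x unfolding Compl_iff tetrablock_iff by blast
      then show ?thesis by (intro exI[of _ "(z, w)"]) simp
    qed
    then obtain p where p: "\<And>n. p n \<in> cball 0 1 \<times> cball 0 1" "\<And>n. ?F (x n) (fst (p n)) (snd (p n)) = 0" by metis
    have "compact (cball 0 1 \<times> cball 0 1 :: (complex \<times> complex) set)" by (intro compact_Times) auto
    then obtain q r where q: "q \<in> cball 0 1 \<times> cball 0 1" "strict_mono r" "(p \<circ> r) \<longlonglongrightarrow> q"
      using p(1) unfolding compact_eq_seq_compact_metric seq_compact_def by blast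
    have "(x \<circ> r) \<longlonglongrightarrow> l" using x q(2) LIMSEQ_subseq_LIMSEQ by blast
    then have "(\<lambda>n. ?F ((x \<circ> r) n) (fst ((p \<circ> r) n)) (snd ((p \<circ> r) n))) \<longlonglongrightarrow> ?F l (fst q) (snd q)"
      using q(3) by (intro tendsto_intros)
    then have "(\<lambda>n. 0) \<longlonglongrightarrow> ?F l (fst q) (snd q)" using p(2) by simp
    then have "?F l (fst q) (snd q) = 0" using LIMSEQ_const_iff by metis
    then show "l \<in> - tetrablock" using q(1) unfolding Compl_iff tetrablock_iff by (auto simp: mem_Times_iff)
  qed
  then show ?thesis by (simp add: open_closed)
qed

text \<open>The parametrisation makes both sides of the quadratic inequality divisible by 1 - |x3|^2
  and reduces it to |beta2| < 1 - |beta1|. This keeps the modulus of \<open>f\<close> below 1 on the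
  circle, and the maximum principle carries the bound into the disc, where a zero (z, w) would mean
  \<open>w * f z = 1\<close>.\<close>

lemma tetrablock_paramI:
  assumes x: "x $ 1 = \<beta>1 + cnj \<beta>2 * x $ 3" "x $ 2 = \<beta>2 + cnj \<beta>1 * x $ 3"
    and b: "norm \<beta>1 + norm \<beta>2 < 1" and x3: "norm (x $ 3) < 1"
  shows "x \<in> tetrablock"
proof -
  have "norm (x $ 1) \<le> norm \<beta>1 + norm \<beta>2 * norm (x $ 3)"
    unfolding x(1) by (metis complex_mod_cnj norm_mult norm_triangle_ineq)
  also have "\<dots> \<le> norm \<beta>1 + norm \<beta>2 * 1" using x3 by (intro add_mono mult_left_mono) auto
  finally have x1: "norm (x $ 1) < 1" using b by simp
  have nz: "1 - z * x $ 1 \<noteq> 0" if "norm z \<le> 1" for z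
  proof
    assume "1 - z * x $ 1 = 0"
    then have "norm z * norm (x $ 1) = 1" by (metis eq_iff_diff_eq_0 norm_mult norm_one)
    moreover have "norm z * norm (x $ 1) \<le> 1 * norm (x $ 1)" using that by (intro mult_right_mono) auto
    ultimately show False using x1 by simp
  qed
  have gap: "x $ 1 - cnj (x $ 2) * x $ 3 = \<beta>1 * of_real (1 - (norm (x $ 3))\<^sup>2)"
    unfolding x of_real_diff complex_norm_square by (simp add: algebra_simps)
  have "(norm (x $ 1))\<^sup>2 - (norm (x $ 2))\<^sup>2 = ((norm \<beta>1)\<^sup>2 - (norm \<beta>2)\<^sup>2) * (1 - (norm (x $ 3))\<^sup>2)"
    unfolding x cmod_power2 by (simp add: power2_eq_square algebra_simps)
  then have sq: "1 + (norm (x $ 1))\<^sup>2 - (norm (x $ 2))\<^sup>2 - (norm (x $ 3))\<^sup>2 = (1 + (norm \<beta>1)\<^sup>2 - (norm \<beta>2)\<^sup>2) * (1 - (norm (x $ 3))\<^sup>2)"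
    by (simp add: algebra_simps)
  have s3: "0 < 1 - (norm (x $ 3))\<^sup>2" using x3 by (simp add: power_less_one_iff abs_square_less_1)
  have "2 * norm \<beta>1 < 1 + (norm \<beta>1)\<^sup>2 - (norm \<beta>2)\<^sup>2"
  proof -
    have "(norm \<beta>2)\<^sup>2 < (1 - norm \<beta>1)\<^sup>2" using b by (intro power_strict_mono) auto
    then show ?thesis by (simp add: power2_eq_square algebra_simps)
  qed
  then have "2 * norm \<beta>1 * (1 - (norm (x $ 3))\<^sup>2) < (1 + (norm \<beta>1)\<^sup>2 - (norm \<beta>2)\<^sup>2) * (1 - (norm (x $ 3))\<^sup>2)"
    using s3 by (rule mult_strict_right_mono)
  then have ineq: "2 * norm (x $ 1 - cnj (x $ 2) * x $ 3) < 1 + (norm (x $ 1))\<^sup>2 - (norm (x $ 2))\<^sup>2 - (norm (x $ 3))\<^sup>2"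
    unfolding sq gap norm_mult norm_of_real using s3 by (simp add: mult.assoc)
  define f where "f z = (x $ 2 - z * x $ 3) / (1 - z * x $ 1)" for z
  have bd: "norm (f z) < 1" if z: "norm z = 1" for z
  proof -
    have "Re (z * (x $ 1 - cnj (x $ 2) * x $ 3)) \<le> norm (x $ 1 - cnj (x $ 2) * x $ 3)"
      using complex_Re_le_cmod[of "z * (x $ 1 - cnj (x $ 2) * x $ 3)"] z by (simp add: norm_mult)
    then have "(norm (x $ 2 - z * x $ 3))\<^sup>2 < (norm (1 - z * x $ 1))\<^sup>2"
      unfolding norm_expand using ineq z by (simp add: right_diff_distrib)
    then have "norm (x $ 2 - z * x $ 3) < norm (1 - z * x $ 1)" by (simp add: power2_less_imp_less)
    then show ?thesis unfolding f_def using nz[of z] z by (simp add: norm_divide divide_less_eq_1)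
  qed
  have cont: "continuous_on (cball 0 1) f" unfolding f_def using nz by (intro continuous_intros) auto
  have hol: "f holomorphic_on ball 0 1" unfolding f_def using nz by (intro holomorphic_intros) auto
  obtain z0 where z0: "z0 \<in> sphere 0 1" "\<And>z. z \<in> sphere 0 1 \<Longrightarrow> norm (f z) \<le> norm (f z0)"
  proof -
    have "compact (sphere (0::complex) 1)" "sphere (0::complex) 1 \<noteq> {}" by auto
    moreover have "continuous_on (sphere 0 1) (\<lambda>z. norm (f z))"
      by (intro continuous_on_norm continuous_on_subset[OF cont]) auto
    ultimately show ?thesis using continuous_attains_sup[of "sphere 0 1" "\<lambda>z. norm (f z)"] that by blast
  qed
  have f1: "norm (f z) < 1" if z: "norm z \<le> 1" for z
  proof -
    have "norm (f z) \<le> norm (f z0)"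
      by (rule maximum_modulus_frontier[of f "cball 0 1"])
         (use hol cont z z0 in \<open>auto simp: frontier_cball interior_cball\<close>)
    also have "\<dots> < 1" using bd z0 by simp
    finally show ?thesis .
  qed
  show ?thesis
    unfolding tetrablock_iff
  proof (intro allI impI notI)
    fix z w :: complex assume z: "norm z \<le> 1" "norm w \<le> 1" and 0: "1 - z * x $ 1 - w * x $ 2 + z * w * x $ 3 = 0"
    have "1 - z * x $ 1 = w * (x $ 2 - z * x $ 3)" using 0 by (simp add: algebra_simps)
    then have "1 = w * f z" using nz[OF z(1)] by (simp add: f_def)
    then have "1 = norm w * norm (f z)" by (metis norm_mult norm_one)
    also have "\<dots> \<le> 1 * norm (f z)" using z by (intro mult_right_mono) auto
    finally show False using f1[OF z(1)] by simp
  qed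
qed

section \<open>Roots of polynomials depending on a parameter\<close>

text \<open>On a circle around \<open>b\<close> that misses the zeros of \<open>f a\<close>, the
  modulus of \<open>f a\<close> has a positive minimum \<open>\<mu>\<close>. For \<open>x\<close>
  near \<open>a\<close> the modulus of \<open>f x\<close> stays at least \<open>\<mu> / 2\<close>
  there while \<open>f x b\<close> is smaller than that, so the minimum principle yields a zero
  inside.\<close>

lemma root_continuity:
  fixes f :: "complex \<Rightarrow> complex \<Rightarrow> complex"
  assumes V: "open V" "a \<in> V" and R: "R > 0"
    and cont: "continuous_on (V \<times> ball b R) (\<lambda>(x, y). f x y)"
    and hol: "\<And>x. x \<in> V \<Longrightarrow> f x holomorphic_on ball b R"
    and zero: "f a b = 0" and fin: "finite {y \<in> ball b R. f a y = 0}" and e: "\<epsilon> > 0"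
  obtains \<delta> where "\<delta> > 0" "\<And>x. dist x a < \<delta> \<Longrightarrow> x \<in> V \<and> (\<exists>y\<in>ball b R. dist y b < \<epsilon> \<and> f x y = 0)"
proof -
  \<comment> \<open>The radius has to avoid only the finitely many distances from \<open>b\<close>
    to zeros of \<open>f a\<close>.\<close>
  have inf: "infinite ({0<..<min \<epsilon> R} - dist b ` {y \<in> ball b R. f a y = 0})"
    using fin e R by (intro Diff_infinite_finite) auto
  obtain r where "r \<in> {0<..<min \<epsilon> R} - dist b ` {y \<in> ball b R. f a y = 0}"
    using infinite_imp_nonempty[OF inf] by blast
  then have r: "0 < r" "r < \<epsilon>" "r < R" "r \<notin> dist b ` {y \<in> ball b R. f a y = 0}"
    by simp_all
  have sub: "sphere b r \<subseteq> ball b R" "cball b r \<subseteq> ball b R" using r by auto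
  have nz: "f a y \<noteq> 0" if "y \<in> sphere b r" for y using that r sub by (auto simp: image_iff)
  have "continuous_on (sphere b r) (\<lambda>y. norm (f a y))"
    using hol[OF V(2)] sub by (intro continuous_on_norm) (meson continuous_on_subset holomorphic_on_imp_continuous_on)
  moreover have "sphere b r \<noteq> {}" using r by simp
  ultimately obtain y0 where y0: "y0 \<in> sphere b r" "\<And>y. y \<in> sphere b r \<Longrightarrow> norm (f a y0) \<le> norm (f a y)"
    using continuous_attains_inf[of "sphere b r" "\<lambda>y. norm (f a y)"] by auto
  define \<mu> where "\<mu> = norm (f a y0)"
  have \<mu>: "\<mu> > 0" using nz y0 by (simp add: \<mu>_def)
  obtain s where s: "s > 0" "cball a s \<subseteq> V" using V open_contains_cball by blast
  have "uniformly_continuous_on (cball a s \<times> cball b r) (\<lambda>(x, y). f x y)"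
    using cont s sub by (intro compact_uniformly_continuous compact_Times continuous_on_subset[OF cont]) auto
  then obtain \<delta> where \<delta>: "\<delta> > 0" "\<And>p q. p \<in> cball a s \<times> cball b r \<Longrightarrow> q \<in> cball a s \<times> cball b r \<Longrightarrow>
     dist p q < \<delta> \<Longrightarrow> dist ((\<lambda>(x, y). f x y) p) ((\<lambda>(x, y). f x y) q) < \<mu> / 2"
    unfolding uniformly_continuous_on_def using \<mu> by (metis half_gt_zero)
  have main: "x \<in> V \<and> (\<exists>y\<in>ball b R. dist y b < \<epsilon> \<and> f x y = 0)" if x: "dist x a < min \<delta> s" for x
  proof -
    have xV: "x \<in> V" "x \<in> cball a s" using x s by (auto simp: dist_commute)
    have close: "dist (f x y) (f a y) < \<mu> / 2" if "y \<in> cball b r" for y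
    proof -
      have "dist ((\<lambda>(x, y). f x y) (x, y)) ((\<lambda>(x, y). f x y) (a, y)) < \<mu> / 2"
        by (rule \<delta>(2)) (use x xV that s in \<open>auto simp: dist_Pair_Pair\<close>)
      then show ?thesis by simp
    qed
    have holx: "f x holomorphic_on ball b R" using hol xV by blast
    obtain z where z: "z \<in> ball b r" "f x z = 0"
    proof (rule holomorphic_contract_to_zero[of b r "f x"])
      show "continuous_on (cball b r) (f x)"
        using holx sub by (meson continuous_on_subset holomorphic_on_imp_continuous_on)
      show "f x holomorphic_on ball b r" using holx by (rule holomorphic_on_subset) (use r in auto)
      show "0 < r" using r by simp
      show "norm (f x b) < norm (f x z)" if "norm (b - z) = r" for z
      proof -
        have z: "z \<in> sphere b r" "z \<in> cball b r" using that by (auto simp: dist_norm)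
        have "norm (f x b) < \<mu> / 2" using close[of b] zero r by simp
        moreover have "norm (f a z) \<le> norm (f x z) + dist (f x z) (f a z)"
          by (metis dist_norm norm_minus_commute norm_triangle_sub)
        ultimately show ?thesis using close[OF z(2)] y0(2)[OF z(1)] by (simp add: \<mu>_def)
      qed
    qed auto
    then show ?thesis using xV r by (intro conjI bexI[of _ z]) (auto simp: dist_commute)
  qed
  show ?thesis by (rule that[of "min \<delta> s"]) (use \<delta> s main in auto)
qed

text \<open>Fraction-free Euclidean algorithm: the leading coefficients used by pseudo-division are
  collected in \<open>c\<close>, and the identities become true gcd identities wherever
  \<open>c\<close> specialises to a nonzero value.\<close>

lemma pseudo_bezout:
  fixes p q :: "'a::idom poly"
  shows "\<exists>g r s u v c. c \<noteq> 0 \<and> Polynomial.smult c p = u * g \<and> Polynomial.smult c q = v * g \<and> Polynomial.smult c g = r * p + s * q"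
proof (induction "if q = 0 then 0 else Suc (degree q)" arbitrary: p q rule: less_induct)
  case less
  show ?case
  proof (cases "q = 0")
    case True
    then show ?thesis by (intro exI[of _ p] exI[of _ 1] exI[of _ 0]) auto
  next
    case False
    define m where "m = pseudo_mod p q"
    obtain a k where a: "a \<noteq> 0" "Polynomial.smult a p = q * k + m" using pseudo_mod(1)[OF False, of p] by (auto simp: m_def)
    have "m = 0 \<or> degree m < degree q" using pseudo_mod(2)[OF False, of p] by (simp add: m_def)
    then have "(if m = 0 then 0 else Suc (degree m)) < (if q = 0 then 0 else Suc (degree q))" using False by auto
    from less[OF this, of q] obtain g r s u v c where *: "c \<noteq> 0" "Polynomial.smult c q = u * g" "Polynomial.smult c m = v * g"
      "Polynomial.smult c g = r * q + s * m" by blast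
    have "Polynomial.smult (c * a) p = Polynomial.smult c q * k + Polynomial.smult c m" by (simp add: a(2)[symmetric] smult_add_right[symmetric] flip: smult_smult)
    also have "\<dots> = (u * k + v) * g" using * by (simp add: algebra_simps)
    finally have 1: "Polynomial.smult (c * a) p = (u * k + v) * g" .
    have 2: "Polynomial.smult (c * a) q = Polynomial.smult a u * g" using *(2) by (metis mult.commute mult_smult_left smult_smult)
    have "Polynomial.smult (c * a) g = Polynomial.smult a (Polynomial.smult c g)" by (simp add: mult.commute)
    also have "\<dots> = Polynomial.smult a r * q + s * Polynomial.smult a m" by (simp add: * smult_add_right)
    also have "Polynomial.smult a m = Polynomial.smult (a * a) p - Polynomial.smult a q * k"
    proof -
      have "m = Polynomial.smult a p - q * k" using a by simp
      then show ?thesis by (simp add: smult_diff_right)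
    qed
    also have "Polynomial.smult a r * q + s * (Polynomial.smult (a * a) p - Polynomial.smult a q * k) = Polynomial.smult (a * a) s * p + Polynomial.smult a (r - s * k) * q"
      by (simp add: algebra_simps smult_diff_right)
    finally have 3: "Polynomial.smult (c * a) g = Polynomial.smult (a * a) s * p + Polynomial.smult a (r - s * k) * q" .
    show ?thesis using 1 2 3 * a by (metis mult_eq_0_iff)
  qed
qed

section \<open>Specialisation of the parameter and holomorphic branches of roots\<close>

definition spec :: "complex \<Rightarrow> complex poly poly \<Rightarrow> complex poly" where
  "spec t p = map_poly (\<lambda>c. poly c t) p"

lemma coeff_spec: "coeff (spec t p) i = poly (coeff p i) t"
  by (simp add: spec_def coeff_map_poly)
lemma spec_pCons [simp]: "spec t (pCons a p) = pCons (poly a t) (spec t p)"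
  by (rule poly_eqI) (simp add: coeff_spec coeff_pCons split: nat.split)
lemma spec_0 [simp]: "spec t 0 = 0" by (simp add: spec_def)
lemma spec_add [simp]: "spec t (p + q) = spec t p + spec t q"
  by (rule poly_eqI) (simp add: coeff_spec)
lemma spec_smult [simp]: "spec t (Polynomial.smult c p) = Polynomial.smult (poly c t) (spec t p)"
  by (rule poly_eqI) (simp add: coeff_spec)
lemma spec_mult [simp]: "spec t (p * q) = spec t p * spec t q"
  by (rule poly_eqI) (simp add: coeff_spec coeff_mult poly_sum)
lemma spec_pderiv: "spec t (pderiv p) = pderiv (spec t p)"
  by (rule poly_eqI) (simp add: coeff_spec coeff_pderiv)
lemma degree_spec: assumes "poly (lead_coeff p) t \<noteq> 0" shows "degree (spec t p) = degree p"
proof (rule antisym)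
  show "degree (spec t p) \<le> degree p" unfolding spec_def by (rule degree_map_poly_le)
  show "degree p \<le> degree (spec t p)" by (rule le_degree) (use assms in \<open>simp add: coeff_spec\<close>)
qed

text \<open>An increment formula with continuous coefficients stands in for partial derivatives:
  near a simple root, minus the quotient of \<open>A\<close> by \<open>B\<close> is the slope of the
  root as a function of the parameter.\<close>

lemma diff_quotients:
  fixes p :: "complex poly poly"
  shows "\<exists>A B. continuous_on UNIV (\<lambda>(t', x'). A t' x') \<and> continuous_on UNIV (\<lambda>(t', x'). B t' x') \<and>
    (\<forall>t' x'. poly (spec t' p) x' = poly (spec t p) x + (t' - t) * A t' x' + (x' - x) * B t' x') \<and>
    B t x = poly (pderiv (spec t p)) x"
proof (induction p)
  case 0
  show ?case by (intro exI[of _ "\<lambda>_ _. 0"]) (simp add: case_prod_unfold)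
next
  case (pCons a p)
  then obtain A B where AB: "continuous_on UNIV (\<lambda>(t', x'). A t' x')" "continuous_on UNIV (\<lambda>(t', x'). B t' x')"
    "\<And>t' x'. poly (spec t' p) x' = poly (spec t p) x + (t' - t) * A t' x' + (x' - x) * B t' x'"
    "B t x = poly (pderiv (spec t p)) x" by blast
  define s where "s = synthetic_div a t"
  have s: "poly a t' = poly a t + (t' - t) * poly s t'" for t'
  proof -
    have "poly ([:-t, 1:] * s + [:poly a t:]) t' = poly a t'" unfolding s_def by (simp only: synthetic_div_correct')
    then show ?thesis by (simp add: algebra_simps)
  qed
  show ?case
  proof (intro exI conjI allI)
    show "continuous_on UNIV (\<lambda>(t', x'). poly s t' + x' * A t' x')"
      using AB(1) by (auto simp: case_prod_unfold intro!: continuous_intros)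
    show "continuous_on UNIV (\<lambda>(t', x'). poly (spec t p) x + x' * B t' x')"
      using AB(2) by (auto simp: case_prod_unfold intro!: continuous_intros)
    show "poly (spec t' (pCons a p)) x' = poly (spec t (pCons a p)) x + (t' - t) * (poly s t' + x' * A t' x')
      + (x' - x) * (poly (spec t p) x + x' * B t' x')" for t' x'
      by (simp add: AB(3)[of t' x'] s[of t'] algebra_simps)
    show "poly (spec t p) x + x * B t x = poly (pderiv (spec t (pCons a p))) x"
      by (simp add: AB(4) pderiv_pCons)
  qed
qed

lemma continuous_spec: "continuous_on UNIV (\<lambda>(t, x). poly (spec t p) x)"
proof -
  obtain A B where AB: "continuous_on UNIV (\<lambda>(t', x'). A t' x')" "continuous_on UNIV (\<lambda>(t', x'). B t' x')"
    "\<And>t' x'. poly (spec t' p) x' = poly (spec 0 p) 0 + (t' - 0) * A t' x' + (x' - 0) * B t' x'"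
    using diff_quotients[of p 0 0] by blast
  have e: "(\<lambda>(t, x). poly (spec t p) x) = (\<lambda>(t', x'). poly (spec 0 p) 0 + (t' - 0) * A t' x' + (x' - 0) * B t' x')"
    unfolding fun_eq_iff split_paired_All prod.case by (intro allI AB(3))
  show ?thesis
    unfolding e unfolding case_prod_unfold
    by (intro continuous_on_add continuous_on_mult continuous_on_diff continuous_on_const continuous_on_fst
        continuous_on_snd continuous_on_id AB(1,2)[unfolded case_prod_unfold])
qed

text \<open>For positive degree, \<open>h\<close> is \<open>d\<close> divided by its gcd with its
  derivative, up to the factor \<open>c\<close>. Away from the zeros of \<open>c\<close> and of the
  leading coefficients the specialised identities are a squarefree decomposition of
  \<open>spec t d\<close>, so the roots are kept, become simple, and the degree is constant.\<close>

lemma squarefree_specialisation: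
  fixes d :: "complex poly poly" assumes d0: "d \<noteq> 0"
  obtains B h where "finite B" "h \<noteq> 0" "\<And>t. t \<notin> B \<Longrightarrow> spec t h \<noteq> 0 \<and> degree (spec t h) = degree h \<and>
     rsquarefree (spec t h) \<and> {x. poly (spec t h) x = 0} = {x. poly (spec t d) x = 0}"
proof (cases "degree d = 0")
  case True
  then obtain a where a: "d = [:a:]" "a \<noteq> 0" using d0 degree_eq_zeroE by (metis pCons_0_0)
  have "finite {t. poly a t = 0}" using a poly_roots_finite by blast
  moreover have s1: "spec t 1 = 1" for t by (rule poly_eqI) (simp add: coeff_spec coeff_1)
  moreover have "rsquarefree (1 :: complex poly)" by (simp add: rsquarefree_def order_0I)
  moreover have "{x. poly (spec t 1) x = 0} = {x. poly (spec t d) x = 0}" if "t \<notin> {t. poly a t = 0}" for t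
    using that by (simp add: a s1)
  ultimately show ?thesis by (intro that[of "{t. poly a t = 0}" 1]) auto
next
  case False
  then have d': "pderiv d \<noteq> 0" by (simp add: pderiv_eq_0_iff)
  obtain g r s u v c where b: "c \<noteq> 0" "Polynomial.smult c d = u * g" "Polynomial.smult c (pderiv d) = v * g" "Polynomial.smult c g = r * d + s * pderiv d"
    using pseudo_bezout[of d "pderiv d"] by blast
  have u0: "u \<noteq> 0" using b d0 by auto
  define B where "B = {t. poly c t = 0} \<union> {t. poly (lead_coeff d) t = 0} \<union> {t. poly (lead_coeff (pderiv d)) t = 0} \<union> {t. poly (lead_coeff u) t = 0}"
  have "finite B" unfolding B_def using b d0 d' u0 by (intro finite_UnI poly_roots_finite) auto
  moreover have "spec t u \<noteq> 0 \<and> degree (spec t u) = degree u \<and>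
     rsquarefree (spec t u) \<and> {x. poly (spec t u) x = 0} = {x. poly (spec t d) x = 0}" if t: "t \<notin> B" for t
  proof -
    define ct where "ct = poly c t"
    have ct: "ct \<noteq> 0" using t by (simp add: B_def ct_def)
    have sp0: "spec t p \<noteq> 0" if "poly (lead_coeff p) t \<noteq> 0" for p
    proof
      assume "spec t p = 0"
      then have "coeff (spec t p) (degree p) = 0" by simp
      then show False using that by (simp add: coeff_spec)
    qed
    have nz: "spec t d \<noteq> 0" "pderiv (spec t d) \<noteq> 0" "spec t u \<noteq> 0"
      using t sp0[of d] sp0[of "pderiv d"] sp0[of u] unfolding B_def spec_pderiv by blast+
    have e: "Polynomial.smult ct (spec t d) = spec t u * spec t g" "Polynomial.smult ct (pderiv (spec t d)) = spec t v * spec t g"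
      "Polynomial.smult ct (spec t g) = spec t r * spec t d + spec t s * pderiv (spec t d)"
      using arg_cong[OF b(2), of "spec t"] arg_cong[OF b(3), of "spec t"] arg_cong[OF b(4), of "spec t"]
      by (simp_all add: ct_def spec_pderiv)
    have inv: "p = Polynomial.smult (1 / ct) q" if "Polynomial.smult ct p = q" for p q using that ct by auto
    have "Polynomial.order a (Polynomial.smult (1 / ct) (spec t u)) = (if Polynomial.order a (spec t d) = 0 then 0 else 1)" for a
    proof (rule poly_squarefree_decomp_order[OF nz(2)])
      show "spec t d = Polynomial.smult (1 / ct) (spec t u) * spec t g" using inv[OF e(1)] by simp
      show "pderiv (spec t d) = Polynomial.smult (1 / ct) (spec t v) * spec t g" using inv[OF e(2)] by simp
      show "spec t g = Polynomial.smult (1 / ct) (spec t r) * spec t d + Polynomial.smult (1 / ct) (spec t s) * pderiv (spec t d)"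
        using inv[OF e(3)] by (simp add: smult_add_right)
    qed
    then have o: "Polynomial.order a (spec t u) = (if Polynomial.order a (spec t d) = 0 then 0 else 1)" for a
      using ct by (simp add: order_smult)
    have "{x. poly (spec t u) x = 0} = {x. poly (spec t d) x = 0}"
      using o nz by (auto simp: order_root split: if_splits)
    moreover have "rsquarefree (spec t u)" unfolding rsquarefree_def using nz o by auto
    moreover have "degree (spec t u) = degree u" using t by (intro degree_spec) (simp add: B_def)
    ultimately show ?thesis using nz by blast
  qed
  ultimately show ?thesis using that u0 by blast
qed

lemma finite_separated:
  assumes "finite (Z :: 'a::metric_space set)"
  obtains \<epsilon> where "\<epsilon> > 0" "\<And>x y. x \<in> Z \<Longrightarrow> y \<in> Z \<Longrightarrow> x \<noteq> y \<Longrightarrow> 2 * \<epsilon> \<le> dist x y"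
proof -
  \<comment> \<open>The 1 keeps the set nonempty when \<open>Z\<close> has fewer than two
    points.\<close>
  define S where "S = insert 1 ((\<lambda>(x, y). dist x y) ` {(x, y) \<in> Z \<times> Z. x \<noteq> y})"
  have S: "finite S" unfolding S_def using assms
    by (intro finite.insertI finite_imageI) (rule finite_subset[of _ "Z \<times> Z"], auto)
  have "\<forall>s\<in>S. s > 0" by (auto simp: S_def)
  then have "Min S > 0" using S Min_in[OF S] by (auto simp: S_def)
  moreover have "Min S \<le> dist x y" if "x \<in> Z" "y \<in> Z" "x \<noteq> y" for x y
    by (rule Min_le[OF S]) (use that in \<open>auto simp: S_def\<close>)
  ultimately show ?thesis using that[of "Min S / 2"] by auto
qed

text \<open>With \<open>diff_quotients\<close> at (t, f t), both polynomial values vanish, so the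
  difference quotient of \<open>f\<close> equals \<open>- A / B\<close>, which has a limit because
  \<open>B\<close> is nonzero at a simple root.\<close>

lemma simple_root_holomorphic:
  assumes op: "open U" and cont: "continuous_on U f" and root: "\<And>t. t \<in> U \<Longrightarrow> poly (spec t h) (f t) = 0"
    and simple: "\<And>t. t \<in> U \<Longrightarrow> poly (pderiv (spec t h)) (f t) \<noteq> 0"
  shows "f holomorphic_on U"
  unfolding holomorphic_on_open[OF op]
proof (intro ballI)
  fix t assume t: "t \<in> U"
  obtain A B where AB: "continuous_on UNIV (\<lambda>(t', x'). A t' x')" "continuous_on UNIV (\<lambda>(t', x'). B t' x')"
    "\<And>t' x'. poly (spec t' h) x' = poly (spec t h) (f t) + (t' - t) * A t' x' + (x' - f t) * B t' x'"
    "B t (f t) = poly (pderiv (spec t h)) (f t)" using diff_quotients[of h t "f t"] by blast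
  have ft: "(f \<longlongrightarrow> f t) (at t)" using cont op t continuous_on_eq_continuous_at isContD by blast
  have lim: "((\<lambda>t'. G t' (f t')) \<longlongrightarrow> G t (f t)) (at t)" if "continuous_on UNIV (\<lambda>(t', x'). G t' x')" for G :: "complex \<Rightarrow> complex \<Rightarrow> complex"
  proof -
    have "isCont (\<lambda>(t', x'). G t' x') (t, f t)" using that continuous_on_eq_continuous_at open_UNIV by blast
    moreover have "((\<lambda>t'. (t', f t')) \<longlongrightarrow> (t, f t)) (at t)" by (intro tendsto_Pair tendsto_ident_at ft)
    ultimately show ?thesis using isCont_tendsto_compose[of "(t, f t)" "\<lambda>(t', x'). G t' x'"] by fastforce
  qed
  have B0: "B t (f t) \<noteq> 0" using AB(4) simple[OF t] by simp
  have evB: "\<forall>\<^sub>F t' in at t. B t' (f t') \<noteq> 0" using lim[OF AB(2)] B0 by (rule tendsto_imp_eventually_ne)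
  have evU: "\<forall>\<^sub>F t' in at t. t' \<in> U" using op t by (metis eventually_at_topological)
  have evt: "\<forall>\<^sub>F t' in at t. t' \<noteq> t" by (simp add: eventually_at_filter)
  have ev: "\<forall>\<^sub>F t' in at t. - A t' (f t') / B t' (f t') = (f t' - f t) / (t' - t)"
    using evB evU evt
  proof eventually_elim
    case (elim t')
    have "(f t' - f t) * B t' (f t') + (t' - t) * A t' (f t') = 0"
      using AB(3)[of t' "f t'"] root[OF elim(2)] root[OF t] by (simp add: add.commute)
    then have "(f t' - f t) * B t' (f t') = - ((t' - t) * A t' (f t'))" by (simp only: eq_neg_iff_add_eq_0)
    then have eq: "- A t' (f t') * (t' - t) = (f t' - f t) * B t' (f t')"
      by (simp only: mult_minus_left mult.commute[of "t' - t"])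
    have nz: "t' - t \<noteq> 0" using elim(3) by simp
    show ?case by (rule frac_eq_eq[THEN iffD2, OF elim(1) nz eq])
  qed
  have "((\<lambda>t'. - A t' (f t') / B t' (f t')) \<longlongrightarrow> - A t (f t) / B t (f t)) (at t)"
    using lim[OF AB(1)] lim[OF AB(2)] B0 by (intro tendsto_divide tendsto_minus)
  then have "((\<lambda>t'. (f t' - f t) / (t' - t)) \<longlongrightarrow> - A t (f t) / B t (f t)) (at t)"
    by (rule Lim_transform_eventually[OF _ ev])
  then show "\<exists>f'. (f has_field_derivative f') (at t)" by (auto simp: has_field_derivative_iff)
qed

lemma rsquarefree_pderiv_nz: assumes "rsquarefree (p::complex poly)" "poly p x = 0" shows "poly (pderiv p) x \<noteq> 0"
  using assms rsquarefree_roots by blast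

text \<open>The number of roots is constant off \<open>B\<close>. Roots at \<open>t0\<close> are at
  least 2 \<epsilon> apart and each has a root within \<epsilon> at nearby \<open>t\<close>, so
  counting makes this correspondence a bijection; uniqueness within distance \<epsilon> then gives
  continuity of each branch.\<close>

lemma root_branches:
  fixes d :: "complex poly poly" assumes d0: "d \<noteq> 0"
  obtains B where "finite B" "\<And>t0. t0 \<notin> B \<Longrightarrow> \<exists>\<delta>>0. \<exists>F. finite F \<and> (\<forall>f\<in>F. f holomorphic_on ball t0 \<delta>) \<and>
     (\<forall>t\<in>ball t0 \<delta>. {x. poly (spec t d) x = 0} = (\<lambda>f. f t) ` F \<and> inj_on (\<lambda>f. f t) F)"
proof -
  obtain B h where B: "finite B" "h \<noteq> 0" and h: "\<And>t. t \<notin> B \<Longrightarrow> spec t h \<noteq> 0 \<and> degree (spec t h) = degree h \<and>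
     rsquarefree (spec t h) \<and> {x. poly (spec t h) x = 0} = {x. poly (spec t d) x = 0}"
    using squarefree_specialisation[OF d0] by metis
  define Z where "Z t = {x. poly (spec t h) x = 0}" for t
  have finZ: "finite (Z t)" if "t \<notin> B" for t unfolding Z_def using h[OF that] by (intro poly_roots_finite) auto
  have cardZ: "card (Z t) = degree h" if "t \<notin> B" for t
    using h[OF that] rsquarefree_card_degree[of "spec t h"] by (simp add: Z_def)
  have "\<exists>\<delta>>0. \<exists>F. finite F \<and> (\<forall>f\<in>F. f holomorphic_on ball t0 \<delta>) \<and>
     (\<forall>t\<in>ball t0 \<delta>. {x. poly (spec t d) x = 0} = (\<lambda>f. f t) ` F \<and> inj_on (\<lambda>f. f t) F)" if t0: "t0 \<notin> B" for t0
  proof -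
    have "open (- B)" using B by (simp add: finite_imp_closed open_Compl)
    then obtain R where R: "R > 0" "ball t0 R \<subseteq> - B" using t0 open_contains_ball by blast
    obtain \<epsilon> where e: "\<epsilon> > 0" "\<And>x y. x \<in> Z t0 \<Longrightarrow> y \<in> Z t0 \<Longrightarrow> x \<noteq> y \<Longrightarrow> 2 * \<epsilon> \<le> dist x y"
      using finite_separated[OF finZ[OF t0]] by blast
    have rc: "\<exists>\<delta>>0. \<forall>t'. dist t' t < \<delta> \<longrightarrow> t' \<in> ball t0 R \<and> (\<exists>y. dist y b < \<eta> \<and> y \<in> Z t')"
      if t: "t \<in> ball t0 R" and b: "b \<in> Z t" and eta: "\<eta> > 0" for t b \<eta>
    proof (rule root_continuity[of "ball t0 R" t 1 b "\<lambda>t x. poly (spec t h) x" \<eta>])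
      show "continuous_on (ball t0 R \<times> ball b 1) (\<lambda>(t, x). poly (spec t h) x)"
        using continuous_spec continuous_on_subset by blast
      show "finite {y \<in> ball b 1. poly (spec t h) y = 0}"
        using finZ[of t] t R by (intro finite_subset[OF _ finZ[of t]]) (auto simp: Z_def)
      show "\<exists>\<delta>>0. \<forall>t'. dist t' t < \<delta> \<longrightarrow> t' \<in> ball t0 R \<and> (\<exists>y. dist y b < \<eta> \<and> y \<in> Z t')"
        if "\<delta> > 0" "\<And>x. dist x t < \<delta> \<Longrightarrow> x \<in> ball t0 R \<and> (\<exists>y\<in>ball b 1. dist y b < \<eta> \<and> poly (spec x h) y = 0)" for \<delta>
        using that unfolding Z_def by blast
    qed (use t b eta in \<open>auto simp: Z_def intro!: holomorphic_intros\<close>)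
    have "\<forall>b\<in>Z t0. \<exists>\<delta>>0. \<forall>t'. dist t' t0 < \<delta> \<longrightarrow> t' \<in> ball t0 R \<and> (\<exists>y. dist y b < \<epsilon> \<and> y \<in> Z t')"
      using rc[of t0] R e by auto
    then obtain \<Delta> where \<Delta>: "\<And>b. b \<in> Z t0 \<Longrightarrow> \<Delta> b > 0 \<and> (\<forall>t'. dist t' t0 < \<Delta> b \<longrightarrow> t' \<in> ball t0 R \<and> (\<exists>y. dist y b < \<epsilon> \<and> y \<in> Z t'))"
      by metis
    define \<delta> where "\<delta> = Min (insert R (\<Delta> ` Z t0))"
    have fS: "finite (insert R (\<Delta> ` Z t0))" using finZ[OF t0] by simp
    have \<delta>0: "\<delta> > 0" unfolding \<delta>_def using fS R \<Delta> by (subst Min_gr_iff) auto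
    have \<delta>R: "\<delta> \<le> R" unfolding \<delta>_def using fS by (intro Min_le) auto
    have \<delta>b: "\<delta> \<le> \<Delta> b" if "b \<in> Z t0" for b unfolding \<delta>_def using fS that by (intro Min_le) auto
    have ex: "\<exists>y. dist y b < \<epsilon> \<and> y \<in> Z t" if "t \<in> ball t0 \<delta>" "b \<in> Z t0" for t b
      using \<Delta>[OF that(2)] \<delta>b[OF that(2)] that(1) by (auto simp: dist_commute)
    have tB: "t \<notin> B" "t \<in> ball t0 R" if "t \<in> ball t0 \<delta>" for t
    proof -
      show "t \<in> ball t0 R" using that \<delta>R by simp
      then show "t \<notin> B" using R(2) by blast
    qed
    define f where "f b t = (SOME y. dist y b < \<epsilon> \<and> y \<in> Z t)" for b t
    have f: "dist (f b t) b < \<epsilon>" "f b t \<in> Z t" if "t \<in> ball t0 \<delta>" "b \<in> Z t0" for t b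
      using someI_ex[OF ex[OF that]] by (auto simp: f_def)
    have inj: "inj_on (\<lambda>b. f b t) (Z t0)" if t: "t \<in> ball t0 \<delta>" for t
    proof (rule inj_onI, rule ccontr)
      fix b c assume bc: "b \<in> Z t0" "c \<in> Z t0" "f b t = f c t" "b \<noteq> c"
      then have "dist b c < 2 * \<epsilon>" using f(1)[OF t bc(1)] f(1)[OF t bc(2)] dist_triangle2[of b c "f b t"]
        by (simp add: dist_commute)
      then show False using e(2)[OF bc(1,2,4)] by simp
    qed
    have img: "(\<lambda>b. f b t) ` Z t0 = Z t" if t: "t \<in> ball t0 \<delta>" for t
      by (rule card_subset_eq) (use f[OF t] finZ cardZ tB[OF t] t0 card_image[OF inj[OF t]] in auto)
    have uniq: "y = f b t" if t: "t \<in> ball t0 \<delta>" and b: "b \<in> Z t0" and y: "y \<in> Z t" "dist y b < \<epsilon>" for y b t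
    proof -
      obtain c where c: "c \<in> Z t0" "y = f c t" using img[OF t] y by auto
      have "dist b c < 2 * \<epsilon>" using y(2) f(1)[OF t c(1)] c dist_triangle2[of b c y] by (simp add: dist_commute)
      then show ?thesis using e(2)[OF b c(1)] c by fastforce
    qed
    have cont: "continuous_on (ball t0 \<delta>) (f b)" if b: "b \<in> Z t0" for b
      unfolding continuous_on_iff
    proof (intro ballI allI impI)
      fix t \<eta> :: "_" assume t: "t \<in> ball t0 \<delta>" and eta: "(0::real) < \<eta>"
      \<comment> \<open>The second bound keeps the root found at \<open>t'\<close> within \<epsilon>
        of \<open>b\<close>, where \<open>uniq\<close> identifies it with
        \<open>f b t'\<close>.\<close>
      define \<eta>' where "\<eta>' = min \<eta> (\<epsilon> - dist (f b t) b)"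
      have "\<eta>' > 0" using eta f[OF t b] by (simp add: \<eta>'_def)
      then obtain \<delta>' where d': "\<delta>' > 0" "\<And>t'. dist t' t < \<delta>' \<Longrightarrow> \<exists>y. dist y (f b t) < \<eta>' \<and> y \<in> Z t'"
        using rc[OF tB(2)[OF t] f(2)[OF t b]] by blast
      have "dist (f b t') (f b t) < \<eta>" if t': "t' \<in> ball t0 \<delta>" "dist t' t < \<delta>'" for t'
      proof -
        obtain y where y: "dist y (f b t) < \<eta>'" "y \<in> Z t'" using d'(2)[OF t'(2)] by blast
        have "dist y b < \<epsilon>" using y(1) dist_triangle[of y b "f b t"] by (simp add: \<eta>'_def)
        then have "y = f b t'" using uniq[OF t'(1) b y(2)] by blast
        then show ?thesis using y by (simp add: \<eta>'_def)
      qed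
      then show "\<exists>d>0. \<forall>x'\<in>ball t0 \<delta>. dist x' t < d \<longrightarrow> dist (f b x') (f b t) < \<eta>" using d' by blast
    qed
    have hol: "f b holomorphic_on ball t0 \<delta>" if b: "b \<in> Z t0" for b
    proof (rule simple_root_holomorphic[OF open_ball cont[OF b]])
      fix t assume t: "t \<in> ball t0 \<delta>"
      show r: "poly (spec t h) (f b t) = 0" using f(2)[OF t b] by (simp add: Z_def)
      show "poly (pderiv (spec t h)) (f b t) \<noteq> 0" using rsquarefree_pderiv_nz[OF _ r] h[OF tB(1)[OF t]] by blast
    qed
    show ?thesis
    proof (intro exI[of _ \<delta>] conjI exI[of _ "f ` Z t0"] ballI \<delta>0)
      show "finite (f ` Z t0)" using finZ t0 by blast
      show "g holomorphic_on ball t0 \<delta>" if "g \<in> f ` Z t0" for g using that hol by auto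
      show "{x. poly (spec t d) x = 0} = (\<lambda>f. f t) ` f ` Z t0" if t: "t \<in> ball t0 \<delta>" for t
        using img[OF t] h[OF tB(1)[OF t]] by (simp add: Z_def image_image)
      show "inj_on (\<lambda>f. f t) (f ` Z t0)" if t: "t \<in> ball t0 \<delta>" for t
        using inj[OF t] by (auto simp: inj_on_def)
    qed
  qed
  then show ?thesis using that B by blast
qed

definition vec3 :: "'a \<Rightarrow> 'a \<Rightarrow> 'a \<Rightarrow> 'a ^ 3" where
  "vec3 a b c = (\<chi> i. if i = 1 then a else if i = 2 then b else c)"

lemma vec3_nth [simp]: "vec3 a b c $ 1 = a" "vec3 a b c $ 2 = b" "vec3 a b c $ 3 = c"
  by (simp_all add: vec3_def)

lemma vec3_eta: "vec3 (x $ 1) (x $ 2) (x $ 3) = x" by (rule vec3_eqI) auto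

lemma vec3_inject [simp]: "vec3 a b c = vec3 a' b' c' \<longleftrightarrow> a = a' \<and> b = b' \<and> c = c'"
  by (metis vec3_nth)

lemma continuous_on_vec3 [continuous_intros]:
  fixes f g h :: "'a::topological_space \<Rightarrow> 'b::real_normed_vector"
  assumes "continuous_on U f" "continuous_on U g" "continuous_on U h"
  shows "continuous_on U (\<lambda>x. vec3 (f x) (g x) (h x))"
  unfolding vec3_def
proof (rule continuous_on_vec_lambda)
  show "continuous_on U (\<lambda>x. if i = 1 then f x else if i = 2 then g x else h x)" for i :: 3
    by (cases "i = 1"; cases "i = 2") (use assms in simp_all)
qed

lemma poly3_0 [simp]: "poly3 0 x = 0" by (simp add: poly3_def)
lemma poly3_pCons: "poly3 (pCons a p) x = poly (poly a [:x $ 2:]) (x $ 1) + x $ 3 * poly3 p x"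
  by (simp add: poly3_def)
lemma poly2_pCons: "poly (poly (pCons b a) [:y:]) x = poly b x + y * poly (poly a [:y:]) x"
  by simp

lemma continuous_on_poly3 [continuous_intros]:
  assumes "continuous_on U \<phi>" shows "continuous_on U (\<lambda>x. poly3 p (\<phi> x))"
proof (induction p)
  case (pCons a p)
  have "continuous_on U (\<lambda>x. poly (poly a [:\<phi> x $ 2:]) (\<phi> x $ 1))"
    by (induction a) (auto simp only: poly2_pCons poly_0 intro!: continuous_intros assms)
  then show ?case unfolding poly3_pCons using pCons by (intro continuous_intros assms)
qed simp

lemma holomorphic_poly3:
  assumes "f holomorphic_on U" "g holomorphic_on U" "h holomorphic_on U"
  shows "(\<lambda>t. poly3 p (vec3 (f t) (g t) (h t))) holomorphic_on U"
proof (induction p)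
  case (pCons a p)
  have "(\<lambda>t. poly (poly a [:g t:]) (f t)) holomorphic_on U"
    by (induction a) (auto simp only: poly2_pCons poly_0 intro!: holomorphic_intros assms)
  then show ?case unfolding poly3_pCons vec3_nth using pCons by (intro holomorphic_intros assms)
qed simp

lemma dist_nth3: "dist ((x::complex^3) $ i) (y $ i) \<le> dist x y"
  by (rule dist_vec_nth_le)

text \<open>Ensures that near a point of one branch no other branch of the finite family
  interferes.\<close>

lemma branch_isolated:
  fixes \<phi> :: "'k \<Rightarrow> complex \<Rightarrow> complex ^ 3"
  assumes fin: "finite K" and op: "open W" "t \<in> W"
    and cont: "\<And>k. k \<in> K \<Longrightarrow> continuous_on W (\<phi> k)" and ne: "\<And>k. k \<in> K \<Longrightarrow> \<phi> k t \<noteq> x"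
  shows "\<exists>e>0. \<forall>k\<in>K. \<forall>s\<in>W. dist s t < e \<longrightarrow> e \<le> dist (\<phi> k s) x"
  using fin cont ne
proof (induction K rule: finite_induct)
  case empty then show ?case by (intro exI[of _ 1]) auto
next
  case (insert k K)
  then obtain e1 where e1: "e1 > 0" "\<And>k s. k \<in> K \<Longrightarrow> s \<in> W \<Longrightarrow> dist s t < e1 \<Longrightarrow> e1 \<le> dist (\<phi> k s) x" by auto
  define c where "c = dist (\<phi> k t) x"
  have c: "c > 0" using insert.prems(2)[of k] by (simp add: c_def)
  have "continuous_on W (\<phi> k)" using insert.prems by blast
  then obtain d where d: "d > 0" "\<And>s. s \<in> W \<Longrightarrow> dist s t < d \<Longrightarrow> dist (\<phi> k s) (\<phi> k t) < c / 2"
    unfolding continuous_on_iff using op(2) c by (metis half_gt_zero)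
  have k: "c / 2 \<le> dist (\<phi> k s) x" if "s \<in> W" "dist s t < d" for s
    using d(2)[OF that] dist_triangle[of "\<phi> k t" x "\<phi> k s"] by (simp add: c_def dist_commute)
  show ?case
  proof (intro exI[of _ "min e1 (min d (c / 2))"] conjI ballI impI)
    fix k' s assume s: "k' \<in> insert k K" "s \<in> W" "dist s t < min e1 (min d (c / 2))"
    show "min e1 (min d (c / 2)) \<le> dist (\<phi> k' s) x"
    proof (cases "k' = k")
      case True then show ?thesis using k[of s] s by simp
    next
      case False then show ?thesis using e1(2)[of k' s] s by simp
    qed
  qed (use e1 d c in auto)
qed

text \<open>The candidates are pairs of a branch of \<open>d1\<close> for \<open>x $ 1\<close> and a
  branch of \<open>d2\<close> for \<open>x $ 2\<close>. Over the connected set \<open>W\<close> such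
  a pair lies in \<open>\<Omega>\<close> everywhere or nowhere, by the clopen argument in
  \<open>dich\<close>. The base point \<open>t0\<close> may lie on the unit circle, and then the
  branches continue holomorphically across it.\<close>

lemma local_branches:
  fixes \<Omega> :: "(complex ^ 3) set" and d1 d2 :: "complex poly poly"
  assumes var: "\<Omega> = zero_locus S \<inter> tetrablock"
    and iso: "\<And>x. x \<in> \<Omega> \<Longrightarrow> x islimpt \<Omega>"
    and cl: "\<And>x. x \<in> closure \<Omega> \<Longrightarrow> norm (x $ 3) < 1 \<Longrightarrow> x \<in> \<Omega>"
    and d0: "d1 \<noteq> 0" "d2 \<noteq> 0"
    and dZ: "\<And>x. x \<in> \<Omega> \<Longrightarrow> poly (spec (x $ 3) d1) (x $ 1) = 0" "\<And>x. x \<in> \<Omega> \<Longrightarrow> poly (spec (x $ 3) d2) (x $ 2) = 0"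
  obtains B where "finite B"
    "\<And>t0. t0 \<notin> B \<Longrightarrow> \<exists>\<delta>>0. \<exists>P. finite P \<and>
      (\<forall>(f, g)\<in>P. f holomorphic_on ball t0 \<delta> \<and> g holomorphic_on ball t0 \<delta>) \<and>
      (\<forall>t\<in>ball t0 \<delta>. inj_on (\<lambda>(f, g). vec3 (f t) (g t) t) P \<and>
         (norm t < 1 \<longrightarrow> {x\<in>\<Omega>. x $ 3 = t} = (\<lambda>(f, g). vec3 (f t) (g t) t) ` P))"
proof -
  obtain B1 where B1: "finite B1" "\<And>t0. t0 \<notin> B1 \<Longrightarrow> \<exists>\<delta>>0. \<exists>F. finite F \<and> (\<forall>f\<in>F. f holomorphic_on ball t0 \<delta>) \<and>
     (\<forall>t\<in>ball t0 \<delta>. {x. poly (spec t d1) x = 0} = (\<lambda>f. f t) ` F \<and> inj_on (\<lambda>f. f t) F)"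
    using root_branches[OF d0(1)] by metis
  obtain B2 where B2: "finite B2" "\<And>t0. t0 \<notin> B2 \<Longrightarrow> \<exists>\<delta>>0. \<exists>F. finite F \<and> (\<forall>f\<in>F. f holomorphic_on ball t0 \<delta>) \<and>
     (\<forall>t\<in>ball t0 \<delta>. {x. poly (spec t d2) x = 0} = (\<lambda>f. f t) ` F \<and> inj_on (\<lambda>f. f t) F)"
    using root_branches[OF d0(2)] by metis
  have "\<exists>\<delta>>0. \<exists>P. finite P \<and>
      (\<forall>(f, g)\<in>P. f holomorphic_on ball t0 \<delta> \<and> g holomorphic_on ball t0 \<delta>) \<and>
      (\<forall>t\<in>ball t0 \<delta>. inj_on (\<lambda>(f, g). vec3 (f t) (g t) t) P \<and>
         (norm t < 1 \<longrightarrow> {x\<in>\<Omega>. x $ 3 = t} = (\<lambda>(f, g). vec3 (f t) (g t) t) ` P))" if t0: "t0 \<notin> B1 \<union> B2" for t0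
  proof -
    obtain \<delta>1 F where F: "\<delta>1 > 0" "finite F" "\<And>f. f \<in> F \<Longrightarrow> f holomorphic_on ball t0 \<delta>1"
      "\<And>t. t \<in> ball t0 \<delta>1 \<Longrightarrow> {x. poly (spec t d1) x = 0} = (\<lambda>f. f t) ` F"
      "\<And>t. t \<in> ball t0 \<delta>1 \<Longrightarrow> inj_on (\<lambda>f. f t) F" using B1(2)[of t0] t0 by auto
    obtain \<delta>2 G where G: "\<delta>2 > 0" "finite G" "\<And>f. f \<in> G \<Longrightarrow> f holomorphic_on ball t0 \<delta>2"
      "\<And>t. t \<in> ball t0 \<delta>2 \<Longrightarrow> {x. poly (spec t d2) x = 0} = (\<lambda>f. f t) ` G"
      "\<And>t. t \<in> ball t0 \<delta>2 \<Longrightarrow> inj_on (\<lambda>f. f t) G" using B2(2)[of t0] t0 by auto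
    define \<delta> where "\<delta> = min \<delta>1 \<delta>2"
    have \<delta>0: "\<delta> > 0" using F G by (simp add: \<delta>_def)
    have sub: "ball t0 \<delta> \<subseteq> ball t0 \<delta>1" "ball t0 \<delta> \<subseteq> ball t0 \<delta>2" by (auto simp: \<delta>_def)
    define W where "W = ball t0 \<delta> \<inter> ball 0 1"
    have W: "open W" "connected W" by (auto simp: W_def intro: convex_connected convex_Int)
    define \<phi> :: "(complex \<Rightarrow> complex) \<times> (complex \<Rightarrow> complex) \<Rightarrow> complex \<Rightarrow> complex ^ 3"
      where "\<phi> k t = vec3 (fst k t) (snd k t) t" for k t
    have \<phi>_nth: "\<phi> k t $ 3 = t" for k t by (simp add: \<phi>_def)
    have hol: "fst k holomorphic_on ball t0 \<delta>" "snd k holomorphic_on ball t0 \<delta>" if "k \<in> F \<times> G" for k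
    proof -
      have "fst k \<in> F" "snd k \<in> G" using that by (auto simp: mem_Times_iff)
      then show "fst k holomorphic_on ball t0 \<delta>" "snd k holomorphic_on ball t0 \<delta>"
        using holomorphic_on_subset[OF F(3) sub(1)] holomorphic_on_subset[OF G(3) sub(2)] by blast+
    qed
    have contb: "continuous_on (ball t0 \<delta>) (\<phi> k)" if "k \<in> F \<times> G" for k
      unfolding \<phi>_def using hol[OF that] by (intro continuous_intros holomorphic_on_imp_continuous_on)
    have cont: "continuous_on W (\<phi> k)" if "k \<in> F \<times> G" for k
      using contb[OF that] by (rule continuous_on_subset) (auto simp: W_def)
    have inj: "k = k'" if "k \<in> F \<times> G" "k' \<in> F \<times> G" "t \<in> ball t0 \<delta>" "\<phi> k t = \<phi> k' t" for k k' t
    proof -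
      have "fst k t = fst k' t" "snd k t = snd k' t" using that(4) by (auto simp: \<phi>_def)
      moreover have "t \<in> ball t0 \<delta>1" "t \<in> ball t0 \<delta>2" using that(3) sub by blast+
      moreover have "fst k \<in> F" "snd k \<in> G" "fst k' \<in> F" "snd k' \<in> G" using that by (auto simp: mem_Times_iff)
      ultimately have "fst k = fst k'" "snd k = snd k'"
        using inj_onD[OF F(5)[of t], of "fst k" "fst k'"] inj_onD[OF G(5)[of t], of "snd k" "snd k'"] by simp_all
      then show ?thesis by (rule prod_eqI)
    qed
    have onbranch: "\<exists>k\<in>F \<times> G. x = \<phi> k (x $ 3)" if x: "x \<in> \<Omega>" "x $ 3 \<in> ball t0 \<delta>" for x
    proof -
      have "x $ 1 \<in> (\<lambda>f. f (x $ 3)) ` F" using F(4)[of "x $ 3"] dZ(1)[OF x(1)] x sub by blast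
      moreover have "x $ 2 \<in> (\<lambda>f. f (x $ 3)) ` G" using G(4)[of "x $ 3"] dZ(2)[OF x(1)] x sub by blast
      ultimately obtain f g where "f \<in> F" "g \<in> G" "x $ 1 = f (x $ 3)" "x $ 2 = g (x $ 3)" by blast
      then show ?thesis by (intro bexI[of _ "(f, g)"] vec3_eqI) (auto simp: \<phi>_def)
    qed
    have dich: "{t \<in> W. \<phi> k t \<in> \<Omega>} = {} \<or> {t \<in> W. \<phi> k t \<in> \<Omega>} = W" if k: "k \<in> F \<times> G" for k
    proof -
      let ?Z = "{t \<in> W. \<phi> k t \<in> \<Omega>}"
      have "?Z = W \<inter> \<phi> k -` closure \<Omega>"
        using cl closure_subset by (fastforce simp: W_def \<phi>_nth)
      then have 1: "closedin (top_of_set W) ?Z"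
        using continuous_closedin_preimage[OF cont[OF k] closed_closure] by simp
      have "open ?Z"
        unfolding open_contains_ball
      proof (intro ballI)
        fix t assume t: "t \<in> ?Z"
        define x where "x = \<phi> k t"
        have x: "x \<in> \<Omega>" "t \<in> W" "t \<in> ball t0 \<delta>" using t by (auto simp: x_def W_def)
        have ne: "\<phi> k' t \<noteq> x" if "k' \<in> F \<times> G - {k}" for k'
          using inj[of k' k t] that k x by (auto simp: x_def)
        obtain e where e: "e > 0" "\<And>k' s. k' \<in> F \<times> G - {k} \<Longrightarrow> s \<in> W \<Longrightarrow> dist s t < e \<Longrightarrow> e \<le> dist (\<phi> k' s) x"
          using branch_isolated[of "F \<times> G - {k}" W t \<phi> x] F G W x cont ne by auto
        have "open (W \<inter> \<phi> k -` tetrablock)" using continuous_open_preimage[OF cont[OF k] W(1) open_tetrablock] .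
        moreover have "t \<in> W \<inter> \<phi> k -` tetrablock" using x var by (auto simp: x_def)
        ultimately obtain \<rho> where \<rho>: "\<rho> > 0" "ball t \<rho> \<subseteq> W \<inter> \<phi> k -` tetrablock" using open_contains_ball by blast
        \<comment> \<open>Points of \<open>\<Omega>\<close> accumulate at \<open>x\<close>, and
          close to \<open>x\<close> only the branch \<open>k\<close> is present, so they lie on it;
          the identity theorem then makes the equations vanish along a whole disc.\<close>
        have lim: "t islimpt {s \<in> ball t \<rho>. \<phi> k s \<in> \<Omega>}"
          unfolding islimpt_approachable
        proof (intro allI impI)
          fix \<eta> :: real assume eta: "\<eta> > 0"
          obtain y where y: "y \<in> \<Omega>" "y \<noteq> x" "dist y x < min \<eta> (min e \<rho>)"
            using iso[OF x(1)] unfolding islimpt_approachable using eta e \<rho> by (metis min_less_iff_conj)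
          have s: "dist (y $ 3) t < min \<eta> (min e \<rho>)"
            using dist_nth3[of y 3 x] y(3) by (simp add: x_def \<phi>_nth)
          then have sW: "y $ 3 \<in> ball t \<rho>" "y $ 3 \<in> W" using \<rho> by (auto simp: dist_commute)
          obtain k' where k': "k' \<in> F \<times> G" "y = \<phi> k' (y $ 3)" using onbranch[OF y(1)] sW by (auto simp: W_def)
          have "k' = k"
          proof (rule ccontr)
            assume "k' \<noteq> k"
            then have "e \<le> dist y x" using e(2)[of k' "y $ 3"] k' sW s by simp
            then show False using y(3) by simp
          qed
          then have yk: "y = \<phi> k (y $ 3)" using k' by simp
          then have "y $ 3 \<noteq> t" using y(2) by (auto simp: x_def)
          moreover have "\<phi> k (y $ 3) \<in> \<Omega>" using yk y(1) by simp
          ultimately show "\<exists>x'\<in>{s \<in> ball t \<rho>. \<phi> k s \<in> \<Omega>}. x' \<noteq> t \<and> dist x' t < \<eta>"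
            using s sW by (intro bexI[of _ "y $ 3"]) auto
        qed
        have "ball t \<rho> \<subseteq> ?Z"
        proof
          fix s assume s: "s \<in> ball t \<rho>"
          have "poly3 p (\<phi> k s) = 0" if p: "p \<in> S" for p
          proof (rule analytic_continuation[of "\<lambda>s. poly3 p (\<phi> k s)" "ball t \<rho>" "{s \<in> ball t \<rho>. \<phi> k s \<in> \<Omega>}" t])
            have "ball t \<rho> \<subseteq> ball t0 \<delta>" using \<rho> by (auto simp: W_def)
            then show "(\<lambda>s. poly3 p (\<phi> k s)) holomorphic_on ball t \<rho>"
              unfolding \<phi>_def using hol[OF k] by (intro holomorphic_poly3 holomorphic_intros) (auto intro: holomorphic_on_subset)
            show "poly3 p (\<phi> k z) = 0" if "z \<in> {s \<in> ball t \<rho>. \<phi> k s \<in> \<Omega>}" for z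
              using that p by (auto simp: var zero_locus_def)
          qed (use \<rho> s lim in auto)
          then show "s \<in> ?Z" using s \<rho> by (auto simp: var zero_locus_def)
        qed
        then show "\<exists>e>0. ball t e \<subseteq> ?Z" using \<rho> by blast
      qed
      then have 2: "openin (top_of_set W) ?Z" by (intro open_subset) auto
      have "?Z = {} \<or> ?Z = W" by (rule W(2)[unfolded connected_clopen, rule_format]) (use 1 2 in simp)
      then show ?thesis .
    qed
    \<comment> \<open>The pairs that meet \<open>\<Omega>\<close> somewhere over \<open>W\<close>,
      and hence by \<open>dich\<close> stay in it over all of \<open>W\<close>.\<close>
    define P where "P = {k \<in> F \<times> G. \<exists>t\<in>W. \<phi> k t \<in> \<Omega>}"
    have PFG: "P \<subseteq> F \<times> G" by (auto simp: P_def)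
    show ?thesis
    proof (intro exI[of _ \<delta>] conjI exI[of _ P] ballI \<delta>0 impI)
      show "finite P" by (rule finite_subset[OF PFG]) (use F(2) G(2) in simp)
      show "case k of (f, g) \<Rightarrow> f holomorphic_on ball t0 \<delta> \<and> g holomorphic_on ball t0 \<delta>" if "k \<in> P" for k
        using hol[of k] that PFG by (auto simp: case_prod_unfold)
      fix t assume t: "t \<in> ball t0 \<delta>"
      have eq: "(\<lambda>(f, g). vec3 (f t) (g t) t) = (\<lambda>k. \<phi> k t)" by (auto simp: \<phi>_def fun_eq_iff)
      show "inj_on (\<lambda>(f, g). vec3 (f t) (g t) t) P"
        unfolding eq using inj t PFG by (intro inj_onI) blast
      assume "norm t < 1"
      then have tW: "t \<in> W" using t by (simp add: W_def)
      show "{x \<in> \<Omega>. x $ 3 = t} = (\<lambda>(f, g). vec3 (f t) (g t) t) ` P"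
        unfolding eq
      proof (intro equalityI subsetI)
        fix x assume "x \<in> {x \<in> \<Omega>. x $ 3 = t}"
        then have x: "x \<in> \<Omega>" "x $ 3 = t" by auto
        obtain k where k: "k \<in> F \<times> G" "x = \<phi> k t" using onbranch[OF x(1)] t unfolding x(2) by blast
        then have "k \<in> P" using x tW by (auto simp: P_def)
        then show "x \<in> (\<lambda>k. \<phi> k t) ` P" using k by blast
      next
        fix x assume "x \<in> (\<lambda>k. \<phi> k t) ` P"
        then obtain k where k: "k \<in> P" "x = \<phi> k t" by blast
        then have "{t \<in> W. \<phi> k t \<in> \<Omega>} = W" using dich[of k] by (auto simp: P_def)
        then show "x \<in> {x \<in> \<Omega>. x $ 3 = t}" using tW k by (auto simp: \<phi>_nth)
      qed
    qed
  qed
  then show ?thesis using that[of "B1 \<union> B2"] B1(1) B2(1) by blast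
qed

section \<open>Elimination\<close>

lemma finite_complement_connected: "finite (S :: complex set) \<Longrightarrow> connected (- S)"
  by (rule connected_open_delete_finite[of UNIV S, simplified Compl_eq_Diff_UNIV[symmetric]]) auto

text \<open>The coefficient ring is left abstract with an evaluation \<open>e\<close>: polynomials
  in the parameter, evaluated at t, give the whole family of slices, and complex numbers with the
  identity give a single slice.\<close>

definition bieval :: "('r::idom \<Rightarrow> complex) \<Rightarrow> 'r poly poly \<Rightarrow> complex \<Rightarrow> complex \<Rightarrow> complex" where
  "bieval e p x y = poly (map_poly (\<lambda>c. poly (map_poly e c) x) p) y"

context
  fixes e :: "'r::idom \<Rightarrow> complex"
  assumes hom: "comm_ring_hom e"
begin

lemma inner_hom: "comm_ring_hom (\<lambda>c. poly (map_poly e c) x)"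
proof -
  interpret comm_ring_hom e by (rule hom)
  interpret m: map_poly_comm_ring_hom e ..
  show ?thesis by unfold_locales (simp_all add: m.hom_add m.hom_mult)
qed

lemma bieval_add: "bieval e (p + q) x y = bieval e p x y + bieval e q x y"
proof -
  interpret comm_ring_hom "\<lambda>c. poly (map_poly e c) x" by (rule inner_hom)
  interpret m: map_poly_comm_ring_hom "\<lambda>c. poly (map_poly e c) x" ..
  show ?thesis by (simp add: bieval_def m.hom_add)
qed

lemma bieval_mult: "bieval e (p * q) x y = bieval e p x y * bieval e q x y"
proof -
  interpret comm_ring_hom "\<lambda>c. poly (map_poly e c) x" by (rule inner_hom)
  interpret m: map_poly_comm_ring_hom "\<lambda>c. poly (map_poly e c) x" ..
  show ?thesis by (simp add: bieval_def m.hom_mult)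
qed

lemma bieval_pCons: "bieval e (pCons c p) x y = poly (map_poly e c) x + y * bieval e p x y"
proof -
  interpret comm_ring_hom "\<lambda>c. poly (map_poly e c) x" by (rule inner_hom)
  have "map_poly (\<lambda>c. poly (map_poly e c) x) (pCons c p) = pCons (poly (map_poly e c) x) (map_poly (\<lambda>c. poly (map_poly e c) x) p)"
    by (rule poly_eqI) (simp add: coeff_map_poly coeff_pCons split: nat.split)
  then show ?thesis by (simp add: bieval_def)
qed

lemma poly_map_pCons: "poly (map_poly e (pCons c p)) x = e c + x * poly (map_poly e p) x"
proof -
  interpret comm_ring_hom e by (rule hom)
  have "map_poly e (pCons c p) = pCons (e c) (map_poly e p)"
    by (rule poly_eqI) (simp add: coeff_map_poly coeff_pCons split: nat.split)
  then show ?thesis by simp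
qed

lemma bieval_0: "bieval e 0 x y = 0" by (simp add: bieval_def)

lemma bieval_smult: "bieval e (Polynomial.smult c p) x y = poly (map_poly e c) x * bieval e p x y"
  using bieval_mult[of "[:c:]" p x y] by (simp add: bieval_pCons bieval_0)

lemma coeff_inner: "coeff (map_poly (\<lambda>c. poly (map_poly e c) x) p) k = poly (map_poly e (coeff p k)) x"
proof -
  interpret comm_ring_hom "\<lambda>c. poly (map_poly e c) x" by (rule inner_hom)
  show ?thesis by simp
qed

end

text \<open>If the zero set \<open>Z\<close> of \<open>S\<close> in a union of open slices has compact slices, a polynomial of
  least degree in the outer variable vanishing on \<open>Z\<close> does not involve that variable: otherwise,
  off the zeros of its leading coefficient \<open>l\<close>, its zero set would lie in \<open>Z\<close> by
  pseudo-division, so that the projection of a slice to the inner variable would be relatively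
  clopen in the complement of the zeros of \<open>l\<close>.\<close>

lemma elimination:
  fixes ev :: "'i \<Rightarrow> 'r::idom \<Rightarrow> complex" and S :: "'r poly poly set" and U :: "'i \<Rightarrow> (complex \<times> complex) set" and I
  assumes hom: "\<And>i. comm_ring_hom (ev i)"
  defines "E i p x y \<equiv> bieval (ev i) p x y"
  defines "Z \<equiv> {(i, x, y). (x, y) \<in> U i \<and> (\<forall>p\<in>S. E i p x y = 0)}"
  assumes op: "\<And>i. i \<in> I \<Longrightarrow> open (U i)" and emp: "\<And>i. i \<notin> I \<Longrightarrow> U i = {}"
    and comp: "\<And>i. i \<in> I \<Longrightarrow> compact {(x, y). (i, x, y) \<in> Z}"
  shows "\<exists>d. d \<noteq> 0 \<and> (\<forall>(i, x, y)\<in>Z. poly (map_poly (ev i) d) x = 0)"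
proof (cases "Z = {}")
  case True
  then show ?thesis by (intro exI[of _ 1]) auto
next
  case False
  note E_mult = bieval_mult[OF hom, folded E_def] and E_add = bieval_add[OF hom, folded E_def]
    and E_smult = bieval_smult[OF hom, folded E_def] and E_coeff = coeff_inner[OF hom]
  have E_const: "E i [:c:] x y = poly (map_poly (ev i) c) x" for i c x y
    using bieval_pCons[OF hom, of i c 0 x y] bieval_0[OF hom] by (simp add: E_def)
  have E_deg: "degree (map_poly (\<lambda>c. poly (map_poly (ev i) c) x) p) \<le> degree p" for i p x
    by (rule degree_map_poly_le)
  have E_cont: "continuous_on UNIV (\<lambda>(x, y). E i p x y)" for i p
  proof -
    have "E i p x y = (\<Sum>k\<le>degree p. poly (map_poly (ev i) (coeff p k)) x * y ^ k)" for x y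
    proof -
      have "poly q y = (\<Sum>k\<le>m. coeff q k * y ^ k)" if "degree q \<le> m" for q :: "complex poly" and m
        unfolding poly_altdef by (rule sum.mono_neutral_left) (use that in \<open>auto simp: coeff_eq_0\<close>)
      from this[OF E_deg] show ?thesis unfolding E_def bieval_def E_coeff .
    qed
    then show ?thesis by (simp add: case_prod_unfold) (intro continuous_intros)
  qed
  define J where "J = {p. p \<noteq> 0 \<and> (\<forall>(i, x, y)\<in>Z. E i p x y = 0)}"
  \<comment> \<open>If all polynomials of \<open>S\<close> were zero, a nonempty slice of
    \<open>Z\<close> would be both open and compact in the space of two complex variables.\<close>
  have "\<exists>p\<in>S. p \<noteq> 0"
  proof (rule ccontr)
    assume S0: "\<not> ?thesis"
    have E0: "E i 0 x y = 0" for i x y by (simp add: E_def bieval_def)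
    have ZU: "(i, x, y) \<in> Z \<longleftrightarrow> (x, y) \<in> U i" for i x y unfolding Z_def using S0 E0 by auto
    obtain i x y where z: "(i, x, y) \<in> Z" using False by auto
    then have iI: "i \<in> I" using emp ZU by fastforce
    have "{(x, y). (i, x, y) \<in> Z} = U i" using ZU by auto
    then have "compact (U i)" using comp[OF iI] by simp
    then have "U i = {} \<or> U i = UNIV" using op[OF iI] clopen[of "U i"] compact_imp_closed by blast
    then have "compact (UNIV :: (complex \<times> complex) set)" using z ZU \<open>compact (U i)\<close> by auto
    then have "bounded (fst ` (UNIV :: (complex \<times> complex) set))" by (intro bounded_fst compact_imp_bounded)
    then have "bounded (UNIV :: complex set)" by simp
    then show False using not_bounded_UNIV by blast
  qed
  then have "J \<noteq> {}" by (auto simp: J_def Z_def)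
  then obtain p0 where "p0 \<in> J" by blast
  then obtain g where g: "g \<in> J" and gmin: "\<And>p. p \<in> J \<Longrightarrow> degree g \<le> degree p"
    using ex_has_least_nat[of "\<lambda>p. p \<in> J" p0 degree] by blast
  have g0: "g \<noteq> 0" and gZ: "\<And>i x y. (i, x, y) \<in> Z \<Longrightarrow> E i g x y = 0" using g by (auto simp: J_def)
  show ?thesis
  proof (cases "degree g = 0")
    case True
    then obtain d where d: "g = [:d:]" using degree_eq_zeroE by blast
    then show ?thesis using g0 gZ E_const by (intro exI[of _ d]) auto
  next
    case dg: False
    define l where "l = lead_coeff g"
    have l0: "l \<noteq> 0" using g0 by (simp add: l_def)
    have div: "\<exists>N q. Polynomial.smult (l ^ N) p = g * q" if p: "p \<in> S" for p
    proof -
      obtain q r where qr: "pseudo_divmod p g = (q, r)" by force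
      note pd = pseudo_divmod[OF g0 qr]
      have r: "r = Polynomial.smult (l ^ (Suc (degree p) - degree g)) p - g * q" using pd(1) by (simp add: l_def)
      have "E i r x y = 0" if "(i, x, y) \<in> Z" for i x y
      proof -
        have "E i (Polynomial.smult (l ^ (Suc (degree p) - degree g)) p) x y = E i (g * q + r) x y"
          using pd(1) by (simp add: l_def)
        then show ?thesis using gZ[OF that] that p by (simp add: E_add E_mult E_smult Z_def)
      qed
      then have "r = 0" using gmin[of r] pd(2) dg by (force simp: J_def)
      then show ?thesis using pd(1) by (auto simp: l_def)
    qed
    \<comment> \<open>Degree 0 is below the least degree in \<open>J\<close>, so the leading
      coefficient \<open>l\<close> is nonzero at some point of \<open>Z\<close>; the index
      \<open>i\<close> of that point is fixed from here on.\<close>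
    have "[:l:] \<notin> J" using gmin[of "[:l:]"] dg by auto
    then obtain i x0 y0 where z0: "(i, x0, y0) \<in> Z" and lx0: "poly (map_poly (ev i) l) x0 \<noteq> 0"
      using l0 by (auto simp: J_def E_const)
    have iI: "i \<in> I" using z0 emp by (force simp: Z_def)
    define li where "li = map_poly (ev i) l"
    have li0: "li \<noteq> 0" using lx0 by (auto simp: li_def)
    define N where "N = {x. poly li x = 0}"
    have finN: "finite N" unfolding N_def by (rule poly_roots_finite[OF li0])
    define K where "K = {(x, y). (i, x, y) \<in> Z}"
    have K: "compact K" unfolding K_def by (rule comp[OF iI])
    define P where "P = fst ` K"
    have Pc: "compact P" unfolding P_def by (intro compact_continuous_image continuous_intros K)
    have into: "(i, x, y) \<in> Z" if "(x, y) \<in> U i" "E i g x y = 0" "x \<notin> N" for x y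
    proof -
      have "E i p x y = 0" if p: "p \<in> S" for p
      proof -
        obtain M q where "Polynomial.smult (l ^ M) p = g * q" using div[OF p] by blast
        then have "E i (Polynomial.smult (l ^ M) p) x y = E i (g * q) x y" by simp
        moreover have "E i (Polynomial.smult (l ^ M) p) x y = poly li x ^ M * E i p x y"
        proof -
          interpret comm_ring_hom "ev i" by (rule hom)
          interpret m: map_poly_comm_ring_hom "ev i" ..
          show ?thesis by (simp add: E_smult li_def m.hom_power)
        qed
        ultimately show ?thesis using \<open>x \<notin> N\<close> \<open>E i g x y = 0\<close> by (simp add: E_mult N_def)
      qed
      then show ?thesis using that by (simp add: Z_def)
    qed
    have "openin (top_of_set (- N)) (P - N)"
    proof -
      \<comment> \<open>By \<open>root_continuity\<close> a root of \<open>g\<close> persists under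
        small changes of \<open>x\<close>, and off \<open>N\<close> it lies in \<open>Z\<close> by
        \<open>into\<close>.\<close>
      have "open (P - N)"
        unfolding open_dist
      proof (intro ballI)
        fix a assume a: "a \<in> P - N"
        then obtain b where b: "(i, a, b) \<in> Z" by (auto simp: P_def K_def)
        have "(a, b) \<in> U i" using b by (simp add: Z_def)
        then have "\<exists>A B. open A \<and> open B \<and> (a, b) \<in> A \<times> B \<and> A \<times> B \<subseteq> U i"
          using op[OF iI, unfolded open_prod_def] by (rule bspec[rotated])
        then obtain A B where AB: "open A" "open B" "a \<in> A" "b \<in> B" "A \<times> B \<subseteq> U i" by auto
        obtain R where R: "R > 0" "ball b R \<subseteq> B" using AB open_contains_ball by blast
        have V: "open (A - N)" using AB finN by (simp add: open_Diff finite_imp_closed)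
        have ne: "map_poly (\<lambda>c. poly (map_poly (ev i) c) a) g \<noteq> 0"
        proof
          assume "map_poly (\<lambda>c. poly (map_poly (ev i) c) a) g = 0"
          then have "poly (map_poly (ev i) (coeff g (degree g))) a = 0" using E_coeff[of i a g "degree g"] by simp
          then show False using a by (simp add: N_def li_def l_def)
        qed
        obtain \<delta> where \<delta>: "\<delta> > 0" "\<And>x. dist x a < \<delta> \<Longrightarrow> x \<in> A - N \<and> (\<exists>y\<in>ball b R. dist y b < 1 \<and> E i g x y = 0)"
        proof (rule root_continuity[of "A - N" a R b "E i g" 1])
          show "continuous_on ((A - N) \<times> ball b R) (\<lambda>(x, y). E i g x y)" using E_cont continuous_on_subset by blast
          show "E i g x holomorphic_on ball b R" for x unfolding E_def bieval_def by (intro holomorphic_intros)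
          show "finite {y \<in> ball b R. E i g a y = 0}"
            unfolding E_def bieval_def by (rule finite_subset[OF _ poly_roots_finite[OF ne]]) auto
        qed (use V a AB R gZ b in auto)
        have "x \<in> P - N" if xa: "dist x a < \<delta>" for x
        proof -
          obtain y where y: "y \<in> ball b R" "E i g x y = 0" "x \<in> A - N" using \<delta>(2)[OF xa] by blast
          then have "(i, x, y) \<in> Z" using R AB by (intro into) auto
          then show ?thesis using y by (force simp: P_def K_def)
        qed
        then show "\<exists>e>0. \<forall>y. dist y a < e \<longrightarrow> y \<in> P - N" using \<delta>(1) by blast
      qed
      then show ?thesis by (intro open_subset) auto
    qed
    moreover have "closedin (top_of_set (- N)) (P - N)"
      using compact_imp_closed[OF Pc] closedin_closed_Int[of P "- N"] by (simp add: Diff_eq Int_commute)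
    moreover have "connected (- N)" using finite_complement_connected finN by blast
    moreover have "P - N \<noteq> {}" using z0 lx0 by (force simp: P_def K_def N_def li_def)
    ultimately have "P - N = - N" unfolding connected_clopen by blast
    then have "bounded (- N)" using compact_imp_bounded[OF Pc] bounded_subset by blast
    then have "bounded (- N \<union> N)" using finite_imp_bounded[OF finN] unfolding bounded_Un by blast
    then have "bounded (UNIV :: complex set)" by (simp only: Compl_partition2)
    then show ?thesis using not_bounded_UNIV by blast
  qed
qed

section \<open>Distinguished varieties\<close>

text \<open>Serves to carry a polynomial from one nesting of the variables to another through the
  function it defines.\<close>

lemma poly3_induct_fun:
  fixes R :: "(complex ^ 3 \<Rightarrow> complex) \<Rightarrow> bool"
  assumes const: "\<And>c. R (\<lambda>x. c)" and x1: "R (\<lambda>x. x $ 1)" and x2: "R (\<lambda>x. x $ 2)" and x3: "R (\<lambda>x. x $ 3)"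
    and add: "\<And>f g. R f \<Longrightarrow> R g \<Longrightarrow> R (\<lambda>x. f x + g x)" and mult: "\<And>f g. R f \<Longrightarrow> R g \<Longrightarrow> R (\<lambda>x. f x * g x)"
  shows "R (poly3 p)"
proof (induction p)
  case 0
  have "poly3 0 = (\<lambda>x. 0)" by (simp add: fun_eq_iff)
  then show ?case using const by simp
next
  case (pCons a p)
  have b: "R (\<lambda>x. poly b (x $ 1))" for b :: "complex poly"
    by (induction b) (auto intro!: const add mult x1)
  have a: "R (\<lambda>x. poly (poly a [:x $ 2:]) (x $ 1))"
  proof (induction a)
    case (pCons b a)
    then show ?case unfolding poly2_pCons by (intro add mult b x2)
  qed (simp add: const)
  have "poly3 (pCons a p) = (\<lambda>x. poly (poly a [:x $ 2:]) (x $ 1) + x $ 3 * poly3 p x)"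
    by (simp add: fun_eq_iff poly3_pCons)
  then show ?case using a pCons by (auto intro!: add mult x3)
qed

lemma poly3_add [simp]: "poly3 (p + q) x = poly3 p x + poly3 q x" by (simp add: poly3_def)
lemma poly3_mult [simp]: "poly3 (p * q) x = poly3 p x * poly3 q x" by (simp add: poly3_def)
lemma poly3_1 [simp]: "poly3 1 x = 1" by (simp add: poly3_def)

definition K3 :: "complex \<Rightarrow> complex poly poly poly" where "K3 c = [:[:[:c:]:]:]"
definition X3 :: "complex poly poly poly" where "X3 = [:[:[:0, 1:]:]:]"
definition Y3 :: "complex poly poly poly" where "Y3 = [:[:0, 1:]:]"
definition T3 :: "complex poly poly poly" where "T3 = [:0, 1:]"

lemma poly3_gens [simp]: "poly3 (K3 c) x = c" "poly3 X3 x = x $ 1" "poly3 Y3 x = x $ 2" "poly3 T3 x = x $ 3"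
  by (simp_all add: poly3_def K3_def X3_def Y3_def T3_def)

lemma poly3_swap: "\<exists>q. \<forall>x. poly3 q x = poly3 p (swap12 x)"
proof (rule poly3_induct_fun[where R = "\<lambda>f. \<exists>q. \<forall>x. poly3 q x = f (swap12 x)"])
  show "\<exists>q. \<forall>x. poly3 q x = c" for c by (rule exI[of _ "K3 c"]) simp
  show "\<exists>q. \<forall>x. poly3 q x = swap12 x $ 1" by (rule exI[of _ Y3]) simp
  show "\<exists>q. \<forall>x. poly3 q x = swap12 x $ 2" by (rule exI[of _ X3]) simp
  show "\<exists>q. \<forall>x. poly3 q x = swap12 x $ 3" by (rule exI[of _ T3]) simp
qed (metis poly3_add, metis poly3_mult)

lemma comm_ring_hom_poly: "comm_ring_hom (\<lambda>c :: complex poly. poly c t)"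
  by unfold_locales simp_all
lemma comm_ring_hom_id: "comm_ring_hom (\<lambda>c :: complex. c)"
  by unfold_locales simp_all

text \<open>Renests the variables: \<open>x $ 2\<close> becomes outermost, the one to be eliminated,
  and \<open>x $ 3\<close> the innermost, the parameter.\<close>

lemma bieval_poly3: "\<exists>q. \<forall>x. bieval (\<lambda>c. poly c (x $ 3)) q (x $ 1) (x $ 2) = poly3 p x"
proof (rule poly3_induct_fun[where R = "\<lambda>f. \<exists>q. \<forall>x. bieval (\<lambda>c. poly c (x $ 3)) q (x $ 1) (x $ 2) = f x"])
  note s = bieval_pCons[OF comm_ring_hom_poly] poly_map_pCons[OF comm_ring_hom_poly] bieval_0[OF comm_ring_hom_poly]
  show "\<exists>q. \<forall>x :: complex ^ 3. bieval (\<lambda>c. poly c (x $ 3)) q (x $ 1) (x $ 2) = c" for c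
    by (rule exI[of _ "[:[:[:c:]:]:]"]) (simp add: s)
  show "\<exists>q. \<forall>x :: complex ^ 3. bieval (\<lambda>c. poly c (x $ 3)) q (x $ 1) (x $ 2) = x $ 1"
    by (rule exI[of _ "[:[:0, 1:]:]"]) (simp add: s)
  show "\<exists>q. \<forall>x :: complex ^ 3. bieval (\<lambda>c. poly c (x $ 3)) q (x $ 1) (x $ 2) = x $ 2"
    by (rule exI[of _ "[:0, [:[:1:]:]:]"]) (simp add: s del: pCons_one)
  show "\<exists>q. \<forall>x :: complex ^ 3. bieval (\<lambda>c. poly c (x $ 3)) q (x $ 1) (x $ 2) = x $ 3"
    by (rule exI[of _ "[:[:[:0, 1:]:]:]"]) (simp add: s)
qed (metis bieval_add[OF comm_ring_hom_poly], metis bieval_mult[OF comm_ring_hom_poly])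

lemma bieval_fibre: "\<exists>q. \<forall>x y. bieval (\<lambda>c. c) q x y = poly3 p (vec3 x y t)"
proof (rule poly3_induct_fun[where R = "\<lambda>f. \<exists>q. \<forall>x y. bieval (\<lambda>c. c) q x y = f (vec3 x y t)"])
  note s = bieval_pCons[OF comm_ring_hom_id] poly_map_pCons[OF comm_ring_hom_id] bieval_0[OF comm_ring_hom_id]
  show c: "\<exists>q. \<forall>x y. bieval (\<lambda>c. c) q x y = c" for c :: complex
    by (rule exI[of _ "[:[:c:]:]"]) (simp add: s)
  show "\<exists>q. \<forall>x y. bieval (\<lambda>c. c) q x y = vec3 x y t $ 1"
    by (rule exI[of _ "[:[:0, 1:]:]"]) (simp add: s)
  show "\<exists>q. \<forall>x y. bieval (\<lambda>c. c) q x y = vec3 x y t $ 2"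
    by (rule exI[of _ "[:0, [:1:]:]"]) (simp add: s del: pCons_one)
  show "\<exists>q. \<forall>x y. bieval (\<lambda>c. c) q x y = vec3 x y t $ 3" using c[of t] by simp
qed (metis bieval_add[OF comm_ring_hom_id], metis bieval_mult[OF comm_ring_hom_id])

lemma open_slice: "open {(x, y). vec3 x y t \<in> tetrablock}"
proof -
  have "open ((\<lambda>z. vec3 (fst z) (snd z) t) -` tetrablock)"
    by (intro open_vimage open_tetrablock continuous_intros)
  moreover have "(\<lambda>z. vec3 (fst z) (snd z) t) -` tetrablock = {(x, y). vec3 x y t \<in> tetrablock}" by auto
  ultimately show ?thesis by simp
qed

text \<open>This is \<open>elimination\<close> for the family of slices indexed by the unit disc;
  outside it the slices of the tetrablock are empty.\<close>

lemma eliminate_second: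
  assumes var: "\<Omega> = zero_locus S \<inter> tetrablock"
    and comp: "\<And>t. norm t < 1 \<Longrightarrow> compact {(x, y). vec3 x y t \<in> \<Omega>}"
  shows "\<exists>d. d \<noteq> 0 \<and> (\<forall>x\<in>\<Omega>. poly (spec (x $ 3) d) (x $ 1) = 0)"
proof -
  define U where "U t = {(x, y). vec3 x y t \<in> tetrablock}" for t
  define S' where "S' = {q. \<exists>p\<in>S. \<forall>x. bieval (\<lambda>c. poly c (x $ 3)) q (x $ 1) (x $ 2) = poly3 p x}"
  have mem: "vec3 x y t \<in> \<Omega> \<longleftrightarrow> (x, y) \<in> U t \<and> (\<forall>q\<in>S'. bieval (\<lambda>c. poly c t) q x y = 0)" for x y t
  proof -
    have "(\<forall>q\<in>S'. bieval (\<lambda>c. poly c t) q x y = 0) \<longleftrightarrow> (\<forall>p\<in>S. poly3 p (vec3 x y t) = 0)"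
    proof safe
      fix p assume *: "\<forall>q\<in>S'. bieval (\<lambda>c. poly c t) q x y = 0" "p \<in> S"
      obtain q where q: "\<And>x. bieval (\<lambda>c. poly c (x $ 3)) q (x $ 1) (x $ 2) = poly3 p x" using bieval_poly3 by blast
      then have "q \<in> S'" using *(2) by (auto simp: S'_def)
      then show "poly3 p (vec3 x y t) = 0" using *(1) q[of "vec3 x y t"] by simp
    next
      fix q assume *: "\<forall>p\<in>S. poly3 p (vec3 x y t) = 0" "q \<in> S'"
      then obtain p where "p \<in> S" "\<And>x. bieval (\<lambda>c. poly c (x $ 3)) q (x $ 1) (x $ 2) = poly3 p x" by (auto simp: S'_def)
      then show "bieval (\<lambda>c. poly c t) q x y = 0" using *(1) by (metis vec3_nth)
    qed
    then show ?thesis by (auto simp: var zero_locus_def U_def)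
  qed
  have "\<exists>d. d \<noteq> 0 \<and> (\<forall>(i, x, y)\<in>{(i, x, y). (x, y) \<in> U i \<and> (\<forall>p\<in>S'. bieval (\<lambda>c. poly c i) p x y = 0)}.
      poly (map_poly (\<lambda>c. poly c i) d) x = 0)"
  proof (rule elimination[where I = "ball 0 1"])
    show "comm_ring_hom (\<lambda>c :: complex poly. poly c i)" for i by (rule comm_ring_hom_poly)
    show "open (U i)" for i unfolding U_def by (rule open_slice)
    show "U i = {}" if "i \<notin> ball 0 1" for i
      using that tetrablock_3_less[of "vec3 _ _ i"] by (fastforce simp: U_def)
    show "compact {(x, y). (i, x, y) \<in> {(i, x, y). (x, y) \<in> U i \<and> (\<forall>p\<in>S'. bieval (\<lambda>c. poly c i) p x y = 0)}}"
      if "i \<in> ball 0 1" for i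
      using comp[of i] that unfolding mem by simp
  qed
  then obtain d where d: "d \<noteq> 0" "\<forall>(i, x, y)\<in>{(i, x, y). (x, y) \<in> U i \<and> (\<forall>p\<in>S'. bieval (\<lambda>c. poly c i) p x y = 0)}.
      poly (map_poly (\<lambda>c. poly c i) d) x = 0" by blast
  have "poly (spec (x $ 3) d) (x $ 1) = 0" if "x \<in> \<Omega>" for x
    using mem[of "x $ 1" "x $ 2" "x $ 3"] that bspec[OF d(2), of "(x $ 3, x $ 1, x $ 2)"] by (simp add: vec3_eta spec_def)
  then show ?thesis using d(1) by blast
qed

text \<open>The polynomial from \<open>eliminate_second\<close> may vanish identically at a
  particular \<open>t\<close>, so each single slice gets its own elimination, with a one-element
  index type.\<close>

lemma fibre_first_finite:
  assumes var: "\<Omega> = zero_locus S \<inter> tetrablock"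
    and comp: "compact {(x, y). vec3 x y t \<in> \<Omega>}"
  shows "finite ((\<lambda>x. x $ 1) ` {x \<in> \<Omega>. x $ 3 = t})"
proof -
  define U where "U = {(x, y). vec3 x y t \<in> tetrablock}"
  define S' where "S' = {q. \<exists>p\<in>S. \<forall>x y. bieval (\<lambda>c. c) q x y = poly3 p (vec3 x y t)}"
  have mem: "vec3 x y t \<in> \<Omega> \<longleftrightarrow> (x, y) \<in> U \<and> (\<forall>q\<in>S'. bieval (\<lambda>c. c) q x y = 0)" for x y
  proof -
    have "(\<forall>q\<in>S'. bieval (\<lambda>c. c) q x y = 0) \<longleftrightarrow> (\<forall>p\<in>S. poly3 p (vec3 x y t) = 0)"
    proof safe
      fix p assume *: "\<forall>q\<in>S'. bieval (\<lambda>c. c) q x y = 0" "p \<in> S"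
      obtain q where q: "\<And>x y. bieval (\<lambda>c. c) q x y = poly3 p (vec3 x y t)" using bieval_fibre by blast
      then have "q \<in> S'" using *(2) by (auto simp: S'_def)
      then show "poly3 p (vec3 x y t) = 0" using *(1) q by metis
    next
      fix q assume *: "\<forall>p\<in>S. poly3 p (vec3 x y t) = 0" "q \<in> S'"
      then show "bieval (\<lambda>c. c) q x y = 0" by (auto simp: S'_def)
    qed
    then show ?thesis by (auto simp: var zero_locus_def U_def)
  qed
  have "\<exists>d. d \<noteq> 0 \<and> (\<forall>(i, x, y)\<in>{(i :: unit, x, y). (x, y) \<in> U \<and> (\<forall>p\<in>S'. bieval (\<lambda>c. c) p x y = 0)}.
      poly (map_poly (\<lambda>c. c) d) x = 0)"
  proof (rule elimination[where I = "UNIV :: unit set" and ev = "\<lambda>_ c. c" and U = "\<lambda>_. U" and S = S'])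
    show "compact {(x, y). (i, x, y) \<in> {(i, x, y). (x, y) \<in> U \<and> (\<forall>p\<in>S'. bieval (\<lambda>c. c) p x y = 0)}}" for i :: unit
      using comp unfolding mem by simp
  qed (auto simp: comm_ring_hom_id U_def open_slice)
  then obtain d where d: "d \<noteq> 0" "\<And>x y. vec3 x y t \<in> \<Omega> \<Longrightarrow> poly (map_poly (\<lambda>c. c) d) x = 0"
    unfolding mem by auto
  have "map_poly (\<lambda>c. c) d = d" by (rule poly_eqI) (simp add: coeff_map_poly)
  then have "(\<lambda>x. x $ 1) ` {x \<in> \<Omega>. x $ 3 = t} \<subseteq> {x. poly d x = 0}"
    using d(2) by (auto) (metis vec3_eta)
  then show ?thesis using poly_roots_finite[OF d(1)] finite_subset by blast
qed

lemma swap12_zero_locus: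
  assumes var: "\<Omega> = zero_locus S \<inter> tetrablock"
  shows "\<exists>S'. swap12 ` \<Omega> = zero_locus S' \<inter> tetrablock"
proof -
  define S' where "S' = {q. \<exists>p\<in>S. \<forall>x. poly3 q x = poly3 p (swap12 x)}"
  have z: "x \<in> zero_locus S' \<longleftrightarrow> swap12 x \<in> zero_locus S" for x
  proof safe
    assume *: "x \<in> zero_locus S'"
    have "poly3 p (swap12 x) = 0" if "p \<in> S" for p
    proof -
      obtain q where q: "\<And>x. poly3 q x = poly3 p (swap12 x)" using poly3_swap by blast
      then have "q \<in> S'" using that by (auto simp: S'_def)
      then show ?thesis using * q by (auto simp: zero_locus_def)
    qed
    then show "swap12 x \<in> zero_locus S" by (simp add: zero_locus_def)
  next
    assume "swap12 x \<in> zero_locus S"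
    then show "x \<in> zero_locus S'" by (auto simp: zero_locus_def S'_def)
  qed
  have "x \<in> swap12 ` \<Omega> \<longleftrightarrow> swap12 x \<in> \<Omega>" for x by (metis image_iff swap12_swap12)
  moreover have "swap12 x \<in> tetrablock \<longleftrightarrow> x \<in> tetrablock" for x using swap12_tetrablock swap12_swap12 by metis
  ultimately show ?thesis using z var by (intro exI[of _ S']) auto
qed

lemma compact_swap_slice:
  assumes "compact {(x, y). vec3 x y t \<in> \<Omega>}" shows "compact {(x, y). vec3 x y t \<in> swap12 ` \<Omega>}"
proof -
  have m: "vec3 x y t \<in> swap12 ` \<Omega> \<longleftrightarrow> vec3 y x t \<in> \<Omega>" for x y
  proof -
    have "swap12 (vec3 y x t) = vec3 x y t" by (rule vec3_eqI) auto
    then show ?thesis by (metis image_iff swap12_swap12)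
  qed
  have "{(x, y). vec3 x y t \<in> swap12 ` \<Omega>} = (\<lambda>z. (snd z, fst z)) ` {(x, y). vec3 x y t \<in> \<Omega>}"
    unfolding m by force
  then show ?thesis using assms by (auto intro!: compact_continuous_image continuous_intros)
qed

lemma fibre_finite:
  assumes var: "\<Omega> = zero_locus S \<inter> tetrablock"
    and comp: "compact {(x, y). vec3 x y t \<in> \<Omega>}"
  shows "finite {x \<in> \<Omega>. x $ 3 = t}"
proof -
  obtain S' where S': "swap12 ` \<Omega> = zero_locus S' \<inter> tetrablock" using swap12_zero_locus[OF var] by blast
  have 1: "finite ((\<lambda>x. x $ 1) ` {x \<in> \<Omega>. x $ 3 = t})" by (rule fibre_first_finite[OF var comp])
  have "finite ((\<lambda>x. x $ 1) ` {x \<in> swap12 ` \<Omega>. x $ 3 = t})"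
    by (rule fibre_first_finite[OF S' compact_swap_slice[OF comp]])
  moreover have "(\<lambda>x. x $ 1) ` {x \<in> swap12 ` \<Omega>. x $ 3 = t} = (\<lambda>x. x $ 2) ` {x \<in> \<Omega>. x $ 3 = t}" by force
  ultimately have 2: "finite ((\<lambda>x. x $ 2) ` {x \<in> \<Omega>. x $ 3 = t})" by simp
  have "{x \<in> \<Omega>. x $ 3 = t} \<subseteq> (\<lambda>(a, b). vec3 a b t) ` ((\<lambda>x. x $ 1) ` {x \<in> \<Omega>. x $ 3 = t} \<times> (\<lambda>x. x $ 2) ` {x \<in> \<Omega>. x $ 3 = t})"
  proof
    fix x assume x: "x \<in> {x \<in> \<Omega>. x $ 3 = t}"
    then have "x = vec3 (x $ 1) (x $ 2) t" using vec3_eta[of x] by simp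
    then show "x \<in> (\<lambda>(a, b). vec3 a b t) ` ((\<lambda>x. x $ 1) ` {x \<in> \<Omega>. x $ 3 = t} \<times> (\<lambda>x. x $ 2) ` {x \<in> \<Omega>. x $ 3 = t})"
      using x by (intro image_eqI[of _ _ "(x $ 1, x $ 2)"]) auto
  qed
  then show ?thesis by (rule finite_subset) (use 1 2 in auto)
qed

lemma closed_zero_locus: "closed (zero_locus S)"
proof -
  have "zero_locus S = (\<Inter>p\<in>S. poly3 p -` {0})" by (auto simp: zero_locus_def)
  moreover have "closed (poly3 p -` {0})" for p
    by (intro closed_vimage continuous_on_poly3[of _ "\<lambda>x. x", simplified] continuous_intros)
  ultimately show ?thesis by auto
qed

lemma norm_vec3_le: "norm (x :: complex ^ 3) \<le> norm (x $ 1) + norm (x $ 2) + norm (x $ 3)"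
proof -
  have "norm x \<le> (\<Sum>i\<in>UNIV. norm (x $ i))" unfolding norm_vec_def by (intro L2_set_le_sum) auto
  then show ?thesis by (simp add: sum_3)
qed

lemma bounded_tetrablock: "bounded tetrablock"
proof (rule boundedI)
  fix x assume "x \<in> tetrablock"
  then show "norm x \<le> 3"
    using norm_vec3_le[of x] tetrablock_nth_less[of x] tetrablock_3_less[of x] by simp
qed

text \<open>Positive dimension appears here as \<open>iso\<close>, the absence of isolated
  points.\<close>

locale dvar =
  fixes \<Omega> :: "(complex ^ 3) set" and S
  assumes var: "\<Omega> = zero_locus S \<inter> tetrablock"
    and iso: "x \<in> \<Omega> \<Longrightarrow> x islimpt \<Omega>"
    and ne: "\<Omega> \<noteq> {}"
    and bnd: "closure \<Omega> \<inter> frontier tetrablock = closure \<Omega> \<inter> dist_boundary"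
    and bD: "closure \<Omega> \<inter> frontier tetrablock \<inter> bD_tetrablock = {}"
begin

lemma sub: "\<Omega> \<subseteq> tetrablock" using var by blast

lemma closure_sub: "closure \<Omega> \<subseteq> closure tetrablock" using closure_mono sub by blast

text \<open>A frontier point of the tetrablock in the closure has |x3| = 1 by \<open>bnd\<close>;
  the other points of the closure lie in the tetrablock and inherit the equations, since zero loci
  are closed.\<close>

lemma closure_interior: assumes "x \<in> closure \<Omega>" "norm (x $ 3) < 1" shows "x \<in> \<Omega>"
proof -
  have "x \<notin> dist_boundary" using assms by (simp add: dist_boundary_def)
  then have "x \<notin> frontier tetrablock" using bnd assms by blast
  then have "x \<in> tetrablock"
    using assms closure_sub open_tetrablock by (auto simp: frontier_def interior_open)
  moreover have "closure \<Omega> \<subseteq> zero_locus S"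
    by (rule closure_minimal) (use var closed_zero_locus in auto)
  ultimately show ?thesis using assms var by auto
qed

lemma closure_boundary: assumes "x \<in> closure \<Omega>" "norm (x $ 3) = 1" shows "x \<in> dist_boundary" "x \<notin> bD_tetrablock"
proof -
  show d: "x \<in> dist_boundary" using assms closure_sub by (auto simp: dist_boundary_def)
  then show "x \<notin> bD_tetrablock" using bnd bD assms by blast
qed

lemma compact_closure_Omega: "compact (closure \<Omega>)"
  using bounded_subset[OF bounded_tetrablock sub] by (simp add: compact_closure)

lemma compact_slice: assumes "norm t < 1" shows "compact {(x, y). vec3 x y t \<in> \<Omega>}"
proof -
  have "{(x, y). vec3 x y t \<in> \<Omega>} = (\<lambda>x. (x $ 1, x $ 2)) ` (closure \<Omega> \<inter> {x. x $ 3 = t})"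
  proof (intro equalityI subsetI)
    fix z assume "z \<in> {(x, y). vec3 x y t \<in> \<Omega>}"
    then show "z \<in> (\<lambda>x. (x $ 1, x $ 2)) ` (closure \<Omega> \<inter> {x. x $ 3 = t})"
      using closure_subset[of \<Omega>] by (intro image_eqI[of _ _ "vec3 (fst z) (snd z) t"]) auto
  next
    fix z assume "z \<in> (\<lambda>x. (x $ 1, x $ 2)) ` (closure \<Omega> \<inter> {x. x $ 3 = t})"
    then obtain x where "x \<in> closure \<Omega>" "x $ 3 = t" "z = (x $ 1, x $ 2)" by auto
    then show "z \<in> {(x, y). vec3 x y t \<in> \<Omega>}" using closure_interior[of x] assms vec3_eta[of x] by auto
  qed
  moreover have "compact (closure \<Omega> \<inter> {x. x $ 3 = t})"
    by (intro compact_Int_closed compact_closure_Omega closed_Collect_eq continuous_intros)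
  ultimately show ?thesis by (auto intro!: compact_continuous_image continuous_intros)
qed

definition "Fib t = {x \<in> \<Omega>. x $ 3 = t}"

lemma Fib_finite: "finite (Fib t)"
proof (cases "norm t < 1")
  case True
  then show ?thesis unfolding Fib_def using fibre_finite[OF var compact_slice] by blast
next
  case False
  then have "Fib t = {}" using sub tetrablock_3_less by (auto simp: Fib_def)
  then show ?thesis by simp
qed

lemma equations: obtains d1 d2 where "d1 \<noteq> 0" "d2 \<noteq> 0"
  "\<And>x. x \<in> \<Omega> \<Longrightarrow> poly (spec (x $ 3) d1) (x $ 1) = 0" "\<And>x. x \<in> \<Omega> \<Longrightarrow> poly (spec (x $ 3) d2) (x $ 2) = 0"
proof -
  obtain d1 where d1: "d1 \<noteq> 0" "\<forall>x\<in>\<Omega>. poly (spec (x $ 3) d1) (x $ 1) = 0"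
    using eliminate_second[OF var compact_slice] by blast
  obtain S' where S': "swap12 ` \<Omega> = zero_locus S' \<inter> tetrablock" using swap12_zero_locus[OF var] by blast
  obtain d2 where d2: "d2 \<noteq> 0" "\<forall>x\<in>swap12 ` \<Omega>. poly (spec (x $ 3) d2) (x $ 1) = 0"
    using eliminate_second[OF S' compact_swap_slice[OF compact_slice]] by blast
  show ?thesis by (rule that[OF d1(1) d2(1)]) (use d1(2) d2(2) in auto)
qed

end

section \<open>Boundary inner products\<close>

context dvar
begin

definition sumf :: "(complex ^ 3 \<Rightarrow> complex) \<Rightarrow> complex \<Rightarrow> complex" where
  "sumf h t = (\<Sum>x\<in>Fib t. h x)"

text \<open>\<open>B\<close> is enlarged by the zeros of the leading coefficients, so that off
  \<open>B\<close> every fibre has at most \<open>degree d1 * degree d2\<close> points.\<close>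

lemma sheets: obtains B m where "finite B" "\<And>t. t \<notin> B \<Longrightarrow> card (Fib t) \<le> m"
    "\<And>t0. t0 \<notin> B \<Longrightarrow> \<exists>\<delta>>0. \<exists>P. finite P \<and>
      (\<forall>(f, g)\<in>P. f holomorphic_on ball t0 \<delta> \<and> g holomorphic_on ball t0 \<delta>) \<and>
      (\<forall>t\<in>ball t0 \<delta>. norm t < 1 \<longrightarrow> (\<forall>h. sumf h t = (\<Sum>(f, g)\<in>P. h (vec3 (f t) (g t) t))))"
    "\<exists>t0. norm t0 < 1 \<and> t0 \<notin> B"
    "\<exists>d1 d2. (\<forall>t. t \<notin> B \<longrightarrow> poly (lead_coeff d1) t \<noteq> 0 \<and> poly (lead_coeff d2) t \<noteq> 0) \<and>
     (\<forall>x\<in>\<Omega>. poly (spec (x $ 3) d1) (x $ 1) = 0 \<and> poly (spec (x $ 3) d2) (x $ 2) = 0)"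
proof -
  obtain d1 d2 where d: "d1 \<noteq> 0" "d2 \<noteq> 0"
    "\<And>x. x \<in> \<Omega> \<Longrightarrow> poly (spec (x $ 3) d1) (x $ 1) = 0" "\<And>x. x \<in> \<Omega> \<Longrightarrow> poly (spec (x $ 3) d2) (x $ 2) = 0"
    by (rule equations) (rule that)
  obtain B where B: "finite B" "\<And>t0. t0 \<notin> B \<Longrightarrow> \<exists>\<delta>>0. \<exists>P. finite P \<and>
      (\<forall>(f, g)\<in>P. f holomorphic_on ball t0 \<delta> \<and> g holomorphic_on ball t0 \<delta>) \<and>
      (\<forall>t\<in>ball t0 \<delta>. inj_on (\<lambda>(f, g). vec3 (f t) (g t) t) P \<and>
         (norm t < 1 \<longrightarrow> {x\<in>\<Omega>. x $ 3 = t} = (\<lambda>(f, g). vec3 (f t) (g t) t) ` P))"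
    by (rule local_branches[OF var iso closure_interior d(1,2) d(3,4)]) (blast+)
  define B' where "B' = B \<union> {t. poly (lead_coeff d1) t = 0} \<union> {t. poly (lead_coeff d2) t = 0}"
  have fB: "finite B'" unfolding B'_def using B d by (intro finite_UnI poly_roots_finite) auto
  have card: "card (Fib t) \<le> degree d1 * degree d2" if t: "t \<notin> B'" for t
  proof -
    have *: "finite {x. poly (spec t p) x = 0} \<and> card {x. poly (spec t p) x = 0} \<le> degree p"
      if "poly (lead_coeff p) t \<noteq> 0" for p
    proof -
      have "spec t p \<noteq> 0" using that coeff_spec[of t p "degree p"] by force
      then show ?thesis using poly_roots_finite card_poly_roots_bound degree_spec[OF that] by metis
    qed
    have "Fib t \<subseteq> (\<lambda>(a, b). vec3 a b t) ` ({x. poly (spec t d1) x = 0} \<times> {x. poly (spec t d2) x = 0})" (is "_ \<subseteq> _ ` ?C")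
    proof
      fix x assume "x \<in> Fib t"
      then have x: "x \<in> \<Omega>" "x $ 3 = t" by (auto simp: Fib_def)
      have "x = vec3 (x $ 1) (x $ 2) t" using vec3_eta[of x] x by simp
      then show "x \<in> (\<lambda>(a, b). vec3 a b t) ` ?C"
        using d(3,4)[OF x(1)] x(2) by (intro image_eqI[of _ _ "(x $ 1, x $ 2)"]) auto
    qed
    moreover have "finite ?C" using * t by (auto simp: B'_def)
    ultimately have "card (Fib t) \<le> card ?C"
      by (meson card_image_le card_mono finite_imageI order_trans)
    also have "\<dots> \<le> degree d1 * degree d2"
      unfolding card_cartesian_product using *[of d1] *[of d2] t by (intro mult_mono) (auto simp: B'_def)
    finally show ?thesis .
  qed
  have br: "\<exists>\<delta>>0. \<exists>P. finite P \<and>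
      (\<forall>(f, g)\<in>P. f holomorphic_on ball t0 \<delta> \<and> g holomorphic_on ball t0 \<delta>) \<and>
      (\<forall>t\<in>ball t0 \<delta>. norm t < 1 \<longrightarrow> (\<forall>h. sumf h t = (\<Sum>(f, g)\<in>P. h (vec3 (f t) (g t) t))))" if tB: "t0 \<notin> B'" for t0
  proof -
    obtain \<delta> P where P: "\<delta> > 0" "finite P" "\<forall>(f, g)\<in>P. f holomorphic_on ball t0 \<delta> \<and> g holomorphic_on ball t0 \<delta>"
      "\<forall>t\<in>ball t0 \<delta>. inj_on (\<lambda>(f, g). vec3 (f t) (g t) t) P \<and>
         (norm t < 1 \<longrightarrow> {x\<in>\<Omega>. x $ 3 = t} = (\<lambda>(f, g). vec3 (f t) (g t) t) ` P)"
    proof -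
      have "t0 \<notin> B" using tB by (simp add: B'_def)
      from B(2)[OF this] show ?thesis using that by blast
    qed
    have "sumf h t = (\<Sum>(f, g)\<in>P. h (vec3 (f t) (g t) t))" if t: "t \<in> ball t0 \<delta>" "norm t < 1" for t h
    proof -
      have "sumf h t = sum h ((\<lambda>(f, g). vec3 (f t) (g t) t) ` P)"
        using bspec[OF P(4) t(1)] t(2) by (simp add: sumf_def Fib_def)
      also have "\<dots> = (\<Sum>(f, g)\<in>P. h (vec3 (f t) (g t) t))"
        using bspec[OF P(4) t(1)] by (subst sum.reindex) (auto simp: case_prod_unfold)
      finally show ?thesis .
    qed
    then show ?thesis using P(1-3) by blast
  qed
  have "\<exists>t0. norm t0 < 1 \<and> t0 \<notin> B'"
  proof -
    have "infinite (ball (0::complex) 1)" using uncountable_ball[of 1 "0::complex"] uncountable_infinite by simp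
    then have "ball (0::complex) 1 - B' \<noteq> {}" using fB infinite_imp_nonempty Diff_infinite_finite by metis
    then show ?thesis by auto
  qed
  then show ?thesis using that[OF fB card br] d(3,4) by (auto simp: B'_def)
qed

text \<open>Bundled into a predicate so that one choice of \<open>B\<close> and \<open>m\<close> can
  be fixed as locale parameters.\<close>

definition sheet_data :: "complex set \<Rightarrow> nat \<Rightarrow> bool" where
  "sheet_data B m \<longleftrightarrow> finite B \<and> (\<forall>t. t \<notin> B \<longrightarrow> card (Fib t) \<le> m) \<and>
    (\<forall>t0. t0 \<notin> B \<longrightarrow> (\<exists>\<delta>>0. \<exists>P. finite P \<and>
      (\<forall>(f, g)\<in>P. f holomorphic_on ball t0 \<delta> \<and> g holomorphic_on ball t0 \<delta>) \<and>
      (\<forall>t\<in>ball t0 \<delta>. norm t < 1 \<longrightarrow> (\<forall>h. sumf h t = (\<Sum>(f, g)\<in>P. h (vec3 (f t) (g t) t)))))) \<and>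
    (\<exists>t0. norm t0 < 1 \<and> t0 \<notin> B) \<and>
    (\<exists>d1 d2. (\<forall>t. t \<notin> B \<longrightarrow> poly (lead_coeff d1) t \<noteq> 0 \<and> poly (lead_coeff d2) t \<noteq> 0) \<and>
     (\<forall>x\<in>\<Omega>. poly (spec (x $ 3) d1) (x $ 1) = 0 \<and> poly (spec (x $ 3) d2) (x $ 2) = 0))"

lemma sheet_data_ex: "\<exists>B m. sheet_data B m"
proof -
  obtain B m where "sheet_data B m" unfolding sheet_data_def by (rule sheets) blast
  then show ?thesis by blast
qed

end

locale dvar_sheets = dvar +
  fixes B m assumes sheet: "sheet_data B m"
begin

lemma B_finite: "finite B" and card_Fib: "t \<notin> B \<Longrightarrow> card (Fib t) \<le> m"
  using sheet by (auto simp: sheet_data_def)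

lemma branch: assumes "t0 \<notin> B"
  obtains \<delta> P where "\<delta> > 0" "finite P" "\<And>f g. (f, g) \<in> P \<Longrightarrow> f holomorphic_on ball t0 \<delta>"
    "\<And>f g. (f, g) \<in> P \<Longrightarrow> g holomorphic_on ball t0 \<delta>"
    "\<And>t h. t \<in> ball t0 \<delta> \<Longrightarrow> norm t < 1 \<Longrightarrow> sumf h t = (\<Sum>(f, g)\<in>P. h (vec3 (f t) (g t) t))"
proof -
  from sheet assms have "\<exists>\<delta>>0. \<exists>P. finite P \<and>
      (\<forall>(f, g)\<in>P. f holomorphic_on ball t0 \<delta> \<and> g holomorphic_on ball t0 \<delta>) \<and>
      (\<forall>t\<in>ball t0 \<delta>. norm t < 1 \<longrightarrow> (\<forall>h. sumf h t = (\<Sum>(f, g)\<in>P. h (vec3 (f t) (g t) t))))"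
    unfolding sheet_data_def by blast
  then obtain \<delta> P where P: "\<delta> > 0" "finite P" "\<forall>(f, g)\<in>P. f holomorphic_on ball t0 \<delta> \<and> g holomorphic_on ball t0 \<delta>"
    "\<forall>t\<in>ball t0 \<delta>. norm t < 1 \<longrightarrow> (\<forall>h. sumf h t = (\<Sum>(f, g)\<in>P. h (vec3 (f t) (g t) t)))" by blast
  show ?thesis by (rule that[OF P(1,2)]) (use P(3,4) in auto)
qed

lemma branch_sum_continuous:
  assumes P: "finite P" "\<And>f g. (f, g) \<in> P \<Longrightarrow> f holomorphic_on U" "\<And>f g. (f, g) \<in> P \<Longrightarrow> g holomorphic_on U"
    and h: "continuous_on UNIV h"
  shows "continuous_on U (\<lambda>t. \<Sum>(f, g)\<in>P. h (vec3 (f t) (g t) t) :: complex)"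
  unfolding case_prod_unfold
proof (intro continuous_on_sum)
  fix p assume "p \<in> P"
  then have "continuous_on U (\<lambda>t. vec3 (fst p t) (snd p t) t)"
    using P(2,3)[of "fst p" "snd p"] by (intro continuous_on_vec3 holomorphic_on_imp_continuous_on continuous_on_id) auto
  then show "continuous_on U (\<lambda>t. h (vec3 (fst p t) (snd p t) t))"
    by (rule continuous_on_compose2[OF h]) auto
qed

lemma sumf_continuous: assumes h: "continuous_on UNIV h" shows "continuous_on (ball 0 1 - B) (sumf h)"
proof (rule continuous_at_imp_continuous_on, intro ballI)
  fix t0 assume t0: "t0 \<in> ball 0 1 - B"
  obtain \<delta> P where P: "\<delta> > 0" "finite P" "\<And>f g. (f, g) \<in> P \<Longrightarrow> f holomorphic_on ball t0 \<delta>"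
    "\<And>f g. (f, g) \<in> P \<Longrightarrow> g holomorphic_on ball t0 \<delta>"
    "\<And>t h. t \<in> ball t0 \<delta> \<Longrightarrow> norm t < 1 \<Longrightarrow> sumf h t = (\<Sum>(f, g)\<in>P. h (vec3 (f t) (g t) t))"
    using branch[of t0] t0 by blast
  have "continuous_on (ball t0 \<delta> \<inter> ball 0 1) (\<lambda>t. \<Sum>(f, g)\<in>P. h (vec3 (f t) (g t) t))"
    by (rule continuous_on_subset[OF branch_sum_continuous[OF P(2-4) h]]) auto
  then have "continuous_on (ball t0 \<delta> \<inter> ball 0 1) (sumf h)"
    by (rule continuous_on_eq) (use P(5) in auto)
  then show "continuous (at t0) (sumf h)"
    by (rule continuous_on_interior) (use t0 P(1) in \<open>auto simp: interior_open\<close>)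
qed

lemma sumf_holomorphic: "sumf (poly3 p) holomorphic_on (ball 0 1 - B)"
proof -
  have op: "open (ball 0 1 - B)" using B_finite by (simp add: finite_imp_closed open_Diff)
  have "sumf (poly3 p) field_differentiable at t0" if t0: "t0 \<in> ball 0 1 - B" for t0
  proof -
    obtain \<delta> P where P: "\<delta> > 0" "finite P" "\<And>f g. (f, g) \<in> P \<Longrightarrow> f holomorphic_on ball t0 \<delta>"
      "\<And>f g. (f, g) \<in> P \<Longrightarrow> g holomorphic_on ball t0 \<delta>"
      "\<And>t h. t \<in> ball t0 \<delta> \<Longrightarrow> norm t < 1 \<Longrightarrow> sumf h t = (\<Sum>(f, g)\<in>P. h (vec3 (f t) (g t) t))"
      using branch[of t0] t0 by blast
    have "(\<lambda>t. \<Sum>(f, g)\<in>P. poly3 p (vec3 (f t) (g t) t)) holomorphic_on ball t0 \<delta>"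
      unfolding case_prod_unfold using P(3,4) by (intro holomorphic_intros holomorphic_poly3) auto
    then have "(\<lambda>t. \<Sum>(f, g)\<in>P. poly3 p (vec3 (f t) (g t) t)) holomorphic_on (ball t0 \<delta> \<inter> ball 0 1)"
      by (rule holomorphic_on_subset) auto
    then have "sumf (poly3 p) holomorphic_on (ball t0 \<delta> \<inter> ball 0 1)"
      by (rule holomorphic_transform) (use P(5) in auto)
    then show ?thesis
      by (rule holomorphic_on_imp_differentiable_at) (use t0 P(1) in auto)
  qed
  then show ?thesis using op by (simp add: holomorphic_on_def field_differentiable_at_within)
qed

text \<open>The branches at \<open>t0\<close> are holomorphic on a full disc around it, so the
  branch sum is continuous at \<open>t0\<close> although the variety stops at the unit
  circle.\<close>

lemma sumf_boundary_limit: assumes h: "continuous_on UNIV h" and t0: "norm t0 = 1" "t0 \<notin> B"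
  shows "\<exists>l. (sumf h \<longlongrightarrow> l) (at t0 within ball 0 1)"
proof -
  obtain \<delta> P where P: "\<delta> > 0" "finite P" "\<And>f g. (f, g) \<in> P \<Longrightarrow> f holomorphic_on ball t0 \<delta>"
    "\<And>f g. (f, g) \<in> P \<Longrightarrow> g holomorphic_on ball t0 \<delta>"
    "\<And>t h. t \<in> ball t0 \<delta> \<Longrightarrow> norm t < 1 \<Longrightarrow> sumf h t = (\<Sum>(f, g)\<in>P. h (vec3 (f t) (g t) t))"
    using branch[of t0] t0 by blast
  let ?s = "\<lambda>t. \<Sum>(f, g)\<in>P. h (vec3 (f t) (g t) t)"
  have "continuous_on (ball t0 \<delta>) ?s" using branch_sum_continuous[OF P(2-4) h] .
  then have "isCont ?s t0" using P(1) by (simp add: continuous_on_eq_continuous_at)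
  then have "(?s \<longlongrightarrow> ?s t0) (at t0)" by (rule isContD)
  then have 1: "(?s \<longlongrightarrow> ?s t0) (at t0 within ball 0 1)" by (rule tendsto_within_subset) simp
  have "\<forall>\<^sub>F t in at t0 within ball 0 1. ?s t = sumf h t"
    unfolding eventually_at using P(1,5) by (intro exI[of _ \<delta>]) (auto simp: dist_commute)
  then show ?thesis using Lim_transform_eventually[OF 1] by blast
qed

text \<open>Radii increasing to 1 whose circles avoid the exceptional set.\<close>

definition "\<eta> = Max (insert 0 {norm b | b. b \<in> B \<and> norm b < 1})"
definition "rad k = 1 - (1 - \<eta>) / real (Suc (Suc k))"

lemma eta: "0 \<le> \<eta>" "\<eta> < 1" "\<And>b. b \<in> B \<Longrightarrow> norm b < 1 \<Longrightarrow> norm b \<le> \<eta>"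
proof -
  have f: "finite (insert 0 {norm b | b. b \<in> B \<and> norm b < 1})"
    using B_finite by (intro finite.insertI) (rule finite_subset[of _ "norm ` B"], auto)
  show "0 \<le> \<eta>" unfolding \<eta>_def using f by (intro Max_ge) auto
  show "\<eta> < 1" unfolding \<eta>_def using f by (subst Max_less_iff) auto
  show "norm b \<le> \<eta>" if "b \<in> B" "norm b < 1" for b
    unfolding \<eta>_def using f that by (intro Max_ge) auto
qed

lemma rad: "\<eta> < rad k" "rad k < 1" "0 < rad k"
proof -
  have "(1 - \<eta>) / real (Suc (Suc k)) \<le> (1 - \<eta>) / 2" using eta by (intro divide_left_mono) auto
  also have "\<dots> < 1 - \<eta>" using eta by simp
  finally show "\<eta> < rad k" by (simp add: rad_def)
  then show "0 < rad k" using eta by simp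
  show "rad k < 1" using eta by (simp add: rad_def)
qed

lemma rad_lim: "rad \<longlonglongrightarrow> 1"
proof -
  have "(\<lambda>k. (1 - \<eta>) / real (Suc (Suc k))) \<longlonglongrightarrow> 0"
    using LIMSEQ_Suc[OF LIMSEQ_Suc[OF lim_const_over_n[of "1 - \<eta>"]]] by simp
  then have "(\<lambda>k. 1 - (1 - \<eta>) / real (Suc (Suc k))) \<longlonglongrightarrow> 1 - 0" by (intro tendsto_intros)
  then show ?thesis by (simp add: rad_def[abs_def])
qed

definition "pt k \<theta> = circlepath 0 (rad k) \<theta>"

lemma pt: "pt k \<theta> = of_real (rad k) * exp (2 * of_real pi * \<i> * of_real \<theta>)"
  by (simp add: pt_def circlepath)

lemma norm_pt: "norm (pt k \<theta>) = rad k"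
  using rad(3)[of k] by (simp add: pt norm_mult)

lemma pt_disc: "pt k \<theta> \<in> ball 0 1 - B"
  using norm_pt[of k \<theta>] rad[of k] eta(3) by fastforce

lemma pt_continuous: "continuous_on A (pt k)"
  unfolding pt[abs_def] by (intro continuous_intros)

definition "J k h = integral {0..1} (\<lambda>\<theta>. sumf h (pt k \<theta>))"
text \<open>Plays the part of integration against a positive measure on the points of the closure
  with |x3| = 1, made from arc length on the circle and counting measure on the fibres, without such
  a measure being constructed.\<close>

definition "\<Lambda> h = lim (\<lambda>k. J k h)"

lemma bounded_on_closure: assumes "continuous_on UNIV (h :: complex^3 \<Rightarrow> complex)"
  obtains C where "C \<ge> 0" "\<And>x. x \<in> \<Omega> \<Longrightarrow> norm (h x) \<le> C"
proof -
  have "compact (h ` closure \<Omega>)"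
    by (rule compact_continuous_image[OF continuous_on_subset[OF assms] compact_closure_Omega]) simp
  then have "bounded (h ` closure \<Omega>)" by (rule compact_imp_bounded)
  then obtain C where C: "\<And>x. x \<in> closure \<Omega> \<Longrightarrow> norm (h x) \<le> C" unfolding bounded_iff by blast
  show ?thesis
  proof (rule that[of "\<bar>C\<bar>"])
    show "norm (h x) \<le> \<bar>C\<bar>" if "x \<in> \<Omega>" for x
      using C[of x] subsetD[OF closure_subset that] by linarith
  qed simp
qed

lemma sumf_bound: assumes "\<And>x. x \<in> \<Omega> \<Longrightarrow> norm (h x) \<le> C" "t \<notin> B" "C \<ge> 0"
  shows "norm (sumf h t) \<le> real m * C"
proof -
  have "norm (sumf h t) \<le> (\<Sum>x\<in>Fib t. C)" unfolding sumf_def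
    by (rule sum_norm_le) (use assms in \<open>auto simp: Fib_def\<close>)
  also have "\<dots> = real (card (Fib t)) * C" by simp
  also have "\<dots> \<le> real m * C" using card_Fib[OF assms(2)] assms(3) by (intro mult_right_mono) auto
  finally show ?thesis .
qed

lemma J_integrable: assumes "continuous_on UNIV h" shows "(\<lambda>\<theta>. sumf h (pt k \<theta>)) integrable_on {0..1}"
proof (rule integrable_continuous_real)
  show "continuous_on {0..1} (\<lambda>\<theta>. sumf h (pt k \<theta>))"
    by (rule continuous_on_compose2[OF sumf_continuous[OF assms] pt_continuous]) (use pt_disc in blast)
qed

lemma finite_exceptional: "finite {\<theta>\<in>{0..1}. exp (2 * of_real pi * \<i> * of_real \<theta>) \<in> B}"
proof -
  let ?e = "\<lambda>\<theta>::real. exp (2 * of_real pi * \<i> * of_real \<theta>) :: complex"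
  have "inj_on ?e {0..<1}"
  proof (rule inj_onI)
    fix s t :: real assume st: "s \<in> {0..<1}" "t \<in> {0..<1}" "?e s = ?e t"
    then obtain n :: int where "2 * of_real pi * \<i> * of_real s = 2 * of_real pi * \<i> * of_real t + of_real (of_int (2 * n) * pi) * \<i>"
      unfolding exp_eq by blast
    then have "(2 * of_real pi * \<i>) * of_real s = (2 * of_real pi * \<i>) * (of_real t + of_int n)" by (simp add: algebra_simps)
    then have "(of_real s :: complex) = of_real t + of_int n" by simp
    then have "s = t + of_int n" by (metis of_real_add of_real_eq_iff of_real_of_int_eq)
    moreover have "n = 0" using calculation st by (auto simp: )
    ultimately show "s = t" by simp
  qed
  then have "finite (?e -` B \<inter> {0..<1})" using B_finite finite_vimage_IntI by blast
  then have "finite (insert 1 (?e -` B \<inter> {0..<1}))" by simp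
  then show ?thesis by (rule finite_subset[rotated]) (auto simp: less_le)
qed

text \<open>Dominated convergence in the angle: the sums converge along every radius not ending in
  \<open>B\<close> and are bounded by \<open>m\<close> times a bound for \<open>h\<close>.\<close>

lemma J_convergent: assumes h: "continuous_on UNIV h" shows "(\<lambda>k. J k h) \<longlonglongrightarrow> \<Lambda> h"
proof -
  define N where "N = {\<theta>\<in>{0..1::real}. exp (2 * of_real pi * \<i> * of_real \<theta>) \<in> B}"
  have N: "finite N" unfolding N_def by (rule finite_exceptional)
  \<comment> \<open>The finitely many bad angles get the value 0, so that limits exist at every
    angle; the integrals do not change.\<close>
  define F where "F k \<theta> = (if \<theta> \<in> N then 0 else sumf h (pt k \<theta>))" for k \<theta>
  obtain C where C: "C \<ge> 0" "\<And>x. x \<in> \<Omega> \<Longrightarrow> norm (h x) \<le> C"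
    by (rule bounded_on_closure[OF h]) (rule that)
  have ex: "\<exists>l. (\<lambda>k. F k \<theta>) \<longlonglongrightarrow> l" if \<theta>: "\<theta> \<in> {0..1}" for \<theta>
  proof (cases "\<theta> \<in> N")
    case True then show ?thesis by (auto simp: F_def)
  next
    case False
    let ?t = "exp (2 * of_real pi * \<i> * of_real \<theta>) :: complex"
    have t: "norm ?t = 1" "?t \<notin> B" using False \<theta> by (auto simp: N_def)
    obtain l where l: "(sumf h \<longlongrightarrow> l) (at ?t within ball 0 1)" using sumf_boundary_limit[OF h t] by blast
    have "(\<lambda>k. of_real (rad k) * ?t) \<longlonglongrightarrow> of_real 1 * ?t" by (intro tendsto_intros rad_lim)
    then have "(\<lambda>k. pt k \<theta>) \<longlonglongrightarrow> ?t" by (simp add: pt)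
    moreover have "\<forall>\<^sub>F k in sequentially. pt k \<theta> \<in> ball 0 1 \<and> pt k \<theta> \<noteq> ?t"
      using pt_disc[of _ \<theta>] norm_pt[of _ \<theta>] rad(2) t(1) by (intro always_eventually allI conjI) (blast, metis less_irrefl)
    ultimately have "filterlim (\<lambda>k. pt k \<theta>) (at ?t within ball 0 1) sequentially"
      by (auto simp: filterlim_at)
    then have "(\<lambda>k. sumf h (pt k \<theta>)) \<longlonglongrightarrow> l" using l filterlim_compose by blast
    then show ?thesis using False by (auto simp: F_def)
  qed
  then obtain g where g: "\<And>\<theta>. \<theta> \<in> {0..1} \<Longrightarrow> (\<lambda>k. F k \<theta>) \<longlonglongrightarrow> g \<theta>" by metis
  have spike: "integral {0..1} (F k) = J k h" "F k integrable_on {0..1}" for k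
  proof -
    show "integral {0..1} (F k) = J k h" unfolding J_def
      by (rule integral_spike[of N]) (use N negligible_finite in \<open>auto simp: F_def\<close>)
    show "F k integrable_on {0..1}"
      by (rule integrable_spike[OF J_integrable[OF h, of k], of N]) (use N negligible_finite in \<open>auto simp: F_def\<close>)
  qed
  have "(\<lambda>k. integral {0..1} (F k)) \<longlonglongrightarrow> integral {0..1} g"
  proof (rule dominated_convergence(2))
    show "(\<lambda>_. real m * C) integrable_on {0..1::real}" by (intro integrable_continuous_real continuous_on_const)
    show "norm (F k \<theta>) \<le> real m * C" for k \<theta>
      using sumf_bound[OF C(2) _ C(1)] pt_disc[of k \<theta>] C(1) by (auto simp: F_def)
  qed (use spike g in auto)
  then have "(\<lambda>k. J k h) \<longlonglongrightarrow> integral {0..1} g" by (simp add: spike)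
  then show ?thesis unfolding \<Lambda>_def by (metis limI)
qed

lemma \<Lambda>_eqI: "continuous_on UNIV h \<Longrightarrow> (\<lambda>k. J k h) \<longlonglongrightarrow> l \<Longrightarrow> \<Lambda> h = l"
  using J_convergent LIMSEQ_unique by blast

lemma \<Lambda>_add: assumes "continuous_on UNIV f" "continuous_on UNIV g"
  shows "\<Lambda> (\<lambda>x. f x + g x) = \<Lambda> f + \<Lambda> g"
proof (rule \<Lambda>_eqI)
  have "J k (\<lambda>x. f x + g x) = J k f + J k g" for k
    unfolding J_def sumf_def sum.distrib
    by (rule integral_add) (use J_integrable[OF assms(1)] J_integrable[OF assms(2)] in \<open>auto simp: sumf_def\<close>)
  then show "(\<lambda>k. J k (\<lambda>x. f x + g x)) \<longlonglongrightarrow> \<Lambda> f + \<Lambda> g"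
    using tendsto_add[OF J_convergent[OF assms(1)] J_convergent[OF assms(2)]] by simp
qed (use assms in \<open>intro continuous_intros\<close>)

lemma \<Lambda>_scale: assumes "continuous_on UNIV f" shows "\<Lambda> (\<lambda>x. c * f x) = c * \<Lambda> f"
proof (rule \<Lambda>_eqI)
  have "J k (\<lambda>x. c * f x) = c * J k f" for k
    unfolding J_def sumf_def sum_distrib_left[symmetric] by (rule integral_mult_right)
  then show "(\<lambda>k. J k (\<lambda>x. c * f x)) \<longlonglongrightarrow> c * \<Lambda> f"
    using tendsto_mult[OF tendsto_const J_convergent[OF assms]] by simp
qed (use assms in \<open>intro continuous_intros\<close>)

lemma \<Lambda>_cnj: assumes "continuous_on UNIV f" shows "\<Lambda> (\<lambda>x. cnj (f x)) = cnj (\<Lambda> f)"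
proof (rule \<Lambda>_eqI)
  have "J k (\<lambda>x. cnj (f x)) = cnj (J k f)" for k
    unfolding J_def sumf_def cnj_sum[symmetric] by (rule integral_cnj[symmetric])
  then show "(\<lambda>k. J k (\<lambda>x. cnj (f x))) \<longlonglongrightarrow> cnj (\<Lambda> f)"
    using tendsto_cnj[OF J_convergent[OF assms]] by simp
qed (use assms in \<open>intro continuous_intros\<close>)

text \<open>Otherwise points with \<open>h x \<le> - \<epsilon>\<close> would have |x3| arbitrarily
  close to 1, and on the compact set of such points of the closure the maximum of |x3| would be 1,
  where \<open>h\<close> is nonnegative.\<close>

lemma near_boundary: assumes h: "continuous_on UNIV (h :: complex^3 \<Rightarrow> real)"
  and pos: "\<And>x. x \<in> closure \<Omega> \<Longrightarrow> norm (x $ 3) = 1 \<Longrightarrow> h x \<ge> 0" and e: "\<epsilon> > 0"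
  shows "\<exists>r<1. \<forall>x\<in>\<Omega>. norm (x $ 3) > r \<longrightarrow> h x > - \<epsilon>"
proof (rule ccontr)
  assume neg: "\<not> ?thesis"
  let ?K = "closure \<Omega> \<inter> {x. h x \<le> - \<epsilon>}"
  have cl: "closed {x. h x \<le> - \<epsilon>}" using h by (intro closed_Collect_le continuous_intros)
  have K: "compact ?K" using compact_Int_closed[OF compact_closure_Omega cl] .
  have "\<exists>x\<in>\<Omega>. norm (x $ 3) > r \<and> h x \<le> - \<epsilon>" if "r < 1" for r using neg that by (meson not_less)
  then have ex: "\<exists>x\<in>?K. norm (x $ 3) > r" if "r < 1" for r
    using that subsetD[OF closure_subset, of _ \<Omega>] by fastforce
  have "?K \<noteq> {}" using ex[of 0] by auto
  then obtain x where x: "x \<in> ?K" "\<And>y. y \<in> ?K \<Longrightarrow> norm (y $ 3) \<le> norm (x $ 3)"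
  proof -
    have "continuous_on ?K (\<lambda>x. norm (x $ 3))" by (intro continuous_intros)
    then show ?thesis using continuous_attains_sup[OF K \<open>?K \<noteq> {}\<close>] that by blast
  qed
  have "norm (x $ 3) \<le> 1" using closure_tetrablock_nth_le(3) x closure_sub by blast
  moreover have "\<not> norm (x $ 3) < 1" using ex[of "norm (x $ 3)"] x(2) by force
  ultimately have "h x \<ge> 0" using pos[of x] x(1) by simp
  then show False using x e by simp
qed

lemma \<Lambda>_nonneg: assumes h: "continuous_on UNIV h" and pos: "\<And>x. x \<in> closure \<Omega> \<Longrightarrow> norm (x $ 3) = 1 \<Longrightarrow> 0 \<le> Re (h x)"
  shows "0 \<le> Re (\<Lambda> h)"
proof (rule field_le_epsilon)
  fix e :: real assume e: "e > 0"
  \<comment> \<open>A fibre has at most \<open>m\<close> points, so their total error is at most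
    \<open>e\<close>.\<close>
  define \<epsilon> where "\<epsilon> = e / (real m + 1)"
  have eps: "\<epsilon> > 0" "real m * \<epsilon> \<le> e" using e by (simp_all add: \<epsilon>_def field_simps)
  obtain r where r: "r < 1" "\<And>x. x \<in> \<Omega> \<Longrightarrow> norm (x $ 3) > r \<Longrightarrow> Re (h x) > - \<epsilon>"
    using near_boundary[of "\<lambda>x. Re (h x)" \<epsilon>] h pos eps(1) by (auto intro!: continuous_intros)
  have "\<forall>\<^sub>F k in sequentially. rad k > r" using rad_lim r(1) by (rule order_tendstoD)
  then have "\<forall>\<^sub>F k in sequentially. - e \<le> Re (J k h)"
  proof eventually_elim
    case (elim k)
    have low: "- e \<le> Re (sumf h (pt k \<theta>))" for \<theta>
    proof -
      have "(\<Sum>x\<in>Fib (pt k \<theta>). - \<epsilon>) \<le> (\<Sum>x\<in>Fib (pt k \<theta>). Re (h x))"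
        using r(2) elim norm_pt[of k \<theta>] by (intro sum_mono less_imp_le) (auto simp: Fib_def)
      moreover have "(\<Sum>x\<in>Fib (pt k \<theta>). - \<epsilon>) \<ge> - e"
      proof -
        have "real (card (Fib (pt k \<theta>))) * \<epsilon> \<le> real m * \<epsilon>"
          using card_Fib[of "pt k \<theta>"] pt_disc[of k \<theta>] eps(1) by (intro mult_right_mono) auto
        from order_trans[OF this eps(2)] show ?thesis by simp
      qed
      ultimately show ?thesis by (simp add: sumf_def)
    qed
    have hi: "((\<lambda>\<theta>. sumf h (pt k \<theta>)) has_integral J k h) {0..1}"
      unfolding J_def using J_integrable[OF h] by (rule integrable_integral)
    have "((\<lambda>\<theta>. Re (sumf h (pt k \<theta>))) has_integral Re (J k h)) {0..1}"
      using has_integral_linear[OF hi bounded_linear_Re] by (simp add: o_def)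
    moreover have "((\<lambda>\<theta>. - e) has_integral - e) {0..1::real}"
      using has_integral_const_real[of "- e" 0 1] by simp
    ultimately show ?case using low has_integral_le by blast
  qed
  moreover have "(\<lambda>k. Re (J k h)) \<longlonglongrightarrow> Re (\<Lambda> h)" by (intro tendsto_Re J_convergent h)
  ultimately have "- e \<le> Re (\<Lambda> h)" by (intro tendsto_lowerbound[of "\<lambda>k. Re (J k h)"]) auto
  then show "0 \<le> Re (\<Lambda> h) + e" by simp
qed

text \<open>\<open>\<Lambda>_nonneg\<close> applies to \<open>c * h\<close> for every scalar
  \<open>c\<close>; the values 1, -1, i and -i pin down both parts of
  \<open>\<Lambda> h\<close>.\<close>

lemma \<Lambda>_zero: assumes h: "continuous_on UNIV h" and z: "\<And>x. x \<in> closure \<Omega> \<Longrightarrow> norm (x $ 3) = 1 \<Longrightarrow> h x = 0"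
  shows "\<Lambda> h = 0"
proof -
  have *: "0 \<le> Re (c * \<Lambda> h)" for c
    using \<Lambda>_nonneg[of "\<lambda>x. c * h x"] \<Lambda>_scale[OF h, of c] h z by (simp add: continuous_intros)
  show ?thesis using *[of 1] *[of "-1"] *[of \<i>] *[of "-\<i>"] by (simp add: complex_eq_iff)
qed

lemma \<Lambda>_zero_interior: assumes h: "continuous_on UNIV h" and z: "\<And>x. x \<in> \<Omega> \<Longrightarrow> h x = 0"
  shows "\<Lambda> h = 0"
proof (rule \<Lambda>_eqI[OF h])
  have "J k h = 0" for k unfolding J_def sumf_def using z by (simp add: Fib_def)
  then show "(\<lambda>k. J k h) \<longlonglongrightarrow> 0" by simp
qed

end

section \<open>Linear functionals on the polynomial ring\<close>

lemma poly3_ring_induct: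
  assumes K: "\<And>c. P (K3 c)" and add: "\<And>p q. P p \<Longrightarrow> P q \<Longrightarrow> P (p + q)"
    and X: "\<And>p. P p \<Longrightarrow> P (X3 * p)" and Y: "\<And>p. P p \<Longrightarrow> P (Y3 * p)" and T: "\<And>p. P p \<Longrightarrow> P (T3 * p)"
  shows "P p"
proof -
  have 0: "P 0" using K[of 0] by (simp add: K3_def)
  have 1: "P [:[:b:]:]" for b
  proof (induction b)
    case (pCons c b)
    have "[:[:pCons c b:]:] = K3 c + X3 * [:[:b:]:]" by (simp add: K3_def X3_def)
    then show ?case using pCons K add X by metis
  qed (use 0 in simp)
  have 2: "P [:a:]" for a
  proof (induction a)
    case (pCons b a)
    have "[:pCons b a:] = [:[:b:]:] + Y3 * [:a:]" by (simp add: Y3_def)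
    then show ?case using pCons 1 add Y by metis
  qed (use 0 in simp)
  show ?thesis
  proof (induction p)
    case (pCons a p)
    have "pCons a p = [:a:] + T3 * p" by (simp add: T3_def)
    then show ?case using pCons 2 add T by metis
  qed (use 0 in simp)
qed

lemma K3_hom: "K3 (a + b) = K3 a + K3 b" "K3 (a * b) = K3 a * K3 b" "K3 1 = 1" "K3 0 = 0"
  by (simp_all add: K3_def flip: one_pCons)

text \<open>Used to recognise the functional built from a left eigenvector as a multiple of a point
  evaluation.\<close>

lemma functional_evaluation:
  assumes add: "\<And>p q. \<phi> (p + q) = \<phi> p + \<phi> q" and K: "\<And>c p. \<phi> (K3 c * p) = c * \<phi> p"
    and X: "\<And>p. \<phi> (X3 * p) = x $ 1 * \<phi> p" and Y: "\<And>p. \<phi> (Y3 * p) = x $ 2 * \<phi> p" and T: "\<And>p. \<phi> (T3 * p) = x $ 3 * \<phi> p"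
  shows "\<phi> p = poly3 p x * (\<phi> 1 :: complex)"
proof (rule poly3_ring_induct[where P = "\<lambda>p. \<phi> p = poly3 p x * \<phi> 1"])
  show "\<phi> (K3 c) = poly3 (K3 c) x * \<phi> 1" for c using K[of c 1] by simp
qed (simp_all add: add X Y T distrib_right mult.assoc)

text \<open>Coordinate \<open>W\<close> is integral over \<open>T\<close> at \<open>t0\<close>, so only its powers below the degree of the
  equation matter modulo \<open>T - t0\<close>.\<close>

lemma functional_reduction:
  fixes q :: "complex poly poly"
  assumes add: "\<And>p q. \<phi> (p + q) = \<phi> p + \<phi> q" and K: "\<And>c p. \<phi> (K3 c * p) = c * \<phi> p"
    and T: "\<And>p. \<phi> (T3 * p) = t0 * \<phi> p" and null: "\<And>p. (\<And>x. x \<in> \<Omega> \<Longrightarrow> poly3 p x = 0) \<Longrightarrow> \<phi> p = (0::complex)"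
    and W: "\<And>x. poly3 W x = w x" and q: "\<And>x. x \<in> \<Omega> \<Longrightarrow> poly (spec (x $ 3) q) (w x) = 0"
    and lc: "poly (lead_coeff q) t0 \<noteq> 0"
    and low: "\<And>i. i < degree q \<Longrightarrow> \<phi> (W ^ i * p) = 0"
  shows "\<phi> (W ^ i * p) = 0"
proof (induction i rule: less_induct)
  case (less i)
  show ?case
  proof (cases "i < degree q")
    case True then show ?thesis by (rule low)
  next
    case False
    define n where "n = degree q"
    define p' where "p' = W ^ (i - n) * p"
    define embT where "embT a = (\<Sum>l\<le>degree a. K3 (coeff a l) * T3 ^ l)" for a
    \<comment> \<open>The equation \<open>q\<close> written inside the ring, with \<open>T3\<close>
      and \<open>W\<close> for its variables. It vanishes on \<open>\<Omega>\<close>, so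
      \<open>\<phi>\<close> kills its multiples, which expresses the value at \<open>W ^ i\<close>
      through lower powers.\<close>
    define E where "E = (\<Sum>j\<le>n. embT (coeff q j) * W ^ j)"
    have zero: "\<phi> 0 = 0" using add[of 0 0] by simp
    have sum: "\<phi> (sum f A) = (\<Sum>a\<in>A. \<phi> (f a))" for f and A :: "nat set"
      by (induction A rule: infinite_finite_induct) (auto simp: zero add)
    have Tp: "\<phi> (T3 ^ l * r) = t0 ^ l * \<phi> r" for l r
      by (induction l) (auto simp: T mult.assoc)
    have emb: "\<phi> (embT a * r) = poly a t0 * \<phi> r" for a r
      unfolding embT_def sum_distrib_right sum poly_altdef
      by (rule sum.cong[OF refl]) (simp add: mult.assoc K Tp)
    have p3sum: "poly3 (sum f A) x = (\<Sum>a\<in>A. poly3 (f a) x)" for f x and A :: "nat set"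
      by (induction A rule: infinite_finite_induct) auto
    have p3pow: "poly3 (r ^ l) x = poly3 r x ^ l" for r l x by (induction l) auto
    have emb3: "poly3 (embT a) x = poly a (x $ 3)" for a x
      unfolding embT_def p3sum poly_altdef by (simp add: p3pow)
    have big: "poly r y = (\<Sum>k\<le>m. coeff r k * y ^ k)" if "degree r \<le> m" for r :: "complex poly" and m y
      unfolding poly_altdef by (rule sum.mono_neutral_left) (use that in \<open>auto simp: coeff_eq_0\<close>)
    have "degree (spec t q) \<le> n" for t unfolding spec_def n_def by (rule degree_map_poly_le)
    then have sp: "poly (spec t q) y = (\<Sum>k\<le>n. poly (coeff q k) t * y ^ k)" for t y
      using big[of "spec t q" n y] by (simp add: coeff_spec)
    have "poly3 (E * p') x = 0" if "x \<in> \<Omega>" for x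
      using q[OF that] unfolding sp by (simp add: E_def p3sum p3pow emb3 W)
    then have "\<phi> (E * p') = 0" by (rule null)
    moreover have "\<phi> (E * p') = (\<Sum>j\<le>n. poly (coeff q j) t0 * \<phi> (W ^ j * p'))"
      unfolding E_def sum_distrib_right sum by (rule sum.cong[OF refl]) (simp add: mult.assoc emb)
    moreover have "(\<Sum>j\<le>n. poly (coeff q j) t0 * \<phi> (W ^ j * p')) = poly (coeff q n) t0 * \<phi> (W ^ n * p')"
    proof (rule sum.remove[of "{..n}" n, THEN trans])
      have "(\<Sum>j\<in>{..n} - {n}. poly (coeff q j) t0 * \<phi> (W ^ j * p')) = 0"
      proof (rule sum.neutral, intro ballI)
        fix j assume "j \<in> {..n} - {n}"
        then have j: "j < n" by auto
        then have "\<phi> (W ^ (j + (i - n)) * p) = 0" using False by (intro less.IH) (auto simp: n_def)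
        then show "poly (coeff q j) t0 * \<phi> (W ^ j * p') = 0" by (simp add: p'_def power_add mult.assoc)
      qed
      then show "poly (coeff q n) t0 * \<phi> (W ^ n * p') + (\<Sum>j\<in>{..n} - {n}. poly (coeff q j) t0 * \<phi> (W ^ j * p'))
          = poly (coeff q n) t0 * \<phi> (W ^ n * p')" by simp
    qed auto
    ultimately have "\<phi> (W ^ n * p') = 0" using lc by (simp add: n_def)
    moreover have "W ^ n * p' = W ^ i * p"
      using False by (simp add: p'_def n_def mult.assoc[symmetric] power_add[symmetric])
    ultimately show ?thesis by simp
  qed
qed

section \<open>The inner product on polynomials and bounded point evaluations\<close>

context dvar_sheets
begin

lemma cont_poly3: "continuous_on A (poly3 p)"
  using continuous_on_poly3[OF continuous_on_id] by simp

definition "ip p q = \<Lambda> (\<lambda>x. poly3 p x * cnj (poly3 q x))"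

lemma cont_ip: "continuous_on UNIV (\<lambda>x. poly3 p x * cnj (poly3 q x))"
  by (intro continuous_intros cont_poly3)

lemma boundary_eqs: assumes "x \<in> closure \<Omega>" "norm (x $ 3) = 1"
  shows "x $ 1 = cnj (x $ 2) * x $ 3" "x $ 2 = cnj (x $ 1) * x $ 3" "norm (x $ 1) < 1" "cnj (x $ 3) * x $ 3 = 1"
proof -
  note d = closure_boundary[OF assms]
  show "x $ 1 = cnj (x $ 2) * x $ 3" "x $ 2 = cnj (x $ 1) * x $ 3" using dist_boundary_eqs[OF d(1)] by auto
  show "norm (x $ 1) < 1" using dist_boundary_eqs(3,4)[OF d(1)] d(2) by force
  show "cnj (x $ 3) * x $ 3 = 1" using assms(2) by (metis complex_norm_square mult.commute of_real_1 power_one)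
qed

lemma bound_ex: "\<exists>\<rho>. 0 \<le> \<rho> \<and> \<rho> < 1 \<and> (\<forall>x\<in>closure \<Omega>. norm (x $ 3) = 1 \<longrightarrow> norm (x $ 1) \<le> \<rho>)"
proof (cases "closure \<Omega> \<inter> {x. norm (x $ 3) = 1} = {}")
  case True then show ?thesis by (intro exI[of _ 0]) auto
next
  case False
  have K: "compact (closure \<Omega> \<inter> {x. norm (x $ 3) = 1})"
    by (intro compact_Int_closed compact_closure_Omega closed_Collect_eq continuous_intros)
  obtain x where x: "x \<in> closure \<Omega> \<inter> {x. norm (x $ 3) = 1}"
    "\<And>y. y \<in> closure \<Omega> \<inter> {x. norm (x $ 3) = 1} \<Longrightarrow> norm (y $ 1) \<le> norm (x $ 1)"
  proof -
    have "continuous_on (closure \<Omega> \<inter> {x. norm (x $ 3) = 1}) (\<lambda>x. norm (x $ 1))" by (intro continuous_intros)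
    then show ?thesis using continuous_attains_sup[OF K False] that by blast
  qed
  then show ?thesis using boundary_eqs(3)[of x] by (intro exI[of _ "norm (x $ 1)"]) auto
qed

definition "\<rho> = (SOME \<rho>. 0 \<le> \<rho> \<and> \<rho> < 1 \<and> (\<forall>x\<in>closure \<Omega>. norm (x $ 3) = 1 \<longrightarrow> norm (x $ 1) \<le> \<rho>))"

lemma rho: "0 \<le> \<rho>" "\<rho> < 1" "\<And>x. x \<in> closure \<Omega> \<Longrightarrow> norm (x $ 3) = 1 \<Longrightarrow> norm (x $ 1) \<le> \<rho>"
  using someI_ex[OF bound_ex] unfolding \<rho>_def by blast+

lemma ip_eqI: assumes "\<And>x. x \<in> closure \<Omega> \<Longrightarrow> norm (x $ 3) = 1 \<Longrightarrow> poly3 p x * cnj (poly3 q x) = poly3 r x * cnj (poly3 s x)"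
  shows "ip p q = ip r s"
proof -
  have "\<Lambda> (\<lambda>x. poly3 p x * cnj (poly3 q x) + (- 1) * (poly3 r x * cnj (poly3 s x))) = 0"
    by (rule \<Lambda>_zero) (use assms in \<open>auto intro!: continuous_intros cont_poly3\<close>)
  moreover have "\<Lambda> (\<lambda>x. poly3 p x * cnj (poly3 q x) + (- 1) * (poly3 r x * cnj (poly3 s x))) = ip p q + (- 1) * ip r s"
    unfolding ip_def using \<Lambda>_add[OF cont_ip, of "\<lambda>x. (- 1) * (poly3 r x * cnj (poly3 s x))" p q]
      \<Lambda>_scale[OF cont_ip, of "-1" r s] cont_ip[of r s] by (simp add: continuous_on_minus)
  ultimately show ?thesis by simp
qed

sublocale sip UNIV K3 ip
proof
  show "ip (u + v) w = ip u w + ip v w" for u v w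
    unfolding ip_def using \<Lambda>_add[OF cont_ip cont_ip, of u w v w] by (simp add: ring_distribs)
  show "ip (K3 c * u) v = c * ip u v" for c u v
    unfolding ip_def using \<Lambda>_scale[OF cont_ip, of c u v] by (simp add: mult.assoc)
  show "ip v u = cnj (ip u v)" for u v
    unfolding ip_def using \<Lambda>_cnj[OF cont_ip, of u v] by (simp add: mult.commute)
  show "0 \<le> Re (ip u u)" for u
    unfolding ip_def by (rule \<Lambda>_nonneg[OF cont_ip]) (simp add: complex_mult_cnj)
qed (simp_all add: K3_hom)

text \<open>Each law holds pointwise at the points of the closure with |x3| = 1, by
  \<open>boundary_eqs\<close> and \<open>rho\<close>, and \<open>ip_eqI\<close> or
  \<open>\<Lambda>_nonneg\<close> transfers it to the form.\<close>

sublocale pre_hardy K3 ip X3 Y3 T3 \<rho>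
proof
  show "ip (T3 * u) (T3 * v) = ip u v" for u v
  proof (rule ip_eqI)
    fix x assume x: "x \<in> closure \<Omega>" "norm (x $ 3) = 1"
    have "poly3 (T3 * u) x * cnj (poly3 (T3 * v) x) = (cnj (x $ 3) * x $ 3) * (poly3 u x * cnj (poly3 v x))" by simp
    then show "poly3 (T3 * u) x * cnj (poly3 (T3 * v) x) = poly3 u x * cnj (poly3 v x)"
      using boundary_eqs(4)[OF x] by simp
  qed
  show "ip (X3 * u) v = ip (T3 * u) (Y3 * v)" for u v
  proof (rule ip_eqI)
    fix x assume x: "x \<in> closure \<Omega>" "norm (x $ 3) = 1"
    have "x $ 1 * w = cnj (x $ 2) * x $ 3 * w" for w using boundary_eqs(1)[OF x] by simp
    then show "poly3 (X3 * u) x * cnj (poly3 v x) = poly3 (T3 * u) x * cnj (poly3 (Y3 * v) x)"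
      by (simp add: mult_ac)
  qed
  show "ip (Y3 * u) v = ip (T3 * u) (X3 * v)" for u v
  proof (rule ip_eqI)
    fix x assume x: "x \<in> closure \<Omega>" "norm (x $ 3) = 1"
    have "x $ 2 * w = cnj (x $ 1) * x $ 3 * w" for w using boundary_eqs(2)[OF x] by simp
    then show "poly3 (Y3 * u) x * cnj (poly3 v x) = poly3 (T3 * u) x * cnj (poly3 (X3 * v) x)"
      by (simp add: mult_ac)
  qed
  show "nrm (X3 * u) \<le> \<rho> * nrm u" for u
  proof -
    let ?h = "\<lambda>x. of_real (\<rho>\<^sup>2) * (poly3 u x * cnj (poly3 u x)) + (- 1) * (poly3 (X3 * u) x * cnj (poly3 (X3 * u) x))"
    have "0 \<le> Re (\<Lambda> ?h)"
    proof (rule \<Lambda>_nonneg)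
      fix x assume x: "x \<in> closure \<Omega>" "norm (x $ 3) = 1"
      have "(norm (x $ 1))\<^sup>2 * (norm (poly3 u x))\<^sup>2 \<le> \<rho>\<^sup>2 * (norm (poly3 u x))\<^sup>2"
        using rho(3)[OF x] by (intro mult_right_mono power_mono) auto
      moreover have "?h x = of_real (\<rho>\<^sup>2 * (norm (poly3 u x))\<^sup>2 - (norm (x $ 1))\<^sup>2 * (norm (poly3 u x))\<^sup>2)"
        unfolding complex_norm_square[symmetric] by (simp add: norm_mult power_mult_distrib)
      ultimately show "0 \<le> Re (?h x)" by (metis Re_complex_of_real diff_ge_0_iff_ge)
    qed (intro continuous_intros cont_poly3)
    also have "\<Lambda> ?h = of_real (\<rho>\<^sup>2) * ip u u + (- 1) * ip (X3 * u) (X3 * u)"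
      unfolding ip_def by (subst \<Lambda>_add, (intro continuous_intros cont_poly3)+) (simp only: \<Lambda>_scale[OF cont_ip])
    finally have "Re (ip (X3 * u) (X3 * u)) \<le> \<rho>\<^sup>2 * Re (ip u u)" by simp
    then have "sqrt (Re (ip (X3 * u) (X3 * u))) \<le> sqrt (\<rho>\<^sup>2 * Re (ip u u))" by (rule real_sqrt_le_mono)
    also have "\<dots> = \<rho> * sqrt (Re (ip u u))" using rho(1) by (simp add: real_sqrt_mult)
    finally show ?thesis by (simp add: nrm_def)
  qed
qed

lemma null_vanishing: assumes "\<And>x. x \<in> \<Omega> \<Longrightarrow> poly3 p x = 0" shows "nrm p = 0"
proof -
  have "ip p p = 0" unfolding ip_def by (rule \<Lambda>_zero_interior[OF cont_ip]) (use assms in simp)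
  then show ?thesis by (simp add: nrm_def)
qed

lemma separating_poly: assumes "finite F" "x \<notin> F" "\<And>y. y \<in> F \<Longrightarrow> y $ 3 = x $ 3"
  shows "\<exists>e. poly3 e x = 1 \<and> (\<forall>y\<in>F. poly3 e y = 0)"
  using assms
proof (induction F rule: finite_induct)
  case empty then show ?case by (intro exI[of _ 1]) simp
next
  case (insert y F)
  then obtain e where e: "poly3 e x = 1" "\<forall>y\<in>F. poly3 e y = 0" by auto
  have "\<exists>q. poly3 q x = 1 \<and> poly3 q y = 0"
  proof (cases "x $ 1 = y $ 1")
    case False
    then show ?thesis
      by (intro exI[of _ "K3 (1 / (x $ 1 - y $ 1)) * (X3 + K3 (- (y $ 1)))"]) simp
  next
    case True
    then have "x $ 2 \<noteq> y $ 2" using insert.prems vec3_eqI[of x y] by auto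
    then show ?thesis
      by (intro exI[of _ "K3 (1 / (x $ 2 - y $ 2)) * (Y3 + K3 (- (y $ 2)))"]) simp
  qed
  then obtain q where "poly3 q x = 1" "poly3 q y = 0" by blast
  then show ?case using e by (intro exI[of _ "q * e"]) auto
qed

text \<open>With \<open>e\<close> equal to 1 at \<open>x\<close> and 0 on the rest of its fibre, the
  fibre sum of \<open>p * e\<close> takes the value \<open>poly3 p x\<close> at \<open>t0\<close>.
  It is bounded off \<open>B\<close>, so it extends holomorphically over \<open>B\<close>; Cauchy's
  formula for the square of the extension on circles near the boundary, with Cauchy-Schwarz on each
  fibre, bounds this value by \<open>ip p p\<close>.\<close>

lemma evaluation_bound: assumes x: "x \<in> \<Omega>" "x $ 3 \<notin> B"
  shows "\<exists>K\<ge>0. \<forall>p. norm (poly3 p x) \<le> K * nrm p"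
proof -
  define t0 where "t0 = x $ 3"
  have t0: "norm t0 < 1" using x sub tetrablock_3_less by (auto simp: t0_def)
  obtain e where e: "poly3 e x = 1" "\<And>y. y \<in> Fib t0 - {x} \<Longrightarrow> poly3 e y = 0"
  proof -
    have "finite (Fib t0 - {x})" using Fib_finite by blast
    moreover have "y $ 3 = x $ 3" if "y \<in> Fib t0 - {x}" for y using that by (simp add: Fib_def t0_def)
    ultimately show ?thesis using separating_poly[of "Fib t0 - {x}" x] that by blast
  qed
  obtain C where C: "C \<ge> 0" "\<And>y. y \<in> \<Omega> \<Longrightarrow> norm (poly3 e y) \<le> C"
    by (rule bounded_on_closure[OF cont_poly3[of UNIV e]]) (rule that)
  have "\<forall>\<^sub>F k in sequentially. rad k > (1 + norm t0) / 2"
    using rad_lim by (rule order_tendstoD) (use t0 in simp)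
  then obtain k0 where k0: "\<And>k. k \<ge> k0 \<Longrightarrow> rad k > (1 + norm t0) / 2" unfolding eventually_sequentially by blast
  \<comment> \<open>\<open>m * C\<^sup>2\<close> bounds the sum of |e|^2 over a fibre, and
    \<open>(1 - norm t0) / 2\<close> bounds from below the distance from \<open>t0\<close> to the
    circles used.\<close>
  define c where "c = real m * C\<^sup>2 / ((1 - norm t0) / 2)"
  have c0: "c \<ge> 0" unfolding c_def using t0 by simp
  have main: "(norm (poly3 p x))\<^sup>2 \<le> c * Re (ip p p)" for p
  proof -
    define g where "g = sumf (poly3 (p * e))"
    obtain C' where C': "C' \<ge> 0" "\<And>y. y \<in> \<Omega> \<Longrightarrow> norm (poly3 (p * e) y) \<le> C'"
      by (rule bounded_on_closure[OF cont_poly3[of UNIV "p * e"]]) (rule that)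
    have gb: "norm (g t) \<le> real m * C'" if "t \<notin> B" for t unfolding g_def by (rule sumf_bound[OF C'(2) that C'(1)])
    have "\<exists>G. G holomorphic_on ball 0 1 \<and> (\<forall>z\<in>ball 0 1 - (B \<inter> ball 0 1). G z = g z)"
    proof (rule removable_singularities)
      show "g holomorphic_on ball 0 1 - (B \<inter> ball 0 1)"
        unfolding g_def using sumf_holomorphic[of "p * e"] by (simp add: Diff_Int_distrib2 Diff_Int)
      show "g \<in> O[at z](\<lambda>_. 1)" if "z \<in> B \<inter> ball 0 1" for z
      proof (rule bigoI[of _ "real m * C'"])
        have "finite (B - {z})" using B_finite by simp
        then have "open (- (B - {z}))" by (intro open_Compl finite_imp_closed)
        then have "\<forall>\<^sub>F w in at z. w \<in> - (B - {z})" by (rule eventually_at_in_open') simp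
        moreover have "\<forall>\<^sub>F w in at z. w \<noteq> z" by (simp add: eventually_at_filter)
        ultimately show "\<forall>\<^sub>F w in at z. norm (g w) \<le> real m * C' * norm (1::complex)"
          by eventually_elim (use gb in auto)
      qed
    qed (use B_finite in \<open>auto simp: interior_open\<close>)
    then obtain G where G: "G holomorphic_on ball 0 1" "\<And>z. z \<in> ball 0 1 - B \<Longrightarrow> G z = g z" by auto
    have Gt0: "G t0 = poly3 p x"
    proof -
      have "g t0 = (\<Sum>y\<in>Fib t0. poly3 p y * poly3 e y)" by (simp add: g_def sumf_def)
      also have "\<dots> = (\<Sum>y\<in>{x}. poly3 p y * poly3 e y)"
        by (rule sum.mono_neutral_right) (use Fib_finite e x in \<open>auto simp: Fib_def t0_def\<close>)
      finally have "g t0 = poly3 p x" using e by simp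
      then show ?thesis using G(2)[of t0] t0 x by (simp add: t0_def)
    qed
    have est: "(norm (poly3 p x))\<^sup>2 \<le> c * Re (J k (\<lambda>x. poly3 p x * cnj (poly3 p x)))" if k: "k \<ge> k0" for k
    proof -
      have r: "norm t0 < rad k" "rad k - norm t0 > (1 - norm t0) / 2" using k0[OF k] t0 by (simp_all add: field_simps)
      \<comment> \<open>The square matches the quadratic form: on the circle |G|^2 is at most a
        constant times the fibre sum of |p|^2.\<close>
      have "((\<lambda>u. (G u)\<^sup>2 / (u - t0)) has_contour_integral (2 * of_real pi * \<i> * (G t0)\<^sup>2)) (circlepath 0 (rad k))"
      proof (rule Cauchy_integral_circlepath_simple)
        show "(\<lambda>u. (G u)\<^sup>2) holomorphic_on cball 0 (rad k)"
          using G(1) rad(2)[of k] by (intro holomorphic_intros) (auto elim!: holomorphic_on_subset)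
      qed (use r in simp)
      then have ci: "((\<lambda>\<theta>. (G (pt k \<theta>))\<^sup>2 / (pt k \<theta> - t0) * vector_derivative (circlepath 0 (rad k)) (at \<theta> within {0..1}))
         has_integral (2 * of_real pi * \<i> * (G t0)\<^sup>2)) {0..1}"
        by (simp add: has_contour_integral_def pt_def)
      define h where "h = (\<lambda>x. poly3 p x * cnj (poly3 p x))"
      have hc: "continuous_on UNIV h" unfolding h_def by (rule cont_ip)
      have hi: "((\<lambda>\<theta>. sumf h (pt k \<theta>)) has_integral J k h) {0..1}"
        unfolding J_def using J_integrable[OF hc] by (rule integrable_integral)
      have hr: "((\<lambda>\<theta>. 2 * pi * c * Re (sumf h (pt k \<theta>))) has_integral 2 * pi * c * Re (J k h)) {0..1}"
        using has_integral_mult_right[OF has_integral_linear[OF hi bounded_linear_Re]] by (simp add: o_def)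
      have bd: "norm ((G (pt k \<theta>))\<^sup>2 / (pt k \<theta> - t0) * vector_derivative (circlepath 0 (rad k)) (at \<theta> within {0..1}))
          \<le> 2 * pi * c * Re (sumf h (pt k \<theta>))" if \<theta>: "\<theta> \<in> {0..1}" for \<theta>
      proof -
        let ?t = "pt k \<theta>"
        have vd: "norm (vector_derivative (circlepath 0 (rad k)) (at \<theta> within {0..1})) \<le> 2 * pi"
          using \<theta> rad(2,3)[of k] by (simp add: vector_derivative_circlepath01 norm_mult)
        have dn: "(1 - norm t0) / 2 \<le> norm (?t - t0)"
          using norm_triangle_ineq2[of ?t t0] norm_pt[of k \<theta>] r by simp
        have Gg: "G ?t = g ?t" using G(2) pt_disc by blast
        have "norm (g ?t) \<le> (\<Sum>y\<in>Fib ?t. norm (poly3 p y) * norm (poly3 e y))"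
          unfolding g_def sumf_def by (rule order_trans[OF norm_sum]) (simp add: norm_mult)
        then have "(norm (g ?t))\<^sup>2 \<le> (\<Sum>y\<in>Fib ?t. norm (poly3 p y) * norm (poly3 e y))\<^sup>2"
          by (rule power_mono) simp
        also have "\<dots> \<le> (\<Sum>y\<in>Fib ?t. (norm (poly3 p y))\<^sup>2) * (\<Sum>y\<in>Fib ?t. (norm (poly3 e y))\<^sup>2)"
          by (rule Cauchy_Schwarz_ineq_sum)
        also have "\<dots> \<le> (\<Sum>y\<in>Fib ?t. (norm (poly3 p y))\<^sup>2) * (real m * C\<^sup>2)"
        proof (rule mult_left_mono)
          have "(\<Sum>y\<in>Fib ?t. (norm (poly3 e y))\<^sup>2) \<le> (\<Sum>y\<in>Fib ?t. C\<^sup>2)"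
            by (rule sum_mono, rule power_mono) (use C in \<open>auto simp: Fib_def\<close>)
          also have "\<dots> = real (card (Fib ?t)) * C\<^sup>2" by simp
          also have "\<dots> \<le> real m * C\<^sup>2" using card_Fib[of ?t] pt_disc[of k \<theta>] by (intro mult_right_mono) auto
          finally show "(\<Sum>y\<in>Fib ?t. (norm (poly3 e y))\<^sup>2) \<le> real m * C\<^sup>2" .
        qed (simp add: sum_nonneg)
        also have "(\<Sum>y\<in>Fib ?t. (norm (poly3 p y))\<^sup>2) = Re (sumf h ?t)"
          unfolding h_def sumf_def complex_norm_square[symmetric] by simp
        finally have g2: "(norm (g ?t))\<^sup>2 \<le> Re (sumf h ?t) * (real m * C\<^sup>2)" .
        have h0: "0 \<le> Re (sumf h ?t)"
          unfolding h_def sumf_def complex_norm_square[symmetric] by (simp add: sum_nonneg)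
        have "norm ((G ?t)\<^sup>2 / (?t - t0)) \<le> Re (sumf h ?t) * (real m * C\<^sup>2) / ((1 - norm t0) / 2)"
          unfolding Gg norm_divide norm_power using g2 dn h0 t0 by (intro frac_le) auto
        then have "norm ((G ?t)\<^sup>2 / (?t - t0)) \<le> c * Re (sumf h ?t)" by (simp add: c_def mult_ac)
        then have "norm ((G ?t)\<^sup>2 / (?t - t0)) * norm (vector_derivative (circlepath 0 (rad k)) (at \<theta> within {0..1}))
           \<le> (c * Re (sumf h ?t)) * (2 * pi)"
          using vd c0 h0 by (intro mult_mono) auto
        then show ?thesis by (simp only: norm_mult mult_ac)
      qed
      have "norm (2 * of_real pi * \<i> * (G t0)\<^sup>2) \<le> 2 * pi * c * Re (J k h)"
        using integral_norm_bound_integral[OF has_integral_integrable[OF ci] has_integral_integrable[OF hr] bd]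
        by (simp only: integral_unique[OF ci] integral_unique[OF hr])
      then have "2 * pi * (norm (poly3 p x))\<^sup>2 \<le> 2 * pi * (c * Re (J k h))"
        by (simp add: norm_mult norm_power Gt0 mult.assoc)
      then show ?thesis by (simp add: h_def)
    qed
    have "(\<lambda>k. c * Re (J k (\<lambda>x. poly3 p x * cnj (poly3 p x)))) \<longlonglongrightarrow> c * Re (ip p p)"
      unfolding ip_def by (intro tendsto_intros tendsto_Re J_convergent cont_ip)
    then show ?thesis by (rule LIMSEQ_le_const) (use est in blast)
  qed
  have "norm (poly3 p x) \<le> sqrt c * nrm p" for p
    using real_sqrt_le_mono[OF main[of p]] by (simp add: real_sqrt_mult nrm_def)
  then show ?thesis using c0 by (intro exI[of _ "sqrt c"]) auto
qed

end

context dvar_sheets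
begin

lemma generic_point: obtains t0 d1 d2 where "norm t0 < 1" "poly (lead_coeff d1) t0 \<noteq> 0" "poly (lead_coeff d2) t0 \<noteq> 0"
  "\<And>x. x \<in> \<Omega> \<Longrightarrow> poly (spec (x $ 3) d1) (x $ 1) = 0" "\<And>x. x \<in> \<Omega> \<Longrightarrow> poly (spec (x $ 3) d2) (x $ 2) = 0"
proof -
  have "\<exists>t0. norm t0 < 1 \<and> t0 \<notin> B" using sheet unfolding sheet_data_def by (elim conjE)
  then obtain t0 where t0: "norm t0 < 1" "t0 \<notin> B" by blast
  have "\<exists>d1 d2. (\<forall>t. t \<notin> B \<longrightarrow> poly (lead_coeff d1) t \<noteq> 0 \<and> poly (lead_coeff d2) t \<noteq> 0) \<and>
     (\<forall>x\<in>\<Omega>. poly (spec (x $ 3) d1) (x $ 1) = 0 \<and> poly (spec (x $ 3) d2) (x $ 2) = 0)"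
    using sheet unfolding sheet_data_def by (elim conjE)
  then obtain d1 d2 where d: "\<forall>t. t \<notin> B \<longrightarrow> poly (lead_coeff d1) t \<noteq> 0 \<and> poly (lead_coeff d2) t \<noteq> 0"
     "\<forall>x\<in>\<Omega>. poly (spec (x $ 3) d1) (x $ 1) = 0 \<and> poly (spec (x $ 3) d2) (x $ 2) = 0" by blast
  show ?thesis by (rule that[of t0 d1 d2]) (use d t0 in auto)
qed

text \<open>At a \<open>t0\<close> where neither leading coefficient vanishes,
  \<open>functional_reduction\<close> in both coordinates leaves only the monomials of degree below
  \<open>degree d1\<close> in \<open>X3\<close> and below \<open>degree d2\<close> in
  \<open>Y3\<close>.\<close>

lemma finite_multiplicity:
  obtains t0 M b where "norm t0 < 1"
   "\<And>\<phi> p. (\<And>p q. \<phi> (p + q) = \<phi> p + \<phi> q) \<Longrightarrow> (\<And>c p. \<phi> (K3 c * p) = c * \<phi> p) \<Longrightarrow>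
       (\<And>p. \<phi> (T3 * p) = t0 * \<phi> p) \<Longrightarrow> (\<And>p. nrm p = 0 \<Longrightarrow> \<phi> p = 0) \<Longrightarrow>
       (\<And>i::nat. i < M \<Longrightarrow> \<phi> (b i) = 0) \<Longrightarrow> \<phi> p = (0::complex)"
proof -
  obtain t0 d1 d2 where d: "norm t0 < 1" "poly (lead_coeff d1) t0 \<noteq> 0" "poly (lead_coeff d2) t0 \<noteq> 0"
    "\<And>x. x \<in> \<Omega> \<Longrightarrow> poly (spec (x $ 3) d1) (x $ 1) = 0" "\<And>x. x \<in> \<Omega> \<Longrightarrow> poly (spec (x $ 3) d2) (x $ 2) = 0"
    by (rule generic_point) (rule that)
  \<comment> \<open>The index \<open>k\<close> runs through the pairs of exponents by division with
    remainder.\<close>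
  define b where "b k = X3 ^ (k div degree d2) * (Y3 ^ (k mod degree d2) * 1)" for k
  have main: "\<phi> p = 0" if add: "\<And>p q. \<phi> (p + q) = \<phi> p + \<phi> q" and K: "\<And>c p. \<phi> (K3 c * p) = c * \<phi> p"
     and T: "\<And>p. \<phi> (T3 * p) = t0 * \<phi> p" and nl: "\<And>p. nrm p = 0 \<Longrightarrow> \<phi> p = 0"
     and bz: "\<And>i. i < degree d1 * degree d2 \<Longrightarrow> \<phi> (b i) = 0" for \<phi> p
  proof -
    have null: "\<phi> p = 0" if "\<And>x. x \<in> \<Omega> \<Longrightarrow> poly3 p x = 0" for p using nl null_vanishing that by blast
    have 1: "\<phi> (X3 ^ i * (Y3 ^ j * 1)) = 0" if "i < degree d1" "j < degree d2" for i j
    proof -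
      have "i * degree d2 + j < Suc i * degree d2" using that by simp
      also have "\<dots> \<le> degree d1 * degree d2" using that by (intro mult_right_mono) auto
      finally show ?thesis using bz[of "i * degree d2 + j"] that by (simp add: b_def)
    qed
    have 2: "\<phi> (X3 ^ i * (Y3 ^ j * 1)) = 0" if "j < degree d2" for i j
      by (rule functional_reduction[where q = d1 and w = "\<lambda>x. x $ 1" and \<Omega> = \<Omega>, OF add K T null]) (use d 1 that in auto)
    have 3: "\<phi> (Y3 ^ j * (X3 ^ i * 1)) = 0" for i j
      by (rule functional_reduction[where q = d2 and w = "\<lambda>x. x $ 2" and \<Omega> = \<Omega>, OF add K T null])
         (use d 2 in \<open>auto simp: mult.commute\<close>)
    have "\<forall>i j. \<phi> (X3 ^ i * (Y3 ^ j * p)) = 0"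
    proof (rule poly3_ring_induct[where P = "\<lambda>p. \<forall>i j. \<phi> (X3 ^ i * (Y3 ^ j * p)) = 0"])
      show "\<forall>i j. \<phi> (X3 ^ i * (Y3 ^ j * K3 c)) = 0" for c
      proof (intro allI)
        fix i j
        have eq: "X3 ^ i * (Y3 ^ j * K3 c) = K3 c * (Y3 ^ j * (X3 ^ i * 1))" by (simp add: mult_ac)
        show "\<phi> (X3 ^ i * (Y3 ^ j * K3 c)) = 0" by (simp only: eq K 3 mult_zero_right)
      qed
      show "\<forall>i j. \<phi> (X3 ^ i * (Y3 ^ j * (p + q))) = 0"
        if "\<forall>i j. \<phi> (X3 ^ i * (Y3 ^ j * p)) = 0" "\<forall>i j. \<phi> (X3 ^ i * (Y3 ^ j * q)) = 0" for p q
        using that by (simp add: distrib_left add)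
      show "\<forall>i j. \<phi> (X3 ^ i * (Y3 ^ j * (X3 * p))) = 0" if "\<forall>i j. \<phi> (X3 ^ i * (Y3 ^ j * p)) = 0" for p
      proof (intro allI)
        fix i j
        have "X3 ^ i * (Y3 ^ j * (X3 * p)) = X3 ^ Suc i * (Y3 ^ j * p)" by (simp add: mult_ac)
        then show "\<phi> (X3 ^ i * (Y3 ^ j * (X3 * p))) = 0" using that by (simp only:)
      qed
      show "\<forall>i j. \<phi> (X3 ^ i * (Y3 ^ j * (Y3 * p))) = 0" if "\<forall>i j. \<phi> (X3 ^ i * (Y3 ^ j * p)) = 0" for p
      proof (intro allI)
        fix i j
        have "X3 ^ i * (Y3 ^ j * (Y3 * p)) = X3 ^ i * (Y3 ^ Suc j * p)" by (simp add: mult_ac)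
        then show "\<phi> (X3 ^ i * (Y3 ^ j * (Y3 * p))) = 0" using that by (simp only:)
      qed
      show "\<forall>i j. \<phi> (X3 ^ i * (Y3 ^ j * (T3 * p))) = 0" if "\<forall>i j. \<phi> (X3 ^ i * (Y3 ^ j * p)) = 0" for p
      proof (intro allI)
        fix i j
        have "X3 ^ i * (Y3 ^ j * (T3 * p)) = T3 * (X3 ^ i * (Y3 ^ j * p))" by (simp add: mult_ac)
        then show "\<phi> (X3 ^ i * (Y3 ^ j * (T3 * p))) = 0" using that T by (simp only:) simp
      qed
    qed
    then have "\<phi> (X3 ^ 0 * (Y3 ^ 0 * p)) = 0" by blast
    then show ?thesis by simp
  qed
  show ?thesis
  proof (rule that[of t0 "degree d1 * degree d2" b, OF d(1)])
    fix \<phi> :: "complex poly poly poly \<Rightarrow> complex" and p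
    assume A: "\<And>p q. \<phi> (p + q) = \<phi> p + \<phi> q" "\<And>c p. \<phi> (K3 c * p) = c * \<phi> p"
      "\<And>p. \<phi> (T3 * p) = t0 * \<phi> p" "\<And>p. nrm p = 0 \<Longrightarrow> \<phi> p = 0" "\<And>i. i < degree d1 * degree d2 \<Longrightarrow> \<phi> (b i) = 0"
    show "\<phi> p = 0" by (rule main[of \<phi>]) (fact A)+
  qed
qed

lemma evaluation_extends:
  assumes K: "K \<ge> 0" "\<And>p. norm (poly3 p x) \<le> K * nrm p"
  shows "\<exists>\<psi>. (\<forall>u\<in>cau. \<forall>v\<in>cau. \<psi> (u + v) = \<psi> u + \<psi> v) \<and> (\<forall>c. \<forall>u\<in>cau. \<psi> ((\<lambda>_. K3 c) * u) = c * \<psi> u) \<and>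
    (\<forall>u\<in>cau. \<psi> ((\<lambda>_. X3) * u) = x $ 1 * \<psi> u) \<and> (\<forall>u\<in>cau. \<psi> ((\<lambda>_. Y3) * u) = x $ 2 * \<psi> u) \<and>
    (\<forall>u\<in>cau. \<psi> ((\<lambda>_. T3) * u) = x $ 3 * \<psi> u) \<and> (\<forall>u\<in>cau. norm (\<psi> u) \<le> K * lim.nrm u) \<and> \<psi> 1 = (1::complex)"
proof -
  define \<psi> where "\<psi> u = lim (\<lambda>k. poly3 (u k) x)" for u :: "nat \<Rightarrow> complex poly poly poly"
  have pdiff: "poly3 (p - q) x = poly3 p x - poly3 q x" for p q
    by (simp add: poly3_def)
  have conv: "(\<lambda>k. poly3 (u k) x) \<longlonglongrightarrow> \<psi> u" if u: "u \<in> cau" for u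
  proof -
    have "Cauchy (\<lambda>k. poly3 (u k) x)"
    proof (rule metric_CauchyI)
      fix \<epsilon> :: real assume e: "\<epsilon> > 0"
      obtain N where N: "\<And>m k. m \<ge> N \<Longrightarrow> k \<ge> N \<Longrightarrow> nrm (u m - u k) < \<epsilon> / (K + 1)"
        using cauD[OF u, of "\<epsilon> / (K + 1)"] e K by auto
      have "dist (poly3 (u m) x) (poly3 (u k) x) < \<epsilon>" if mk: "m \<ge> N" "k \<ge> N" for m k
      proof -
        have "dist (poly3 (u m) x) (poly3 (u k) x) \<le> K * nrm (u m - u k)"
          using K(2)[of "u m - u k"] by (simp add: dist_norm pdiff)
        also have "\<dots> \<le> (K + 1) * nrm (u m - u k)" using nonneg by (intro mult_right_mono) auto
        also have "\<dots> < (K + 1) * (\<epsilon> / (K + 1))" using N[OF mk] K by (intro mult_strict_left_mono) auto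
        finally show ?thesis using K by simp
      qed
      then show "\<exists>M. \<forall>m\<ge>M. \<forall>n\<ge>M. dist (poly3 (u m) x) (poly3 (u n) x) < \<epsilon>" by blast
    qed
    then show ?thesis unfolding \<psi>_def by (simp add: Cauchy_convergent_iff convergent_LIMSEQ_iff)
  qed
  have eqI: "\<psi> u = l" if "(\<lambda>k. poly3 (u k) x) \<longlonglongrightarrow> l" for u l
    unfolding \<psi>_def using that by (rule limI)
  show ?thesis
  proof (intro exI[of _ \<psi>] conjI ballI allI)
    show "\<psi> (u + v) = \<psi> u + \<psi> v" if "u \<in> cau" "v \<in> cau" for u v
      by (rule eqI) (use tendsto_add[OF conv[OF that(1)] conv[OF that(2)]] in simp)
    show "\<psi> ((\<lambda>_. K3 c) * u) = c * \<psi> u" if "u \<in> cau" for u c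
      by (rule eqI) (use tendsto_mult[OF tendsto_const[of c] conv[OF that]] in simp)
    show "\<psi> ((\<lambda>_. X3) * u) = x $ 1 * \<psi> u" if "u \<in> cau" for u
      by (rule eqI) (use tendsto_mult[OF tendsto_const[of "x $ 1"] conv[OF that]] in simp)
    show "\<psi> ((\<lambda>_. Y3) * u) = x $ 2 * \<psi> u" if "u \<in> cau" for u
      by (rule eqI) (use tendsto_mult[OF tendsto_const[of "x $ 2"] conv[OF that]] in simp)
    show "\<psi> ((\<lambda>_. T3) * u) = x $ 3 * \<psi> u" if "u \<in> cau" for u
      by (rule eqI) (use tendsto_mult[OF tendsto_const[of "x $ 3"] conv[OF that]] in simp)
    show "norm (\<psi> u) \<le> K * lim.nrm u" if "u \<in> cau" for u
      using tendsto_norm[OF conv[OF that]] tendsto_mult[OF tendsto_const[of K] lnrm_tendsto[OF that]]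
      by (rule LIMSEQ_le) (use K in auto)
    show "\<psi> 1 = 1" by (rule eqI) simp
  qed
qed

text \<open>The operator model in coordinates, with matrices as functions of indices. The last two
  clauses prepare the two inclusions for the spectrum in terms of left eigenvectors: points of
  \<open>\<Omega>\<close> off \<open>B\<close> give one, and one over the disc gives a point of
  \<open>zero_locus S\<close>.\<close>

theorem matrix_model:
  "\<exists>(n::nat) (a1::nat \<Rightarrow> nat \<Rightarrow> complex) a2.
     (\<forall>i<n. \<forall>j<n. (\<Sum>k<n. a1 i k * a2 k j) = (\<Sum>k<n. a2 i k * a1 k j)) \<and>
     (\<forall>i<n. \<forall>j<n. (\<Sum>k<n. cnj (a1 k i) * a1 k j) - (\<Sum>k<n. a1 i k * cnj (a1 j k))
       = (\<Sum>k<n. cnj (a2 k i) * a2 k j) - (\<Sum>k<n. a2 i k * cnj (a2 j k))) \<and>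
     (\<forall>z v. norm z = 1 \<longrightarrow> sqrt (\<Sum>i<n. (norm (\<Sum>j<n. (cnj (a1 j i) + z * a2 i j) * v j))\<^sup>2) \<le> \<rho> * sqrt (\<Sum>i<n. (norm (v i))\<^sup>2)) \<and>
     (\<forall>x\<in>\<Omega>. x $ 3 \<notin> B \<longrightarrow> (\<exists>c. (\<exists>k<n. c k \<noteq> 0) \<and>
        (\<forall>j<n. (\<Sum>k<n. c k * (cnj (a1 j k) + x $ 3 * a2 k j)) = x $ 1 * c j) \<and>
        (\<forall>j<n. (\<Sum>k<n. c k * (cnj (a2 j k) + x $ 3 * a1 k j)) = x $ 2 * c j))) \<and>
     (\<forall>x c. norm (x $ 3) < 1 \<longrightarrow> (\<exists>k<n. c k \<noteq> 0) \<longrightarrow>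
        (\<forall>j<n. (\<Sum>k<n. c k * (cnj (a1 j k) + x $ 3 * a2 k j)) = x $ 1 * c j) \<longrightarrow>
        (\<forall>j<n. (\<Sum>k<n. c k * (cnj (a2 j k) + x $ 3 * a1 k j)) = x $ 2 * c j) \<longrightarrow> x \<in> zero_locus S)"
proof -
  obtain t0 M b where t0: "norm t0 < 1" and fin:
   "\<And>\<phi> p. (\<And>p q. \<phi> (p + q) = \<phi> p + \<phi> q) \<Longrightarrow> (\<And>c p. \<phi> (K3 c * p) = c * \<phi> p) \<Longrightarrow>
       (\<And>p. \<phi> (T3 * p) = t0 * \<phi> p) \<Longrightarrow> (\<And>p. nrm p = 0 \<Longrightarrow> \<phi> p = 0) \<Longrightarrow>
       (\<And>i::nat. i < M \<Longrightarrow> \<phi> (b i) = 0) \<Longrightarrow> \<phi> p = (0::complex)"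
    using finite_multiplicity by blast
  interpret h: hardy cau "\<lambda>c _. K3 c" lip "range (\<lambda>p _. p)" "\<lambda>_. X3" "\<lambda>_. Y3" "\<lambda>_. T3" \<rho> t0 M "\<lambda>i _. b i"
  proof (rule completion_hardy[OF t0])
    fix \<phi> :: "complex poly poly poly \<Rightarrow> complex" and p
    assume A: "\<And>p q. \<phi> (p + q) = \<phi> p + \<phi> q" "\<And>c p. \<phi> (K3 c * p) = c * \<phi> p"
      "\<And>p. \<phi> (T3 * p) = t0 * \<phi> p" "\<And>p. nrm p = 0 \<Longrightarrow> \<phi> p = 0" "\<And>i. i < M \<Longrightarrow> \<phi> (b i) = 0"
    show "\<phi> p = 0" by (rule fin[of \<phi>]) (fact A)+
  qed
  obtain n e where e: "h.onf n e" "\<And>w. w \<in> h.L \<Longrightarrow> lim.nrm (w - (\<Sum>i<n. (\<lambda>_. K3 (lip w (e i))) * e i)) = 0"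
    by (rule h.obtain_basis) (rule that)
  interpret hb: hardy_basis cau "\<lambda>c _. K3 c" lip "range (\<lambda>p _. p)" "\<lambda>_. X3" "\<lambda>_. Y3" "\<lambda>_. T3" \<rho> t0 M "\<lambda>i _. b i" n e
    by unfold_locales (use e in auto)
  define a1 where "a1 = hb.a (\<lambda>_. X3)"
  define a2 where "a2 = hb.a (\<lambda>_. Y3)"
  have P4: "\<exists>c. (\<exists>k<n. c k \<noteq> 0) \<and>
        (\<forall>j<n. (\<Sum>k<n. c k * (cnj (a1 j k) + x $ 3 * a2 k j)) = x $ 1 * c j) \<and>
        (\<forall>j<n. (\<Sum>k<n. c k * (cnj (a2 j k) + x $ 3 * a1 k j)) = x $ 2 * c j)" if x: "x \<in> \<Omega>" "x $ 3 \<notin> B" for x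
  proof -
    obtain K where K: "K \<ge> 0" "\<forall>p. norm (poly3 p x) \<le> K * nrm p" using evaluation_bound[OF x] by blast
    obtain \<psi> where psi: "\<forall>u\<in>cau. \<forall>v\<in>cau. \<psi> (u + v) = \<psi> u + \<psi> v" "\<forall>c. \<forall>u\<in>cau. \<psi> ((\<lambda>_. K3 c) * u) = c * \<psi> u"
      "\<forall>u\<in>cau. \<psi> ((\<lambda>_. X3) * u) = x $ 1 * \<psi> u" "\<forall>u\<in>cau. \<psi> ((\<lambda>_. Y3) * u) = x $ 2 * \<psi> u"
      "\<forall>u\<in>cau. \<psi> ((\<lambda>_. T3) * u) = x $ 3 * \<psi> u" "\<forall>u\<in>cau. norm (\<psi> u) \<le> K * lim.nrm u" "\<psi> 1 = 1"
      using evaluation_extends[OF K(1) spec[OF K(2)]] by blast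
    have t: "norm (x $ 3) < 1" using x sub tetrablock_3_less by blast
    have one: "\<psi> 1 \<noteq> 0" using psi(7) by simp
    note ev = hb.evaluation_eigenvector[of \<psi> "x $ 3" K, OF _ _ _ _ t one]
    have "\<exists>k<n. \<psi> (e k) \<noteq> 0" by (rule ev(1)) (use psi in auto)
    moreover have "(\<Sum>k<n. \<psi> (e k) * (cnj (a1 j k) + x $ 3 * a2 k j)) = x $ 1 * \<psi> (e j)" if "j < n" for j
      unfolding a1_def a2_def by (rule ev(2)[OF _ _ _ _ hb.pair_XY]) (use psi that in auto)
    moreover have "(\<Sum>k<n. \<psi> (e k) * (cnj (a2 j k) + x $ 3 * a1 k j)) = x $ 2 * \<psi> (e j)" if "j < n" for j
      unfolding a1_def a2_def by (rule ev(2)[OF _ _ _ _ hb.pair_YX]) (use psi that in auto)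
    ultimately show ?thesis by (intro exI[of _ "\<lambda>k. \<psi> (e k)"]) simp
  qed
  have P5: "x \<in> zero_locus S" if t: "norm (x $ 3) < 1" and c: "\<exists>k<n. c k \<noteq> 0"
    and e1: "\<And>j. j < n \<Longrightarrow> (\<Sum>k<n. c k * (cnj (a1 j k) + x $ 3 * a2 k j)) = x $ 1 * c j"
    and e2: "\<And>j. j < n \<Longrightarrow> (\<Sum>k<n. c k * (cnj (a2 j k) + x $ 3 * a1 k j)) = x $ 2 * c j" for x c
  proof -
    define w where "w = hb.comb (\<lambda>k. cnj (c k))"
    have w: "w \<in> cau" "w \<in> h.L" unfolding w_def using hb.comb_C hb.comb_L by auto
    define \<phi> where "\<phi> p = h.phi (x $ 3) w (\<lambda>_. p)" for p
    have add: "\<phi> (p + q) = \<phi> p + \<phi> q" for p q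
      using h.phi_add[OF t w(1) cau_const cau_const, of p q] by (simp add: \<phi>_def plus_fun_def)
    have sc: "\<phi> (K3 c * p) = c * \<phi> p" for c p
      using h.phi_scale[OF t w(1) cau_const, of c p] by (simp add: \<phi>_def times_fun_def)
    have mT: "\<phi> (T3 * p) = x $ 3 * \<phi> p" for p
      using h.phi_T[OF t w(2) cau_const, of p] by (simp add: \<phi>_def times_fun_def)
    have mX: "\<phi> (X3 * p) = x $ 1 * \<phi> p" for p
      using hb.eigenvector_functional[OF t hb.pair_XY hb.pair_YX e1[unfolded a1_def a2_def], of "\<lambda>_. p"]
      by (simp add: \<phi>_def w_def times_fun_def)
    have mY: "\<phi> (Y3 * p) = x $ 2 * \<phi> p" for p
      using hb.eigenvector_functional[OF t hb.pair_YX hb.pair_XY e2[unfolded a1_def a2_def], of "\<lambda>_. p"]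
      by (simp add: \<phi>_def w_def times_fun_def)
    have ev: "\<phi> p = poly3 p x * \<phi> 1" for p
      by (rule functional_evaluation[of \<phi> x]) (fact add sc mX mY mT)+
    obtain p where "\<phi> p \<noteq> 0"
      using hb.eigenvector_functional_nonzero[OF t, of _ c] c by (auto simp: \<phi>_def w_def)
    then have one: "\<phi> 1 \<noteq> 0" using ev[of p] by auto
    \<comment> \<open>\<open>q\<close> vanishes on \<open>\<Omega>\<close> and is therefore null, so
      \<open>\<phi>\<close> kills it; but \<open>\<phi>\<close> is a nonzero multiple of evaluation
      at \<open>x\<close>.\<close>
    have "poly3 q x = 0" if q: "q \<in> S" for q
    proof -
      have "nrm q = 0" by (rule null_vanishing) (use q var in \<open>auto simp: zero_locus_def\<close>)
      then have "\<phi> q = 0" unfolding \<phi>_def using h.phi_null[OF t w(1) cau_const, of q] lnrm_const by simp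
      then show ?thesis using ev[of q] one by simp
    qed
    then show ?thesis by (simp add: zero_locus_def)
  qed
  show ?thesis
    by (rule exI[of _ n], rule exI[of _ a1], rule exI[of _ a2], intro conjI)
       (use hb.a_commute hb.a_selfcommutator hb.pencil_norm P4 P5 in \<open>auto simp: a1_def a2_def\<close>)
qed

end

section \<open>Joint spectra of commuting matrices\<close>

lemma mat_inverse_ex: assumes A: "(A :: complex mat) \<in> carrier_mat n n" and d: "det A \<noteq> 0"
  obtains S where "S \<in> carrier_mat n n" "S * A = 1\<^sub>m n" "A * S = 1\<^sub>m n"
proof -
  have "A \<in> Units (ring_mat TYPE(complex) n ())" by (rule det_non_zero_imp_unit[OF A d])
  then show ?thesis using that by (auto simp: Units_def ring_mat_def)
qed

text \<open>In Schur form, a kernel vector \<open>w\<close> of \<open>N\<close> whose transform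
  \<open>Q *\<^sub>v w\<close> vanishes from index \<open>Suc k\<close> on is sent by
  \<open>T\<close> minus the diagonal entry at \<open>k\<close> to a kernel vector whose transform
  vanishes already from index \<open>k\<close>. Nonzero vectors have nonzero transforms, so some
  step must produce zero, and the vector before it is an eigenvector.\<close>

lemma invariant_eigenvector:
  fixes N T :: "complex mat"
  assumes N: "N \<in> carrier_mat n n" and T: "T \<in> carrier_mat n n" and comm: "N * T = T * N"
    and v: "v \<in> carrier_vec n" "v \<noteq> 0\<^sub>v n" "N *\<^sub>v v = 0\<^sub>v n"
  shows "\<exists>u \<mu>. u \<in> carrier_vec n \<and> u \<noteq> 0\<^sub>v n \<and> N *\<^sub>v u = 0\<^sub>v n \<and> T *\<^sub>v u = \<mu> \<cdot>\<^sub>v u"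
proof -
  obtain es where es: "char_poly T = (\<Prod>a\<leftarrow>es. [:- a, 1:])" using char_poly_factorized[OF T] by blast
  obtain U where U: "U \<in> carrier_mat n n" "upper_triangular U" "similar_mat T U"
    using schur_decomposition_exists[OF T es] by blast
  then obtain P Q where "similar_mat_wit T U P Q" unfolding similar_mat_def by blast
  from similar_mat_witD2[OF T this] have PQ: "P \<in> carrier_mat n n" "Q \<in> carrier_mat n n" "P * Q = 1\<^sub>m n" "Q * P = 1\<^sub>m n" "T = P * U * Q" by auto
  have QT: "Q * T = U * Q"
  proof -
    have UQ: "U * Q \<in> carrier_mat n n" using PQ U by simp
    have "P * U * Q = P * (U * Q)" using PQ U by (intro assoc_mult_mat) auto
    then have "Q * T = Q * P * (U * Q)" unfolding PQ(5) using assoc_mult_mat[OF PQ(2,1) UQ] by simp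
    then show ?thesis using left_mult_one_mat[OF UQ] by (simp only: PQ(4))
  qed
  have "\<exists>u \<mu>. u \<in> carrier_vec n \<and> u \<noteq> 0\<^sub>v n \<and> N *\<^sub>v u = 0\<^sub>v n \<and> T *\<^sub>v u = \<mu> \<cdot>\<^sub>v u"
    if "k \<le> n" "w \<in> carrier_vec n" "w \<noteq> 0\<^sub>v n" "N *\<^sub>v w = 0\<^sub>v n" "\<And>i. k \<le> i \<Longrightarrow> i < n \<Longrightarrow> vec_index (Q *\<^sub>v w) i = 0" for k w
    using that
  proof (induction k arbitrary: w)
    case 0
    have "Q *\<^sub>v w = 0\<^sub>v n" using 0 PQ by (intro eq_vecI) auto
    then have "P *\<^sub>v (Q *\<^sub>v w) = 0\<^sub>v n" using PQ by (intro eq_vecI) auto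
    moreover have "P *\<^sub>v (Q *\<^sub>v w) = w" using PQ 0 by (metis assoc_mult_mat_vec one_mult_mat_vec)
    ultimately show ?case using 0 by simp
  next
    case (Suc k)
    define b where "b = U $$ (k, k)"
    define w' where "w' = T *\<^sub>v w - b \<cdot>\<^sub>v w"
    have Tw: "T *\<^sub>v w \<in> carrier_vec n" using T Suc.prems(2) by simp
    have w'c: "w' \<in> carrier_vec n" unfolding w'_def using Tw Suc.prems by auto
    show ?case
    proof (cases "w' = 0\<^sub>v n")
      case True
      have "T *\<^sub>v w = b \<cdot>\<^sub>v w"
      proof (rule eq_vecI)
        fix i assume "i < dim_vec (b \<cdot>\<^sub>v w)"
        then have "i < n" using Suc.prems by simp
        then have "vec_index w' i = 0" using True by simp
        then show "vec_index (T *\<^sub>v w) i = vec_index (b \<cdot>\<^sub>v w) i" using \<open>i < n\<close> Suc.prems(2) by (simp add: w'_def)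
      qed (use Suc.prems T in simp)
      then show ?thesis using Suc.prems by blast
    next
      case False
      have "N *\<^sub>v w' = N *\<^sub>v (T *\<^sub>v w) - N *\<^sub>v (b \<cdot>\<^sub>v w)"
        unfolding w'_def using N Tw Suc.prems(2) by (intro mult_minus_distrib_mat_vec) auto
      also have "N *\<^sub>v (T *\<^sub>v w) = T *\<^sub>v (N *\<^sub>v w)"
        using comm N T Suc.prems(2) by (metis assoc_mult_mat_vec)
      also have "\<dots> = 0\<^sub>v n" using Suc.prems(4) T by (intro eq_vecI) auto
      also have "N *\<^sub>v (b \<cdot>\<^sub>v w) = b \<cdot>\<^sub>v (N *\<^sub>v w)" using N Suc.prems(2) by (rule mult_mat_vec)
      finally have Nw': "N *\<^sub>v w' = 0\<^sub>v n" using Suc.prems(4) by (intro eq_vecI) auto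
      define q where "q = Q *\<^sub>v w"
      have qc: "q \<in> carrier_vec n" unfolding q_def using PQ Suc.prems by simp
      have "Q *\<^sub>v w' = Q *\<^sub>v (T *\<^sub>v w) - Q *\<^sub>v (b \<cdot>\<^sub>v w)"
        unfolding w'_def using PQ Tw Suc.prems(2) by (intro mult_minus_distrib_mat_vec) auto
      also have "Q *\<^sub>v (T *\<^sub>v w) = U *\<^sub>v q"
        using QT PQ T U Suc.prems(2) unfolding q_def by (metis assoc_mult_mat_vec)
      also have "Q *\<^sub>v (b \<cdot>\<^sub>v w) = b \<cdot>\<^sub>v q" unfolding q_def using PQ(2) Suc.prems(2) by (rule mult_mat_vec)
      finally have Qw': "Q *\<^sub>v w' = U *\<^sub>v q - b \<cdot>\<^sub>v q" .
      have "vec_index (Q *\<^sub>v w') i = 0" if i: "k \<le> i" "i < n" for i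
      proof -
        have "vec_index (U *\<^sub>v q) i = (\<Sum>j<n. U $$ (i, j) * vec_index q j)"
          using U i qc by (simp add: scalar_prod_def lessThan_atLeast0)
        also have "\<dots> = (\<Sum>j<n. if j = k then U $$ (i, k) * vec_index q k else 0)"
        proof (rule sum.cong[OF refl])
          fix j assume j: "j \<in> {..<n}"
          show "U $$ (i, j) * vec_index q j = (if j = k then U $$ (i, k) * vec_index q k else 0)"
          proof (cases "j \<le> k")
            case False then show ?thesis using Suc.prems(5)[of j] j by (simp add: q_def)
          next
            case True
            show ?thesis
            proof (cases "j = k")
              case False
              then have "U $$ (i, j) = 0" using U i True by (intro upper_triangularD) auto
              then show ?thesis using False by simp
            qed simp
          qed
        qed
        also have "\<dots> = U $$ (i, k) * vec_index q k" using Suc.prems(1) by simp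
        finally have e: "vec_index (U *\<^sub>v q) i = U $$ (i, k) * vec_index q k" .
        have "U $$ (i, k) * vec_index q k = b * vec_index q i"
        proof (cases "i = k")
          case False
          then have "U $$ (i, k) = 0" using U i by (intro upper_triangularD) auto
          moreover have "vec_index q i = 0" using Suc.prems(5)[of i] i False by (simp add: q_def)
          ultimately show ?thesis by simp
        qed (simp add: b_def)
        then show ?thesis unfolding Qw' using e i qc U by (simp del: index_mult_mat_vec)
      qed
      then show ?thesis using Suc.IH[OF _ w'c False Nw'] Suc.prems(1) by auto
    qed
  qed
  from this[of n v] show ?thesis using v by auto
qed

lemma finite_eigenvalues: assumes "(A :: complex mat) \<in> carrier_mat n n"
  shows "finite {k. \<exists>v\<in>carrier_vec n. v \<noteq> 0\<^sub>v n \<and> A *\<^sub>v v = k \<cdot>\<^sub>v v}"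
proof -
  have "char_poly A \<noteq> 0" using degree_monic_char_poly[OF assms] by auto
  then have "finite {k. poly (char_poly A) k = 0}" by (rule poly_roots_finite)
  moreover have "{k. \<exists>v\<in>carrier_vec n. v \<noteq> 0\<^sub>v n \<and> A *\<^sub>v v = k \<cdot>\<^sub>v v} \<subseteq> {k. poly (char_poly A) k = 0}"
    using eigenvalue_root_char_poly[OF assms] assms by (auto simp: eigenvalue_def eigenvector_def)
  ultimately show ?thesis using finite_subset by blast
qed

text \<open>\<open>T2\<close> commutes with \<open>T1 + c \<cdot>\<^sub>m T2\<close> and so has an
  eigenvector in its kernel.\<close>

lemma pencil_kernel_eigen:
  fixes T1 T2 :: "complex mat"
  assumes T: "T1 \<in> carrier_mat n n" "T2 \<in> carrier_mat n n" and comm: "T1 * T2 = T2 * T1"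
    and d: "det (T1 + c \<cdot>\<^sub>m T2) = 0"
  shows "\<exists>u \<mu>. u \<in> carrier_vec n \<and> u \<noteq> 0\<^sub>v n \<and> T1 *\<^sub>v u = (- c * \<mu>) \<cdot>\<^sub>v u \<and> T2 *\<^sub>v u = \<mu> \<cdot>\<^sub>v u"
proof -
  let ?N = "T1 + c \<cdot>\<^sub>m T2"
  have N: "?N \<in> carrier_mat n n" using T by simp
  obtain v where v: "v \<in> carrier_vec n" "v \<noteq> 0\<^sub>v n" "?N *\<^sub>v v = 0\<^sub>v n"
    using det_0_iff_vec_prod_zero[OF N] d by blast
  have "?N * T2 = T1 * T2 + c \<cdot>\<^sub>m T2 * T2" using T by (intro add_mult_distrib_mat) auto
  also have "\<dots> = T2 * T1 + T2 * (c \<cdot>\<^sub>m T2)" using T comm by (simp add: mult_smult_distrib[of _ n n _ n] mult_smult_assoc_mat[of _ n n _ n])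
  also have "\<dots> = T2 * ?N" using T by (intro mult_add_distrib_mat[symmetric]) auto
  finally obtain u \<mu> where u: "u \<in> carrier_vec n" "u \<noteq> 0\<^sub>v n" "?N *\<^sub>v u = 0\<^sub>v n" "T2 *\<^sub>v u = \<mu> \<cdot>\<^sub>v u"
    using invariant_eigenvector[OF N T(2) _ v] by blast
  have "T1 *\<^sub>v u = (- c * \<mu>) \<cdot>\<^sub>v u"
  proof (rule eq_vecI)
    fix i assume "i < dim_vec ((- c * \<mu>) \<cdot>\<^sub>v u)"
    then have i: "i < n" using u by simp
    have "?N *\<^sub>v u = T1 *\<^sub>v u + c \<cdot>\<^sub>m T2 *\<^sub>v u" using T u by (intro add_mult_distrib_mat_vec) auto
    also have "c \<cdot>\<^sub>m T2 *\<^sub>v u = c \<cdot>\<^sub>v (T2 *\<^sub>v u)" using T u(1) by (intro eq_vecI) auto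
    finally have "T1 *\<^sub>v u + c \<cdot>\<^sub>v (\<mu> \<cdot>\<^sub>v u) = 0\<^sub>v n" using u(3,4) by simp
    then have "vec_index (T1 *\<^sub>v u + c \<cdot>\<^sub>v (\<mu> \<cdot>\<^sub>v u)) i = 0" using i by (simp only: index_zero_vec)
    then show "vec_index (T1 *\<^sub>v u) i = vec_index ((- c * \<mu>) \<cdot>\<^sub>v u) i"
      using i u T by (simp del: index_mult_mat_vec) (simp add: eq_neg_iff_add_eq_0 mult.assoc)
  qed (use u T in simp)
  then show ?thesis using u by blast
qed

text \<open>\<open>c\<close> avoids the finitely many quotients - l / m of eigenvalues, so the
  eigenvector from \<open>pencil_kernel_eigen\<close> must have eigenvalue 0 for both
  matrices.\<close>

lemma common_kernel:
  fixes T1 T2 :: "complex mat"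
  assumes T: "T1 \<in> carrier_mat n n" "T2 \<in> carrier_mat n n" and comm: "T1 * T2 = T2 * T1"
    and d: "\<And>c. det (T1 + c \<cdot>\<^sub>m T2) = 0"
  shows "\<exists>u\<in>carrier_vec n. u \<noteq> 0\<^sub>v n \<and> T1 *\<^sub>v u = 0\<^sub>v n \<and> T2 *\<^sub>v u = 0\<^sub>v n"
proof -
  let ?E = "\<lambda>A. {k. \<exists>v\<in>carrier_vec n. v \<noteq> 0\<^sub>v n \<and> A *\<^sub>v v = k \<cdot>\<^sub>v v}"
  have "finite ((\<lambda>(l, m). - l / m) ` (?E T1 \<times> ?E T2))" using finite_eigenvalues T by blast
  then obtain c where c: "c \<notin> (\<lambda>(l, m). - l / m) ` (?E T1 \<times> ?E T2)"
    using infinite_UNIV_char_0[where 'a = complex] ex_new_if_finite by blast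
  obtain u \<mu> where u: "u \<in> carrier_vec n" "u \<noteq> 0\<^sub>v n" "T1 *\<^sub>v u = (- c * \<mu>) \<cdot>\<^sub>v u" "T2 *\<^sub>v u = \<mu> \<cdot>\<^sub>v u"
    using pencil_kernel_eigen[OF T comm d] by blast
  have "\<mu> = 0"
  proof (rule ccontr)
    assume m: "\<mu> \<noteq> 0"
    have "(- c * \<mu>, \<mu>) \<in> ?E T1 \<times> ?E T2" using u by blast
    then have "- (- c * \<mu>) / \<mu> \<in> (\<lambda>(l, m). - l / m) ` (?E T1 \<times> ?E T2)" by (rule rev_image_eqI) simp
    then show False using c m by simp
  qed
  then have "T1 *\<^sub>v u = 0\<^sub>v n" "T2 *\<^sub>v u = 0\<^sub>v n" proof -
    have "(0::complex) \<cdot>\<^sub>v u = 0\<^sub>v n" using u(1) by (intro eq_vecI) auto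
    then show "T1 *\<^sub>v u = 0\<^sub>v n" "T2 *\<^sub>v u = 0\<^sub>v n" using u(3,4) \<open>\<mu> = 0\<close> by simp_all
  qed
  then show ?thesis using u by blast
qed

text \<open>The inverse \<open>S\<close> of \<open>T1 + c \<cdot>\<^sub>m T2\<close> commutes with
  both matrices and provides a contracting homotopy of the Koszul complex; the witness
  \<open>S *\<^sub>v (u + c \<cdot>\<^sub>v w)\<close> in the middle and the pair (- c s, s) at the
  end are its components.\<close>

lemma koszul_exact_if_det:
  fixes T1 T2 :: "complex mat"
  assumes T: "T1 \<in> carrier_mat n n" "T2 \<in> carrier_mat n n" and comm: "T1 * T2 = T2 * T1"
    and d: "det (T1 + c \<cdot>\<^sub>m T2) \<noteq> 0"
  shows "koszul_exact n T1 T2"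
proof -
  define M where "M = T1 + c \<cdot>\<^sub>m T2"
  have M: "M \<in> carrier_mat n n" unfolding M_def using T by simp
  obtain S where S: "S \<in> carrier_mat n n" "S * M = 1\<^sub>m n" "M * S = 1\<^sub>m n"
    using mat_inverse_ex[OF M] d unfolding M_def by blast
  have Mv: "M *\<^sub>v v = T1 *\<^sub>v v + c \<cdot>\<^sub>v (T2 *\<^sub>v v)" if v: "v \<in> carrier_vec n" for v
  proof -
    have "M *\<^sub>v v = T1 *\<^sub>v v + c \<cdot>\<^sub>m T2 *\<^sub>v v" unfolding M_def using T v by (intro add_mult_distrib_mat_vec) auto
    also have "c \<cdot>\<^sub>m T2 *\<^sub>v v = c \<cdot>\<^sub>v (T2 *\<^sub>v v)" using T v by (intro eq_vecI) auto
    finally show ?thesis .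
  qed
  have SM: "S *\<^sub>v (M *\<^sub>v v) = v" and MS: "M *\<^sub>v (S *\<^sub>v v) = v" if v: "v \<in> carrier_vec n" for v
    using S M v by (metis assoc_mult_mat_vec one_mult_mat_vec)+
  have cM1: "M * T1 = T1 * M" and cM2: "M * T2 = T2 * M"
  proof -
    have "M * T1 = T1 * T1 + c \<cdot>\<^sub>m T2 * T1" unfolding M_def using T by (intro add_mult_distrib_mat) auto
    also have "\<dots> = T1 * T1 + T1 * (c \<cdot>\<^sub>m T2)" using T comm by (simp add: mult_smult_distrib[of _ n n _ n] mult_smult_assoc_mat[of _ n n _ n])
    also have "\<dots> = T1 * M" unfolding M_def using T by (intro mult_add_distrib_mat[symmetric]) auto
    finally show "M * T1 = T1 * M" .
    have "M * T2 = T1 * T2 + c \<cdot>\<^sub>m T2 * T2" unfolding M_def using T by (intro add_mult_distrib_mat) auto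
    also have "\<dots> = T2 * T1 + T2 * (c \<cdot>\<^sub>m T2)" using T comm by (simp add: mult_smult_distrib[of _ n n _ n] mult_smult_assoc_mat[of _ n n _ n])
    also have "\<dots> = T2 * M" unfolding M_def using T by (intro mult_add_distrib_mat[symmetric]) auto
    finally show "M * T2 = T2 * M" .
  qed
  have cS: "S *\<^sub>v (A *\<^sub>v v) = A *\<^sub>v (S *\<^sub>v v)" if A: "A \<in> carrier_mat n n" "M * A = A * M" and v: "v \<in> carrier_vec n" for A v
  proof -
    have Sv: "S *\<^sub>v v \<in> carrier_vec n" using S v by simp
    have "A *\<^sub>v v = A *\<^sub>v (M *\<^sub>v (S *\<^sub>v v))" using MS[OF v] by simp
    also have "\<dots> = M *\<^sub>v (A *\<^sub>v (S *\<^sub>v v))" using A M Sv by (metis assoc_mult_mat_vec)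
    finally have "S *\<^sub>v (A *\<^sub>v v) = S *\<^sub>v (M *\<^sub>v (A *\<^sub>v (S *\<^sub>v v)))" by simp
    also have "\<dots> = A *\<^sub>v (S *\<^sub>v v)" using A Sv by (intro SM) simp
    finally show ?thesis .
  qed
  have zero: "A *\<^sub>v 0\<^sub>v n = 0\<^sub>v n" if "A \<in> carrier_mat n n" for A :: "complex mat" using that by (intro eq_vecI) auto
  show ?thesis
    unfolding koszul_exact_def
  proof (intro conjI ballI impI)
    fix v assume v: "v \<in> carrier_vec n" "T1 *\<^sub>v v = 0\<^sub>v n \<and> T2 *\<^sub>v v = 0\<^sub>v n"
    then have "M *\<^sub>v v = 0\<^sub>v n" using Mv[OF v(1)] by (intro eq_vecI) auto
    then show "v = 0\<^sub>v n" using SM[OF v(1)] zero[OF S(1)] by simp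
  next
    fix u w assume u: "u \<in> carrier_vec n" and w: "w \<in> carrier_vec n" and e: "T1 *\<^sub>v w - T2 *\<^sub>v u = 0\<^sub>v n"
    have e': "T1 *\<^sub>v w = T2 *\<^sub>v u"
    proof (rule eq_vecI)
      fix i assume "i < dim_vec (T2 *\<^sub>v u)"
      then have i: "i < n" using T by simp
      have "vec_index (T1 *\<^sub>v w - T2 *\<^sub>v u) i = 0" using e i by simp
      then show "vec_index (T1 *\<^sub>v w) i = vec_index (T2 *\<^sub>v u) i" using i T by (simp del: index_mult_mat_vec)
    qed (use T in simp)
    define v where "v = S *\<^sub>v (u + c \<cdot>\<^sub>v w)"
    have uw: "u + c \<cdot>\<^sub>v w \<in> carrier_vec n" "c \<cdot>\<^sub>v w \<in> carrier_vec n" using u w by auto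
    have lin: "A *\<^sub>v (u + c \<cdot>\<^sub>v w) = A *\<^sub>v u + c \<cdot>\<^sub>v (A *\<^sub>v w)" if "A \<in> carrier_mat n n" for A
      using mult_add_distrib_mat_vec[OF that u uw(2)] mult_mat_vec[OF that w] by simp
    have "T1 *\<^sub>v v = S *\<^sub>v (T1 *\<^sub>v u + c \<cdot>\<^sub>v (T2 *\<^sub>v u))"
      unfolding v_def using cS[OF T(1) cM1 uw(1)] lin[OF T(1)] e' by simp
    also have "\<dots> = u" using Mv[OF u] SM[OF u] by simp
    finally have 1: "u = T1 *\<^sub>v v" by simp
    have "T2 *\<^sub>v v = S *\<^sub>v (T1 *\<^sub>v w + c \<cdot>\<^sub>v (T2 *\<^sub>v w))"
      unfolding v_def using cS[OF T(2) cM2 uw(1)] lin[OF T(2)] e' by simp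
    also have "\<dots> = w" using Mv[OF w] SM[OF w] by simp
    finally have 2: "w = T2 *\<^sub>v v" by simp
    show "\<exists>v\<in>carrier_vec n. u = T1 *\<^sub>v v \<and> w = T2 *\<^sub>v v"
    proof (intro bexI[of _ v] conjI)
      show "v \<in> carrier_vec n" unfolding v_def using S(1) uw(1) by simp
    qed (fact 1, fact 2)
  next
    fix y :: "complex Matrix.vec" assume y: "y \<in> carrier_vec n"
    define s where "s = S *\<^sub>v y"
    have s: "s \<in> carrier_vec n" unfolding s_def using S y by simp
    have "y = M *\<^sub>v s" unfolding s_def using MS[OF y] by simp
    also have "\<dots> = T1 *\<^sub>v s - T2 *\<^sub>v ((- c) \<cdot>\<^sub>v s)"
      unfolding Mv[OF s] mult_mat_vec[OF T(2) s] using T s by (intro eq_vecI) auto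
    finally show "\<exists>u\<in>carrier_vec n. \<exists>w\<in>carrier_vec n. y = T1 *\<^sub>v w - T2 *\<^sub>v u"
      using s by (intro bexI[of _ "(- c) \<cdot>\<^sub>v s"] bexI[of _ s]) auto
  qed
qed

text \<open>The determinant criterion is a closed condition and invariant under transposition; later
  arguments rest on these two properties.\<close>

lemma not_koszul_exact_iff_det:
  fixes T1 T2 :: "complex mat"
  assumes T: "T1 \<in> carrier_mat n n" "T2 \<in> carrier_mat n n" and comm: "T1 * T2 = T2 * T1"
  shows "\<not> koszul_exact n T1 T2 \<longleftrightarrow> (\<forall>c. det (T1 + c \<cdot>\<^sub>m T2) = 0)"
proof
  assume "\<forall>c. det (T1 + c \<cdot>\<^sub>m T2) = 0"
  then obtain u where "u \<in> carrier_vec n" "u \<noteq> 0\<^sub>v n" "T1 *\<^sub>v u = 0\<^sub>v n" "T2 *\<^sub>v u = 0\<^sub>v n"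
    using common_kernel[OF T comm] by blast
  then show "\<not> koszul_exact n T1 T2" unfolding koszul_exact_def by blast
qed (use koszul_exact_if_det[OF T comm] in blast)

text \<open>The row vector \<open>c\<close> annihilates the range of the last map, but not its own
  conjugate, so that map is not onto.\<close>

lemma left_kernel_not_exact:
  fixes T1 T2 :: "complex mat"
  assumes T: "T1 \<in> carrier_mat n n" "T2 \<in> carrier_mat n n"
    and c: "\<exists>k<n. c k \<noteq> 0" "\<And>j. j < n \<Longrightarrow> (\<Sum>k<n. c k * T1 $$ (k, j)) = 0" "\<And>j. j < n \<Longrightarrow> (\<Sum>k<n. c k * T2 $$ (k, j)) = 0"
  shows "\<not> koszul_exact n T1 T2"
proof
  assume ex: "koszul_exact n T1 T2"
  define y where "y = Matrix.vec n (\<lambda>k. cnj (c k))"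
  have kill: "(\<Sum>k<n. c k * vec_index (A *\<^sub>v v) k) = 0"
    if A: "A \<in> carrier_mat n n" "\<And>j. j < n \<Longrightarrow> (\<Sum>k<n. c k * A $$ (k, j)) = 0" and v: "v \<in> carrier_vec n" for A v
  proof -
    have "(\<Sum>k<n. c k * vec_index (A *\<^sub>v v) k) = (\<Sum>k<n. \<Sum>j<n. c k * A $$ (k, j) * vec_index v j)"
      using A v by (intro sum.cong refl) (simp add: scalar_prod_def lessThan_atLeast0 sum_distrib_left mult.assoc)
    also have "\<dots> = (\<Sum>j<n. (\<Sum>k<n. c k * A $$ (k, j)) * vec_index v j)"
      by (subst sum.swap) (simp add: sum_distrib_right)
    also have "\<dots> = 0" using A(2) by simp
    finally show ?thesis .
  qed
  have "y \<in> carrier_vec n" by (simp add: y_def)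
  then obtain u w where uw: "u \<in> carrier_vec n" "w \<in> carrier_vec n" "y = T1 *\<^sub>v w - T2 *\<^sub>v u"
    using ex unfolding koszul_exact_def by blast
  have "(\<Sum>k<n. c k * vec_index y k) = (\<Sum>k<n. c k * vec_index (T1 *\<^sub>v w) k) - (\<Sum>k<n. c k * vec_index (T2 *\<^sub>v u) k)"
    unfolding uw(3) using T by (simp add: right_diff_distrib sum_subtractf del: index_mult_mat_vec)
  also have "\<dots> = 0" using kill[OF T(1) c(2) uw(2)] kill[OF T(2) c(3) uw(1)] by simp
  finally have "(\<Sum>k<n. c k * cnj (c k)) = 0" by (simp add: y_def)
  then have "of_real (\<Sum>k<n. (norm (c k))\<^sup>2) = (0::complex)"
    unfolding of_real_sum complex_norm_square .
  then have "(\<Sum>k<n. (norm (c k))\<^sup>2) = 0" by (simp only: of_real_eq_0_iff)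
  then have "\<forall>k\<in>{..<n}. (norm (c k))\<^sup>2 = 0" by (subst (asm) sum_nonneg_eq_0_iff) auto
  then show False using c(1) by auto
qed

text \<open>This is \<open>common_kernel\<close> for the transposed matrices, whose pencils have the
  same determinants.\<close>

lemma common_left_kernel:
  fixes T1 T2 :: "complex mat"
  assumes T: "T1 \<in> carrier_mat n n" "T2 \<in> carrier_mat n n" and comm: "T1 * T2 = T2 * T1"
    and ex: "\<not> koszul_exact n T1 T2"
  obtains c where "\<exists>k<n. c k \<noteq> 0" "\<And>j. j < n \<Longrightarrow> (\<Sum>k<n. c k * T1 $$ (k, j)) = 0" "\<And>j. j < n \<Longrightarrow> (\<Sum>k<n. c k * T2 $$ (k, j)) = 0"
proof -
  let ?T1 = "transpose_mat T1" and ?T2 = "transpose_mat T2"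
  have Tt: "?T1 \<in> carrier_mat n n" "?T2 \<in> carrier_mat n n" using T by auto
  have comm': "?T1 * ?T2 = ?T2 * ?T1"
    using transpose_mult[OF T] transpose_mult[OF T(2,1)] comm by simp
  have "det (?T1 + c \<cdot>\<^sub>m ?T2) = 0" for c
  proof -
    have "?T1 + c \<cdot>\<^sub>m ?T2 = transpose_mat (T1 + c \<cdot>\<^sub>m T2)" using T by (intro eq_matI) auto
    then have "det (?T1 + c \<cdot>\<^sub>m ?T2) = det (T1 + c \<cdot>\<^sub>m T2)" using det_transpose[of "T1 + c \<cdot>\<^sub>m T2" n] T by simp
    then show ?thesis using not_koszul_exact_iff_det[OF T comm] ex by simp
  qed
  then obtain u where u: "u \<in> carrier_vec n" "u \<noteq> 0\<^sub>v n" "?T1 *\<^sub>v u = 0\<^sub>v n" "?T2 *\<^sub>v u = 0\<^sub>v n"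
    using common_kernel[OF Tt comm'] by blast
  have s: "(\<Sum>k<n. vec_index u k * A $$ (k, j)) = vec_index (transpose_mat A *\<^sub>v u) j" if "A \<in> carrier_mat n n" "j < n" for A j
    using that u by (simp add: scalar_prod_def lessThan_atLeast0 mult.commute)
  have "\<exists>k<n. vec_index u k \<noteq> 0"
  proof (rule ccontr)
    assume "\<not> ?thesis"
    then have "u = 0\<^sub>v n" using u(1) by (intro eq_vecI) auto
    then show False using u(2) by simp
  qed
  then show ?thesis by (rule that) (use s[OF T(1)] s[OF T(2)] u in simp_all)
qed

section \<open>Complex dimension\<close>

lemma has_derivative_vec3:
  assumes "(f has_derivative f') F" "(g has_derivative g') F" "(h has_derivative h') F"
  shows "((\<lambda>x. vec3 (f x) (g x) (h x) :: complex ^ 3) has_derivative (\<lambda>k. vec3 (f' k) (g' k) (h' k))) F"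
proof -
  have bl: "bounded_linear (\<lambda>z. vec3 z 0 0 :: complex ^ 3)" "bounded_linear (\<lambda>z. vec3 0 z 0 :: complex ^ 3)"
    "bounded_linear (\<lambda>z. vec3 0 0 z :: complex ^ 3)"
    unfolding linear_conv_bounded_linear[symmetric] by (rule linearI; rule vec3_eqI; simp)+
  have e: "vec3 a b c = vec3 a 0 0 + vec3 0 b 0 + (vec3 0 0 c :: complex ^ 3)" for a b c by (rule vec3_eqI) auto
  have "((\<lambda>x. vec3 (f x) 0 0 + vec3 0 (g x) 0 + (vec3 0 0 (h x) :: complex ^ 3)) has_derivative
    (\<lambda>k. vec3 (f' k) 0 0 + vec3 0 (g' k) 0 + vec3 0 0 (h' k))) F"
    by (rule has_derivative_add[OF has_derivative_add[OF bounded_linear.has_derivative[OF bl(1) assms(1)]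
        bounded_linear.has_derivative[OF bl(2) assms(2)]] bounded_linear.has_derivative[OF bl(3) assms(3)]])
  then show ?thesis by (simp only: e[symmetric])
qed

lemma has_derivative_nth: "((\<lambda>x::complex^'n. x $ i) has_derivative (\<lambda>h. h $ i)) F"
  by (rule bounded_linear_imp_has_derivative) (rule bounded_linear_vec_nth)

lemma shear_holomorphic:
  fixes U :: "(complex ^ 3) set"
  assumes f: "f holomorphic_on W" and g: "g holomorphic_on W" and W: "open W" and U: "\<And>y. y \<in> U \<Longrightarrow> y $ 3 \<in> W"
  shows "holomorphic_map_on (\<lambda>y. vec3 (y $ 1 + f (y $ 3)) (y $ 2 + g (y $ 3)) (y $ 3)) U"
  unfolding holomorphic_map_on_def
proof
  fix x assume x: "x \<in> U"
  obtain a where a: "(f has_field_derivative a) (at (x $ 3))"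
    using f U[OF x] W holomorphic_on_imp_differentiable_at field_differentiable_def by blast
  obtain b where b: "(g has_field_derivative b) (at (x $ 3))"
    using g U[OF x] W holomorphic_on_imp_differentiable_at field_differentiable_def by blast
  have comp: "((\<lambda>y::complex^3. k (y $ 3)) has_derivative (\<lambda>h. c * h $ 3)) (at x)"
    if "(k has_field_derivative c) (at (x $ 3))" for k c
    by (rule has_derivative_compose[OF has_derivative_nth that[unfolded has_field_derivative_def]])
  define A :: "complex ^ 3 ^ 3" where "A = vec3 (vec3 1 0 a) (vec3 0 1 b) (vec3 0 0 1)"
  have A: "A *v h = vec3 (h $ 1 + a * h $ 3) (h $ 2 + b * h $ 3) (h $ 3)" for h
    by (rule vec3_eqI) (simp_all add: A_def matrix_vector_mult_def sum_3)
  show "\<exists>A. ((\<lambda>y. vec3 (y $ 1 + f (y $ 3)) (y $ 2 + g (y $ 3)) (y $ 3)) has_derivative (\<lambda>h. A *v h)) (at x)"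
  proof (intro exI[of _ A], unfold A)
    show "((\<lambda>y. vec3 (y $ 1 + f (y $ 3)) (y $ 2 + g (y $ 3)) (y $ 3)) has_derivative
        (\<lambda>h. vec3 (h $ 1 + a * h $ 3) (h $ 2 + b * h $ 3) (h $ 3))) (at x)"
      by (intro has_derivative_vec3 has_derivative_add has_derivative_nth comp a b)
  qed
qed

text \<open>The shear that subtracts \<open>f\<close> and \<open>g\<close> of the third coordinate
  straightens the graph to the third axis; its inverse adds them back.\<close>

lemma graph_submanifold:
  fixes Z :: "(complex ^ 3) set"
  assumes f: "f holomorphic_on ball t \<eta>" and g: "g holomorphic_on ball t \<eta>" and eta: "\<eta> > 0" and eps: "\<epsilon> > 0"
    and Z: "\<And>y. y $ 3 \<in> ball t \<eta> \<Longrightarrow> dist (y $ 1) (f (y $ 3)) < \<epsilon> \<Longrightarrow> dist (y $ 2) (g (y $ 3)) < \<epsilon> \<Longrightarrow>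
       y \<in> Z \<longleftrightarrow> y $ 1 = f (y $ 3) \<and> y $ 2 = g (y $ 3)"
  shows "submanifold_at 1 Z (vec3 (f t) (g t) t)"
proof -
  let ?x = "vec3 (f t) (g t) t"
  define U where "U = {y :: complex ^ 3. y $ 3 \<in> ball t \<eta> \<and> dist (y $ 1) (f (y $ 3)) < \<epsilon> \<and> dist (y $ 2) (g (y $ 3)) < \<epsilon>}"
  define V where "V = {y :: complex ^ 3. y $ 3 \<in> ball t \<eta> \<and> norm (y $ 1) < \<epsilon> \<and> norm (y $ 2) < \<epsilon>}"
  define F where "F y = vec3 (y $ 1 + (- f (y $ 3))) (y $ 2 + (- g (y $ 3))) (y $ 3)" for y :: "complex ^ 3"
  define G where "G y = vec3 (y $ 1 + f (y $ 3)) (y $ 2 + g (y $ 3)) (y $ 3)" for y :: "complex ^ 3"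
  have V: "open V"
  proof -
    have "V = (\<lambda>y. y $ 3) -` ball t \<eta> \<inter> (\<lambda>y. norm (y $ 1)) -` {..<\<epsilon>} \<inter> (\<lambda>y. norm (y $ 2)) -` {..<\<epsilon>}" by (auto simp: V_def)
    then show ?thesis by (auto intro!: open_Int open_vimage continuous_intros)
  qed
  have W: "open ((\<lambda>y :: complex ^ 3. y $ 3) -` ball t \<eta>)" (is "open ?W") by (intro open_vimage continuous_intros) auto
  have nth: "(\<lambda>y :: complex ^ 3. y $ 3) ` ?W \<subseteq> ball t \<eta>" by auto
  have cf: "continuous_on ?W (\<lambda>y. f (y $ 3))"
    by (rule continuous_on_compose2[OF holomorphic_on_imp_continuous_on[OF f] _ nth]) (intro continuous_intros)
  have cg: "continuous_on ?W (\<lambda>y. g (y $ 3))"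
    by (rule continuous_on_compose2[OF holomorphic_on_imp_continuous_on[OF g] _ nth]) (intro continuous_intros)
  have cF: "continuous_on ?W F" and cG: "continuous_on ?W G"
    unfolding F_def G_def by (intro continuous_intros cf cg)+
  have UW: "U \<subseteq> ?W" "V \<subseteq> ?W" by (auto simp: U_def V_def)
  have U_eq: "U = ?W \<inter> F -` V" by (auto simp: U_def V_def F_def dist_norm)
  have U: "open U" unfolding U_eq by (rule continuous_open_preimage[OF cF W V])
  have FG: "F (G y) = y" "G (F y) = y" for y by (rule vec3_eqI; simp add: F_def G_def)+
  have FU: "F ` U = V"
  proof
    show "F ` U \<subseteq> V" unfolding U_eq by auto
    show "V \<subseteq> F ` U"
    proof
      fix y assume y: "y \<in> V"
      have "G y \<in> U" proof -
        have "G y $ 3 \<in> ball t \<eta>" using y by (simp add: V_def G_def)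
        then show ?thesis unfolding U_eq using y by (simp only: Int_iff vimage_eq FG)
      qed
      then show "y \<in> F ` U" using FG by (metis imageI)
    qed
  qed
  have GV: "G ` V = U" using FU FG by (metis (no_types, lifting) image_image image_ident image_cong)
  have hom: "homeomorphism U V F G"
    unfolding homeomorphism_def using FU GV FG continuous_on_subset[OF cF UW(1)] continuous_on_subset[OF cG UW(2)] by auto
  have hF: "holomorphic_map_on F U" unfolding F_def
    by (rule shear_holomorphic[OF holomorphic_on_minus[OF f] holomorphic_on_minus[OF g] open_ball]) (auto simp: U_def)
  have hG: "holomorphic_map_on G V" unfolding G_def
    by (rule shear_holomorphic[OF f g open_ball]) (auto simp: V_def)
  have xU: "?x \<in> U" using eta eps by (simp add: U_def)
  have xZ: "?x \<in> Z" using Z[of ?x] eta eps by simp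
  have "F ` (Z \<inter> U) = {y \<in> V. \<forall>i. i \<notin> {3} \<longrightarrow> y $ i = 0}"
  proof (intro equalityI subsetI)
    fix w assume "w \<in> F ` (Z \<inter> U)"
    then obtain y where y: "y \<in> Z" "y \<in> U" "w = F y" by blast
    have "w \<in> V" using y FU by blast
    moreover have "y $ 1 = f (y $ 3)" "y $ 2 = g (y $ 3)" using Z[of y] y by (auto simp: U_def)
    ultimately show "w \<in> {y \<in> V. \<forall>i. i \<notin> {3} \<longrightarrow> y $ i = 0}" using y by (simp add: F_def forall_3)
  next
    fix w assume w: "w \<in> {y \<in> V. \<forall>i. i \<notin> {3} \<longrightarrow> y $ i = 0}"
    then have w0: "w $ 1 = 0" "w $ 2 = 0" by auto
    have "G w \<in> U" using w GV by blast
    moreover have "G w \<in> Z" using Z[of "G w"] w eps by (simp add: G_def w0 V_def)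
    ultimately show "w \<in> F ` (Z \<inter> U)" using FG(1)[of w] by (metis IntI imageI)
  qed
  then show ?thesis
    unfolding submanifold_at_def using xZ U V xU hom hF hG
    by (intro conjI exI[of _ U] exI[of _ V] exI[of _ F] exI[of _ G] exI[of _ "{3}"]) auto
qed

text \<open>The dimension arguments need only a local parametrisation \<open>G\<close> of
  \<open>Z\<close>, the inverse of the straightening map.\<close>

lemma submanifold_chart:
  fixes Z :: "(complex ^ 3) set"
  assumes "submanifold_at k Z z"
  obtains V G y0 and J :: "3 set" where "open V" "y0 \<in> V" "G y0 = z" "inj_on G V" "continuous_on V G" "holomorphic_map_on G V" "card J = k"
    "\<And>y. y \<in> V \<Longrightarrow> \<forall>i. i \<notin> J \<longrightarrow> y $ i = 0 \<Longrightarrow> G y \<in> Z" "\<forall>i. i \<notin> J \<longrightarrow> y0 $ i = 0"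
proof -
  obtain U V F G and J :: "3 set" where *: "z \<in> Z" "open U" "z \<in> U" "open V" "homeomorphism U V F G" "holomorphic_map_on F U" "holomorphic_map_on G V"
     "card J = k" "F ` (Z \<inter> U) = {y \<in> V. \<forall>i. i \<notin> J \<longrightarrow> y $ i = 0}"
    using assms unfolding submanifold_at_def by blast
  note h = *(5)[unfolded homeomorphism_def]
  have FV: "F z \<in> {y \<in> V. \<forall>i. i \<notin> J \<longrightarrow> y $ i = 0}" using *(1,3,9) by blast
  show ?thesis
  proof (rule that[of V "F z" G J])
    show "G (F z) = z" using h *(3) by blast
    show "inj_on G V" using h by (metis inj_on_inverseI)
    show "G y \<in> Z" if y: "y \<in> V" "\<forall>i. i \<notin> J \<longrightarrow> y $ i = 0" for y
    proof -
      have "y \<in> F ` (Z \<inter> U)" using *(9) y by blast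
      then obtain x where "x \<in> Z" "x \<in> U" "y = F x" by blast
      then show ?thesis using h by auto
    qed
  qed (use * h FV in auto)
qed

lemma norm_axis: "norm (axis i c :: complex ^ 'n) = norm c"
proof -
  have "(\<Sum>j\<in>UNIV. (norm ((axis i c :: complex ^ 'n) $ j))\<^sup>2) = (\<Sum>j\<in>UNIV. if j = i then (norm c)\<^sup>2 else 0)"
    by (rule sum.cong) (auto simp: axis_def)
  then show ?thesis by (simp add: norm_vec_def L2_set_def)
qed

text \<open>In a chart with two free directions \<eta> and \<xi>, the third coordinate minus its
  value at \<open>z\<close> vanishes at the origin and, for \<eta> = 0, has finitely many zeros in
  \<xi>. By \<open>root_continuity\<close> a zero in \<xi> persists for every small \<eta>, which
  puts infinitely many points into one fibre.\<close>

lemma submanifold_dim_le_1: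
  fixes Z :: "(complex ^ 3) set"
  assumes sm: "submanifold_at k Z z" and fin: "finite {x \<in> Z. x $ 3 = z $ 3}"
  shows "k \<le> 1"
proof (rule ccontr)
  assume "\<not> k \<le> 1"
  obtain V G y0 and J :: "3 set" where C: "open V" "y0 \<in> V" "G y0 = z" "inj_on G V" "continuous_on V G" "holomorphic_map_on G V" "card J = k"
    "\<And>y. y \<in> V \<Longrightarrow> \<forall>i. i \<notin> J \<longrightarrow> y $ i = 0 \<Longrightarrow> G y \<in> Z" "\<forall>i. i \<notin> J \<longrightarrow> y0 $ i = 0"
    by (rule submanifold_chart[OF sm]) blast
  have "\<exists>i\<in>J. \<exists>j\<in>J. i \<noteq> j"
  proof (rule ccontr)
    assume "\<not> ?thesis"
    then have "card J \<le> 1" using card_le_Suc0_iff_eq[of J] by auto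
    then show False using C(7) \<open>\<not> k \<le> 1\<close> by simp
  qed
  then obtain i j where ij: "i \<in> J" "j \<in> J" "i \<noteq> j" by blast
  obtain R where R: "R > 0" "ball y0 R \<subseteq> V" using C(1,2) open_contains_ball by blast
  define y where "y \<eta> \<xi> = y0 + axis i \<xi> + axis j \<eta>" for \<eta> \<xi> :: complex
  have yV: "y \<eta> \<xi> \<in> V" if "\<eta> \<in> ball 0 (R / 2)" "\<xi> \<in> ball 0 (R / 2)" for \<eta> \<xi>
  proof -
    have "dist y0 (y \<eta> \<xi>) = norm (axis i \<xi> + axis j \<eta> :: complex ^ 3)"
      by (subst dist_commute) (simp add: y_def dist_norm add.assoc)
    also have "\<dots> \<le> norm (axis i \<xi> :: complex ^ 3) + norm (axis j \<eta> :: complex ^ 3)"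
      by (rule norm_triangle_ineq)
    also have "\<dots> < R" using that by (simp add: norm_axis)
    finally show ?thesis using R by auto
  qed
  have y_inj: "\<eta> = \<eta>' \<and> \<xi> = \<xi>'" if "y \<eta> \<xi> = y \<eta>' \<xi>'" for \<eta> \<xi> \<eta>' \<xi>'
  proof -
    have "y \<eta> \<xi> $ i = y \<eta>' \<xi>' $ i" "y \<eta> \<xi> $ j = y \<eta>' \<xi>' $ j" using that by simp_all
    then show ?thesis using ij(3) by (simp add: y_def axis_def)
  qed
  have GZ: "G (y \<eta> \<xi>) \<in> Z" if "\<eta> \<in> ball 0 (R / 2)" "\<xi> \<in> ball 0 (R / 2)" for \<eta> \<xi>
    by (rule C(8)[OF yV[OF that]]) (use ij C(9) in \<open>auto simp: y_def axis_def\<close>)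
  define f where "f \<eta> \<xi> = G (y \<eta> \<xi>) $ 3 - z $ 3" for \<eta> \<xi>
  obtain \<delta> where \<delta>: "\<delta> > 0" "\<And>\<eta>. dist \<eta> 0 < \<delta> \<Longrightarrow> \<eta> \<in> ball 0 (R / 2) \<and> (\<exists>\<xi>\<in>ball 0 (R / 2). dist \<xi> 0 < 1 \<and> f \<eta> \<xi> = 0)"
  proof (rule root_continuity[of "ball 0 (R / 2)" 0 "R / 2" 0 f 1])
    have "bounded_linear (\<lambda>z. axis k z :: complex ^ 3)" for k
      unfolding linear_conv_bounded_linear[symmetric]
      by (rule linearI) (auto simp: Finite_Cartesian_Product.vec_eq_iff axis_def)
    note bl = this
    have "continuous_on (ball 0 (R / 2) \<times> ball 0 (R / 2)) (\<lambda>p. G (y (fst p) (snd p)))"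
    proof (rule continuous_on_compose2[OF C(5)])
      show "continuous_on (ball 0 (R / 2) \<times> ball 0 (R / 2)) (\<lambda>p. y (fst p) (snd p))"
        unfolding y_def by (intro continuous_on_add continuous_on_const bounded_linear.continuous_on[OF bl] continuous_on_fst continuous_on_snd continuous_on_id)
    qed (use yV in auto)
    then show "continuous_on (ball 0 (R / 2) \<times> ball 0 (R / 2)) (\<lambda>(\<eta>, \<xi>). f \<eta> \<xi>)"
      unfolding f_def case_prod_unfold by (intro continuous_intros)
    show "f \<eta> holomorphic_on ball 0 (R / 2)" if eta: "\<eta> \<in> ball 0 (R / 2)" for \<eta>
      unfolding holomorphic_on_open[OF open_ball]
    proof
      fix \<xi> :: complex assume xi: "\<xi> \<in> ball 0 (R / 2)"
      obtain A :: "complex ^ 3 ^ 3" where A: "(G has_derivative (\<lambda>h. A *v h)) (at (y \<eta> \<xi>))"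
        using C(6) yV[OF eta xi] unfolding holomorphic_map_on_def by blast
      have dy: "((\<lambda>\<xi>. y \<eta> \<xi>) has_derivative (\<lambda>h. axis i h)) (at \<xi>)"
        unfolding y_def by (auto intro!: derivative_eq_intros bounded_linear.has_derivative[OF bl])
      have "((\<lambda>\<xi>. G (y \<eta> \<xi>)) has_derivative (\<lambda>h. A *v axis i h)) (at \<xi>)"
        by (rule has_derivative_compose[OF dy A])
      then have "((\<lambda>\<xi>. G (y \<eta> \<xi>) $ 3) has_derivative (\<lambda>h. (A *v axis i h) $ 3)) (at \<xi>)"
        by (rule bounded_linear.has_derivative[OF bounded_linear_vec_nth])
      moreover have "(A *v axis i h) $ 3 = A $ 3 $ i * h" for h
        by (simp add: matrix_vector_mult_def axis_def if_distrib cong: if_cong)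
      ultimately have "((\<lambda>\<xi>. G (y \<eta> \<xi>) $ 3 - z $ 3) has_derivative (\<lambda>h. A $ 3 $ i * h)) (at \<xi>)"
        by (auto intro!: derivative_eq_intros)
      then show "\<exists>f'. (f \<eta> has_field_derivative f') (at \<xi>)"
        unfolding f_def has_field_derivative_def by blast
    qed
    have y00: "y 0 0 = y0" by (simp add: y_def axis_def Finite_Cartesian_Product.vec_eq_iff)
    then show "f 0 0 = 0" using C(3) by (simp add: f_def)
    have "inj_on (\<lambda>\<xi>. G (y 0 \<xi>)) {\<xi> \<in> ball 0 (R / 2). f 0 \<xi> = 0}"
    proof (rule inj_onI)
      fix \<xi> \<xi>' assume a: "\<xi> \<in> {\<xi> \<in> ball 0 (R / 2). f 0 \<xi> = 0}" "\<xi>' \<in> {\<xi> \<in> ball 0 (R / 2). f 0 \<xi> = 0}" "G (y 0 \<xi>) = G (y 0 \<xi>')"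
      then have "y 0 \<xi> = y 0 \<xi>'" using inj_onD[OF C(4) a(3)] yV R by auto
      then show "\<xi> = \<xi>'" using y_inj by blast
    qed
    moreover have "(\<lambda>\<xi>. G (y 0 \<xi>)) ` {\<xi> \<in> ball 0 (R / 2). f 0 \<xi> = 0} \<subseteq> {x \<in> Z. x $ 3 = z $ 3}"
      using GZ[of 0] R by (auto simp: f_def)
    ultimately show "finite {\<xi> \<in> ball 0 (R / 2). f 0 \<xi> = 0}" using fin finite_imageD finite_subset by blast
  qed (use R in auto)
  have "\<exists>\<xi>. \<xi> \<in> ball 0 (R / 2) \<and> f \<eta> \<xi> = 0" if "\<eta> \<in> ball 0 \<delta>" for \<eta> :: complex using \<delta>(2)[of \<eta>] that by auto
  then obtain X where X: "\<And>\<eta> :: complex. \<eta> \<in> ball 0 \<delta> \<Longrightarrow> X \<eta> \<in> ball 0 (R / 2) \<and> f \<eta> (X \<eta>) = 0" by metis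
  have e2: "\<eta> \<in> ball 0 (R / 2)" if "\<eta> \<in> ball 0 \<delta>" for \<eta> :: complex using \<delta>(2)[of \<eta>] that by auto
  have "inj_on (\<lambda>\<eta>. G (y \<eta> (X \<eta>))) (ball 0 \<delta>)"
  proof (rule inj_onI)
    fix \<eta> \<eta>' assume a: "\<eta> \<in> ball 0 \<delta>" "\<eta>' \<in> ball 0 \<delta>" "G (y \<eta> (X \<eta>)) = G (y \<eta>' (X \<eta>'))"
    then have "y \<eta> (X \<eta>) = y \<eta>' (X \<eta>')" using inj_onD[OF C(4) a(3)] yV X e2 by blast
    then show "\<eta> = \<eta>'" using y_inj by blast
  qed
  moreover have "(\<lambda>\<eta>. G (y \<eta> (X \<eta>))) ` ball 0 \<delta> \<subseteq> {x \<in> Z. x $ 3 = z $ 3}"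
    using GZ X e2 by (auto simp: f_def)
  ultimately have "finite (ball (0::complex) \<delta>)" using fin finite_imageD finite_subset by blast
  then show False using uncountable_ball[OF \<delta>(1), of "0::complex"] countable_finite by blast
qed

text \<open>Translation is a chart of dimension 0 at \<open>a\<close>, while a chart with a free
  direction would yield further points of \<open>Z\<close> arbitrarily near
  \<open>a\<close>.\<close>

lemma isolated_local_dim:
  fixes Z :: "(complex ^ 3) set"
  assumes a: "a \<in> Z" and iso: "\<not> a islimpt Z"
  shows "local_dim Z a = 0"
proof -
  obtain r where r: "r > 0" "\<And>x. x \<in> Z \<Longrightarrow> dist x a < r \<Longrightarrow> x = a"
    using iso unfolding islimpt_approachable by blast
  have "submanifold_at 0 Z a"
  proof -
    have hm: "holomorphic_map_on (\<lambda>x :: complex ^ 3. x + c) U" for c U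
      unfolding holomorphic_map_on_def
    proof (intro ballI exI[of _ "Finite_Cartesian_Product.mat 1"])
      fix x :: "complex ^ 3"
      have "((\<lambda>x. x + c) has_derivative (\<lambda>h. h)) (at x)" by (auto intro!: derivative_eq_intros)
      then show "((\<lambda>x. x + c) has_derivative (\<lambda>h. Finite_Cartesian_Product.mat 1 *v h)) (at x)" by (simp only: matrix_vector_mul_lid)
    qed
    have hom: "homeomorphism (ball a r) (ball 0 r) (\<lambda>x. x + (- a)) (\<lambda>x. x + a)"
      unfolding homeomorphism_def
    proof (intro conjI ballI)
      show "(\<lambda>x. x + - a) ` ball a r = ball 0 r"
      proof (intro equalityI subsetI)
        fix x :: "complex ^ 3" assume "x \<in> ball 0 r"
        then show "x \<in> (\<lambda>x. x + - a) ` ball a r" by (intro image_eqI[of _ _ "x + a"]) (auto simp: dist_norm)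
      qed (auto simp: dist_norm norm_minus_commute)
      show "(\<lambda>x. x + a) ` ball 0 r = ball a r"
      proof (intro equalityI subsetI)
        fix x assume "x \<in> ball a r"
        then show "x \<in> (\<lambda>x. x + a) ` ball 0 r" by (intro image_eqI[of _ _ "x - a"]) (auto simp: dist_norm norm_minus_commute)
      qed (auto simp: dist_norm)
    qed (auto intro!: continuous_intros)
    have "(\<lambda>x. x + (- a)) ` (Z \<inter> ball a r) = {y \<in> ball 0 r. \<forall>i. i \<notin> {} \<longrightarrow> y $ i = 0}"
    proof -
      have "Z \<inter> ball a r = {a}" using r a by (auto simp: dist_commute)
      moreover have "{y \<in> ball 0 r. \<forall>i. i \<notin> {} \<longrightarrow> y $ i = 0} = {0 :: complex ^ 3}"
        using r(1) by (auto simp: Finite_Cartesian_Product.vec_eq_iff)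
      ultimately show ?thesis by simp
    qed
    moreover have "card ({} :: 3 set) = 0" by simp
    moreover have "a \<in> ball a r" using r(1) by simp
    ultimately show ?thesis unfolding submanifold_at_def using a hom hm open_ball by blast
  qed
  then have 0: "0 \<in> {k. a \<in> closure {z. submanifold_at k Z z}}" using closure_subset by fastforce
  have "k = 0" if k: "a \<in> closure {z. submanifold_at k Z z}" for k
  proof (rule ccontr)
    assume "k \<noteq> 0"
    obtain z where z: "submanifold_at k Z z" "dist z a < r" using k r(1) unfolding closure_approachable by blast
    have "z \<in> Z" using z by (simp add: submanifold_at_def)
    then have za: "z = a" using r z by blast
    obtain V G y0 and J :: "3 set" where C: "open V" "y0 \<in> V" "G y0 = z" "inj_on G V" "continuous_on V G" "holomorphic_map_on G V" "card J = k"
      "\<And>y. y \<in> V \<Longrightarrow> \<forall>i. i \<notin> J \<longrightarrow> y $ i = 0 \<Longrightarrow> G y \<in> Z" "\<forall>i. i \<notin> J \<longrightarrow> y0 $ i = 0"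
      by (rule submanifold_chart[OF z(1)]) blast
    obtain i where i: "i \<in> J" using C(7) \<open>k \<noteq> 0\<close> by fastforce
    obtain d where d: "d > 0" "\<And>y. y \<in> V \<Longrightarrow> dist y y0 < d \<Longrightarrow> dist (G y) (G y0) < r"
      using C(2,5) r(1) unfolding continuous_on_iff by blast
    obtain R where R: "R > 0" "ball y0 R \<subseteq> V" using C(1,2) open_contains_ball by blast
    \<comment> \<open>The step is short enough to stay in the chart and, by continuity of
      \<open>G\<close>, to be mapped within \<open>r\<close> of \<open>a\<close>.\<close>
    define y where "y = y0 + axis i (of_real (min d R / 2))"
    have dist: "dist y y0 = min d R / 2" using d R by (simp add: y_def dist_norm norm_axis)
    have yV: "y \<in> V" using R dist d(1) by (auto simp: dist_commute)
    have "G y \<in> Z" by (rule C(8)[OF yV]) (use i C(9) in \<open>auto simp: y_def axis_def\<close>)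
    moreover have "dist (G y) a < r" using d(2)[OF yV] dist d(1) R(1) C(3) za by simp
    ultimately have "G y = G y0" using r(2) C(3) za by simp
    then have "y = y0" using inj_onD[OF C(4)] yV C(2) by blast
    then show False using dist d(1) R(1) by simp
  qed
  then have "{k. a \<in> closure {z. submanifold_at k Z z}} = {0}" using 0 by blast
  then show ?thesis by (simp add: local_dim_def)
qed

text \<open>Finitely many finite fibres make up a finite set, whose removal cannot destroy a limit
  point.\<close>

lemma generic_points_dense:
  fixes \<Omega> :: "(complex ^ 3) set"
  assumes x: "x islimpt \<Omega>" and B: "finite B" and fib: "\<And>t. t \<in> B \<Longrightarrow> finite {y \<in> \<Omega>. y $ 3 = t}"
  shows "x \<in> closure {y \<in> \<Omega>. y $ 3 \<notin> B}"
proof -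
  let ?F = "\<Union>t\<in>B. {y \<in> \<Omega>. y $ 3 = t}"
  have "\<Omega> = ?F \<union> {y \<in> \<Omega>. y $ 3 \<notin> B}" by auto
  then have "x islimpt (?F \<union> {y \<in> \<Omega>. y $ 3 \<notin> B})" using x by simp
  moreover have "finite ?F" using B fib by blast
  ultimately have "x islimpt {y \<in> \<Omega>. y $ 3 \<notin> B}" using islimpt_Un islimpt_finite by blast
  then show ?thesis by (simp add: closure_def)
qed

text \<open>Off \<open>B\<close> each branch is isolated from the others, so the set is locally a
  graph over the third coordinate; such points are dense, and finite fibres exclude larger
  dimensions.\<close>

lemma one_dimensional:
  fixes \<Omega> :: "(complex ^ 3) set"
  assumes var: "\<Omega> = zero_locus S \<inter> tetrablock"
    and iso: "\<And>x. x \<in> \<Omega> \<Longrightarrow> x islimpt \<Omega>" and ne: "\<Omega> \<noteq> {}"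
    and cl: "\<And>x. x \<in> closure \<Omega> \<Longrightarrow> norm (x $ 3) < 1 \<Longrightarrow> x \<in> \<Omega>"
    and d0: "d1 \<noteq> 0" "d2 \<noteq> 0"
    and dZ: "\<And>x. x \<in> \<Omega> \<Longrightarrow> poly (spec (x $ 3) d1) (x $ 1) = 0" "\<And>x. x \<in> \<Omega> \<Longrightarrow> poly (spec (x $ 3) d2) (x $ 2) = 0"
    and fib: "\<And>t. finite {y \<in> \<Omega>. y $ 3 = t}"
  shows "of_dimension \<Omega> 1"
  unfolding of_dimension_def
proof (intro conjI ballI ne)
  fix a assume a: "a \<in> \<Omega>"
  obtain B where B: "finite B" "\<And>t0. t0 \<notin> B \<Longrightarrow> \<exists>\<delta>>0. \<exists>P. finite P \<and>
      (\<forall>(f, g)\<in>P. f holomorphic_on ball t0 \<delta> \<and> g holomorphic_on ball t0 \<delta>) \<and>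
      (\<forall>t\<in>ball t0 \<delta>. inj_on (\<lambda>(f, g). vec3 (f t) (g t) t) P \<and>
         (norm t < 1 \<longrightarrow> {x\<in>\<Omega>. x $ 3 = t} = (\<lambda>(f, g). vec3 (f t) (g t) t) ` P))"
    by (rule local_branches[OF var iso cl d0 dZ]) (blast+)
  have smooth: "submanifold_at 1 \<Omega> x" if x: "x \<in> \<Omega>" "x $ 3 \<notin> B" for x
  proof -
    define t where "t = x $ 3"
    have t1: "norm t < 1" using x var tetrablock_3_less by (auto simp: t_def)
    obtain \<delta> P where P: "\<delta> > 0" "finite P" "\<forall>(f, g)\<in>P. f holomorphic_on ball t \<delta> \<and> g holomorphic_on ball t \<delta>"
      "\<forall>s\<in>ball t \<delta>. inj_on (\<lambda>(f, g). vec3 (f s) (g s) s) P \<and>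
         (norm s < 1 \<longrightarrow> {x\<in>\<Omega>. x $ 3 = s} = (\<lambda>(f, g). vec3 (f s) (g s) s) ` P)"
      using B(2)[OF x(2)] unfolding t_def by blast
    define \<phi> :: "(complex \<Rightarrow> complex) \<times> (complex \<Rightarrow> complex) \<Rightarrow> complex \<Rightarrow> complex ^ 3"
      where "\<phi> k s = vec3 (fst k s) (snd k s) s" for k s
    have eq: "(\<lambda>(f, g). vec3 (f s) (g s) s) = (\<lambda>k. \<phi> k s)" for s by (auto simp: \<phi>_def fun_eq_iff)
    have inj: "inj_on (\<lambda>k. \<phi> k t) P" and img: "\<And>s. s \<in> ball t \<delta> \<Longrightarrow> norm s < 1 \<Longrightarrow> {x\<in>\<Omega>. x $ 3 = s} = (\<lambda>k. \<phi> k s) ` P"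
      using P(4) P(1) unfolding eq by auto
    have hol: "fst k holomorphic_on ball t \<delta>" "snd k holomorphic_on ball t \<delta>" if "k \<in> P" for k
      using P(3) that by (auto simp: case_prod_unfold)
    obtain k where k: "k \<in> P" "x = \<phi> k t" proof -
      have "x \<in> (\<lambda>k. \<phi> k t) ` P" using img[of t] x P(1) t1 by (simp add: t_def[symmetric]) (use x t_def in blast)
      then show ?thesis using that by blast
    qed
    have "\<exists>e>0. \<forall>k'\<in>P - {k}. \<forall>s\<in>ball t \<delta>. dist s t < e \<longrightarrow> e \<le> dist (\<phi> k' s) x"
    proof (rule branch_isolated)
      show "continuous_on (ball t \<delta>) (\<phi> k')" if "k' \<in> P - {k}" for k'
        unfolding \<phi>_def using hol[of k'] that by (intro continuous_intros holomorphic_on_imp_continuous_on) auto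
      show "\<phi> k' t \<noteq> x" if "k' \<in> P - {k}" for k' using inj_onD[OF inj, of k' k] k that by auto
    qed (use P in auto)
    then obtain e where e: "e > 0" "\<And>k' s. k' \<in> P \<Longrightarrow> k' \<noteq> k \<Longrightarrow> s \<in> ball t \<delta> \<Longrightarrow> dist s t < e \<Longrightarrow> e \<le> dist (\<phi> k' s) x" by auto
    have cont: "continuous_on (ball t \<delta>) (\<phi> k)"
      unfolding \<phi>_def using hol[OF k(1)] by (intro continuous_intros holomorphic_on_imp_continuous_on) auto
    obtain d where d: "d > 0" "\<And>s. s \<in> ball t \<delta> \<Longrightarrow> dist s t < d \<Longrightarrow> dist (\<phi> k s) (\<phi> k t) < e / 2"
      using cont P(1) e(1) unfolding continuous_on_iff by (metis centre_in_ball half_gt_zero)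
    define \<eta> where "\<eta> = min (min \<delta> d) (min e (1 - norm t))"
    have eta: "\<eta> > 0" using P(1) d(1) e(1) t1 by (simp add: \<eta>_def)
    have ball: "s \<in> ball t \<delta>" "dist s t < d" "dist s t < e" "norm s < 1" if "s \<in> ball t \<eta>" for s
    proof -
      have "dist s t < \<eta>" using that by (simp add: dist_commute)
      then show "s \<in> ball t \<delta>" "dist s t < d" "dist s t < e" by (simp_all add: \<eta>_def dist_commute)
      show "norm s < 1" using \<open>dist s t < \<eta>\<close> norm_triangle_sub[of s t] by (simp add: \<eta>_def dist_norm)
    qed
    \<comment> \<open>Two coordinate errors of \<open>e / 4\<close> and a variation of
      \<open>e / 2\<close> along the branch keep \<open>y\<close> within \<open>e\<close> of
      \<open>x\<close>, where only the branch \<open>k\<close> occurs.\<close>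
    have "submanifold_at 1 \<Omega> (vec3 (fst k t) (snd k t) t)"
    proof (rule graph_submanifold[of _ t \<eta> _ "e / 4"])
      have sub: "ball t \<eta> \<subseteq> ball t \<delta>" using ball by blast
      show "fst k holomorphic_on ball t \<eta>" "snd k holomorphic_on ball t \<eta>"
        using hol[OF k(1)] holomorphic_on_subset sub by blast+
      show "y \<in> \<Omega> \<longleftrightarrow> y $ 1 = fst k (y $ 3) \<and> y $ 2 = snd k (y $ 3)"
        if y: "y $ 3 \<in> ball t \<eta>" "dist (y $ 1) (fst k (y $ 3)) < e / 4" "dist (y $ 2) (snd k (y $ 3)) < e / 4" for y
      proof
        note b = ball[OF y(1)]
        assume yO: "y \<in> \<Omega>"
        then obtain k' where k': "k' \<in> P" "y = \<phi> k' (y $ 3)" using img[OF b(1,4)] by blast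
        have "dist y (\<phi> k (y $ 3)) \<le> norm (y $ 1 - fst k (y $ 3)) + norm (y $ 2 - snd k (y $ 3)) + norm (y $ 3 - y $ 3)"
          using norm_vec3_le[of "y - \<phi> k (y $ 3)"] by (simp add: dist_norm \<phi>_def)
        then have "dist y (\<phi> k (y $ 3)) < e / 2" using y by (simp add: dist_norm)
        then have "dist y x < e" using d(2)[OF b(1,2)] dist_triangle[of y x "\<phi> k (y $ 3)"] k(2) by simp
        then have "k' = k" using e(2)[OF k'(1) _ b(1,3)] k'(2) by fastforce
        then have "y = \<phi> k (y $ 3)" using k' by simp
        then have "y $ 1 = \<phi> k (y $ 3) $ 1" "y $ 2 = \<phi> k (y $ 3) $ 2" by simp_all
        then show "y $ 1 = fst k (y $ 3) \<and> y $ 2 = snd k (y $ 3)" by (simp add: \<phi>_def)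
      next
        note b = ball[OF y(1)]
        assume "y $ 1 = fst k (y $ 3) \<and> y $ 2 = snd k (y $ 3)"
        then have "y = \<phi> k (y $ 3)" by (intro vec3_eqI) (auto simp: \<phi>_def)
        then have "y \<in> (\<lambda>k. \<phi> k (y $ 3)) ` P" using k(1) by (rule image_eqI)
        then show "y \<in> \<Omega>" using img[OF b(1,4)] by blast
      qed
    qed (use eta e in auto)
    then show ?thesis using k(2) by (simp add: \<phi>_def)
  qed
  have "a \<in> closure {y \<in> \<Omega>. y $ 3 \<notin> B}" using generic_points_dense[OF iso[OF a] B(1) fib] by blast
  moreover have "{y \<in> \<Omega>. y $ 3 \<notin> B} \<subseteq> {z. submanifold_at 1 \<Omega> z}" using smooth by blast
  ultimately have 1: "1 \<in> {k. a \<in> closure {z. submanifold_at k \<Omega> z}}" using closure_mono by blast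
  have le: "k \<le> 1" if "k \<in> {k. a \<in> closure {z. submanifold_at k \<Omega> z}}" for k
  proof -
    have "{z. submanifold_at k \<Omega> z} \<noteq> {}" using that by force
    then show ?thesis using submanifold_dim_le_1 fib by blast
  qed
  show "local_dim \<Omega> a = 1"
    unfolding local_dim_def using 1 le by (intro Max_eqI) (auto intro: finite_subset[of _ "{..1}"])
qed

section \<open>Spectra of pencils\<close>

lemma shift_carrier [simp]: "(T - s \<cdot>\<^sub>m 1\<^sub>m n :: complex mat) \<in> carrier_mat n n"
  by (rule minus_carrier_mat) simp

lemma shift_mult_vec: assumes T: "(T :: complex mat) \<in> carrier_mat n n" and v: "v \<in> carrier_vec n"
  shows "(T - s \<cdot>\<^sub>m 1\<^sub>m n) *\<^sub>v v = T *\<^sub>v v - s \<cdot>\<^sub>v v"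
proof -
  have "(s \<cdot>\<^sub>m 1\<^sub>m n) *\<^sub>v v = s \<cdot>\<^sub>v v"
    by (rule eq_vecI) (use v in \<open>auto simp: scalar_prod_def if_distrib[of "\<lambda>x. s * x"] if_distrib[of "\<lambda>x. x * _"] cong: if_cong\<close>)
  then show ?thesis using minus_mult_distrib_mat_vec[OF T _ v, of "s \<cdot>\<^sub>m 1\<^sub>m n"] by simp
qed

lemma shift_kernel: assumes T: "(T :: complex mat) \<in> carrier_mat n n" and v: "v \<in> carrier_vec n"
  shows "(T - s \<cdot>\<^sub>m 1\<^sub>m n) *\<^sub>v v = k \<cdot>\<^sub>v v \<longleftrightarrow> T *\<^sub>v v = (s + k) \<cdot>\<^sub>v v"
proof -
  have "vec_index (T *\<^sub>v v) i - s * vec_index v i = k * vec_index v i \<longleftrightarrow> vec_index (T *\<^sub>v v) i = (s + k) * vec_index v i" for i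
    by (auto simp: algebra_simps)
  moreover have "T *\<^sub>v v - s \<cdot>\<^sub>v v = k \<cdot>\<^sub>v v \<longleftrightarrow> (\<forall>i<n. vec_index (T *\<^sub>v v) i - s * vec_index v i = k * vec_index v i)"
    using T v by (auto simp: Matrix.vec_eq_iff)
  moreover have "T *\<^sub>v v = (s + k) \<cdot>\<^sub>v v \<longleftrightarrow> (\<forall>i<n. vec_index (T *\<^sub>v v) i = (s + k) * vec_index v i)"
    using T v by (auto simp: Matrix.vec_eq_iff)
  ultimately show ?thesis unfolding shift_mult_vec[OF T v] by simp
qed

lemma shift_kernel_zero: assumes T: "(T :: complex mat) \<in> carrier_mat n n" and v: "v \<in> carrier_vec n"
  shows "(T - s \<cdot>\<^sub>m 1\<^sub>m n) *\<^sub>v v = 0\<^sub>v n \<longleftrightarrow> T *\<^sub>v v = s \<cdot>\<^sub>v v"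
proof -
  have "0 \<cdot>\<^sub>v v = 0\<^sub>v n" using v by (intro eq_vecI) auto
  then show ?thesis using shift_kernel[OF T v, of s 0] by simp
qed

lemma det_shift_zero_iff: assumes T: "(T :: complex mat) \<in> carrier_mat n n"
  shows "det (T - s \<cdot>\<^sub>m 1\<^sub>m n) = 0 \<longleftrightarrow> (\<exists>v\<in>carrier_vec n. v \<noteq> 0\<^sub>v n \<and> T *\<^sub>v v = s \<cdot>\<^sub>v v)"
proof -
  have c: "T - s \<cdot>\<^sub>m 1\<^sub>m n \<in> carrier_mat n n" by simp
  have "(T - s \<cdot>\<^sub>m 1\<^sub>m n) *\<^sub>v v = 0\<^sub>v n \<longleftrightarrow> T *\<^sub>v v = s \<cdot>\<^sub>v v" if v: "v \<in> carrier_vec n" for v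
    by (rule shift_kernel_zero[OF T v])
  then show ?thesis using det_0_iff_vec_prod_zero[OF c] by blast
qed

lemma shifted_commute:
  fixes T1 T2 :: "complex mat"
  assumes T: "T1 \<in> carrier_mat n n" "T2 \<in> carrier_mat n n" and comm: "T1 * T2 = T2 * T1"
  shows "(T1 - a \<cdot>\<^sub>m 1\<^sub>m n) * (T2 - b \<cdot>\<^sub>m 1\<^sub>m n) = (T2 - b \<cdot>\<^sub>m 1\<^sub>m n) * (T1 - a \<cdot>\<^sub>m 1\<^sub>m n)"
proof -
  have *: "(A - x \<cdot>\<^sub>m 1\<^sub>m n) * (B - y \<cdot>\<^sub>m 1\<^sub>m n) = A * B - y \<cdot>\<^sub>m A - (x \<cdot>\<^sub>m B - (x * y) \<cdot>\<^sub>m 1\<^sub>m n)"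
    if A: "A \<in> carrier_mat n n" and B: "B \<in> carrier_mat n n" for A B :: "complex mat" and x y
  proof -
    have c: "x \<cdot>\<^sub>m 1\<^sub>m n \<in> carrier_mat n n" "y \<cdot>\<^sub>m 1\<^sub>m n \<in> carrier_mat n n" for x y :: complex by simp_all
    have "(A - x \<cdot>\<^sub>m 1\<^sub>m n) * (B - y \<cdot>\<^sub>m 1\<^sub>m n) = A * (B - y \<cdot>\<^sub>m 1\<^sub>m n) - x \<cdot>\<^sub>m 1\<^sub>m n * (B - y \<cdot>\<^sub>m 1\<^sub>m n)"
      by (rule minus_mult_distrib_mat[OF A c(1) shift_carrier])
    also have "A * (B - y \<cdot>\<^sub>m 1\<^sub>m n) = A * B - y \<cdot>\<^sub>m A"
      using mult_minus_distrib_mat[OF A B c(2)] mult_smult_distrib[OF A one_carrier_mat] A by simp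
    also have "x \<cdot>\<^sub>m 1\<^sub>m n * (B - y \<cdot>\<^sub>m 1\<^sub>m n) = x \<cdot>\<^sub>m B - (x * y) \<cdot>\<^sub>m 1\<^sub>m n"
      using mult_smult_assoc_mat[of "1\<^sub>m n" n n "B - y \<cdot>\<^sub>m 1\<^sub>m n" n x] B by (intro eq_matI) (auto simp: right_diff_distrib)
    finally show ?thesis .
  qed
  show ?thesis unfolding *[OF T] *[OF T(2,1)] comm by (rule eq_matI) (use T in \<open>auto simp: algebra_simps\<close>)
qed

lemma taylor_spectrum_iff_det:
  fixes T1 T2 :: "complex mat"
  assumes T: "T1 \<in> carrier_mat n n" "T2 \<in> carrier_mat n n" and comm: "T1 * T2 = T2 * T1"
  shows "(a, b) \<in> taylor_spectrum n T1 T2 \<longleftrightarrow> (\<forall>c. det ((T1 - a \<cdot>\<^sub>m 1\<^sub>m n) + c \<cdot>\<^sub>m (T2 - b \<cdot>\<^sub>m 1\<^sub>m n)) = 0)"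
  unfolding taylor_spectrum_def
  using not_koszul_exact_iff_det[OF shift_carrier shift_carrier shifted_commute[OF T comm]] by simp

lemma taylor_spectrum_iff_eigen:
  fixes T1 T2 :: "complex mat"
  assumes T: "T1 \<in> carrier_mat n n" "T2 \<in> carrier_mat n n" and comm: "T1 * T2 = T2 * T1"
  shows "(a, b) \<in> taylor_spectrum n T1 T2 \<longleftrightarrow>
    (\<exists>v\<in>carrier_vec n. v \<noteq> 0\<^sub>v n \<and> T1 *\<^sub>v v = a \<cdot>\<^sub>v v \<and> T2 *\<^sub>v v = b \<cdot>\<^sub>v v)"
proof -
  let ?T1 = "T1 - a \<cdot>\<^sub>m 1\<^sub>m n" and ?T2 = "T2 - b \<cdot>\<^sub>m 1\<^sub>m n"
  have c: "?T1 \<in> carrier_mat n n" "?T2 \<in> carrier_mat n n" by simp_all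
  have "(\<exists>v\<in>carrier_vec n. v \<noteq> 0\<^sub>v n \<and> T1 *\<^sub>v v = a \<cdot>\<^sub>v v \<and> T2 *\<^sub>v v = b \<cdot>\<^sub>v v) \<longleftrightarrow>
    (\<exists>v\<in>carrier_vec n. v \<noteq> 0\<^sub>v n \<and> ?T1 *\<^sub>v v = 0\<^sub>v n \<and> ?T2 *\<^sub>v v = 0\<^sub>v n)"
    using shift_kernel_zero[OF T(1)] shift_kernel_zero[OF T(2)] by blast
  moreover have "\<not> koszul_exact n ?T1 ?T2 \<longleftrightarrow> (\<exists>v\<in>carrier_vec n. v \<noteq> 0\<^sub>v n \<and> ?T1 *\<^sub>v v = 0\<^sub>v n \<and> ?T2 *\<^sub>v v = 0\<^sub>v n)"
  proof
    assume "\<not> koszul_exact n ?T1 ?T2"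
    then show "\<exists>v\<in>carrier_vec n. v \<noteq> 0\<^sub>v n \<and> ?T1 *\<^sub>v v = 0\<^sub>v n \<and> ?T2 *\<^sub>v v = 0\<^sub>v n"
      using not_koszul_exact_iff_det[OF c shifted_commute[OF T comm]] common_kernel[OF c shifted_commute[OF T comm]] by blast
  qed (unfold koszul_exact_def, blast)
  ultimately show ?thesis by (simp add: taylor_spectrum_def)
qed

lemma continuous_on_det:
  fixes A :: "'a::topological_space \<Rightarrow> complex mat"
  assumes A: "\<And>x. A x \<in> carrier_mat n n" and c: "\<And>i j. i < n \<Longrightarrow> j < n \<Longrightarrow> continuous_on U (\<lambda>x. A x $$ (i, j))"
  shows "continuous_on U (\<lambda>x. det (A x))"
  unfolding det_def'[OF A]
proof (intro continuous_on_sum continuous_on_mult continuous_on_const continuous_on_prod)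
  fix p i assume "p \<in> {p. p permutes {0..<n}}" "i \<in> {0..<n}"
  then show "continuous_on U (\<lambda>x. A x $$ (i, p i))" using c permutes_in_image[of p "{0..<n}" i] by auto
qed

lemma holomorphic_on_det:
  fixes A :: "complex \<Rightarrow> complex mat"
  assumes A: "\<And>x. A x \<in> carrier_mat n n" and c: "\<And>i j. i < n \<Longrightarrow> j < n \<Longrightarrow> (\<lambda>x. A x $$ (i, j)) holomorphic_on U"
  shows "(\<lambda>x. det (A x)) holomorphic_on U"
  unfolding det_def'[OF A]
proof (intro holomorphic_on_sum holomorphic_on_mult holomorphic_on_const holomorphic_on_prod)
  fix p i assume "p \<in> {p. p permutes {0..<n}}" "i \<in> {0..<n}"
  then show "(\<lambda>x. A x $$ (i, p i)) holomorphic_on U" using c permutes_in_image[of p "{0..<n}" i] by auto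
qed

text \<open>A property of functions rather than of matrices over a polynomial ring: closure under
  sums and products carries it through the Leibniz formula to determinants.\<close>

definition bipolynomial :: "(complex \<Rightarrow> complex \<Rightarrow> complex) \<Rightarrow> bool" where
  "bipolynomial f \<longleftrightarrow> (\<exists>d. \<forall>t x. f t x = poly (spec t d) x)"

lemma bipolynomial_const: "bipolynomial (\<lambda>t x. c)"
  unfolding bipolynomial_def by (intro exI[of _ "[:[:c:]:]"]) simp
lemma bipolynomial_fst: "bipolynomial (\<lambda>t x. t)"
  unfolding bipolynomial_def by (intro exI[of _ "[:[:0, 1:]:]"]) simp
lemma bipolynomial_snd: "bipolynomial (\<lambda>t x. x)"
  unfolding bipolynomial_def by (intro exI[of _ "[:0, 1:]"]) simp
lemma bipolynomial_add: assumes "bipolynomial f" "bipolynomial g" shows "bipolynomial (\<lambda>t x. f t x + g t x)"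
proof -
  obtain d e where "\<forall>t x. f t x = poly (spec t d) x" "\<forall>t x. g t x = poly (spec t e) x"
    using assms unfolding bipolynomial_def by blast
  then show ?thesis unfolding bipolynomial_def by (intro exI[of _ "d + e"]) simp
qed
lemma bipolynomial_mult: assumes "bipolynomial f" "bipolynomial g" shows "bipolynomial (\<lambda>t x. f t x * g t x)"
proof -
  obtain d e where "\<forall>t x. f t x = poly (spec t d) x" "\<forall>t x. g t x = poly (spec t e) x"
    using assms unfolding bipolynomial_def by blast
  then show ?thesis unfolding bipolynomial_def by (intro exI[of _ "d * e"]) simp
qed
lemma bipolynomial_sum: assumes "\<And>i. i \<in> I \<Longrightarrow> bipolynomial (f i)" shows "bipolynomial (\<lambda>t x. \<Sum>i\<in>I. f i t x)"
  using assms by (induction I rule: infinite_finite_induct) (simp_all add: bipolynomial_const bipolynomial_add)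
lemma bipolynomial_prod: assumes "\<And>i. i \<in> I \<Longrightarrow> bipolynomial (f i)" shows "bipolynomial (\<lambda>t x. \<Prod>i\<in>I. f i t x)"
  using assms by (induction I rule: infinite_finite_induct) (simp_all add: bipolynomial_const bipolynomial_mult)

lemma bipolynomial_det:
  fixes A :: "complex \<Rightarrow> complex \<Rightarrow> complex mat"
  assumes A: "\<And>t x. A t x \<in> carrier_mat n n" and c: "\<And>i j. i < n \<Longrightarrow> j < n \<Longrightarrow> bipolynomial (\<lambda>t x. A t x $$ (i, j))"
  shows "bipolynomial (\<lambda>t x. det (A t x))"
  unfolding det_def'[OF A]
proof (intro bipolynomial_sum bipolynomial_mult bipolynomial_const bipolynomial_prod)
  fix p i assume "p \<in> {p. p permutes {0..<n}}" "i \<in> {0..<n}"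
  then show "bipolynomial (\<lambda>t x. A t x $$ (i, p i))" using c permutes_in_image[of p "{0..<n}" i] by auto
qed

lemma adjoint_carrier [simp]: assumes "A \<in> carrier_mat n n" shows "mat_adjoint A \<in> carrier_mat n n"
  using mat_of_rows_carrier(1)[of "dim_row A" "map conjugate (cols A)"] carrier_matD[OF assms] by (simp add: mat_adjoint_def)

lemma adjoint_index: assumes "(A :: complex mat) \<in> carrier_mat n n" "i < n" "j < n"
  shows "mat_adjoint A $$ (i, j) = cnj (A $$ (j, i))"
  using carrier_matD[OF assms(1)] assms(2,3) by (simp add: mat_adjoint_def mat_of_rows_index)

section \<open>Commuting pencils and their joint spectra\<close>

locale pencil =
  fixes n :: nat and A1 A2 :: "complex mat"
  assumes n: "n > 0" and A: "A1 \<in> carrier_mat n n" "A2 \<in> carrier_mat n n"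
    and comm: "A1 * A2 = A2 * A1"
    and self: "commutator (mat_adjoint A1) A1 = commutator (mat_adjoint A2) A2"
begin

definition "P1 t = mat_adjoint A1 + t \<cdot>\<^sub>m A2"
definition "P2 t = mat_adjoint A2 + t \<cdot>\<^sub>m A1"
definition "spectra t = taylor_spectrum n (P1 t) (P2 t)"

lemma P_carrier [simp]: "P1 t \<in> carrier_mat n n" "P2 t \<in> carrier_mat n n"
  using A by (simp_all add: P1_def P2_def)

lemma P_dim [simp]: "dim_row (P1 t) = n" "dim_col (P1 t) = n" "dim_row (P2 t) = n" "dim_col (P2 t) = n"
  by (rule carrier_matD[OF P_carrier(1)] carrier_matD[OF P_carrier(2)])+

lemma P_index: assumes "i < n" "j < n"
  shows "P1 t $$ (i, j) = cnj (A1 $$ (j, i)) + t * A2 $$ (i, j)" "P2 t $$ (i, j) = cnj (A2 $$ (j, i)) + t * A1 $$ (i, j)"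
  using A assms by (simp_all add: P1_def P2_def adjoint_index)

text \<open>Comparison of powers of \<open>t\<close>: the constant and quadratic coefficients agree
  because \<open>A1\<close> and \<open>A2\<close> commute, and equality of the linear coefficients
  is exactly the equality of the self-commutators.\<close>

lemma P_commute: "P1 t * P2 t = P2 t * P1 t"
proof (rule eq_matI)
  fix i j assume ij: "i < dim_row (P2 t * P1 t)" "j < dim_col (P2 t * P1 t)"
  then have ij: "i < n" "j < n" by auto
  have mult: "(M * N) $$ (i, j) = (\<Sum>k = 0..<n. M $$ (i, k) * N $$ (k, j))" if "M \<in> carrier_mat n n" "N \<in> carrier_mat n n" "i < n" "j < n" for M N :: "complex mat" and i j
    using that by (simp add: scalar_prod_def)
  have expand: "(\<Sum>k = 0..<n. (a k + t * b k) * (c k + t * d k)) = (\<Sum>k = 0..<n. a k * c k) +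
      t * ((\<Sum>k = 0..<n. a k * d k) + (\<Sum>k = 0..<n. b k * c k)) + t ^ 2 * (\<Sum>k = 0..<n. b k * d k)" for a b c d :: "nat \<Rightarrow> complex"
  proof -
    have "(\<Sum>k = 0..<n. (a k + t * b k) * (c k + t * d k)) =
        (\<Sum>k = 0..<n. a k * c k + t * (a k * d k + b k * c k) + t ^ 2 * (b k * d k))"
      by (rule sum.cong) (auto simp: algebra_simps power2_eq_square)
    then show ?thesis by (simp only: sum.distrib sum_distrib_left[symmetric])
  qed
  let ?B1 = "mat_adjoint A1" and ?B2 = "mat_adjoint A2"
  have B: "?B1 \<in> carrier_mat n n" "?B2 \<in> carrier_mat n n" using A by simp_all
  have adj: "?B1 * ?B2 = ?B2 * ?B1"
  proof (rule eq_matI)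
    fix i j assume "i < dim_row (?B2 * ?B1)" "j < dim_col (?B2 * ?B1)"
    then have ij: "i < n" "j < n" using B by auto
    have "(A2 * A1) $$ (j, i) = (A1 * A2) $$ (j, i)" using comm by simp
    then have "(\<Sum>k = 0..<n. A2 $$ (j, k) * A1 $$ (k, i)) = (\<Sum>k = 0..<n. A1 $$ (j, k) * A2 $$ (k, i))"
      using A ij by (simp add: scalar_prod_def)
    then have "cnj (\<Sum>k = 0..<n. A2 $$ (j, k) * A1 $$ (k, i)) = cnj (\<Sum>k = 0..<n. A1 $$ (j, k) * A2 $$ (k, i))" by simp
    then show "(?B1 * ?B2) $$ (i, j) = (?B2 * ?B1) $$ (i, j)"
      using A ij unfolding mult[OF B ij] mult[OF B(2,1) ij] by (simp add: adjoint_index mult.commute)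
  qed (use B in auto)
  have e: "(?B1 * A1 - A1 * ?B1) $$ (i, j) = (?B2 * A2 - A2 * ?B2) $$ (i, j)"
    using self by (simp add: commutator_def)
  have d: "(X - Y) $$ (i, j) = X $$ (i, j) - Y $$ (i, j)" if "Y \<in> carrier_mat n n" for X Y :: "complex mat"
    using that ij by simp
  have "p + q = r + u" if "p - u = r - q" for p q r u :: complex using that by (simp add: algebra_simps)
  note s = this[OF e[unfolded d[OF mult_carrier_mat[OF A(1) B(1)]] d[OF mult_carrier_mat[OF A(2) B(2)]]]]
  have ent: "P1 t $$ (i, k) = ?B1 $$ (i, k) + t * A2 $$ (i, k)" "P2 t $$ (i, k) = ?B2 $$ (i, k) + t * A1 $$ (i, k)" if "i < n" "k < n" for i k
    using that A B by (simp_all add: P1_def P2_def)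
  have "(P1 t * P2 t) $$ (i, j) = (\<Sum>k = 0..<n. (?B1 $$ (i, k) + t * A2 $$ (i, k)) * (?B2 $$ (k, j) + t * A1 $$ (k, j)))"
    unfolding mult[OF P_carrier ij] by (rule sum.cong) (use ij ent in auto)
  also have "\<dots> = (?B1 * ?B2) $$ (i, j) + t * ((?B1 * A1) $$ (i, j) + (A2 * ?B2) $$ (i, j)) + t ^ 2 * (A2 * A1) $$ (i, j)"
    unfolding expand mult[OF B ij] mult[OF B(1) A(1) ij] mult[OF A(2) B(2) ij] mult[OF A(2,1) ij] ..
  also have "\<dots> = (?B2 * ?B1) $$ (i, j) + t * ((?B2 * A2) $$ (i, j) + (A1 * ?B1) $$ (i, j)) + t ^ 2 * (A1 * A2) $$ (i, j)"
    unfolding s adj comm ..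
  also have "\<dots> = (\<Sum>k = 0..<n. (?B2 $$ (i, k) + t * A1 $$ (i, k)) * (?B1 $$ (k, j) + t * A2 $$ (k, j)))"
    unfolding expand mult[OF B(2,1) ij] mult[OF B(2) A(2) ij] mult[OF A(1) B(1) ij] mult[OF A(1,2) ij] ..
  also have "\<dots> = (P2 t * P1 t) $$ (i, j)"
    unfolding mult[OF P_carrier(2,1) ij] by (rule sum.cong) (use ij ent in auto)
  finally show "(P1 t * P2 t) $$ (i, j) = (P2 t * P1 t) $$ (i, j)" .
qed auto

lemma spectra_eigen: "(a, b) \<in> spectra t \<longleftrightarrow> (\<exists>v\<in>carrier_vec n. v \<noteq> 0\<^sub>v n \<and> P1 t *\<^sub>v v = a \<cdot>\<^sub>v v \<and> P2 t *\<^sub>v v = b \<cdot>\<^sub>v v)"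
  unfolding spectra_def by (rule taylor_spectrum_iff_eigen[OF P_carrier P_commute])

text \<open>By the determinant criterion the set is an intersection of zero sets of continuous
  functions.\<close>

lemma closed_spectra: "closed {x :: complex ^ 3. (x $ 1, x $ 2) \<in> spectra (x $ 3)}"
proof -
  let ?M = "\<lambda>c (x :: complex ^ 3). (P1 (x $ 3) - x $ 1 \<cdot>\<^sub>m 1\<^sub>m n) + c \<cdot>\<^sub>m (P2 (x $ 3) - x $ 2 \<cdot>\<^sub>m 1\<^sub>m n)"
  have "{x :: complex ^ 3. (x $ 1, x $ 2) \<in> spectra (x $ 3)} = (\<Inter>c. (\<lambda>x. det (?M c x)) -` {0})"
    unfolding spectra_def taylor_spectrum_iff_det[OF P_carrier P_commute] by auto
  moreover have "closed ((\<lambda>x. det (?M c x)) -` {0})" for c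
  proof (rule continuous_closed_vimage)
    have "continuous_on UNIV (\<lambda>x. det (?M c x))"
    proof (rule continuous_on_det[of _ n])
      show "?M c x \<in> carrier_mat n n" for x by simp
      fix i j assume "i < n" "j < n"
      then show "continuous_on UNIV (\<lambda>x. ?M c x $$ (i, j))"
        by (cases "i = j") (simp_all add: P_index, (intro continuous_intros)+)
    qed
    then show "\<And>x. isCont (\<lambda>x. det (?M c x)) x" by (simp add: continuous_on_eq_continuous_at)
  qed auto
  ultimately show ?thesis by auto
qed

lemma finite_spectra: "finite (spectra t)"
proof -
  let ?E = "\<lambda>T. {k. \<exists>v\<in>carrier_vec n. v \<noteq> 0\<^sub>v n \<and> T *\<^sub>v v = k \<cdot>\<^sub>v v}"
  have "spectra t \<subseteq> ?E (P1 t) \<times> ?E (P2 t)"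
  proof
    fix p assume "p \<in> spectra t"
    then show "p \<in> ?E (P1 t) \<times> ?E (P2 t)" using spectra_eigen[of "fst p" "snd p" t] by (auto simp: mem_Times_iff)
  qed
  moreover have "finite (?E (P1 t) \<times> ?E (P2 t))" by (intro finite_cartesian_product finite_eigenvalues P_carrier)
  ultimately show ?thesis by (rule finite_subset)
qed

text \<open>Lifts an eigenvalue \<open>s\<close> of the single matrix
  \<open>P1 t + c \<cdot>\<^sub>m P2 t\<close> to a joint eigenvalue (a, b) on the line a + c b =
  s.\<close>

lemma spectra_on_line:
  assumes "det (P1 t + c \<cdot>\<^sub>m P2 t - s \<cdot>\<^sub>m 1\<^sub>m n) = 0"
  shows "\<exists>\<mu>. (s - c * \<mu>, \<mu>) \<in> spectra t"
proof -
  let ?T = "P1 t - s \<cdot>\<^sub>m 1\<^sub>m n"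
  have c: "?T \<in> carrier_mat n n" by simp
  have comm': "?T * P2 t = P2 t * ?T"
  proof -
    have "P2 t - 0 \<cdot>\<^sub>m 1\<^sub>m n = P2 t" by (rule eq_matI) auto
    then show ?thesis using shifted_commute[OF P_carrier P_commute, of t s 0] by simp
  qed
  have "?T + c \<cdot>\<^sub>m P2 t = P1 t + c \<cdot>\<^sub>m P2 t - s \<cdot>\<^sub>m 1\<^sub>m n" by (rule eq_matI) auto
  then obtain u \<mu> where u: "u \<in> carrier_vec n" "u \<noteq> 0\<^sub>v n" "?T *\<^sub>v u = (- c * \<mu>) \<cdot>\<^sub>v u" "P2 t *\<^sub>v u = \<mu> \<cdot>\<^sub>v u"
    using pencil_kernel_eigen[OF c P_carrier(2) comm', of c] assms by auto
  have "P1 t *\<^sub>v u = (s - c * \<mu>) \<cdot>\<^sub>v u"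
    using u(3) shift_kernel[OF P_carrier(1) u(1), of t s "- c * \<mu>"] by simp
  then show ?thesis using u spectra_eigen by blast
qed

lemma on_line_of_spectra:
  assumes "(a, b) \<in> spectra t" shows "det (P1 t + c \<cdot>\<^sub>m P2 t - (a + c * b) \<cdot>\<^sub>m 1\<^sub>m n) = 0"
proof -
  have "(P1 t - a \<cdot>\<^sub>m 1\<^sub>m n) + c \<cdot>\<^sub>m (P2 t - b \<cdot>\<^sub>m 1\<^sub>m n) = P1 t + c \<cdot>\<^sub>m P2 t - (a + c * b) \<cdot>\<^sub>m 1\<^sub>m n"
    by (rule eq_matI) (auto simp: algebra_simps)
  then show ?thesis using assms unfolding spectra_def taylor_spectrum_iff_det[OF P_carrier P_commute] by metis
qed

lemma spectra_nonempty: "spectra t \<noteq> {}"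
proof -
  have "degree (char_poly (P1 t)) = n" using degree_monic_char_poly[OF P_carrier(1)] by blast
  then have "\<not> constant (poly (char_poly (P1 t)))" using n by (simp add: constant_degree)
  from Fundamental_Theorem_Algebra.fundamental_theorem_of_algebra[OF this] obtain s where "poly (char_poly (P1 t)) s = 0" ..
  then have "eigenvalue (P1 t) s" using eigenvalue_root_char_poly[OF P_carrier(1)] by blast
  then obtain v where "v \<in> carrier_vec n" "v \<noteq> 0\<^sub>v n" "P1 t *\<^sub>v v = s \<cdot>\<^sub>v v"
    by (auto simp: eigenvalue_def eigenvector_def)
  then have "det (P1 t - s \<cdot>\<^sub>m 1\<^sub>m n) = 0" using det_shift_zero_iff[OF P_carrier(1)] by blast
  moreover have "P1 t + 0 \<cdot>\<^sub>m P2 t - s \<cdot>\<^sub>m 1\<^sub>m n = P1 t - s \<cdot>\<^sub>m 1\<^sub>m n" by (rule eq_matI) auto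
  ultimately show ?thesis using spectra_on_line[of t 0 s] by auto
qed

text \<open>The determinants of \<open>P1 t - s\<close> and \<open>P2 t - s\<close> as polynomials
  in both variables; they are nonzero because \<open>P1 0\<close> and \<open>P2 0\<close> have
  finitely many eigenvalues.\<close>

lemma spectra_polynomials:
  obtains d1 d2 where "d1 \<noteq> 0" "d2 \<noteq> 0" "\<And>t a b. (a, b) \<in> spectra t \<Longrightarrow> poly (spec t d1) a = 0"
    "\<And>t a b. (a, b) \<in> spectra t \<Longrightarrow> poly (spec t d2) b = 0"
proof -
  have *: "\<exists>d. d \<noteq> 0 \<and> (\<forall>t s. (\<exists>v\<in>carrier_vec n. v \<noteq> 0\<^sub>v n \<and> P t *\<^sub>v v = s \<cdot>\<^sub>v v) \<longrightarrow> poly (spec t d) s = 0)"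
    if P: "\<And>t. P t \<in> carrier_mat n n" and pol: "\<And>i j. i < n \<Longrightarrow> j < n \<Longrightarrow> bipolynomial (\<lambda>t x. P t $$ (i, j))" for P
  proof -
    have "bipolynomial (\<lambda>t s. det (P t - s \<cdot>\<^sub>m 1\<^sub>m n))"
    proof (rule bipolynomial_det[of _ n])
      fix i j assume ij: "i < n" "j < n"
      have "(P t - s \<cdot>\<^sub>m 1\<^sub>m n) $$ (i, j) = P t $$ (i, j) + (if i = j then - 1 else 0) * s" for t s using ij P[of t] by simp
      then show "bipolynomial (\<lambda>t s. (P t - s \<cdot>\<^sub>m 1\<^sub>m n) $$ (i, j))"
        by (simp only:) (intro bipolynomial_add bipolynomial_mult bipolynomial_const bipolynomial_snd pol ij)
    qed simp
    then obtain d where d: "\<And>t s. det (P t - s \<cdot>\<^sub>m 1\<^sub>m n) = poly (spec t d) s" unfolding bipolynomial_def by blast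
    have "d \<noteq> 0"
    proof
      assume "d = 0"
      then have "{k. \<exists>v\<in>carrier_vec n. v \<noteq> 0\<^sub>v n \<and> P 0 *\<^sub>v v = k \<cdot>\<^sub>v v} = UNIV"
        using d det_shift_zero_iff[OF P, of 0] by auto
      then show False using finite_eigenvalues[OF P, of 0] infinite_UNIV_char_0[where 'a = complex] by simp
    qed
    then show ?thesis using d det_shift_zero_iff[OF P] by metis
  qed
  have p: "bipolynomial (\<lambda>t x. P1 t $$ (i, j))" "bipolynomial (\<lambda>t x. P2 t $$ (i, j))" if "i < n" "j < n" for i j
    unfolding P_index[OF that] by (intro bipolynomial_add bipolynomial_mult bipolynomial_const bipolynomial_fst)+
  obtain d1 where "d1 \<noteq> 0" "\<forall>t s. (\<exists>v\<in>carrier_vec n. v \<noteq> 0\<^sub>v n \<and> P1 t *\<^sub>v v = s \<cdot>\<^sub>v v) \<longrightarrow> poly (spec t d1) s = 0"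
    using *[OF P_carrier(1) p(1)] by blast
  moreover obtain d2 where "d2 \<noteq> 0" "\<forall>t s. (\<exists>v\<in>carrier_vec n. v \<noteq> 0\<^sub>v n \<and> P2 t *\<^sub>v v = s \<cdot>\<^sub>v v) \<longrightarrow> poly (spec t d2) s = 0"
    using *[OF P_carrier(2) p(2)] by blast
  ultimately show ?thesis using that[of d1 d2] spectra_eigen by blast
qed

end

lemma mult_mat_vec_index: "(M :: complex mat) \<in> carrier_mat n n \<Longrightarrow> v \<in> carrier_vec n \<Longrightarrow> i < n \<Longrightarrow>
    vec_index (M *\<^sub>v v) i = (\<Sum>j<n. M $$ (i, j) * vec_index v j)"
  by (auto simp: scalar_prod_def atLeast0LessThan intro!: sum.cong)

lemma vec_norm2_mult_le:
  assumes M: "(M :: complex mat) \<in> carrier_mat n n" and v: "v \<in> carrier_vec n" "vec_norm2 v = 1"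
  shows "vec_norm2 (M *\<^sub>v v) \<le> (\<Sum>i<n. \<Sum>j<n. norm (M $$ (i, j)))"
proof -
  have "vec_norm2 (M *\<^sub>v v) = L2_set (\<lambda>i. norm (vec_index (M *\<^sub>v v) i)) {..<n}"
    using M by (simp add: vec_norm2_def)
  also have "\<dots> \<le> (\<Sum>i<n. norm (vec_index (M *\<^sub>v v) i))" by (rule L2_set_le_sum) simp
  also have "\<dots> \<le> (\<Sum>i<n. \<Sum>j<n. norm (M $$ (i, j)))"
  proof (rule sum_mono)
    fix i assume "i \<in> {..<n}"
    then have "norm (vec_index (M *\<^sub>v v) i) \<le> (\<Sum>j<n. norm (M $$ (i, j) * vec_index v j))"
      using mult_mat_vec_index[OF M v(1)] norm_sum by simp
    also have "\<dots> \<le> (\<Sum>j<n. norm (M $$ (i, j)))"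
    proof (rule sum_mono)
      fix j assume j: "j \<in> {..<n}"
      have "norm (vec_index v j) \<le> L2_set (\<lambda>i. norm (vec_index v i)) {..<n}" by (rule member_le_L2_set) (use j in auto)
      then have "norm (vec_index v j) \<le> 1" using v by (simp add: vec_norm2_def)
      then show "norm (M $$ (i, j) * vec_index v j) \<le> norm (M $$ (i, j))" by (simp add: norm_mult mult_left_le)
    qed
    finally show "norm (vec_index (M *\<^sub>v v) i) \<le> (\<Sum>j<n. norm (M $$ (i, j)))" .
  qed
  finally show ?thesis .
qed

lemma unit_vector_exists: assumes "n > 0" shows "\<exists>v :: complex Matrix.vec. v \<in> carrier_vec n \<and> vec_norm2 v = 1"
proof (intro exI conjI)
  show "Matrix.vec n (\<lambda>i. if i = 0 then 1 else 0 :: complex) \<in> carrier_vec n" by simp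
  have "(\<Sum>i<n. (norm (if i = 0 then 1 else 0 :: complex))\<^sup>2) = (\<Sum>i<n. if i = 0 then 1 else 0)" by (rule sum.cong) auto
  then show "vec_norm2 (Matrix.vec n (\<lambda>i. if i = 0 then 1 else 0 :: complex)) = 1"
    using assms by (simp add: vec_norm2_def L2_set_def)
qed

lemma unit_multiple:
  fixes v :: "complex Matrix.vec"
  assumes v: "v \<in> carrier_vec n" "v \<noteq> 0\<^sub>v n"
  obtains k where "k \<noteq> 0" "vec_norm2 (k \<cdot>\<^sub>v v) = 1"
proof -
  have pos: "vec_norm2 v > 0"
  proof -
    obtain i where i: "i < n" "vec_index v i \<noteq> 0" using v by (auto simp: Matrix.vec_eq_iff)
    have "norm (vec_index v i) \<le> L2_set (\<lambda>i. norm (vec_index v i)) {..<n}" by (rule member_le_L2_set) (use i in auto)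
    then show ?thesis using v(1) i(2) by (simp add: vec_norm2_def) (smt (verit) zero_less_norm_iff)
  qed
  have "vec_norm2 (of_real (1 / vec_norm2 v) \<cdot>\<^sub>v v) = L2_set (\<lambda>i. norm (of_real (1 / vec_norm2 v) * vec_index v i)) {..<n}"
    unfolding vec_norm2_def using v(1) by (intro L2_set_cong) auto
  also have "\<dots> = L2_set (\<lambda>i. 1 / vec_norm2 v * norm (vec_index v i)) {..<n}"
    using pos by (intro L2_set_cong) (auto simp: norm_mult norm_divide)
  also have "\<dots> = 1 / vec_norm2 v * vec_norm2 v"
    using pos v(1) by (subst L2_set_right_distrib[symmetric]) (auto simp: vec_norm2_def)
  finally show ?thesis using that[of "of_real (1 / vec_norm2 v)"] pos by simp
qed

lemma aligned_unit: "\<exists>z. norm z = 1 \<and> norm (a + z * cnj b) = norm a + norm (b :: complex)"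
proof (cases "a = 0 \<or> b = 0")
  case True
  then show ?thesis by (intro exI[of _ 1]) auto
next
  case False
  \<comment> \<open>The product of the phases of \<open>a\<close> and \<open>b\<close> cancels the
    conjugate phase of \<open>b\<close> and aligns the second summand with \<open>a\<close>.\<close>
  define z where "z = (a / of_real (norm a)) * (b / of_real (norm b))"
  have z: "norm z = 1" using False by (simp add: z_def norm_mult norm_divide)
  have "z * cnj b = a / of_real (norm a) * of_real (norm b)"
    using False complex_norm_square[of b] by (simp add: z_def field_simps power2_eq_square)
  then have "a + z * cnj b = a / of_real (norm a) * of_real (norm a + norm b)"
    using False by (simp add: field_simps)
  then have "norm (a + z * cnj b) = norm a + norm b" using False by (simp add: norm_mult norm_divide del: of_real_add)
  then show ?thesis using z by blast
qed

context pencil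
begin

definition "opsup = (SUP z \<in> sphere 0 1. mat_opnorm (P1 z))"

lemma opnorm_bound:
  assumes z: "norm z = 1" and v: "v \<in> carrier_vec n" "vec_norm2 v = 1"
  shows "vec_norm2 (P1 z *\<^sub>v v) \<le> opsup"
proof -
  \<comment> \<open>A common bound for all the norms involved; the two suprema are usable as upper
    bounds only once boundedness is known.\<close>
  let ?K = "\<Sum>i<n. \<Sum>j<n. norm (A1 $$ (j, i)) + norm (A2 $$ (i, j))"
  have le: "vec_norm2 (P1 z *\<^sub>v v) \<le> ?K" if z: "norm z = 1" and v: "v \<in> carrier_vec n" "vec_norm2 v = 1" for z v
  proof -
    have "vec_norm2 (P1 z *\<^sub>v v) \<le> (\<Sum>i<n. \<Sum>j<n. norm (P1 z $$ (i, j)))" by (rule vec_norm2_mult_le[OF P_carrier(1) v])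
    also have "\<dots> \<le> ?K"
    proof (intro sum_mono)
      fix i j assume "i \<in> {..<n}" "j \<in> {..<n}"
      then show "norm (P1 z $$ (i, j)) \<le> norm (A1 $$ (j, i)) + norm (A2 $$ (i, j))"
        using norm_triangle_ineq[of "cnj (A1 $$ (j, i))" "z * A2 $$ (i, j)"] z by (simp add: P_index norm_mult)
    qed
    finally show ?thesis .
  qed
  let ?V = "{v \<in> carrier_vec n. vec_norm2 v = 1}"
  have op: "mat_opnorm (P1 z) = (SUP v \<in> ?V. vec_norm2 (P1 z *\<^sub>v v))" for z by (simp add: mat_opnorm_def)
  have "bdd_above ((\<lambda>v. vec_norm2 (P1 z *\<^sub>v v)) ` ?V)"
    by (rule bdd_aboveI2[of _ _ ?K]) (use le[OF z] in blast)
  then have 1: "vec_norm2 (P1 z *\<^sub>v v) \<le> mat_opnorm (P1 z)" unfolding op by (rule cSUP_upper[rotated]) (use v in blast)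
  have "mat_opnorm (P1 z) \<le> ?K" if "norm z = 1" for z
    unfolding op by (rule cSUP_least) (use le[OF that] unit_vector_exists[OF n] in blast)+
  then have "bdd_above ((\<lambda>z. mat_opnorm (P1 z)) ` sphere 0 1)" by (intro bdd_aboveI2[of _ _ ?K]) simp
  then have "mat_opnorm (P1 z) \<le> opsup" unfolding opsup_def by (rule cSUP_upper[rotated]) (use z in simp)
  then show ?thesis using 1 by simp
qed

text \<open>The compressions of \<open>A\<^sub>1\<^sup>*\<close> and \<open>A\<^sub>2\<^sup>*\<close> to a joint eigenvector give the parameters
  \<open>\<beta>\<^sub>1\<close> and \<open>\<beta>\<^sub>2\<close> that describe points of the tetrablock.\<close>

lemma spectra_param:
  assumes ab: "(a, b) \<in> spectra t"
  obtains \<beta>1 \<beta>2 where "a = \<beta>1 + cnj \<beta>2 * t" "b = \<beta>2 + cnj \<beta>1 * t" "norm \<beta>1 + norm \<beta>2 \<le> opsup"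
proof -
  obtain w where w: "w \<in> carrier_vec n" "w \<noteq> 0\<^sub>v n" "P1 t *\<^sub>v w = a \<cdot>\<^sub>v w" "P2 t *\<^sub>v w = b \<cdot>\<^sub>v w"
    using ab spectra_eigen by blast
  obtain k where k: "k \<noteq> 0" "vec_norm2 (k \<cdot>\<^sub>v w) = 1" using unit_multiple[OF w(1,2)] by blast
  define v where "v = k \<cdot>\<^sub>v w"
  have vc: "v \<in> carrier_vec n" and v1: "vec_norm2 v = 1" using w(1) k(2) by (simp_all add: v_def)
  have eig: "P1 t *\<^sub>v v = a \<cdot>\<^sub>v v" "P2 t *\<^sub>v v = b \<cdot>\<^sub>v v"
    unfolding v_def using w mult_mat_vec[OF P_carrier(1) w(1)] mult_mat_vec[OF P_carrier(2) w(1)]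
    by (simp_all add: smult_smult_assoc mult.commute)
  define V where "V i = vec_index v i" for i
  \<comment> \<open>The quadratic form <M v, v> of the matrix with entries
    \<open>M i j\<close>.\<close>
  define h where "h M = (\<Sum>i<n. (\<Sum>j<n. M i j * V j) * cnj (V i))" for M :: "nat \<Rightarrow> nat \<Rightarrow> complex"
  have h_add: "h (\<lambda>i j. M i j + z * N i j) = h M + z * h N" for M N z
  proof -
    have "(\<Sum>j<n. (M i j + z * N i j) * V j) * cnj (V i) = (\<Sum>j<n. M i j * V j) * cnj (V i) + z * ((\<Sum>j<n. N i j * V j) * cnj (V i))" for i
      by (simp add: sum.distrib sum_distrib_left sum_distrib_right distrib_right mult.assoc)
    then show ?thesis unfolding h_def by (simp add: sum.distrib sum_distrib_left)
  qed
  have h_cnj: "h (\<lambda>i j. cnj (M j i)) = cnj (h M)" for M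
  proof -
    have "cnj (h M) = (\<Sum>i<n. \<Sum>j<n. cnj (M i j) * cnj (V j) * V i)" by (simp add: h_def sum_distrib_right)
    also have "\<dots> = (\<Sum>j<n. \<Sum>i<n. cnj (M i j) * cnj (V j) * V i)" by (rule sum.swap)
    also have "\<dots> = h (\<lambda>i j. cnj (M j i))"
      unfolding h_def sum_distrib_right by (intro sum.cong refl) (simp add: mult_ac)
    finally show ?thesis by simp
  qed
  have sq: "(\<Sum>i<n. V i * cnj (V i)) = 1"
  proof -
    have "sqrt (\<Sum>i<n. (norm (V i))\<^sup>2) = 1" using v1 vc by (simp add: vec_norm2_def L2_set_def V_def)
    then have "(\<Sum>i<n. (norm (V i))\<^sup>2) = 1" by simp
    then have "complex_of_real (\<Sum>i<n. (norm (V i))\<^sup>2) = 1" by (simp only: of_real_1)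
    then show ?thesis by (simp only: of_real_sum complex_norm_square)
  qed
  have h_mat: "h (\<lambda>i j. M $$ (i, j)) = (\<Sum>i<n. vec_index (M *\<^sub>v v) i * cnj (V i))" if "M \<in> carrier_mat n n" for M
    unfolding h_def V_def using mult_mat_vec_index[OF that vc] by (intro sum.cong) auto
  have h_cong: "h M = h N" if "\<And>i j. i < n \<Longrightarrow> j < n \<Longrightarrow> M i j = N i j" for M N
    unfolding h_def using that by (intro sum.cong arg_cong2[of _ _ _ _ "(*)"]) auto
  have val: "h (\<lambda>i j. M $$ (i, j)) = c" if "M \<in> carrier_mat n n" "M *\<^sub>v v = c \<cdot>\<^sub>v v" for M c
  proof -
    have "h (\<lambda>i j. M $$ (i, j)) = (\<Sum>i<n. c * (V i * cnj (V i)))"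
      unfolding h_mat[OF that(1)] that(2) using vc by (intro sum.cong) (auto simp: V_def)
    then show ?thesis by (simp add: sum_distrib_left[symmetric] sq)
  qed
  define \<beta>1 \<beta>2 where "\<beta>1 = h (\<lambda>i j. cnj (A1 $$ (j, i)))" and "\<beta>2 = h (\<lambda>i j. cnj (A2 $$ (j, i)))"
  have hA: "h (\<lambda>i j. A1 $$ (i, j)) = cnj \<beta>1" "h (\<lambda>i j. A2 $$ (i, j)) = cnj \<beta>2"
    using h_cnj[of "\<lambda>i j. A1 $$ (i, j)"] h_cnj[of "\<lambda>i j. A2 $$ (i, j)"] by (simp_all add: \<beta>1_def \<beta>2_def)
  have hP: "h (\<lambda>i j. P1 z $$ (i, j)) = \<beta>1 + z * cnj \<beta>2" "h (\<lambda>i j. P2 z $$ (i, j)) = \<beta>2 + z * cnj \<beta>1" for z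
  proof -
    have "h (\<lambda>i j. P1 z $$ (i, j)) = h (\<lambda>i j. cnj (A1 $$ (j, i)) + z * A2 $$ (i, j))" by (rule h_cong) (simp add: P_index)
    then show "h (\<lambda>i j. P1 z $$ (i, j)) = \<beta>1 + z * cnj \<beta>2" by (simp only: h_add hA \<beta>1_def)
    have "h (\<lambda>i j. P2 z $$ (i, j)) = h (\<lambda>i j. cnj (A2 $$ (j, i)) + z * A1 $$ (i, j))" by (rule h_cong) (simp add: P_index)
    then show "h (\<lambda>i j. P2 z $$ (i, j)) = \<beta>2 + z * cnj \<beta>1" by (simp only: h_add hA \<beta>2_def)
  qed
  \<comment> \<open>A suitable unit number \<open>z\<close> makes the modulus of the form at
    \<open>P1 z\<close> equal to |beta1| + |beta2|, which turns the norm bound on the pencil into a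
    bound on the parameters.\<close>
  obtain z where z: "norm z = 1" "norm (\<beta>1 + z * cnj \<beta>2) = norm \<beta>1 + norm \<beta>2" using aligned_unit by blast
  have "norm \<beta>1 + norm \<beta>2 = norm (\<Sum>i<n. vec_index (P1 z *\<^sub>v v) i * cnj (V i))"
    using z(2) hP(1)[of z] h_mat[OF P_carrier(1)] by simp
  also have "\<dots> \<le> (\<Sum>i<n. \<bar>norm (vec_index (P1 z *\<^sub>v v) i)\<bar> * \<bar>norm (V i)\<bar>)"
    by (rule order_trans[OF norm_sum]) (simp add: norm_mult)
  also have "\<dots> \<le> L2_set (\<lambda>i. norm (vec_index (P1 z *\<^sub>v v) i)) {..<n} * L2_set (\<lambda>i. norm (V i)) {..<n}"
    by (rule L2_set_mult_ineq)
  also have "\<dots> = vec_norm2 (P1 z *\<^sub>v v) * vec_norm2 v" using vc by (simp add: vec_norm2_def V_def)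
  also have "\<dots> \<le> opsup" using opnorm_bound[OF z(1) vc v1] v1 by simp
  finally have "norm \<beta>1 + norm \<beta>2 \<le> opsup" .
  moreover have "a = \<beta>1 + cnj \<beta>2 * t" "b = \<beta>2 + cnj \<beta>1 * t"
    using hP[of t] val[OF P_carrier(1) eig(1)] val[OF P_carrier(2) eig(2)] by (simp_all add: mult.commute)
  ultimately show ?thesis by (intro that)
qed

end

section \<open>From a contractive pencil to a distinguished variety\<close>

locale contractive_pencil = pencil +
  fixes \<Omega> :: "(complex ^ 3) set"
  assumes small: "opsup < 1"
    and Om: "\<Omega> = {x \<in> tetrablock. (x $ 1, x $ 2) \<in> spectra (x $ 3)}"
begin

text \<open>Joint eigenvalues over the open disc lie in the tetrablock automatically, by
  \<open>spectra_param\<close> and \<open>tetrablock_paramI\<close>.\<close>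

lemma Om_iff: "x \<in> \<Omega> \<longleftrightarrow> norm (x $ 3) < 1 \<and> (x $ 1, x $ 2) \<in> spectra (x $ 3)"
proof
  assume x: "norm (x $ 3) < 1 \<and> (x $ 1, x $ 2) \<in> spectra (x $ 3)"
  then obtain \<beta>1 \<beta>2 where "x $ 1 = \<beta>1 + cnj \<beta>2 * x $ 3" "x $ 2 = \<beta>2 + cnj \<beta>1 * x $ 3" "norm \<beta>1 + norm \<beta>2 \<le> opsup"
    using spectra_param by blast
  then have "x \<in> tetrablock" using x small by (intro tetrablock_paramI[of x \<beta>1 \<beta>2]) auto
  then show "x \<in> \<Omega>" using x Om by blast
qed (use Om tetrablock_3_less in blast)

lemma closure_spectra: assumes "x \<in> closure \<Omega>" shows "(x $ 1, x $ 2) \<in> spectra (x $ 3)" "x \<in> closure tetrablock"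
proof -
  have "closure \<Omega> \<subseteq> {x. (x $ 1, x $ 2) \<in> spectra (x $ 3)}" by (rule closure_minimal[OF _ closed_spectra]) (use Om in blast)
  then show "(x $ 1, x $ 2) \<in> spectra (x $ 3)" using assms by blast
  have "closure \<Omega> \<subseteq> closure tetrablock" by (rule closure_mono) (use Om in blast)
  then show "x \<in> closure tetrablock" using assms by blast
qed

lemma closure_Om: "x \<in> closure \<Omega> \<Longrightarrow> norm (x $ 3) < 1 \<Longrightarrow> x \<in> \<Omega>"
  using closure_spectra(1) Om_iff by blast

lemma boundary: "closure \<Omega> \<inter> frontier tetrablock = closure \<Omega> \<inter> dist_boundary"
proof (intro equalityI subsetI IntI)
  have int: "interior tetrablock = tetrablock" using open_tetrablock by (rule interior_open)
  fix x assume x: "x \<in> closure \<Omega> \<inter> frontier tetrablock"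
  then show "x \<in> closure \<Omega>" by blast
  have xc: "x \<in> closure tetrablock" "x \<notin> tetrablock" using x int by (auto simp: frontier_def)
  then have "\<not> norm (x $ 3) < 1" using closure_Om[of x] x Om by blast
  then show "x \<in> dist_boundary" using xc closure_tetrablock_nth_le(3)[OF xc(1)] by (simp add: dist_boundary_def)
next
  have int: "interior tetrablock = tetrablock" using open_tetrablock by (rule interior_open)
  fix x assume x: "x \<in> closure \<Omega> \<inter> dist_boundary"
  then show "x \<in> closure \<Omega>" by blast
  have "x \<in> closure tetrablock" "norm (x $ 3) = 1" using x by (auto simp: dist_boundary_def)
  moreover then have "x \<notin> tetrablock" using tetrablock_3_less by force
  ultimately show "x \<in> frontier tetrablock" using int by (auto simp: frontier_def)
qed

text \<open>On the closure \<open>spectra_param\<close> bounds |x1| by \<open>opsup\<close>, which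
  is less than 1.\<close>

lemma boundary_bD: "closure \<Omega> \<inter> frontier tetrablock \<inter> bD_tetrablock = {}"
proof -
  have "norm (x $ 1) < 1" if x: "x \<in> closure \<Omega>" for x
  proof -
    obtain \<beta>1 \<beta>2 where b: "x $ 1 = \<beta>1 + cnj \<beta>2 * x $ 3" "norm \<beta>1 + norm \<beta>2 \<le> opsup"
      using spectra_param[OF closure_spectra(1)[OF x]] by blast
    have "norm (x $ 1) \<le> norm \<beta>1 + norm \<beta>2 * norm (x $ 3)"
      unfolding b(1) using norm_triangle_ineq[of \<beta>1 "cnj \<beta>2 * x $ 3"] by (simp add: norm_mult)
    also have "\<dots> \<le> norm \<beta>1 + norm \<beta>2 * 1"
      using closure_tetrablock_nth_le(3)[OF closure_spectra(2)[OF x]] by (intro add_mono mult_left_mono) auto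
    finally show ?thesis using b(2) small by simp
  qed
  then show ?thesis unfolding bD_tetrablock_def by force
qed

lemma fibre_fin: "finite {y \<in> \<Omega>. y $ 3 = t}"
proof -
  have "{y \<in> \<Omega>. y $ 3 = t} \<subseteq> (\<lambda>(a, b). vec3 a b t) ` spectra t"
  proof
    fix y assume "y \<in> {y \<in> \<Omega>. y $ 3 = t}"
    then have "y = vec3 (y $ 1) (y $ 2) t" "(y $ 1, y $ 2) \<in> spectra t" using vec3_eta[of y] Om_iff[of y] by auto
    then show "y \<in> (\<lambda>(a, b). vec3 a b t) ` spectra t" by (intro image_eqI[of _ _ "(y $ 1, y $ 2)"]) auto
  qed
  then show ?thesis using finite_imageI[OF finite_spectra] by (rule finite_subset)
qed

lemma Om_ne: "\<Omega> \<noteq> {}"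
proof -
  obtain p where "p \<in> spectra 0" using spectra_nonempty by blast
  then have "vec3 (fst p) (snd p) 0 \<in> \<Omega>" by (simp add: Om_iff)
  then show ?thesis by blast
qed

lemma separating_slope:
  assumes "finite L" shows "\<exists>c. \<forall>(y1, y2)\<in>L. y1 + c * y2 = a1 + c * a2 \<longrightarrow> y1 = a1 \<and> y2 = (a2 :: complex)"
proof -
  have "finite ((\<lambda>(y1, y2). - (y1 - a1) / (y2 - a2)) ` L)" using assms by simp
  then obtain c where c: "c \<notin> (\<lambda>(y1, y2). - (y1 - a1) / (y2 - a2)) ` L"
    using infinite_UNIV_char_0[where 'a = complex] ex_new_if_finite by blast
  have "y1 = a1 \<and> y2 = a2" if y: "(y1, y2) \<in> L" "y1 + c * y2 = a1 + c * a2" for y1 y2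
  proof (cases "y2 = a2")
    case False
    have "c * (y2 - a2) = - (y1 - a1)" using y(2) by (simp add: algebra_simps)
    then have "c = - (y1 - a1) / (y2 - a2)" using False by (simp add: field_simps)
    then have "c \<in> (\<lambda>(y1, y2). - (y1 - a1) / (y2 - a2)) ` L" using y(1) by (intro image_eqI[of _ _ "(y1, y2)"]) auto
    then show ?thesis using c by blast
  qed (use y in simp)
  then show ?thesis by blast
qed

text \<open>The function \<open>x $ 1 + c * x $ 2\<close> separates the given point from the rest of
  the fibre over \<open>t0\<close>. By \<open>root_continuity\<close> the determinant has a root
  near \<open>s0\<close> at nearby parameters different from \<open>t0\<close>; a limit of the joint
  eigenvalues so obtained lies over \<open>t0\<close> on the line through \<open>x\<close>, and
  separation makes it equal to \<open>x\<close>.\<close>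

lemma no_isolated: assumes x: "x \<in> \<Omega>" shows "x islimpt \<Omega>"
proof -
  define t0 where "t0 = x $ 3"
  have t0: "norm t0 < 1" "(x $ 1, x $ 2) \<in> spectra t0" using x Om_iff by (auto simp: t0_def)
  obtain c where c: "\<forall>(y1, y2)\<in>spectra t0. y1 + c * y2 = x $ 1 + c * x $ 2 \<longrightarrow> y1 = x $ 1 \<and> y2 = x $ 2"
    using separating_slope[OF finite_spectra] by blast
  define s0 where "s0 = x $ 1 + c * x $ 2"
  define f where "f t s = det (P1 t + c \<cdot>\<^sub>m P2 t - s \<cdot>\<^sub>m 1\<^sub>m n)" for t s
  have ent: "(P1 t + c \<cdot>\<^sub>m P2 t - s \<cdot>\<^sub>m 1\<^sub>m n) $$ (i, j) =
      cnj (A1 $$ (j, i)) + t * A2 $$ (i, j) + c * (cnj (A2 $$ (j, i)) + t * A1 $$ (i, j)) - s * (if i = j then 1 else 0)"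
    if "i < n" "j < n" for i j t s using that by (simp add: P_index)
  have line: "\<exists>\<mu>. (s - c * \<mu>, \<mu>) \<in> spectra t" if "f t s = 0" for t s
    by (rule spectra_on_line) (use that in \<open>simp add: f_def\<close>)
  have near: "\<exists>\<delta>>0. \<forall>t. dist t t0 < \<delta> \<longrightarrow> norm t < 1 \<and> (\<exists>s. dist s s0 < \<epsilon> \<and> f t s = 0)" if eps: "\<epsilon> > 0" for \<epsilon>
  proof -
    obtain \<delta> where "\<delta> > 0" "\<And>t. dist t t0 < \<delta> \<Longrightarrow> t \<in> ball 0 1 \<and> (\<exists>s\<in>ball s0 1. dist s s0 < \<epsilon> \<and> f t s = 0)"
    proof (rule root_continuity[of "ball 0 1" t0 1 s0 f \<epsilon>])
      have "continuous_on (ball 0 1 \<times> ball s0 1) (\<lambda>p. det (P1 (fst p) + c \<cdot>\<^sub>m P2 (fst p) - snd p \<cdot>\<^sub>m 1\<^sub>m n))"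
      proof (rule continuous_on_det[of _ n])
        fix i j assume "i < n" "j < n"
        then show "continuous_on (ball 0 1 \<times> ball s0 1) (\<lambda>p. (P1 (fst p) + c \<cdot>\<^sub>m P2 (fst p) - snd p \<cdot>\<^sub>m 1\<^sub>m n) $$ (i, j))"
          unfolding ent[OF \<open>i < n\<close> \<open>j < n\<close>] by (intro continuous_intros)
      qed simp
      then show "continuous_on (ball 0 1 \<times> ball s0 1) (\<lambda>(t, s). f t s)" by (simp add: f_def case_prod_unfold)
      show "f t holomorphic_on ball s0 1" for t
        unfolding f_def
      proof (rule holomorphic_on_det[of _ n])
        fix i j assume "i < n" "j < n"
        then show "(\<lambda>s. (P1 t + c \<cdot>\<^sub>m P2 t - s \<cdot>\<^sub>m 1\<^sub>m n) $$ (i, j)) holomorphic_on ball s0 1"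
          unfolding ent[OF \<open>i < n\<close> \<open>j < n\<close>] by (intro holomorphic_intros)
      qed simp
      show "f t0 s0 = 0" unfolding f_def s0_def by (rule on_line_of_spectra[OF t0(2)])
      have "{s \<in> ball s0 1. f t0 s = 0} \<subseteq> (\<lambda>(a, b). a + c * b) ` spectra t0"
      proof
        fix s assume "s \<in> {s \<in> ball s0 1. f t0 s = 0}"
        then obtain \<mu> where "(s - c * \<mu>, \<mu>) \<in> spectra t0" using line by blast
        then show "s \<in> (\<lambda>(a, b). a + c * b) ` spectra t0" by (intro image_eqI[of _ _ "(s - c * \<mu>, \<mu>)"]) auto
      qed
      then show "finite {s \<in> ball s0 1. f t0 s = 0}" using finite_imageI[OF finite_spectra] by (rule finite_subset)
    qed (use t0 eps in auto)
    then show ?thesis by (intro exI[of _ \<delta>]) auto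
  qed
  have "\<exists>y. y \<in> \<Omega> \<and> y $ 3 \<noteq> t0 \<and> dist (y $ 3) t0 < 1 / Suc k \<and> dist (y $ 1 + c * y $ 2) s0 < 1 / Suc k" for k
  proof -
    obtain \<delta> where d: "\<delta> > 0" "\<forall>t. dist t t0 < \<delta> \<longrightarrow> norm t < 1 \<and> (\<exists>s. dist s s0 < 1 / Suc k \<and> f t s = 0)"
      using near[of "1 / Suc k"] by auto
    define e where "e = min \<delta> (1 / Suc k)"
    \<comment> \<open>A parameter different from \<open>t0\<close>, so that the resulting point
      differs from \<open>x\<close>.\<close>
    define t where "t = t0 + of_real (e / 2)"
    have e: "0 < e" using d(1) by (simp add: e_def)
    have "dist t t0 = e / 2" using e by (simp add: t_def dist_norm norm_divide)
    then have "dist t t0 < e" "t \<noteq> t0" using e by auto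
    then have t: "dist t t0 < \<delta>" "dist t t0 < 1 / Suc k" "t \<noteq> t0" by (auto simp: e_def)
    obtain s where s: "norm t < 1" "dist s s0 < 1 / Suc k" "f t s = 0" using d(2) t(1) by blast
    obtain \<mu> where "(s - c * \<mu>, \<mu>) \<in> spectra t" using line[OF s(3)] by blast
    then show ?thesis using s t by (intro exI[of _ "vec3 (s - c * \<mu>) \<mu> t"]) (simp add: Om_iff)
  qed
  then obtain y where y: "\<And>k. y k \<in> \<Omega>" "\<And>k. y k $ 3 \<noteq> t0" "\<And>k. dist (y k $ 3) t0 < 1 / Suc k"
    "\<And>k. dist (y k $ 1 + c * y k $ 2) s0 < 1 / Suc k" by metis
  have "bounded (range y)" using bounded_tetrablock by (rule bounded_subset) (use y(1) Om in blast)
  then obtain l r where l: "strict_mono r" "(\<lambda>k. y (r k)) \<longlonglongrightarrow> l" 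
    using bounded_imp_convergent_subsequence[of y] by (auto simp: o_def)
  have z: "(\<lambda>k. 1 / Suc (r k)) \<longlonglongrightarrow> (0 :: real)"
    using LIMSEQ_subseq_LIMSEQ[OF LIMSEQ_Suc[OF lim_1_over_n] l(1)] by (simp add: o_def)
  have lim: "(\<lambda>k. g (r k)) \<longlonglongrightarrow> b" if "\<And>k. dist (g k) b < 1 / Suc k" for g :: "nat \<Rightarrow> complex" and b
  proof (rule metric_LIMSEQ_I)
    fix e :: real assume "e > 0"
    then obtain N where "\<And>k. k \<ge> N \<Longrightarrow> \<bar>1 / Suc (r k)\<bar> < e" using LIMSEQ_D[OF z] by auto
    then show "\<exists>N. \<forall>k\<ge>N. dist (g (r k)) b < e" using that by (meson abs_ge_self le_less_trans less_trans)
  qed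
  have l3: "l $ 3 = t0" by (rule LIMSEQ_unique[OF tendsto_vec_nth[OF l(2)] lim[OF y(3)]])
  have "(\<lambda>k. y (r k) $ 1 + c * y (r k) $ 2) \<longlonglongrightarrow> l $ 1 + c * l $ 2"
    by (intro tendsto_intros tendsto_vec_nth l(2))
  then have l12: "l $ 1 + c * l $ 2 = s0" by (rule LIMSEQ_unique) (rule lim[OF y(4)])
  have "l \<in> closure \<Omega>" unfolding closure_sequential by (intro exI[of _ "\<lambda>k. y (r k)"] conjI allI y(1) l(2))
  then have "l \<in> \<Omega>" using closure_Om l3 t0(1) by simp
  then have "(l $ 1, l $ 2) \<in> spectra t0" using Om_iff l3 by metis
  then have "l $ 1 = x $ 1 \<and> l $ 2 = x $ 2" using c l12 unfolding s0_def by fast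
  then have "l = x" using l3 by (intro vec3_eqI) (simp_all add: t0_def)
  moreover have "y (r k) \<in> \<Omega> - {x}" for k using y(1,2) by (auto simp: t0_def)
  ultimately show ?thesis unfolding islimpt_sequential using l(2) by (intro exI[of _ "\<lambda>k. y (r k)"]) auto
qed

lemma distinguished: assumes var: "variety_in_tetrablock \<Omega>"
  shows "distinguished_variety \<Omega> \<and> variety_boundary \<Omega> \<inter> bD_tetrablock = {}"
proof -
  obtain S where S: "\<Omega> = zero_locus S \<inter> tetrablock" using var by (auto simp: variety_in_tetrablock_def)
  obtain d1 d2 where d: "d1 \<noteq> 0" "d2 \<noteq> 0" "\<And>t a b. (a, b) \<in> spectra t \<Longrightarrow> poly (spec t d1) a = 0"
    "\<And>t a b. (a, b) \<in> spectra t \<Longrightarrow> poly (spec t d2) b = 0" by (rule spectra_polynomials) blast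
  have "of_dimension \<Omega> 1"
    by (rule one_dimensional[OF S no_isolated Om_ne closure_Om d(1,2) _ _ fibre_fin]) (use d(3,4) Om_iff in blast)+
  then show ?thesis using var boundary boundary_bD by (simp add: distinguished_variety_def variety_boundary_def)
qed

end

lemma distinguished_if_pencil:
  assumes var: "variety_in_tetrablock \<Omega>" and n: "n > 0" and A: "A1 \<in> carrier_mat n n" "A2 \<in> carrier_mat n n"
    and comm: "A1 * A2 = A2 * A1" "commutator (mat_adjoint A1) A1 = commutator (mat_adjoint A2) A2"
    and norm: "(SUP z \<in> sphere 0 1. mat_opnorm (mat_adjoint A1 + z \<cdot>\<^sub>m A2)) < 1"
    and Om: "\<Omega> = {x \<in> tetrablock. (x $ 1, x $ 2) \<in>
       taylor_spectrum n (mat_adjoint A1 + x $ 3 \<cdot>\<^sub>m A2) (mat_adjoint A2 + x $ 3 \<cdot>\<^sub>m A1)}"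
  shows "distinguished_variety \<Omega> \<and> variety_boundary \<Omega> \<inter> bD_tetrablock = {}"
proof -
  interpret p: pencil n A1 A2 by unfold_locales (use n A comm in auto)
  interpret contractive_pencil n A1 A2 \<Omega>
    by unfold_locales (use norm Om in \<open>simp_all add: p.opsup_def p.spectra_def p.P1_def p.P2_def\<close>)
  show ?thesis by (rule distinguished[OF var])
qed

lemma positive_dimensional_no_isolated:
  assumes "of_dimension \<Omega> 1 \<or> of_dimension \<Omega> 2" "x \<in> (\<Omega> :: (complex ^ 3) set)"
  shows "x islimpt \<Omega>"
  using assms isolated_local_dim[of x \<Omega>] by (auto simp: of_dimension_def)

text \<open>Off \<open>B\<close>, membership in the spectrum comes from left eigenvectors, and it
  extends to all of \<open>\<Omega>\<close> by density and closedness of the spectrum. For the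
  converse, \<open>common_left_kernel\<close> turns a joint eigenvalue into a left eigenvector, to
  which the last clause of \<open>matrix_model\<close> applies.\<close>

lemma pencil_if_distinguished:
  assumes dist: "distinguished_variety \<Omega>" and bd: "variety_boundary \<Omega> \<inter> bD_tetrablock = {}"
  shows "\<exists>n > 0. \<exists>A1 \<in> carrier_mat n n. \<exists>A2 \<in> carrier_mat n n.
    A1 * A2 = A2 * A1 \<and> commutator (mat_adjoint A1) A1 = commutator (mat_adjoint A2) A2 \<and>
    (SUP z \<in> sphere 0 1. mat_opnorm (mat_adjoint A1 + z \<cdot>\<^sub>m A2)) < 1 \<and>
    \<Omega> = {x \<in> tetrablock. (x $ 1, x $ 2) \<in>
       taylor_spectrum n (mat_adjoint A1 + x $ 3 \<cdot>\<^sub>m A2) (mat_adjoint A2 + x $ 3 \<cdot>\<^sub>m A1)}"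
proof -
  obtain S where S: "\<Omega> = zero_locus S \<inter> tetrablock"
    using dist by (auto simp: distinguished_variety_def variety_in_tetrablock_def)
  have dim: "of_dimension \<Omega> 1 \<or> of_dimension \<Omega> 2" using dist by (simp add: distinguished_variety_def)
  interpret d: dvar \<Omega> S
  proof
    show "\<Omega> \<noteq> {}" using dim by (auto simp: of_dimension_def)
    show "x islimpt \<Omega>" if "x \<in> \<Omega>" for x by (rule positive_dimensional_no_isolated[OF dim that])
  qed (use S dist bd in \<open>simp_all add: distinguished_variety_def variety_boundary_def\<close>)
  obtain B m where "d.sheet_data B m" using d.sheet_data_ex by blast
  then interpret s: dvar_sheets \<Omega> S B m by unfold_locales
  obtain n :: nat and a1 a2 :: "nat \<Rightarrow> nat \<Rightarrow> complex" where
    comm: "\<forall>i<n. \<forall>j<n. (\<Sum>k<n. a1 i k * a2 k j) = (\<Sum>k<n. a2 i k * a1 k j)" and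
    self: "\<forall>i<n. \<forall>j<n. (\<Sum>k<n. cnj (a1 k i) * a1 k j) - (\<Sum>k<n. a1 i k * cnj (a1 j k))
       = (\<Sum>k<n. cnj (a2 k i) * a2 k j) - (\<Sum>k<n. a2 i k * cnj (a2 j k))" and
    contr: "\<forall>z v. norm z = 1 \<longrightarrow> sqrt (\<Sum>i<n. (norm (\<Sum>j<n. (cnj (a1 j i) + z * a2 i j) * v j))\<^sup>2) \<le> s.\<rho> * sqrt (\<Sum>i<n. (norm (v i))\<^sup>2)" and
    left: "\<forall>x\<in>\<Omega>. x $ 3 \<notin> B \<longrightarrow> (\<exists>c. (\<exists>k<n. c k \<noteq> 0) \<and>
        (\<forall>j<n. (\<Sum>k<n. c k * (cnj (a1 j k) + x $ 3 * a2 k j)) = x $ 1 * c j) \<and>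
        (\<forall>j<n. (\<Sum>k<n. c k * (cnj (a2 j k) + x $ 3 * a1 k j)) = x $ 2 * c j))" and
    zero: "\<forall>x c. norm (x $ 3) < 1 \<longrightarrow> (\<exists>k<n. c k \<noteq> 0) \<longrightarrow>
        (\<forall>j<n. (\<Sum>k<n. c k * (cnj (a1 j k) + x $ 3 * a2 k j)) = x $ 1 * c j) \<longrightarrow>
        (\<forall>j<n. (\<Sum>k<n. c k * (cnj (a2 j k) + x $ 3 * a1 k j)) = x $ 2 * c j) \<longrightarrow> x \<in> zero_locus S"
    using s.matrix_model by (elim exE conjE) (rule that, assumption+)
  have dense: "x \<in> closure {y \<in> \<Omega>. y $ 3 \<notin> B}" if x: "x \<in> \<Omega>" for x
    by (rule generic_points_dense[OF d.iso[OF x] s.B_finite]) (use d.Fib_finite in \<open>simp add: d.Fib_def\<close>)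
  \<comment> \<open>A point of \<open>\<Omega>\<close> off \<open>B\<close> supplies a nonzero
    vector, so the matrices are not empty.\<close>
  have n: "n > 0"
  proof -
    obtain x where "x \<in> \<Omega>" using d.ne by blast
    then have "{y \<in> \<Omega>. y $ 3 \<notin> B} \<noteq> {}" using dense by force
    then obtain y where "y \<in> \<Omega>" "y $ 3 \<notin> B" by blast
    then obtain c where "\<exists>k<n. c k \<noteq> (0 :: complex)" using left by blast
    then show ?thesis by auto
  qed
  define A1 A2 where "A1 = Matrix.mat n n (\<lambda>(i, j). a1 i j)" and "A2 = Matrix.mat n n (\<lambda>(i, j). a2 i j)"
  have A: "A1 \<in> carrier_mat n n" "A2 \<in> carrier_mat n n" by (simp_all add: A1_def A2_def)
  have ind: "A1 $$ (i, j) = a1 i j" "A2 $$ (i, j) = a2 i j" if "i < n" "j < n" for i j using that by (simp_all add: A1_def A2_def)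
  have mult: "(M * N) $$ (i, j) = (\<Sum>k<n. M $$ (i, k) * N $$ (k, j))"
    if "M \<in> carrier_mat n n" "N \<in> carrier_mat n n" "i < n" "j < n" for M N :: "complex mat" and i j
    using that by (simp add: scalar_prod_def atLeast0LessThan)
  have AA: "A1 * A2 = A2 * A1"
  proof (rule eq_matI)
    fix i j assume "i < dim_row (A2 * A1)" "j < dim_col (A2 * A1)"
    then have ij: "i < n" "j < n" using A by auto
    show "(A1 * A2) $$ (i, j) = (A2 * A1) $$ (i, j)"
      unfolding mult[OF A ij] mult[OF A(2,1) ij] using comm ij by (simp add: ind)
  qed (use A in auto)
  have com: "commutator (mat_adjoint A1) A1 = commutator (mat_adjoint A2) A2"
    unfolding commutator_def
  proof (rule eq_matI)
    fix i j assume "i < dim_row (mat_adjoint A2 * A2 - A2 * mat_adjoint A2)" "j < dim_col (mat_adjoint A2 * A2 - A2 * mat_adjoint A2)"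
    then have ij: "i < n" "j < n" using A adjoint_carrier[OF A(2)] by auto
    have *: "(mat_adjoint X * X - X * mat_adjoint X) $$ (i, j) = (\<Sum>k<n. cnj (X $$ (k, i)) * X $$ (k, j)) - (\<Sum>k<n. X $$ (i, k) * cnj (X $$ (j, k)))"
      if X: "X \<in> carrier_mat n n" for X
    proof -
      have "(mat_adjoint X * X - X * mat_adjoint X) $$ (i, j) = (mat_adjoint X * X) $$ (i, j) - (X * mat_adjoint X) $$ (i, j)"
        by (rule index_minus_mat(1)) (use carrier_matD[OF X] carrier_matD[OF adjoint_carrier[OF X]] ij in simp_all)
      then show ?thesis unfolding mult[OF adjoint_carrier[OF X] X ij] mult[OF X adjoint_carrier[OF X] ij]
        using ij by (simp add: adjoint_index[OF X])
    qed
    show "(mat_adjoint A1 * A1 - A1 * mat_adjoint A1) $$ (i, j) = (mat_adjoint A2 * A2 - A2 * mat_adjoint A2) $$ (i, j)"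
      unfolding *[OF A(1)] *[OF A(2)] using self ij by (simp add: ind)
  qed (use A carrier_matD[OF adjoint_carrier[OF A(1)]] carrier_matD[OF adjoint_carrier[OF A(2)]] in simp_all)
  interpret p: pencil n A1 A2 by unfold_locales (use n A AA com in auto)
  have Pe: "p.P1 t $$ (i, j) = cnj (a1 j i) + t * a2 i j" "p.P2 t $$ (i, j) = cnj (a2 j i) + t * a1 i j"
    if "i < n" "j < n" for i j t using that by (simp_all add: p.P_index ind)
  have "(SUP z \<in> sphere 0 1. mat_opnorm (p.P1 z)) \<le> s.\<rho>"
  proof (rule cSUP_least)
    show "sphere (0 :: complex) 1 \<noteq> {}" by simp
    fix z :: complex assume z: "z \<in> sphere 0 1"
    show "mat_opnorm (p.P1 z) \<le> s.\<rho>"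
      unfolding mat_opnorm_def
    proof (rule cSUP_least)
      show "{v \<in> carrier_vec (dim_col (p.P1 z)). vec_norm2 v = 1} \<noteq> {}" using unit_vector_exists[OF n] by auto
      fix v assume v: "v \<in> {v \<in> carrier_vec (dim_col (p.P1 z)). vec_norm2 v = 1}"
      then have vc: "v \<in> carrier_vec n" by simp
      have "vec_norm2 (p.P1 z *\<^sub>v v) = sqrt (\<Sum>i<n. (norm (\<Sum>j<n. (cnj (a1 j i) + z * a2 i j) * vec_index v j))\<^sup>2)"
        unfolding vec_norm2_def L2_set_def using mult_mat_vec_index[OF p.P_carrier(1) vc, of _ z]
        by (intro arg_cong[of _ _ sqrt] sum.cong) (auto simp: Pe simp del: index_mult_mat_vec)
      also have "\<dots> \<le> s.\<rho> * sqrt (\<Sum>i<n. (norm (vec_index v i))\<^sup>2)" using contr z by simp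
      also have "sqrt (\<Sum>i<n. (norm (vec_index v i))\<^sup>2) = vec_norm2 v" using vc by (simp add: vec_norm2_def L2_set_def)
      finally show "vec_norm2 (p.P1 z *\<^sub>v v) \<le> s.\<rho>" using v by simp
    qed
  qed
  then have norm: "(SUP z \<in> sphere 0 1. mat_opnorm (p.P1 z)) < 1" using s.rho(2) by simp
  have shift: "(\<Sum>k<n. c k * (T - s \<cdot>\<^sub>m 1\<^sub>m n) $$ (k, j)) = (\<Sum>k<n. c k * T $$ (k, j)) - s * c j"
    if "T \<in> carrier_mat n n" "j < n" for T :: "complex mat" and s c j
  proof -
    have "(\<Sum>k<n. c k * (T - s \<cdot>\<^sub>m 1\<^sub>m n) $$ (k, j)) = (\<Sum>k<n. c k * T $$ (k, j) - (if k = j then s * c j else 0))"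
      by (rule sum.cong) (use that in \<open>auto simp: algebra_simps\<close>)
    then show ?thesis using that by (simp add: sum_subtractf)
  qed
  have ker: "(\<forall>j<n. (\<Sum>k<n. c k * (p.P1 t - s \<cdot>\<^sub>m 1\<^sub>m n) $$ (k, j)) = 0) \<longleftrightarrow> (\<forall>j<n. (\<Sum>k<n. c k * (cnj (a1 j k) + t * a2 k j)) = s * c j)"
      "(\<forall>j<n. (\<Sum>k<n. c k * (p.P2 t - s \<cdot>\<^sub>m 1\<^sub>m n) $$ (k, j)) = 0) \<longleftrightarrow> (\<forall>j<n. (\<Sum>k<n. c k * (cnj (a2 j k) + t * a1 k j)) = s * c j)"
    for c t s
  proof -
    have E: "(\<Sum>k<n. c k * (p.P1 t - s \<cdot>\<^sub>m 1\<^sub>m n) $$ (k, j)) = (\<Sum>k<n. c k * (cnj (a1 j k) + t * a2 k j)) - s * c j"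
      "(\<Sum>k<n. c k * (p.P2 t - s \<cdot>\<^sub>m 1\<^sub>m n) $$ (k, j)) = (\<Sum>k<n. c k * (cnj (a2 j k) + t * a1 k j)) - s * c j" if "j < n" for j
      unfolding shift[OF p.P_carrier(1) that] shift[OF p.P_carrier(2) that] using that by (simp_all add: Pe)
    show "(\<forall>j<n. (\<Sum>k<n. c k * (p.P1 t - s \<cdot>\<^sub>m 1\<^sub>m n) $$ (k, j)) = 0) \<longleftrightarrow> (\<forall>j<n. (\<Sum>k<n. c k * (cnj (a1 j k) + t * a2 k j)) = s * c j)"
      "(\<forall>j<n. (\<Sum>k<n. c k * (p.P2 t - s \<cdot>\<^sub>m 1\<^sub>m n) $$ (k, j)) = 0) \<longleftrightarrow> (\<forall>j<n. (\<Sum>k<n. c k * (cnj (a2 j k) + t * a1 k j)) = s * c j)"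
      using E by (metis (no_types, lifting) right_minus_eq)+
  qed
  have "\<Omega> = {x \<in> tetrablock. (x $ 1, x $ 2) \<in> p.spectra (x $ 3)}"
  proof (intro equalityI subsetI)
    have sub: "{y \<in> \<Omega>. y $ 3 \<notin> B} \<subseteq> {x. (x $ 1, x $ 2) \<in> p.spectra (x $ 3)}"
    proof
      fix x assume "x \<in> {y \<in> \<Omega>. y $ 3 \<notin> B}"
      then obtain c where c: "\<exists>k<n. c k \<noteq> 0"
        "\<forall>j<n. (\<Sum>k<n. c k * (cnj (a1 j k) + x $ 3 * a2 k j)) = x $ 1 * c j"
        "\<forall>j<n. (\<Sum>k<n. c k * (cnj (a2 j k) + x $ 3 * a1 k j)) = x $ 2 * c j" using left by blast
      have "\<not> koszul_exact n (p.P1 (x $ 3) - x $ 1 \<cdot>\<^sub>m 1\<^sub>m n) (p.P2 (x $ 3) - x $ 2 \<cdot>\<^sub>m 1\<^sub>m n)"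
        by (rule left_kernel_not_exact[OF shift_carrier shift_carrier c(1)])
          (use c(2)[folded ker(1)] c(3)[folded ker(2)] in blast)+
      then show "x \<in> {x. (x $ 1, x $ 2) \<in> p.spectra (x $ 3)}" by (simp add: p.spectra_def taylor_spectrum_def)
    qed
    fix x assume x: "x \<in> \<Omega>"
    have "closure {y \<in> \<Omega>. y $ 3 \<notin> B} \<subseteq> {x. (x $ 1, x $ 2) \<in> p.spectra (x $ 3)}"
      by (rule closure_minimal[OF sub p.closed_spectra])
    then show "x \<in> {x \<in> tetrablock. (x $ 1, x $ 2) \<in> p.spectra (x $ 3)}" using dense[OF x] x S by blast
  next
    fix x assume "x \<in> {x \<in> tetrablock. (x $ 1, x $ 2) \<in> p.spectra (x $ 3)}"
    then have x: "x \<in> tetrablock" "\<not> koszul_exact n (p.P1 (x $ 3) - x $ 1 \<cdot>\<^sub>m 1\<^sub>m n) (p.P2 (x $ 3) - x $ 2 \<cdot>\<^sub>m 1\<^sub>m n)"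
      by (simp_all add: p.spectra_def taylor_spectrum_def)
    obtain c where c: "\<exists>k<n. c k \<noteq> 0" "\<And>j. j < n \<Longrightarrow> (\<Sum>k<n. c k * (p.P1 (x $ 3) - x $ 1 \<cdot>\<^sub>m 1\<^sub>m n) $$ (k, j)) = 0"
      "\<And>j. j < n \<Longrightarrow> (\<Sum>k<n. c k * (p.P2 (x $ 3) - x $ 2 \<cdot>\<^sub>m 1\<^sub>m n) $$ (k, j)) = 0"
      by (rule common_left_kernel[OF shift_carrier shift_carrier shifted_commute[OF p.P_carrier p.P_commute] x(2)]) blast
    have "x \<in> zero_locus S"
      by (rule zero[rule_format, OF tetrablock_3_less[OF x(1)] c(1)])
        (use ker(1)[of c "x $ 3" "x $ 1"] ker(2)[of c "x $ 3" "x $ 2"] c(2,3) in blast)+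
    then show "x \<in> \<Omega>" using S x(1) by blast
  qed
  then show ?thesis using n A AA com norm
    by (intro exI[of _ n] conjI bexI[of _ A1] bexI[of _ A2]) (simp_all add: p.P1_def p.P2_def p.spectra_def)
qed

theorem theorem4p8:
  fixes \<Omega> :: "(complex ^ 3) set"
  assumes "variety_in_tetrablock \<Omega>"
  shows "(\<exists>n > 0. \<exists>A\<^sub>1 \<in> carrier_mat n n. \<exists>A\<^sub>2 \<in> carrier_mat n n.
            A\<^sub>1 * A\<^sub>2 = A\<^sub>2 * A\<^sub>1 \<and>
            commutator (mat_adjoint A\<^sub>1) A\<^sub>1 = commutator (mat_adjoint A\<^sub>2) A\<^sub>2 \<and>
            (SUP z \<in> sphere 0 1. mat_opnorm (mat_adjoint A\<^sub>1 + z \<cdot>\<^sub>m A\<^sub>2)) < 1 \<and>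
            \<Omega> = {x \<in> tetrablock. (x $ 1, x $ 2) \<in>
                   taylor_spectrum n (mat_adjoint A\<^sub>1 + x $ 3 \<cdot>\<^sub>m A\<^sub>2) (mat_adjoint A\<^sub>2 + x $ 3 \<cdot>\<^sub>m A\<^sub>1)})
     \<longleftrightarrow> distinguished_variety \<Omega> \<and> variety_boundary \<Omega> \<inter> bD_tetrablock = {}"
proof
  assume "distinguished_variety \<Omega> \<and> variety_boundary \<Omega> \<inter> bD_tetrablock = {}"
  then show "\<exists>n > 0. \<exists>A\<^sub>1 \<in> carrier_mat n n. \<exists>A\<^sub>2 \<in> carrier_mat n n.
            A\<^sub>1 * A\<^sub>2 = A\<^sub>2 * A\<^sub>1 \<and>
            commutator (mat_adjoint A\<^sub>1) A\<^sub>1 = commutator (mat_adjoint A\<^sub>2) A\<^sub>2 \<and>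
            (SUP z \<in> sphere 0 1. mat_opnorm (mat_adjoint A\<^sub>1 + z \<cdot>\<^sub>m A\<^sub>2)) < 1 \<and>
            \<Omega> = {x \<in> tetrablock. (x $ 1, x $ 2) \<in>
                   taylor_spectrum n (mat_adjoint A\<^sub>1 + x $ 3 \<cdot>\<^sub>m A\<^sub>2) (mat_adjoint A\<^sub>2 + x $ 3 \<cdot>\<^sub>m A\<^sub>1)}"
    using pencil_if_distinguished by blast
qed (use distinguished_if_pencil[OF assms] in blast)

end
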